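(* Let $\mathbb{X}$ be a semi-abelian category, $n\geq1$, and let $(K_i)_{0\leq i<n}$ be a collection of $n$ normal subobjects of an object $X$ of $\mathbb{X}$. The collection $(K_i)_{0\leq i<n}$ induces a $3^n$-diagram, and thus an $n$-cubic extension, by first taking intersections and then cokernels of those intersections, if and only if the equality $$\Big(\bigwedge_{j\in J_0}K_j\Big)\wedge\bigvee_{i=1}^k\Big(\bigwedge_{j\in J_i}K_j\Big)=\bigvee_{i=1}^k\Big(\bigwedge_{j\in J_0\cup J_i}K_j\Big)$$ holds whenever $J_0,J_1,\dots,J_k\subseteq n=\{0,\dots,n-1\}$ with $k\geq1$ are such that $J_i\cap J_j=\emptyset$ for all $i\neq j$.
   Context: A semi-abelian category is a pointed, Barr exact, protomodular category with binary coproducts. Meets and joins are taken in the lattice of normal subobjects of $X$ (an empty meet being $X$). $\mathsf{3}$ is the category $0\to1\to2$. An $n$-sequence is a functor $E\colon(\mathsf{3}^n)^{\mathrm{op}}\to\mathbb{X}$; it is a $3^n$-diagram when, for each of the $n$ directions and each choice of values in $\{0,1,2\}$ for the other $n-1$ coordinates, the resulting sequence $E_2\to E_1\to E_0$ in $\mathbb{X}$ is short exact ($E_2\to E_1$ is the kernel of $E_1\to E_0$, which is the cokernel of $E_2\to E_1$). "Induces by first taking intersections and then cokernels" means: form the $n$-cube with vertices $\bigwedge_{i\in I}K_i$ ($I\subseteq n$), terminal vertex $X$, and arrows the inclusions; this is placed on the objects of $\mathsf{3}^n$ with all coordinates in $\{1,2\}$, with $X$ at $(1,\dots,1)$. Then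 complete it to an $n$-sequence $E$ by taking cokernels successively in all $n$ directions. The collection induces a $3^n$-diagram when this $E$ is a $3^n$-diagram; the $n$-cubic extension obtained is then the restriction of $E$ to the objects with all coordinates in $\{0,1\}$. $n$-cubic extension: a $1$-cubic extension is a regular epimorphism in $\mathbb{X}$. For $n\geq 2$, a commutative $n$-cube (an object of $\mathsf{Arr}^n(\mathbb{X})=\mathsf{Arr}(\mathsf{Arr}^{n-1}(\mathbb{X}))$), viewed as a commutative square in $\mathsf{Arr}^{n-2}(\mathbb{X})$, is an $n$-cubic extension when its four sides and the induced comparison from its initial corner to the pullback are all $(n-1)$-cubic extensions. *)

theory Defs
  imports "HOL-Algebra.Lattice"
begin

section \<open>Categories and functors\<close>

record ('o, 'm) category =
  Obj :: "'o set"
  Mor :: "'m set"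
  Dom :: "'m \<Rightarrow> 'o"
  Cod :: "'m \<Rightarrow> 'o"
  Ident :: "'o \<Rightarrow> 'm"
  Comp :: "'m \<Rightarrow> 'm \<Rightarrow> 'm"  (infixl \<open>\<cdot>\<index>\<close> 75)

definition Hom :: "('o, 'm) category \<Rightarrow> 'o \<Rightarrow> 'o \<Rightarrow> 'm set" where
  "Hom C a b = {f \<in> Mor C. Dom C f = a \<and> Cod C f = b}"

text \<open>Composition is written in applicative order: \<open>g \<cdot> f\<close> is \<open>f\<close> followed by \<open>g\<close>.\<close>

locale category =
  fixes C :: "('o, 'm) category" (structure)
  assumes Dom_Obj: "f \<in> Mor C \<Longrightarrow> Dom C f \<in> Obj C"
    and Cod_Obj: "f \<in> Mor C \<Longrightarrow> Cod C f \<in> Obj C"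
    and Ident_Hom: "a \<in> Obj C \<Longrightarrow> Ident C a \<in> Hom C a a"
    and Comp_Hom: "f \<in> Hom C a b \<Longrightarrow> g \<in> Hom C b c \<Longrightarrow> g \<cdot> f \<in> Hom C a c"
    and Comp_Ident: "f \<in> Hom C a b \<Longrightarrow> f \<cdot> Ident C a = f"
    and Ident_Comp: "f \<in> Hom C a b \<Longrightarrow> Ident C b \<cdot> f = f"
    and Comp_assoc: "f \<in> Hom C a b \<Longrightarrow> g \<in> Hom C b c \<Longrightarrow> h \<in> Hom C c d \<Longrightarrow>
      (h \<cdot> g) \<cdot> f = h \<cdot> (g \<cdot> f)"

definition op_cat :: "('o, 'm) category \<Rightarrow> ('o, 'm) category" where
  "op_cat C = \<lparr>Obj = Obj C, Mor = Mor C, Dom = Cod C, Cod = Dom C, Ident = Ident C,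
     Comp = (\<lambda>g f. f \<cdot>\<^bsub>C\<^esub> g)\<rparr>"

definition poset_cat :: "'p::order set \<Rightarrow> ('p, 'p \<times> 'p) category" where
  "poset_cat P = \<lparr>Obj = P, Mor = {(a, b). a \<in> P \<and> b \<in> P \<and> a \<le> b}, Dom = fst, Cod = snd,
     Ident = (\<lambda>a. (a, a)), Comp = (\<lambda>g f. (fst f, snd g))\<rparr>"

record ('o, 'm, 'p, 'q) functor_data =
  FObj :: "'o \<Rightarrow> 'p"
  FMor :: "'m \<Rightarrow> 'q"

definition is_functor ::
    "('o, 'm) category \<Rightarrow> ('p, 'q) category \<Rightarrow> ('o, 'm, 'p, 'q) functor_data \<Rightarrow> bool" where
  "is_functor A B F \<longleftrightarrow>
     (\<forall>a\<in>Obj A. FObj F a \<in> Obj B) \<and>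
     (\<forall>f\<in>Mor A. FMor F f \<in> Hom B (FObj F (Dom A f)) (FObj F (Cod A f))) \<and>
     (\<forall>a\<in>Obj A. FMor F (Ident A a) = Ident B (FObj F a)) \<and>
     (\<forall>f\<in>Mor A. \<forall>g\<in>Mor A. Cod A f = Dom A g \<longrightarrow>
        FMor F (g \<cdot>\<^bsub>A\<^esub> f) = FMor F g \<cdot>\<^bsub>B\<^esub> FMor F f)"

section \<open>Limits and colimits\<close>

definition is_iso :: "('o, 'm) category \<Rightarrow> 'm \<Rightarrow> bool" where
  "is_iso C f \<longleftrightarrow> f \<in> Mor C \<and>
     (\<exists>g \<in> Hom C (Cod C f) (Dom C f).
        g \<cdot>\<^bsub>C\<^esub> f = Ident C (Dom C f) \<and> f \<cdot>\<^bsub>C\<^esub> g = Ident C (Cod C f))"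

definition is_terminal :: "('o, 'm) category \<Rightarrow> 'o \<Rightarrow> bool" where
  "is_terminal C t \<longleftrightarrow> t \<in> Obj C \<and> (\<forall>a\<in>Obj C. \<exists>!f. f \<in> Hom C a t)"

definition is_zero_object :: "('o, 'm) category \<Rightarrow> 'o \<Rightarrow> bool" where
  "is_zero_object C z \<longleftrightarrow> is_terminal C z \<and> (\<forall>a\<in>Obj C. \<exists>!f. f \<in> Hom C z a)"

definition is_zero_mor :: "('o, 'm) category \<Rightarrow> 'm \<Rightarrow> bool" where
  "is_zero_mor C f \<longleftrightarrow> f \<in> Mor C \<and>
     (\<exists>z. is_zero_object C z \<and>
       (\<exists>g \<in> Hom C (Dom C f) z. \<exists>h \<in> Hom C z (Cod C f). f = h \<cdot>\<^bsub>C\<^esub> g))"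

definition is_kernel :: "('o, 'm) category \<Rightarrow> 'm \<Rightarrow> 'm \<Rightarrow> bool" where
  "is_kernel C k f \<longleftrightarrow> k \<in> Mor C \<and> f \<in> Mor C \<and> Cod C k = Dom C f \<and> is_zero_mor C (f \<cdot>\<^bsub>C\<^esub> k) \<and>
     (\<forall>t\<in>Mor C. Cod C t = Dom C f \<and> is_zero_mor C (f \<cdot>\<^bsub>C\<^esub> t) \<longrightarrow>
       (\<exists>!u. u \<in> Hom C (Dom C t) (Dom C k) \<and> k \<cdot>\<^bsub>C\<^esub> u = t))"

definition is_cokernel :: "('o, 'm) category \<Rightarrow> 'm \<Rightarrow> 'm \<Rightarrow> bool" where
  "is_cokernel C q f \<longleftrightarrow> q \<in> Mor C \<and> f \<in> Mor C \<and> Dom C q = Cod C f \<and> is_zero_mor C (q \<cdot>\<^bsub>C\<^esub> f) \<and>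
     (\<forall>t\<in>Mor C. Dom C t = Cod C f \<and> is_zero_mor C (t \<cdot>\<^bsub>C\<^esub> f) \<longrightarrow>
       (\<exists>!u. u \<in> Hom C (Cod C q) (Cod C t) \<and> u \<cdot>\<^bsub>C\<^esub> q = t))"

definition is_short_exact :: "('o, 'm) category \<Rightarrow> 'm \<Rightarrow> 'm \<Rightarrow> bool" where
  "is_short_exact C k f \<longleftrightarrow> is_kernel C k f \<and> is_cokernel C f k"

text \<open>\<open>is_pullback C f g p q\<close>: the span \<open>(p, q)\<close> is a pullback of the cospan \<open>(f, g)\<close>,
  with \<open>f \<cdot> p = g \<cdot> q\<close>.\<close>

definition is_pullback :: "('o, 'm) category \<Rightarrow> 'm \<Rightarrow> 'm \<Rightarrow> 'm \<Rightarrow> 'm \<Rightarrow> bool" where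
  "is_pullback C f g p q \<longleftrightarrow>
     {f, g, p, q} \<subseteq> Mor C \<and> Cod C f = Cod C g \<and> Dom C p = Dom C q \<and>
     Cod C p = Dom C f \<and> Cod C q = Dom C g \<and> f \<cdot>\<^bsub>C\<^esub> p = g \<cdot>\<^bsub>C\<^esub> q \<and>
     (\<forall>s\<in>Mor C. \<forall>t\<in>Mor C.
        Dom C s = Dom C t \<and> Cod C s = Dom C f \<and> Cod C t = Dom C g \<and> f \<cdot>\<^bsub>C\<^esub> s = g \<cdot>\<^bsub>C\<^esub> t \<longrightarrow>
        (\<exists>!u. u \<in> Hom C (Dom C s) (Dom C p) \<and> p \<cdot>\<^bsub>C\<^esub> u = s \<and> q \<cdot>\<^bsub>C\<^esub> u = t))"

definition is_coequalizer :: "('o, 'm) category \<Rightarrow> 'm \<Rightarrow> 'm \<Rightarrow> 'm \<Rightarrow> bool" where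
  "is_coequalizer C q f g \<longleftrightarrow>
     {f, g, q} \<subseteq> Mor C \<and> Dom C f = Dom C g \<and> Cod C f = Cod C g \<and> Dom C q = Cod C f \<and>
     q \<cdot>\<^bsub>C\<^esub> f = q \<cdot>\<^bsub>C\<^esub> g \<and>
     (\<forall>t\<in>Mor C. Dom C t = Cod C f \<and> t \<cdot>\<^bsub>C\<^esub> f = t \<cdot>\<^bsub>C\<^esub> g \<longrightarrow>
        (\<exists>!u. u \<in> Hom C (Cod C q) (Cod C t) \<and> u \<cdot>\<^bsub>C\<^esub> q = t))"

definition is_regular_epi :: "('o, 'm) category \<Rightarrow> 'm \<Rightarrow> bool" where
  "is_regular_epi C q \<longleftrightarrow> (\<exists>f g. is_coequalizer C q f g)"

definition is_binary_coproduct :: "('o, 'm) category \<Rightarrow> 'm \<Rightarrow> 'm \<Rightarrow> bool" where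
  "is_binary_coproduct C i j \<longleftrightarrow> {i, j} \<subseteq> Mor C \<and> Cod C i = Cod C j \<and>
     (\<forall>s\<in>Mor C. \<forall>t\<in>Mor C.
        Cod C s = Cod C t \<and> Dom C s = Dom C i \<and> Dom C t = Dom C j \<longrightarrow>
        (\<exists>!u. u \<in> Hom C (Cod C i) (Cod C s) \<and> u \<cdot>\<^bsub>C\<^esub> i = s \<and> u \<cdot>\<^bsub>C\<^esub> j = t))"

definition has_binary_coproducts :: "('o, 'm) category \<Rightarrow> bool" where
  "has_binary_coproducts C \<longleftrightarrow>
     (\<forall>a\<in>Obj C. \<forall>b\<in>Obj C. \<exists>i j. is_binary_coproduct C i j \<and> Dom C i = a \<and> Dom C j = b)"

text \<open>Finite limits, in the usual form of a terminal object and pullbacks.\<close>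

definition is_finitely_complete :: "('o, 'm) category \<Rightarrow> bool" where
  "is_finitely_complete C \<longleftrightarrow> (\<exists>t. is_terminal C t) \<and>
     (\<forall>f\<in>Mor C. \<forall>g\<in>Mor C. Cod C f = Cod C g \<longrightarrow> (\<exists>p q. is_pullback C f g p q))"

section \<open>Semi-abelian categories\<close>

definition is_pointed :: "('o, 'm) category \<Rightarrow> bool" where
  "is_pointed C \<longleftrightarrow> (\<exists>z. is_zero_object C z)"

definition is_regular_cat :: "('o, 'm) category \<Rightarrow> bool" where
  "is_regular_cat C \<longleftrightarrow> is_finitely_complete C \<and>
     (\<forall>f p q. is_pullback C f f p q \<longrightarrow> (\<exists>c. is_coequalizer C c p q)) \<and>
     (\<forall>f g p q. is_pullback C f g p q \<and> is_regular_epi C f \<longrightarrow> is_regular_epi C q)"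

text \<open>An internal equivalence relation with projections \<open>r\<close> and \<open>s\<close>; in the last clause
  the pullback of \<open>s\<close> and \<open>r\<close> is the object of composable pairs.\<close>

definition is_equivalence_relation :: "('o, 'm) category \<Rightarrow> 'm \<Rightarrow> 'm \<Rightarrow> bool" where
  "is_equivalence_relation C r s \<longleftrightarrow>
     {r, s} \<subseteq> Mor C \<and> Dom C r = Dom C s \<and> Cod C r = Cod C s \<and>
     (\<forall>u\<in>Mor C. \<forall>v\<in>Mor C. Dom C u = Dom C v \<and> Cod C u = Dom C r \<and> Cod C v = Dom C r \<and>
        r \<cdot>\<^bsub>C\<^esub> u = r \<cdot>\<^bsub>C\<^esub> v \<and> s \<cdot>\<^bsub>C\<^esub> u = s \<cdot>\<^bsub>C\<^esub> v \<longrightarrow> u = v) \<and>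
     (\<exists>d \<in> Hom C (Cod C r) (Dom C r).
        r \<cdot>\<^bsub>C\<^esub> d = Ident C (Cod C r) \<and> s \<cdot>\<^bsub>C\<^esub> d = Ident C (Cod C r)) \<and>
     (\<exists>i \<in> Hom C (Dom C r) (Dom C r). r \<cdot>\<^bsub>C\<^esub> i = s \<and> s \<cdot>\<^bsub>C\<^esub> i = r) \<and>
     (\<forall>p q. is_pullback C s r p q \<longrightarrow>
        (\<exists>t \<in> Hom C (Dom C p) (Dom C r). r \<cdot>\<^bsub>C\<^esub> t = r \<cdot>\<^bsub>C\<^esub> p \<and> s \<cdot>\<^bsub>C\<^esub> t = s \<cdot>\<^bsub>C\<^esub> q))"

definition is_Barr_exact :: "('o, 'm) category \<Rightarrow> bool" where
  "is_Barr_exact C \<longleftrightarrow> is_regular_cat C \<and>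
     (\<forall>r s. is_equivalence_relation C r s \<longrightarrow> (\<exists>f. is_pullback C f f r s))"

text \<open>A point over \<open>Y\<close> is a morphism \<open>p\<close> to \<open>Y\<close> with a chosen section \<open>s\<close>.
  Protomodularity in the sense of Bourn: change of base along any \<open>v\<close> in the fibration of
  points reflects isomorphisms. Below, \<open>f\<close> is a morphism of points from \<open>(p, s)\<close> to \<open>(p', s')\<close>
  and \<open>h\<close> is its image under pulling back along \<open>v\<close>.\<close>

definition is_point :: "('o, 'm) category \<Rightarrow> 'm \<Rightarrow> 'm \<Rightarrow> bool" where
  "is_point C p s \<longleftrightarrow> p \<in> Mor C \<and> s \<in> Hom C (Cod C p) (Dom C p) \<and> p \<cdot>\<^bsub>C\<^esub> s = Ident C (Cod C p)"

definition is_protomodular :: "('o, 'm) category \<Rightarrow> bool" where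
  "is_protomodular C \<longleftrightarrow>
     (\<forall>p s p' s' f v a q a' q' h.
        is_point C p s \<and> is_point C p' s' \<and> Cod C p = Cod C p' \<and>
        f \<in> Hom C (Dom C p) (Dom C p') \<and> p' \<cdot>\<^bsub>C\<^esub> f = p \<and> f \<cdot>\<^bsub>C\<^esub> s = s' \<and>
        is_pullback C p v a q \<and> is_pullback C p' v a' q' \<and>
        h \<in> Hom C (Dom C a) (Dom C a') \<and> a' \<cdot>\<^bsub>C\<^esub> h = f \<cdot>\<^bsub>C\<^esub> a \<and> q' \<cdot>\<^bsub>C\<^esub> h = q \<and>
        is_iso C h \<longrightarrow> is_iso C f)"

locale semi_abelian_category = category C for C :: "('o, 'm) category" (structure) +
  assumes pointed: "is_pointed C"
    and Barr_exact: "is_Barr_exact C"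
    and protomodular: "is_protomodular C"
    and binary_coproducts: "has_binary_coproducts C"

section \<open>Normal subobjects\<close>

text \<open>A normal subobject of \<open>X\<close> is represented by a kernel with codomain \<open>X\<close>; representatives are
  ordered by factorisation, and \<open>eq\<close> says that two of them represent the same subobject. Meets and
  joins of this structure are those of \<^theory>\<open>HOL-Algebra.Lattice\<close>, hence determined up to \<open>eq\<close>.\<close>

definition NSub :: "('o, 'm) category \<Rightarrow> 'o \<Rightarrow> 'm gorder" where
  "NSub C X =
     (let factors = (\<lambda>m m'. \<exists>u \<in> Hom C (Dom C m) (Dom C m'). m' \<cdot>\<^bsub>C\<^esub> u = m)
      in \<lparr>carrier = {m \<in> Mor C. Cod C m = X \<and> (\<exists>f. is_kernel C m f)},
          eq = (\<lambda>m m'. factors m m' \<and> factors m' m),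
          le = factors\<rparr>)"

section \<open>\<open>n\<close>-sequences and \<open>3\<^sup>n\<close>-diagrams\<close>

text \<open>\<open>3\<^sup>n\<close> is the \<open>n\<close>-fold power of the chain \<open>0 < 1 < 2\<close>, with the componentwise order. An object is
  a function on \<open>{..<n}\<close>, extended by \<open>0\<close> so that \<open>\<le>\<close> on functions is the right order.\<close>

definition three_objs :: "nat \<Rightarrow> (nat \<Rightarrow> nat) set" where
  "three_objs n = {\<sigma>. (\<forall>i<n. \<sigma> i \<in> {0, 1, 2}) \<and> (\<forall>i\<ge>n. \<sigma> i = 0)}"

definition three_pow :: "nat \<Rightarrow> (nat \<Rightarrow> nat, (nat \<Rightarrow> nat) \<times> (nat \<Rightarrow> nat)) category" where
  "three_pow n = poset_cat (three_objs n)"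

type_synonym ('o, 'm) seq =
  "(nat \<Rightarrow> nat, (nat \<Rightarrow> nat) \<times> (nat \<Rightarrow> nat), 'o, 'm) functor_data"

definition is_n_sequence :: "('o, 'm) category \<Rightarrow> nat \<Rightarrow> ('o, 'm) seq \<Rightarrow> bool" where
  "is_n_sequence C n E \<longleftrightarrow> is_functor (op_cat (three_pow n)) C E"

text \<open>By contravariance \<open>seq_edge E i \<sigma> b a\<close>, for \<open>a \<le> b\<close>, is the morphism from \<open>E\<close> at \<open>\<sigma>(i := b)\<close> to
  \<open>E\<close> at \<open>\<sigma>(i := a)\<close>.\<close>

definition seq_edge :: "('o, 'm) seq \<Rightarrow> nat \<Rightarrow> (nat \<Rightarrow> nat) \<Rightarrow> nat \<Rightarrow> nat \<Rightarrow> 'm" where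
  "seq_edge E i \<sigma> b a = FMor E (\<sigma>(i := a), \<sigma>(i := b))"

definition is_3n_diagram :: "('o, 'm) category \<Rightarrow> nat \<Rightarrow> ('o, 'm) seq \<Rightarrow> bool" where
  "is_3n_diagram C n E \<longleftrightarrow> is_n_sequence C n E \<and>
     (\<forall>i<n. \<forall>\<sigma>\<in>three_objs n. is_short_exact C (seq_edge E i \<sigma> 2 1) (seq_edge E i \<sigma> 1 0))"

text \<open>\<open>ones n\<close> is the object \<open>(1, \<dots>, 1)\<close> of \<open>3\<^sup>n\<close>.\<close>

definition ones :: "nat \<Rightarrow> nat \<Rightarrow> nat" where
  "ones n = (\<lambda>i. if i < n then 1 else 0)"

text \<open>\<open>E\<close> arises from \<open>K\<close> by first taking intersections and then cokernels. The objects \<open>\<sigma>\<close> with all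
  coordinates in \<open>{1, 2}\<close> correspond to the sets \<open>I = {i. i < n \<and> \<sigma> i = 2}\<close>, and the morphism from \<open>E \<sigma>\<close>
  to \<open>X\<close> has to represent the meet of the \<open>K\<^sub>i\<close>, \<open>i \<in> I\<close>; functoriality of \<open>E\<close> then forces all
  other morphisms of this cube to be the inclusions. In the last clause the cokernels in direction
  \<open>i\<close> are taken once directions \<open>0, \<dots>, i - 1\<close> are completed, while the coordinates beyond \<open>i\<close> still
  range over \<open>{1, 2}\<close>.\<close>

definition meets_then_cokernels ::
    "('o, 'm) category \<Rightarrow> nat \<Rightarrow> 'o \<Rightarrow> (nat \<Rightarrow> 'm) \<Rightarrow> ('o, 'm) seq \<Rightarrow> bool" where
  "meets_then_cokernels C n X K E \<longleftrightarrow> is_n_sequence C n E \<and>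
     FObj E (ones n) = X \<and>
     (\<forall>\<sigma>\<in>three_objs n. (\<forall>i<n. \<sigma> i \<noteq> 0) \<longrightarrow>
        greatest (NSub C X) (FMor E (ones n, \<sigma>)) (Lower (NSub C X) (K ` {i. i < n \<and> \<sigma> i = 2}))) \<and>
     (\<forall>i<n. \<forall>\<sigma>\<in>three_objs n. (\<forall>j. i < j \<and> j < n \<longrightarrow> \<sigma> j \<noteq> 0) \<longrightarrow>
        is_cokernel C (seq_edge E i \<sigma> 1 0) (seq_edge E i \<sigma> 2 1))"

section \<open>Iterated arrow categories and \<open>n\<close>-cubic extensions\<close>

text \<open>Objects and morphisms of all the categories \<open>Arr\<^sup>n(C)\<close> live in one type, so that the arrow
  construction can be iterated \<open>n\<close> times. \<open>Sq f g a b\<close> is the commutative square from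
  \<open>f\<close> to \<open>g\<close> with components \<open>a\<close> (between the domains) and \<open>b\<close> (between the codomains), i.e.
  \<open>g \<cdot> a = b \<cdot> f\<close>.\<close>

datatype ('o, 'm) cell =
    Ob (un_Ob: 'o)
  | Ar (un_Ar: 'm)
  | Sq (sq_src: "('o, 'm) cell") (sq_trg: "('o, 'm) cell")
       (sq_fst: "('o, 'm) cell") (sq_snd: "('o, 'm) cell")

type_synonym ('o, 'm) cell_cat = "(('o, 'm) cell, ('o, 'm) cell) category"

definition base_cat :: "('o, 'm) category \<Rightarrow> ('o, 'm) cell_cat" where
  "base_cat C = \<lparr>Obj = Ob ` Obj C, Mor = Ar ` Mor C,
     Dom = (\<lambda>x. Ob (Dom C (un_Ar x))), Cod = (\<lambda>x. Ob (Cod C (un_Ar x))),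
     Ident = (\<lambda>x. Ar (Ident C (un_Ob x))), Comp = (\<lambda>y x. Ar (un_Ar y \<cdot>\<^bsub>C\<^esub> un_Ar x))\<rparr>"

definition arrow_cat :: "('o, 'm) cell_cat \<Rightarrow> ('o, 'm) cell_cat" where
  "arrow_cat D = \<lparr>Obj = Mor D,
     Mor = {Sq f g a b | f g a b. f \<in> Mor D \<and> g \<in> Mor D \<and>
       a \<in> Hom D (Dom D f) (Dom D g) \<and> b \<in> Hom D (Cod D f) (Cod D g) \<and> g \<cdot>\<^bsub>D\<^esub> a = b \<cdot>\<^bsub>D\<^esub> f},
     Dom = sq_src, Cod = sq_trg,
     Ident = (\<lambda>f. Sq f f (Ident D (Dom D f)) (Ident D (Cod D f))),
     Comp = (\<lambda>y x. Sq (sq_src x) (sq_trg y) (sq_fst y \<cdot>\<^bsub>D\<^esub> sq_fst x) (sq_snd y \<cdot>\<^bsub>D\<^esub> sq_snd x))\<rparr>"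

definition Arr_pow :: "('o, 'm) category \<Rightarrow> nat \<Rightarrow> ('o, 'm) cell_cat" where
  "Arr_pow C n = (arrow_cat ^^ n) (base_cat C)"

text \<open>An object of \<open>Arr\<^sup>n\<^sup>+\<^sup>2(C)\<close> is a commutative square \<open>Sq f g a b\<close> in \<open>Arr\<^sup>n(C)\<close>; its initial corner is
  the domain of \<open>f\<close> and \<open>a\<close>, and \<open>c\<close> is the comparison to the pullback of \<open>g\<close> and \<open>b\<close>.\<close>

fun cubic_extension :: "('o, 'm) category \<Rightarrow> nat \<Rightarrow> ('o, 'm) cell \<Rightarrow> bool" where
  "cubic_extension C 0 x \<longleftrightarrow> False"
| "cubic_extension C (Suc 0) x \<longleftrightarrow> (\<exists>f. x = Ar f \<and> is_regular_epi C f)"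
| "cubic_extension C (Suc (Suc n)) x \<longleftrightarrow>
     x \<in> Obj (Arr_pow C (Suc (Suc n))) \<and>
     (\<exists>f g a b. x = Sq f g a b \<and>
        cubic_extension C (Suc n) f \<and> cubic_extension C (Suc n) g \<and>
        cubic_extension C (Suc n) a \<and> cubic_extension C (Suc n) b \<and>
        (\<exists>p q c. is_pullback (Arr_pow C n) g b p q \<and>
           c \<in> Hom (Arr_pow C n) (Dom (Arr_pow C n) f) (Dom (Arr_pow C n) p) \<and>
           p \<cdot>\<^bsub>Arr_pow C n\<^esub> c = a \<and> q \<cdot>\<^bsub>Arr_pow C n\<^esub> c = f \<and>
           cubic_extension C (Suc n) c))"

text \<open>\<open>seq_cube E m \<sigma> \<tau>\<close>, for \<open>\<sigma> \<le> \<tau>\<close>, is the morphism of \<open>Arr\<^sup>m(C)\<close> given by \<open>E\<close> when the coordinates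
  below \<open>m\<close> range over \<open>{0, 1}\<close> and the remaining ones decrease from those of \<open>\<tau>\<close> to those of \<open>\<sigma>\<close>.
  An object of \<open>Arr\<^sup>n(C)\<close> being a morphism of \<open>Arr\<^sup>n\<^sup>-\<^sup>1(C)\<close>, the restriction of an \<open>n\<close>-sequence to the
  objects with all coordinates in \<open>{0, 1}\<close> lets the last coordinate decrease from \<open>1\<close> to \<open>0\<close>.\<close>

fun seq_cube :: "('o, 'm) seq \<Rightarrow> nat \<Rightarrow> (nat \<Rightarrow> nat) \<Rightarrow> (nat \<Rightarrow> nat) \<Rightarrow> ('o, 'm) cell" where
  "seq_cube E 0 \<sigma> \<tau> = Ar (FMor E (\<sigma>, \<tau>))"
| "seq_cube E (Suc m) \<sigma> \<tau> =
     Sq (seq_cube E m (\<tau>(m := 0)) (\<tau>(m := 1))) (seq_cube E m (\<sigma>(m := 0)) (\<sigma>(m := 1)))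
        (seq_cube E m (\<sigma>(m := 1)) (\<tau>(m := 1))) (seq_cube E m (\<sigma>(m := 0)) (\<tau>(m := 0)))"

fun cube_restriction :: "nat \<Rightarrow> ('o, 'm) seq \<Rightarrow> ('o, 'm) cell" where
  "cube_restriction 0 E = Ob (FObj E (\<lambda>_. 0))"
| "cube_restriction (Suc m) E = seq_cube E m (\<lambda>_. 0) ((\<lambda>_. 0)(m := 1))"

end

theory Submission
  imports Defs
begin

text \<open>Write \<open>K(A)\<close> for the meet of the \<open>K\<^sub>i\<close> with \<open>i \<in> A\<close>. Successive cokernels can only produce, at the
  object of \<open>3\<^sup>n\<close> with \<open>2\<close> on \<open>A\<close>, \<open>0\<close> on \<open>B\<close> and \<open>1\<close> elsewhere, the quotient of \<open>K(A)\<close> by the join of the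
  \<open>K(A \<union> {b})\<close> with \<open>b \<in> B\<close>. Hence a sequence in direction \<open>i\<close> is short exact if and only if its first
  morphism is monic, which says that the meet of \<open>K(A \<union> {i})\<close> with this join is the join of the
  \<open>K(A \<union> {i, b})\<close>. In the modular lattice of normal subobjects these special cases imply the general
  equality. For a \<open>3\<^sup>n\<close>-diagram \<open>E\<close> with \<open>n \<ge> 2\<close>, the comparison from its initial corner to the pullback
  in its last two directions is the last direction of a \<open>3\<^sup>n\<^sup>-\<^sup>1\<close>-diagram, so the cubic extension property
  follows by induction.\<close>

section \<open>Regular and protomodular toolkit\<close>

text \<open>An abstract semi-abelian category has no points to argue with, so a subobject of
  \<open>X\<close> is handled as the set of morphisms into \<open>X\<close> that factor through it.
  Meets are then intersections, and regular epimorphisms serve as covers: an element has a preimage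
  only after restriction along one, and membership in a kernel or a subobject may be tested after
  such a restriction. Joins are the obstacle, since a union of such sets does not come from a
  subobject in general. They become computable because the direct image of a normal subobject along
  a regular epimorphism is again normal. This is where Barr exactness (a relation that is reflexive
  and symmetric turns out transitive, hence is a kernel pair) meets protomodularity (the kernel and
  the section of a point generate it). A second obstacle is that cokernels and pullbacks are
  determined only up to isomorphism: a given sequence is compared with concrete quotients through
  pairs \<open>k\<close>, \<open>e\<close>, the inclusion of a meet into \<open>X\<close> and a
  quotient map onto \<open>E \<sigma>\<close>, and pullbacks chosen separately at each vertex of a
  cube have to be assembled into a functor.\<close>

lemma Hom_iff [simp]: "f \<in> Hom C a b \<longleftrightarrow> f \<in> Mor C \<and> Dom C f = a \<and> Cod C f = b"
  by (simp add: Hom_def)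

section \<open>Monomorphisms, pullbacks and regular epimorphisms in an arbitrary category\<close>

context category
begin

lemma Ident_simps [simp]:
  assumes "a \<in> Obj C"
  shows "Ident C a \<in> Mor C" "Dom C (Ident C a) = a" "Cod C (Ident C a) = a"
  using Ident_Hom[OF assms] by auto

lemma Comp_simps [simp]:
  assumes "f \<in> Mor C" "g \<in> Mor C" "Cod C f = Dom C g"
  shows "g \<cdot> f \<in> Mor C" "Dom C (g \<cdot> f) = Dom C f" "Cod C (g \<cdot> f) = Cod C g"
  using Comp_Hom[of f "Dom C f" "Cod C f" g "Cod C g"] assms by auto

lemma Comp_Ident_simp [simp]: "f \<in> Mor C \<Longrightarrow> Dom C f = a \<Longrightarrow> f \<cdot> Ident C a = f"
  using Comp_Ident[of f a "Cod C f"] by auto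

lemma Ident_Comp_simp [simp]: "f \<in> Mor C \<Longrightarrow> Cod C f = b \<Longrightarrow> Ident C b \<cdot> f = f"
  using Ident_Comp[of f "Dom C f" b] by auto

lemma Comp_assoc_simp [simp]:
  assumes "f \<in> Mor C" "g \<in> Mor C" "h \<in> Mor C" "Cod C f = Dom C g" "Cod C g = Dom C h"
  shows "(h \<cdot> g) \<cdot> f = h \<cdot> (g \<cdot> f)"
  using Comp_assoc[of f "Dom C f" "Cod C f" g "Cod C g" h "Cod C h"] assms by auto

lemma Obj_simps [simp]: "f \<in> Mor C \<Longrightarrow> Dom C f \<in> Obj C" "f \<in> Mor C \<Longrightarrow> Cod C f \<in> Obj C"
  by (auto intro: Dom_Obj Cod_Obj)

text \<open>Associativity holds for composable morphisms only, and simp brings composites to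
  right-nested form, in which an equation between two composites no longer matches. This rule and
  \<open>comp_cong1\<close> apply such an equation at the left end of a longer composite.\<close>

lemma comp_cong:
  assumes "g \<cdot> f = g' \<cdot> f'" "t \<in> Mor C" "Cod C t = Dom C f"
    "f \<in> Mor C" "g \<in> Mor C" "Cod C f = Dom C g" "f' \<in> Mor C" "g' \<in> Mor C" "Cod C f' = Dom C g'"
    "Dom C f' = Dom C f"
  shows "g \<cdot> (f \<cdot> t) = g' \<cdot> (f' \<cdot> t)"
proof -
  have "(g \<cdot> f) \<cdot> t = (g' \<cdot> f') \<cdot> t" using assms(1) by simp
  then show ?thesis using assms(2-) by simp
qed

lemma comp_cong1:
  assumes "g \<cdot> f = h" "t \<in> Mor C" "Cod C t = Dom C f"
    "f \<in> Mor C" "g \<in> Mor C" "Cod C f = Dom C g"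
  shows "g \<cdot> (f \<cdot> t) = h \<cdot> t"
  using assms by (metis Comp_assoc_simp)

definition monic :: "'m \<Rightarrow> bool" where
  "monic m \<longleftrightarrow> m \<in> Mor C \<and> (\<forall>u\<in>Mor C. \<forall>v\<in>Mor C. Cod C u = Dom C m \<and> Cod C v = Dom C m \<and>
     Dom C u = Dom C v \<and> m \<cdot> u = m \<cdot> v \<longrightarrow> u = v)"

lemma monic_Mor [simp]: "monic m \<Longrightarrow> m \<in> Mor C"
  by (simp add: monic_def)

lemma monicD:
  assumes "m \<cdot> u = m \<cdot> v" "monic m" "u \<in> Hom C T (Dom C m)" "v \<in> Hom C T (Dom C m)"
  shows "u = v"
  using assms unfolding monic_def by auto

lemma monicI:
  assumes "m \<in> Mor C"
    and "\<And>T u v. u \<in> Hom C T (Dom C m) \<Longrightarrow> v \<in> Hom C T (Dom C m) \<Longrightarrow> m \<cdot> u = m \<cdot> v \<Longrightarrow> u = v"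
  shows "monic m"
  using assms unfolding monic_def by auto

lemma monic_comp:
  assumes "monic m" "monic m'" "Cod C m = Dom C m'"
  shows "monic (m' \<cdot> m)"
proof (rule monicI)
  show "m' \<cdot> m \<in> Mor C" using assms by simp
  fix T u v assume u: "u \<in> Hom C T (Dom C (m' \<cdot> m))" and v: "v \<in> Hom C T (Dom C (m' \<cdot> m))"
    and eq: "m' \<cdot> m \<cdot> u = m' \<cdot> m \<cdot> v"
  have "m' \<cdot> (m \<cdot> u) = m' \<cdot> (m \<cdot> v)" using u v eq assms by simp
  then have "m \<cdot> u = m \<cdot> v" by (rule monicD[OF _ assms(2), where T = T]) (use u v assms in auto)
  then show "u = v" by (rule monicD[OF _ assms(1), where T = T]) (use u v assms in auto)
qed

lemma monic_cancel:
  assumes "monic (m' \<cdot> m)" "m \<in> Mor C" "m' \<in> Mor C" "Cod C m = Dom C m'"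
  shows "monic m"
proof (rule monicI)
  show "m \<in> Mor C" using assms by simp
  fix T u v assume u: "u \<in> Hom C T (Dom C m)" and v: "v \<in> Hom C T (Dom C m)" and eq: "m \<cdot> u = m \<cdot> v"
  show "u = v" by (rule monicD[OF _ assms(1), where T = T]) (use assms u v eq in auto)
qed

lemma monic_Ident: "a \<in> Obj C \<Longrightarrow> monic (Ident C a)"
  by (rule monicI) auto

lemma iso_obtain:
  assumes "is_iso C f"
  obtains g where "f \<in> Mor C" "g \<in> Hom C (Cod C f) (Dom C f)" "g \<cdot> f = Ident C (Dom C f)"
    "f \<cdot> g = Ident C (Cod C f)"
  using assms unfolding is_iso_def by blast

lemma iso_monic:
  assumes "is_iso C f" shows "monic f"
proof -
  obtain g where g: "f \<in> Mor C" "g \<in> Hom C (Cod C f) (Dom C f)" "g \<cdot> f = Ident C (Dom C f)"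
    using iso_obtain[OF assms] by metis
  have "monic (g \<cdot> f)" using g by (simp add: monic_Ident)
  then show ?thesis by (rule monic_cancel) (use g in auto)
qed

lemma split_monic_iso:
  assumes "monic m" "s \<in> Hom C (Cod C m) (Dom C m)" "m \<cdot> s = Ident C (Cod C m)"
  shows "is_iso C m"
proof -
  have "m \<cdot> (s \<cdot> m) = m \<cdot> Ident C (Dom C m)"
    using assms comp_cong1[OF assms(3), of m] by simp
  then have "s \<cdot> m = Ident C (Dom C m)" by (rule monicD[OF _ assms(1)]) (use assms in auto)
  then show ?thesis using assms unfolding is_iso_def by auto
qed

text \<open>Passing from a monomorphism to everything that factors through it turns the order of
  subobjects into set inclusion, and two representatives of one subobject into literally the same
  set.\<close>

definition sieve :: "'m \<Rightarrow> 'm set" where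
  "sieve m = {t \<in> Mor C. Cod C t = Cod C m \<and> (\<exists>u \<in> Hom C (Dom C t) (Dom C m). m \<cdot> u = t)}"

lemma sieveI: "m \<in> Mor C \<Longrightarrow> u \<in> Mor C \<Longrightarrow> Cod C u = Dom C m \<Longrightarrow> m \<cdot> u = t \<Longrightarrow> t \<in> sieve m"
  unfolding sieve_def by auto

lemma sieveE:
  assumes "t \<in> sieve m"
  obtains u where "u \<in> Hom C (Dom C t) (Dom C m)" "m \<cdot> u = t" "t \<in> Mor C" "Cod C t = Cod C m"
  using assms unfolding sieve_def by blast

lemma sieveI_ex:
  assumes "\<exists>u \<in> Hom C T (Dom C m). m \<cdot> u = t \<and> Q u" "m \<in> Mor C"
  shows "t \<in> sieve m"
proof -
  obtain u where "u \<in> Hom C T (Dom C m)" "m \<cdot> u = t" using assms(1) by blast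
  then show ?thesis using assms(2) by (intro sieveI[of m u]) simp_all
qed

lemma sieve_self: "m \<in> Mor C \<Longrightarrow> m \<in> sieve m"
  by (rule sieveI[of _ "Ident C (Dom C m)"]) auto

lemma sieve_comp:
  assumes "t \<in> sieve m" "m \<in> Mor C" "u \<in> Mor C" "Cod C u = Dom C t"
  shows "t \<cdot> u \<in> sieve m"
proof -
  obtain w where w: "w \<in> Hom C (Dom C t) (Dom C m)" "m \<cdot> w = t" using assms(1) by (rule sieveE)
  have "m \<cdot> (w \<cdot> u) = t \<cdot> u" using w(2) by (rule comp_cong1) (use w assms in auto)
  then show ?thesis using w assms by (intro sieveI[of m "w \<cdot> u"]) auto
qed

text \<open>Existence and uniqueness are separated, with the test object \<open>T\<close> left free,
  because most uses need only one half: lifting a pair, or joint monicity of the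
  projections.\<close>

lemma pullbackE:
  assumes "is_pullback C f g p q"
  obtains "f \<in> Mor C" "g \<in> Mor C" "Cod C f = Cod C g" "p \<in> Hom C (Dom C p) (Dom C f)"
    "q \<in> Hom C (Dom C p) (Dom C g)" "f \<cdot> p = g \<cdot> q"
    "\<And>T s t. s \<in> Hom C T (Dom C f) \<Longrightarrow> t \<in> Hom C T (Dom C g) \<Longrightarrow> f \<cdot> s = g \<cdot> t \<Longrightarrow>
      \<exists>u \<in> Hom C T (Dom C p). p \<cdot> u = s \<and> q \<cdot> u = t"
    "\<And>T u v. u \<in> Hom C T (Dom C p) \<Longrightarrow> v \<in> Hom C T (Dom C p) \<Longrightarrow> p \<cdot> u = p \<cdot> v \<Longrightarrow>
      q \<cdot> u = q \<cdot> v \<Longrightarrow> u = v"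
proof
  note A = assms[unfolded is_pullback_def]
  show b: "f \<in> Mor C" "g \<in> Mor C" "Cod C f = Cod C g" "p \<in> Hom C (Dom C p) (Dom C f)"
    "q \<in> Hom C (Dom C p) (Dom C g)" "f \<cdot> p = g \<cdot> q"
    using A by auto
  have un: "\<exists>!u. u \<in> Hom C (Dom C s) (Dom C p) \<and> p \<cdot> u = s \<and> q \<cdot> u = t"
    if "s \<in> Mor C" "t \<in> Mor C" "Dom C s = Dom C t" "Cod C s = Dom C f" "Cod C t = Dom C g"
      "f \<cdot> s = g \<cdot> t" for s t
    using A that by blast
  show "\<exists>u \<in> Hom C T (Dom C p). p \<cdot> u = s \<and> q \<cdot> u = t"
    if "s \<in> Hom C T (Dom C f)" "t \<in> Hom C T (Dom C g)" "f \<cdot> s = g \<cdot> t" for T s t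
  proof -
    have "\<exists>!u. u \<in> Hom C (Dom C s) (Dom C p) \<and> p \<cdot> u = s \<and> q \<cdot> u = t"
      by (rule un) (use that in auto)
    then obtain u where "u \<in> Hom C (Dom C s) (Dom C p)" "p \<cdot> u = s" "q \<cdot> u = t" by blast
    then show ?thesis using that(1) by (intro bexI[of _ u]) simp_all
  qed
  show "u = v" if "u \<in> Hom C T (Dom C p)" "v \<in> Hom C T (Dom C p)" "p \<cdot> u = p \<cdot> v"
    "q \<cdot> u = q \<cdot> v" for T u v
  proof -
    have "\<exists>!w. w \<in> Hom C (Dom C (p \<cdot> u)) (Dom C p) \<and> p \<cdot> w = p \<cdot> u \<and> q \<cdot> w = q \<cdot> u"
    proof (rule un)
      show "f \<cdot> (p \<cdot> u) = g \<cdot> (q \<cdot> u)" by (rule comp_cong) (use b that in auto)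
    qed (use b that in auto)
    moreover have "Dom C (p \<cdot> u) = T" using that b by simp
    ultimately show ?thesis using that by auto
  qed
qed

lemma pullbackI:
  assumes "f \<in> Mor C" "g \<in> Mor C" "Cod C f = Cod C g" "p \<in> Hom C P (Dom C f)"
    "q \<in> Hom C P (Dom C g)" "f \<cdot> p = g \<cdot> q"
    "\<And>T s t. s \<in> Hom C T (Dom C f) \<Longrightarrow> t \<in> Hom C T (Dom C g) \<Longrightarrow> f \<cdot> s = g \<cdot> t \<Longrightarrow>
      \<exists>u \<in> Hom C T P. p \<cdot> u = s \<and> q \<cdot> u = t"
    "\<And>T u v. u \<in> Hom C T P \<Longrightarrow> v \<in> Hom C T P \<Longrightarrow> p \<cdot> u = p \<cdot> v \<Longrightarrow>
      q \<cdot> u = q \<cdot> v \<Longrightarrow> u = v"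
  shows "is_pullback C f g p q"
  unfolding is_pullback_def
proof (intro conjI ballI impI)
  fix s t assume s: "s \<in> Mor C" and t: "t \<in> Mor C" and
    "Dom C s = Dom C t \<and> Cod C s = Dom C f \<and> Cod C t = Dom C g \<and> f \<cdot> s = g \<cdot> t"
  then obtain u where "u \<in> Hom C (Dom C s) P" "p \<cdot> u = s \<and> q \<cdot> u = t"
    using assms(7)[of s "Dom C s" t] by auto
  then show "\<exists>!u. u \<in> Hom C (Dom C s) (Dom C p) \<and> p \<cdot> u = s \<and> q \<cdot> u = t"
    using assms(4) assms(8) by (intro ex1I[of _ u]) auto
qed (use assms in auto)

definition epic :: "'m \<Rightarrow> bool" where
  "epic e \<longleftrightarrow> e \<in> Mor C \<and> (\<forall>u\<in>Mor C. \<forall>v\<in>Mor C. Dom C u = Cod C e \<and> Dom C v = Cod C e \<and>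
     Cod C u = Cod C v \<and> u \<cdot> e = v \<cdot> e \<longrightarrow> u = v)"

lemma epicD:
  assumes "u \<cdot> e = v \<cdot> e" "epic e" "u \<in> Hom C (Cod C e) T" "v \<in> Hom C (Cod C e) T"
  shows "u = v"
  using assms unfolding epic_def by auto

abbreviation regepi :: "'m \<Rightarrow> bool" where
  "regepi e \<equiv> is_regular_epi C e"

lemma coequalizerE:
  assumes "is_coequalizer C e f g"
  obtains "e \<in> Mor C" "f \<in> Mor C" "g \<in> Mor C" "Dom C g = Dom C f" "Cod C f = Dom C e"
    "Cod C g = Dom C e" "e \<cdot> f = e \<cdot> g"
    "\<And>T t. t \<in> Hom C (Dom C e) T \<Longrightarrow> t \<cdot> f = t \<cdot> g \<Longrightarrow> \<exists>u \<in> Hom C (Cod C e) T. u \<cdot> e = t"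
    "\<And>T u v. u \<in> Hom C (Cod C e) T \<Longrightarrow> v \<in> Hom C (Cod C e) T \<Longrightarrow> u \<cdot> e = v \<cdot> e \<Longrightarrow> u = v"
proof
  note A = assms[unfolded is_coequalizer_def]
  show b: "e \<in> Mor C" "f \<in> Mor C" "g \<in> Mor C" "Dom C g = Dom C f" "Cod C f = Dom C e"
    "Cod C g = Dom C e" "e \<cdot> f = e \<cdot> g"
    using A by auto
  have un: "\<exists>!u. u \<in> Hom C (Cod C e) (Cod C t) \<and> u \<cdot> e = t"
    if "t \<in> Mor C" "Dom C t = Cod C f" "t \<cdot> f = t \<cdot> g" for t
    using A that by blast
  show "\<exists>u \<in> Hom C (Cod C e) T. u \<cdot> e = t" if "t \<in> Hom C (Dom C e) T" "t \<cdot> f = t \<cdot> g" for T t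
  proof -
    have "\<exists>!u. u \<in> Hom C (Cod C e) (Cod C t) \<and> u \<cdot> e = t"
      by (rule un) (use that b in auto)
    then obtain u where "u \<in> Hom C (Cod C e) (Cod C t)" "u \<cdot> e = t" by blast
    then show ?thesis using that(1) by (intro bexI[of _ u]) simp_all
  qed
  show "u = v" if "u \<in> Hom C (Cod C e) T" "v \<in> Hom C (Cod C e) T" "u \<cdot> e = v \<cdot> e" for T u v
  proof -
    have "\<exists>!w. w \<in> Hom C (Cod C e) (Cod C (u \<cdot> e)) \<and> w \<cdot> e = u \<cdot> e"
    proof (rule un)
      have "u \<cdot> (e \<cdot> f) = u \<cdot> (e \<cdot> g)" using b(7) by simp
      then show "(u \<cdot> e) \<cdot> f = (u \<cdot> e) \<cdot> g" using b(1-6) that(1) by simp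
    qed (use b that in auto)
    moreover have "Cod C (u \<cdot> e) = T" using that b by simp
    ultimately show ?thesis using that by auto
  qed
qed

lemma regepiE:
  assumes "regepi e"
  obtains f g where "e \<in> Mor C" "f \<in> Mor C" "g \<in> Mor C" "Dom C g = Dom C f" "Cod C f = Dom C e"
    "Cod C g = Dom C e" "e \<cdot> f = e \<cdot> g"
    "\<And>T t. t \<in> Hom C (Dom C e) T \<Longrightarrow> t \<cdot> f = t \<cdot> g \<Longrightarrow> \<exists>u \<in> Hom C (Cod C e) T. u \<cdot> e = t"
    "\<And>T u v. u \<in> Hom C (Cod C e) T \<Longrightarrow> v \<in> Hom C (Cod C e) T \<Longrightarrow> u \<cdot> e = v \<cdot> e \<Longrightarrow> u = v"
proof -
  obtain f g where "is_coequalizer C e f g" using assms unfolding is_regular_epi_def by auto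
  then show ?thesis by (rule coequalizerE) (rule that[of f g], assumption+)
qed

lemma regepi_epic: assumes "regepi e" shows "epic e"
proof -
  obtain f g where "e \<in> Mor C" and
    un: "\<And>T u v. u \<in> Hom C (Cod C e) T \<Longrightarrow> v \<in> Hom C (Cod C e) T \<Longrightarrow> u \<cdot> e = v \<cdot> e \<Longrightarrow> u = v"
    using assms by (rule regepiE) blast
  then show ?thesis unfolding epic_def using un by auto
qed

lemma regepi_Mor [simp]: "regepi e \<Longrightarrow> e \<in> Mor C"
  unfolding is_regular_epi_def is_coequalizer_def by auto

text \<open>As \<open>m\<close> is monic, \<open>u\<close> already identifies the pair coequalized
  by \<open>e\<close>, so it descends along \<open>e\<close>. This diagonal makes it possible to
  descend factorisations along covers.\<close>

lemma regepi_strong: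
  assumes e: "regepi e" and m: "monic m" and u: "u \<in> Hom C (Dom C e) (Dom C m)"
    and v: "v \<in> Hom C (Cod C e) (Cod C m)" and eq: "m \<cdot> u = v \<cdot> e"
  obtains w where "w \<in> Hom C (Cod C e) (Dom C m)" "w \<cdot> e = u" "m \<cdot> w = v"
proof -
  obtain f g where B: "e \<in> Mor C" "f \<in> Mor C" "g \<in> Mor C" "Dom C g = Dom C f" "Cod C f = Dom C e"
    "Cod C g = Dom C e" "e \<cdot> f = e \<cdot> g"
    and ex: "\<And>T t. t \<in> Hom C (Dom C e) T \<Longrightarrow> t \<cdot> f = t \<cdot> g \<Longrightarrow> \<exists>u \<in> Hom C (Cod C e) T. u \<cdot> e = t"
    using e by (rule regepiE) blast
  have "m \<cdot> (u \<cdot> f) = m \<cdot> (u \<cdot> g)"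
  proof -
    have "m \<cdot> (u \<cdot> f) = v \<cdot> (e \<cdot> f)" using eq by (rule comp_cong) (use B u v m in auto)
    also have "\<dots> = v \<cdot> (e \<cdot> g)" using B(7) by simp
    also have "\<dots> = m \<cdot> (u \<cdot> g)" using eq[symmetric] by (rule comp_cong) (use B u v m in auto)
    finally show ?thesis .
  qed
  then have "u \<cdot> f = u \<cdot> g" by (rule monicD[OF _ m]) (use B(1-6) u in auto)
  then obtain w where w: "w \<in> Hom C (Cod C e) (Dom C m)" "w \<cdot> e = u" using ex[OF u] by auto
  have "(m \<cdot> w) \<cdot> e = v \<cdot> e" using w eq m B(1-6) by simp
  then have "m \<cdot> w = v" by (rule epicD[OF _ regepi_epic[OF e]]) (use w v m in auto)
  then show ?thesis using w that by auto
qed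

text \<open>The diagonal filler against the identity of the codomain is a section of
  \<open>m\<close>.\<close>

lemma regepi_monic_iso:
  assumes e: "regepi e" and m: "monic m" and u: "u \<in> Hom C (Dom C e) (Dom C m)"
    and eq: "m \<cdot> u = e"
  shows "is_iso C m"
proof -
  have [simp]: "Cod C m = Cod C e" using eq u m e by (metis Comp_simps(3) Hom_iff monic_Mor)
  obtain w where "w \<in> Hom C (Cod C e) (Dom C m)" "w \<cdot> e = u" "m \<cdot> w = Ident C (Cod C e)"
    using regepi_strong[OF e m u, of "Ident C (Cod C e)"] eq e m by auto
  then show ?thesis using split_monic_iso[OF m, of w] by auto
qed

lemma regepi_iso_comp:
  assumes e: "regepi e" and m: "is_iso C m" and c: "Cod C e = Dom C m"
  shows "regepi (m \<cdot> e)"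
proof -
  obtain f g where B: "e \<in> Mor C" "f \<in> Mor C" "g \<in> Mor C" "Dom C g = Dom C f" "Cod C f = Dom C e"
    "Cod C g = Dom C e" "e \<cdot> f = e \<cdot> g"
    and ex: "\<And>T t. t \<in> Hom C (Dom C e) T \<Longrightarrow> t \<cdot> f = t \<cdot> g \<Longrightarrow> \<exists>u \<in> Hom C (Cod C e) T. u \<cdot> e = t"
    using e by (rule regepiE) blast
  obtain i where i: "m \<in> Mor C" "i \<in> Hom C (Cod C m) (Dom C m)" "i \<cdot> m = Ident C (Dom C m)"
    "m \<cdot> i = Ident C (Cod C m)" using iso_obtain[OF m] by blast
  have "is_coequalizer C (m \<cdot> e) f g" unfolding is_coequalizer_def
  proof (intro conjI ballI impI)
    have "m \<cdot> (e \<cdot> f) = m \<cdot> (e \<cdot> g)" using B(7) by simp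
    then show "m \<cdot> e \<cdot> f = m \<cdot> e \<cdot> g" using B(1-6) i(1) c by simp
    fix t assume t: "t \<in> Mor C" and t2: "Dom C t = Cod C f \<and> t \<cdot> f = t \<cdot> g"
    obtain u where u: "u \<in> Hom C (Cod C e) (Cod C t)" "u \<cdot> e = t"
      using ex[of t "Cod C t"] t t2 B(5) by auto
    show "\<exists>!u. u \<in> Hom C (Cod C (m \<cdot> e)) (Cod C t) \<and> u \<cdot> (m \<cdot> e) = t"
    proof (rule ex1I[of _ "u \<cdot> i"], rule conjI)
      show "u \<cdot> i \<in> Hom C (Cod C (m \<cdot> e)) (Cod C t)" using u i c e by auto
      have "u \<cdot> (i \<cdot> (m \<cdot> e)) = u \<cdot> e" using i c e comp_cong1[OF i(3), of e] by simp
      then show "u \<cdot> i \<cdot> (m \<cdot> e) = t" using u i c e by simp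
      fix w assume w: "w \<in> Hom C (Cod C (m \<cdot> e)) (Cod C t) \<and> w \<cdot> (m \<cdot> e) = t"
      have "(w \<cdot> m) \<cdot> e = u \<cdot> e" using w u(2) i c e by simp
      then have wm: "w \<cdot> m = u"
        by (rule epicD[OF _ regepi_epic[OF e], where T = "Cod C t"]) (use w u(1) i(1) c e in auto)
      have "w = w \<cdot> (m \<cdot> i)" using w i c e by simp
      also have "\<dots> = u \<cdot> i" using wm by (rule comp_cong1) (use w i(1,2) c e in auto)
      finally show "w = u \<cdot> i" .
    qed
  qed (use B i c in auto)
  then show ?thesis unfolding is_regular_epi_def by auto
qed

text \<open>Membership in a subobject is a local property: the factorisation found on the cover
  descends by the diagonal filler.\<close>

lemma regepi_sieve:
  assumes te: "t \<cdot> e \<in> sieve m" and e: "regepi e" and m: "monic m"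
    and t: "t \<in> Hom C (Cod C e) (Cod C m)"
  shows "t \<in> sieve m"
proof -
  obtain u where u: "u \<in> Hom C (Dom C e) (Dom C m)" "m \<cdot> u = t \<cdot> e"
    using te t e by (auto elim!: sieveE)
  obtain w where "w \<in> Hom C (Cod C e) (Dom C m)" "m \<cdot> w = t"
    using regepi_strong[OF e m u(1) t u(2)] by blast
  then show ?thesis using m by (intro sieveI[of m w]) auto
qed

end

section \<open>Image factorisations and the calculus of regular epimorphisms\<close>

context semi_abelian_category
begin

lemma regular: "is_regular_cat C"
  using Barr_exact unfolding is_Barr_exact_def by auto

lemma pullback_obtain:
  assumes "f \<in> Mor C" "g \<in> Mor C" "Cod C f = Cod C g"
  obtains P p q where "is_pullback C f g p q" "p \<in> Hom C P (Dom C f)"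
    "q \<in> Hom C P (Dom C g)" "f \<cdot> p = g \<cdot> q"
    "\<And>T s t. s \<in> Hom C T (Dom C f) \<Longrightarrow> t \<in> Hom C T (Dom C g) \<Longrightarrow> f \<cdot> s = g \<cdot> t \<Longrightarrow>
      \<exists>u \<in> Hom C T P. p \<cdot> u = s \<and> q \<cdot> u = t"
    "\<And>T u v. u \<in> Hom C T P \<Longrightarrow> v \<in> Hom C T P \<Longrightarrow> p \<cdot> u = p \<cdot> v \<Longrightarrow>
      q \<cdot> u = q \<cdot> v \<Longrightarrow> u = v"
proof -
  obtain p q where pb: "is_pullback C f g p q"
    using regular assms unfolding is_regular_cat_def is_finitely_complete_def by blast
  then show ?thesis by (rule pullbackE) (rule that[OF pb], assumption+)
qed

lemma regepi_pullback:
  "is_pullback C f g p q \<Longrightarrow> regepi f \<Longrightarrow> regepi q"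
  using regular unfolding is_regular_cat_def by blast

text \<open>The substitute for choosing a preimage: the pullback of \<open>e\<close> along
  \<open>t\<close> is a cover of the domain of \<open>t\<close>, and on this cover \<open>t\<close>
  has a preimage under \<open>e\<close>.\<close>

lemma regepi_lift:
  assumes "regepi e" "t \<in> Mor C" "Cod C t = Cod C e"
  obtains T e' t' where "regepi e'" "e' \<in> Hom C T (Dom C t)" "t' \<in> Hom C T (Dom C e)"
    "e \<cdot> t' = t \<cdot> e'"
proof -
  obtain P p q where "is_pullback C e t p q" "p \<in> Hom C P (Dom C e)"
    "q \<in> Hom C P (Dom C t)" "e \<cdot> p = t \<cdot> q"
    using pullback_obtain[of e t] assms by (metis regepi_Mor)
  then show ?thesis using regepi_pullback[of e t p q] assms that by auto
qed

text \<open>The regular epimorphism is the coequalizer of the kernel pair of \<open>f\<close>. The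
  induced \<open>m\<close> is monic because two elements with the same value under \<open>m\<close>
  have, on a cover, preimages under \<open>c\<close> that form an element of the kernel pair, and
  \<open>c\<close> identifies these.\<close>

lemma image_obtain:
  assumes f: "f \<in> Mor C"
  obtains I c m where "regepi c" "monic m" "c \<in> Hom C (Dom C f) I" "m \<in> Hom C I (Cod C f)"
    "m \<cdot> c = f"
proof -
  obtain P p q where pb: "is_pullback C f f p q" "p \<in> Hom C P (Dom C f)"
    "q \<in> Hom C P (Dom C f)" "f \<cdot> p = f \<cdot> q"
    and un: "\<And>T s t. s \<in> Hom C T (Dom C f) \<Longrightarrow> t \<in> Hom C T (Dom C f) \<Longrightarrow> f \<cdot> s = f \<cdot> t \<Longrightarrow>
      \<exists>u \<in> Hom C T P. p \<cdot> u = s \<and> q \<cdot> u = t"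
    by (rule pullback_obtain[OF f f refl]) (rule that, assumption+)
  obtain c where c: "is_coequalizer C c p q"
    using pb(1) regular unfolding is_regular_cat_def by blast
  have B: "c \<in> Mor C" "p \<in> Mor C" "q \<in> Mor C" "Cod C p = Dom C c" "c \<cdot> p = c \<cdot> q"
    and ex: "\<And>T t. t \<in> Hom C (Dom C c) T \<Longrightarrow> t \<cdot> p = t \<cdot> q \<Longrightarrow> \<exists>u \<in> Hom C (Cod C c) T. u \<cdot> c = t"
    using c by (auto elim!: coequalizerE)
  obtain m where m: "m \<in> Hom C (Cod C c) (Cod C f)" "m \<cdot> c = f"
    using ex[of f "Cod C f"] f pb B(4) by auto
  have rc: "regepi c" using c unfolding is_regular_epi_def by auto
  have ct: "c \<in> Hom C (Dom C f) (Cod C c)" using B pb by auto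
  have "monic m"
  proof (rule monicI)
    fix T u v assume u: "u \<in> Hom C T (Dom C m)" and v: "v \<in> Hom C T (Dom C m)" and eq: "m \<cdot> u = m \<cdot> v"
    \<comment> \<open>The second lift starts from \<open>v\<close> already restricted along
      \<open>e1\<close>, so that both preimages finally live on the common cover
      \<open>T2\<close>.\<close>
    obtain T1 e1 x1 where 1: "regepi e1" "e1 \<in> Hom C T1 T" "x1 \<in> Hom C T1 (Dom C f)" "c \<cdot> x1 = u \<cdot> e1"
      using regepi_lift[OF rc, of u] u m ct by auto
    obtain T2 e2 x2 where 2: "regepi e2" "e2 \<in> Hom C T2 T1" "x2 \<in> Hom C T2 (Dom C f)"
      "c \<cdot> x2 = v \<cdot> e1 \<cdot> e2"
      using regepi_lift[OF rc, of "v \<cdot> e1"] v m ct 1 by auto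
    have "f \<cdot> (x1 \<cdot> e2) = m \<cdot> (u \<cdot> (e1 \<cdot> e2))"
    proof -
      have "f \<cdot> (x1 \<cdot> e2) = m \<cdot> (c \<cdot> (x1 \<cdot> e2))"
        using comp_cong1[OF m(2), of "x1 \<cdot> e2"] 1 2 ct m by simp
      also have "c \<cdot> (x1 \<cdot> e2) = u \<cdot> (e1 \<cdot> e2)" by (rule comp_cong) (use 1 2 ct m u in auto)
      finally show ?thesis .
    qed
    moreover have "f \<cdot> x2 = m \<cdot> (v \<cdot> (e1 \<cdot> e2))"
    proof -
      have "f \<cdot> x2 = m \<cdot> (c \<cdot> x2)"
        using comp_cong1[OF m(2), of "x2"] 1 2 ct m by simp
      also have "c \<cdot> x2 = v \<cdot> (e1 \<cdot> e2)" using 1 2 ct m v by simp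
      finally show ?thesis .
    qed
    moreover have "m \<cdot> (u \<cdot> (e1 \<cdot> e2)) = m \<cdot> (v \<cdot> (e1 \<cdot> e2))"
      using comp_cong[OF eq, of "e1 \<cdot> e2"] u v 1 2 m by auto
    ultimately have "f \<cdot> (x1 \<cdot> e2) = f \<cdot> x2" by simp
    then obtain w where w: "w \<in> Hom C T2 P" "p \<cdot> w = x1 \<cdot> e2" "q \<cdot> w = x2"
      using un[of "x1 \<cdot> e2" T2 x2] 1 2 f by auto
    have "c \<cdot> (p \<cdot> w) = c \<cdot> (q \<cdot> w)" by (rule comp_cong) (use B w pb in auto)
    then have "c \<cdot> (x1 \<cdot> e2) = v \<cdot> e1 \<cdot> e2" using w 2 by simp
    moreover have "c \<cdot> (x1 \<cdot> e2) = (u \<cdot> e1) \<cdot> e2" using 1 2 ct comp_cong1[OF 1(4), of e2] by simp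
    ultimately have "(u \<cdot> e1) \<cdot> e2 = (v \<cdot> e1) \<cdot> e2" by simp
    then have "u \<cdot> e1 = v \<cdot> e1"
      by (rule epicD[OF _ regepi_epic[OF 2(1)], where T = "Dom C m"]) (use 1 2 u v in auto)
    then show "u = v" by (rule epicD[OF _ regepi_epic[OF 1(1)], where T = "Dom C m"]) (use 1 u v in auto)
  qed (use m in simp)
  then show ?thesis using that[OF rc _ ct m] by auto
qed

text \<open>Extremal epimorphisms are regular: the monic part of the image factorisation is
  invertible. Cancellation and closure under composition are easy in this form.\<close>

lemma regepiI:
  assumes f: "f \<in> Mor C"
    and ex: "\<And>m u. monic m \<Longrightarrow> Cod C m = Cod C f \<Longrightarrow> u \<in> Hom C (Dom C f) (Dom C m) \<Longrightarrow> m \<cdot> u = f \<Longrightarrow> is_iso C m"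
  shows "regepi f"
proof -
  obtain I c m where A: "regepi c" "monic m" "c \<in> Hom C (Dom C f) I" "m \<in> Hom C I (Cod C f)"
    "m \<cdot> c = f" using f by (rule image_obtain)
  then have "is_iso C m" using ex[of m c] by auto
  then show ?thesis using regepi_iso_comp[OF A(1), of m] A by auto
qed

lemma regepi_cancel:
  assumes "regepi (g \<cdot> f)" "f \<in> Mor C" "g \<in> Mor C" "Cod C f = Dom C g"
  shows "regepi g"
proof (rule regepiI)
  fix m u assume m: "monic m" "Cod C m = Cod C g" and u: "u \<in> Hom C (Dom C g) (Dom C m)" "m \<cdot> u = g"
  have "m \<cdot> (u \<cdot> f) = g \<cdot> f" by (rule comp_cong1) (use m u assms in auto)
  then show "is_iso C m" using regepi_monic_iso[OF assms(1) m(1), of "u \<cdot> f"] assms u by auto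
qed (use assms in auto)

lemma regepi_comp:
  assumes f: "regepi f" and g: "regepi g" and c: "Cod C f = Dom C g"
  shows "regepi (g \<cdot> f)"
proof (rule regepiI)
  fix m u assume m: "monic m" "Cod C m = Cod C (g \<cdot> f)" and u: "u \<in> Hom C (Dom C (g \<cdot> f)) (Dom C m)"
    "m \<cdot> u = g \<cdot> f"
  obtain w where "w \<in> Hom C (Cod C f) (Dom C m)" "m \<cdot> w = g"
    using regepi_strong[OF f m(1), of u g] u f g c m by auto
  then show "is_iso C m" using regepi_monic_iso[OF g m(1), of w] c by auto
qed (use assms in auto)

lemma regepi_Ident: "a \<in> Obj C \<Longrightarrow> regepi (Ident C a)"
proof (rule regepiI)
  fix m u assume "a \<in> Obj C" "monic m" "Cod C m = Cod C (Ident C a)"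
    "u \<in> Hom C (Dom C (Ident C a)) (Dom C m)" "m \<cdot> u = Ident C a"
  then show "is_iso C m" using split_monic_iso[of m u] by simp
qed simp

lemma regepi_monic_is_iso: "regepi e \<Longrightarrow> monic e \<Longrightarrow> is_iso C e"
  using regepi_monic_iso[of e e "Ident C (Dom C e)"] by simp


section \<open>Zero morphisms and kernels\<close>

definition zero_obj :: 'o where "zero_obj = (SOME z. is_zero_object C z)"

lemma zero_object: "is_zero_object C zero_obj"
  using pointed unfolding is_pointed_def zero_obj_def by (rule someI_ex)

lemma zero_obj_Obj [simp]: "zero_obj \<in> Obj C"
  using zero_object by (simp add: is_zero_object_def is_terminal_def)

definition to_zero :: "'o \<Rightarrow> 'm" where "to_zero a = (THE f. f \<in> Hom C a zero_obj)"
definition from_zero :: "'o \<Rightarrow> 'm" where "from_zero a = (THE f. f \<in> Hom C zero_obj a)"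
definition zero_mor :: "'o \<Rightarrow> 'o \<Rightarrow> 'm" where "zero_mor a b = from_zero b \<cdot> to_zero a"

lemma to_zero_Hom: assumes "a \<in> Obj C" shows "to_zero a \<in> Hom C a zero_obj"
proof -
  have "\<exists>!f. f \<in> Hom C a zero_obj"
    using zero_object assms unfolding is_zero_object_def is_terminal_def by blast
  then show ?thesis unfolding to_zero_def by (rule theI')
qed

lemma from_zero_Hom: assumes "a \<in> Obj C" shows "from_zero a \<in> Hom C zero_obj a"
proof -
  have "\<exists>!f. f \<in> Hom C zero_obj a"
    using zero_object assms unfolding is_zero_object_def by blast
  then show ?thesis unfolding from_zero_def by (rule theI')
qed

lemma to_zero_unique: assumes "f \<in> Hom C a zero_obj" shows "f = to_zero a"
proof -
  have a: "a \<in> Obj C" using assms by auto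
  then have "\<exists>!f. f \<in> Hom C a zero_obj"
    using zero_object unfolding is_zero_object_def is_terminal_def by blast
  then show ?thesis using assms to_zero_Hom[OF a] by blast
qed

lemma from_zero_unique: assumes "f \<in> Hom C zero_obj a" shows "f = from_zero a"
proof -
  have a: "a \<in> Obj C" using assms by auto
  then have "\<exists>!f. f \<in> Hom C zero_obj a"
    using zero_object unfolding is_zero_object_def by blast
  then show ?thesis using assms from_zero_Hom[OF a] by blast
qed

lemma to_zero_simps [simp]:
  assumes "a \<in> Obj C" shows "to_zero a \<in> Mor C" "Dom C (to_zero a) = a" "Cod C (to_zero a) = zero_obj"
  using to_zero_Hom[OF assms] by auto

lemma from_zero_simps [simp]:
  assumes "a \<in> Obj C" shows "from_zero a \<in> Mor C" "Dom C (from_zero a) = zero_obj" "Cod C (from_zero a) = a"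
  using from_zero_Hom[OF assms] by auto

lemma zero_mor_simps [simp]:
  assumes "a \<in> Obj C" "b \<in> Obj C"
  shows "zero_mor a b \<in> Mor C" "Dom C (zero_mor a b) = a" "Cod C (zero_mor a b) = b"
  using assms by (auto simp: zero_mor_def)

lemma zero_mor_right [simp]:
  assumes "f \<in> Mor C" "Dom C f = b" "a \<in> Obj C"
  shows "f \<cdot> zero_mor a b = zero_mor a (Cod C f)"
proof -
  have b: "b \<in> Obj C" using assms by auto
  then have "f \<cdot> from_zero b = from_zero (Cod C f)" by (intro from_zero_unique) (use assms in auto)
  then have "f \<cdot> (from_zero b \<cdot> to_zero a) = from_zero (Cod C f) \<cdot> to_zero a" by (rule comp_cong1) (use assms b in auto)
  then show ?thesis unfolding zero_mor_def .
qed

lemma zero_mor_left [simp]: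
  assumes "f \<in> Mor C" "Cod C f = b" "c \<in> Obj C"
  shows "zero_mor b c \<cdot> f = zero_mor (Dom C f) c"
proof -
  have b: "b \<in> Obj C" using assms by auto
  then have "to_zero b \<cdot> f = to_zero (Dom C f)" by (intro to_zero_unique) (use assms in auto)
  then show ?thesis unfolding zero_mor_def using assms b by simp
qed

text \<open>The factorisation may run through any zero object \<open>z\<close>. It can be moved to
  the chosen one because the composite of \<open>z\<close> to \<open>zero_obj\<close> and back is
  the only endomorphism of \<open>z\<close>, its identity.\<close>

lemma is_zero_mor_iff: "is_zero_mor C f \<longleftrightarrow> f \<in> Mor C \<and> f = zero_mor (Dom C f) (Cod C f)"
proof
  assume "f \<in> Mor C \<and> f = zero_mor (Dom C f) (Cod C f)"
  then show "is_zero_mor C f"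
    unfolding is_zero_mor_def using zero_object
    by (intro conjI exI[of _ zero_obj] bexI[of _ "from_zero (Cod C f)"] bexI[of _ "to_zero (Dom C f)"]) (auto simp: zero_mor_def)
next
  assume "is_zero_mor C f"
  then obtain z g h where f: "f \<in> Mor C" and z: "is_zero_object C z" and g: "g \<in> Hom C (Dom C f) z"
    and h: "h \<in> Hom C z (Cod C f)" and eq: "f = h \<cdot> g"
    unfolding is_zero_mor_def by blast
  have zO: "z \<in> Obj C" using z by (simp add: is_zero_object_def is_terminal_def)
  have "\<exists>!k. k \<in> Hom C z z" using z zO unfolding is_zero_object_def by blast
  then have id: "from_zero z \<cdot> to_zero z = Ident C z" using zO by auto
  have "h \<cdot> from_zero z = from_zero (Cod C f)" by (rule from_zero_unique) (use h zO in auto)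
  then have 1: "h \<cdot> (from_zero z \<cdot> (to_zero z \<cdot> g)) = from_zero (Cod C f) \<cdot> (to_zero z \<cdot> g)"
    by (rule comp_cong1) (use h g zO in auto)
  have "to_zero z \<cdot> g = to_zero (Dom C f)" by (rule to_zero_unique) (use g zO in auto)
  then have "h \<cdot> (from_zero z \<cdot> (to_zero z \<cdot> g)) = zero_mor (Dom C f) (Cod C f)" using 1 by (simp add: zero_mor_def)
  moreover have "from_zero z \<cdot> (to_zero z \<cdot> g) = Ident C z \<cdot> g" using id by (rule comp_cong1) (use g zO in auto)
  moreover have "Ident C z \<cdot> g = g" using g by auto
  ultimately show "f \<in> Mor C \<and> f = zero_mor (Dom C f) (Cod C f)" using f eq by simp
qed

text \<open>The kernel as a set of generalised elements, which needs no choice of a representing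
  monomorphism and can be compared directly with a \<open>sieve\<close>.\<close>

definition kernel_elems :: "'m \<Rightarrow> 'm set" where
  "kernel_elems f = {t \<in> Mor C. Cod C t = Dom C f \<and> f \<cdot> t = zero_mor (Dom C t) (Cod C f)}"

lemma kernel_elems_iff: "t \<in> kernel_elems f \<longleftrightarrow> t \<in> Mor C \<and> Cod C t = Dom C f \<and> f \<cdot> t = zero_mor (Dom C t) (Cod C f)"
  by (simp add: kernel_elems_def)

lemma kernel_elemsI: "t \<in> Mor C \<Longrightarrow> Cod C t = Dom C f \<Longrightarrow> f \<cdot> t = zero_mor (Dom C t) (Cod C f) \<Longrightarrow> t \<in> kernel_elems f"
  by (simp add: kernel_elems_def)

lemma kernel_elemsE:
  assumes "t \<in> kernel_elems f"
  obtains "t \<in> Mor C" "Cod C t = Dom C f" "f \<cdot> t = zero_mor (Dom C t) (Cod C f)"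
  using assms by (simp add: kernel_elems_def)

lemma kernel_elems_zero_mor: "f \<in> Mor C \<Longrightarrow> a \<in> Obj C \<Longrightarrow> zero_mor a (Dom C f) \<in> kernel_elems f"
  by (rule kernel_elemsI) auto

lemma kernel_elems_comp:
  assumes "t \<in> kernel_elems f" "f \<in> Mor C" "u \<in> Mor C" "Cod C u = Dom C t"
  shows "t \<cdot> u \<in> kernel_elems f"
proof (rule kernel_elemsI)
  have t: "t \<in> Mor C" "Cod C t = Dom C f" "f \<cdot> t = zero_mor (Dom C t) (Cod C f)"
    using assms(1) by (auto elim: kernel_elemsE)
  have "f \<cdot> (t \<cdot> u) = zero_mor (Dom C t) (Cod C f) \<cdot> u" using t(3) by (rule comp_cong1) (use t assms in auto)
  then show "f \<cdot> (t \<cdot> u) = zero_mor (Dom C (t \<cdot> u)) (Cod C f)" using t assms by simp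
qed (use assms in \<open>auto elim: kernel_elemsE\<close>)

lemma kernel_elems_mono_comp:
  assumes "f \<in> Mor C" "g \<in> Mor C" "Cod C f = Dom C g"
  shows "kernel_elems f \<subseteq> kernel_elems (g \<cdot> f)"
proof
  fix t assume "t \<in> kernel_elems f"
  then show "t \<in> kernel_elems (g \<cdot> f)" using assms by (auto simp: kernel_elems_iff)
qed

lemma kernel_elems_monic_comp:
  assumes "monic m" "f \<in> Mor C" "Cod C f = Dom C m"
  shows "kernel_elems (m \<cdot> f) = kernel_elems f"
proof
  show "kernel_elems f \<subseteq> kernel_elems (m \<cdot> f)" using assms by (intro kernel_elems_mono_comp) auto
  show "kernel_elems (m \<cdot> f) \<subseteq> kernel_elems f"
  proof
    fix t assume t: "t \<in> kernel_elems (m \<cdot> f)"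
    have "m \<cdot> (f \<cdot> t) = m \<cdot> zero_mor (Dom C t) (Cod C f)" using t assms by (auto simp: kernel_elems_iff)
    then have "f \<cdot> t = zero_mor (Dom C t) (Cod C f)"
      by (rule monicD[OF _ assms(1)]) (use t assms in \<open>auto simp: kernel_elems_iff\<close>)
    then show "t \<in> kernel_elems f" using t assms by (auto simp: kernel_elems_iff)
  qed
qed

lemma kernel_elems_regepi:
  assumes te: "t \<cdot> e \<in> kernel_elems f" and e: "regepi e" and assms: "t \<in> Mor C" "Cod C e = Dom C t"
    "f \<in> Mor C" "Cod C t = Dom C f"
  shows "t \<in> kernel_elems f"
proof (rule kernel_elemsI)
  have "(f \<cdot> t) \<cdot> e = zero_mor (Dom C t) (Cod C f) \<cdot> e" using te e assms by (auto simp: kernel_elems_iff)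
  then show "f \<cdot> t = zero_mor (Dom C t) (Cod C f)"
    by (rule epicD[OF _ regepi_epic[OF e], where T = "Cod C f"]) (use e assms in auto)
qed (use e assms in auto)

text \<open>The kernel is the pullback of \<open>f\<close> along the morphism out of the zero
  object. The second projection is forced, so the first one alone is monic.\<close>

lemma kernel_obtain:
  assumes f: "f \<in> Mor C"
  obtains K k where "monic k" "k \<in> Hom C K (Dom C f)" "sieve k = kernel_elems f"
proof -
  have fzf: "from_zero (Cod C f) \<in> Mor C" "Cod C f = Cod C (from_zero (Cod C f))" using f by auto
  obtain P p q where pb: "p \<in> Hom C P (Dom C f)"
    "q \<in> Hom C P (Dom C (from_zero (Cod C f)))" "f \<cdot> p = from_zero (Cod C f) \<cdot> q"
    "\<And>T s t. s \<in> Hom C T (Dom C f) \<Longrightarrow> t \<in> Hom C T (Dom C (from_zero (Cod C f))) \<Longrightarrow> f \<cdot> s = from_zero (Cod C f) \<cdot> t \<Longrightarrow>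
      \<exists>u \<in> Hom C T P. p \<cdot> u = s \<and> q \<cdot> u = t"
    "\<And>T u v. u \<in> Hom C T P \<Longrightarrow> v \<in> Hom C T P \<Longrightarrow> p \<cdot> u = p \<cdot> v \<Longrightarrow>
      q \<cdot> u = q \<cdot> v \<Longrightarrow> u = v"
    by (rule pullback_obtain[OF f fzf]) (rule that, assumption+)
  have q: "q = to_zero P" by (rule to_zero_unique) (use pb f in auto)
  have fp: "f \<cdot> p = zero_mor P (Cod C f)" using pb(3) q by (simp add: zero_mor_def)
  have P: "P \<in> Obj C" using pb(1) by auto
  have mono: "monic p"
  proof (rule monicI)
    fix T u v assume u: "u \<in> Hom C T (Dom C p)" and v: "v \<in> Hom C T (Dom C p)" and eq: "p \<cdot> u = p \<cdot> v"
    have "q \<cdot> u = to_zero T" "q \<cdot> v = to_zero T" by (rule to_zero_unique; use u v pb f in auto)+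
    then show "u = v" using pb(5)[of u T v] u v eq pb(1) by auto
  qed (use pb in auto)
  have "sieve p = kernel_elems f"
  proof (intro Set.set_eqI iffI)
    fix t assume "t \<in> sieve p"
    then obtain u where u: "u \<in> Hom C (Dom C t) (Dom C p)" "p \<cdot> u = t" "t \<in> Mor C" "Cod C t = Cod C p" by (rule sieveE)
    have "f \<cdot> (p \<cdot> u) = zero_mor P (Cod C f) \<cdot> u" using fp by (rule comp_cong1) (use u pb(1) f in auto)
    then show "t \<in> kernel_elems f" using u pb(1) f by (simp add: kernel_elems_iff)
  next
    fix t assume t: "t \<in> kernel_elems f"
    have "\<exists>u \<in> Hom C (Dom C t) P. p \<cdot> u = t \<and> q \<cdot> u = to_zero (Dom C t)"
      by (rule pb(4)) (use t f in \<open>auto simp: kernel_elems_iff zero_mor_def\<close>)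
    then show "t \<in> sieve p" by (intro sieveI_ex[of "Dom C t" p t "\<lambda>u. q \<cdot> u = to_zero (Dom C t)"]) (use pb(1) in simp_all)
  qed
  then show ?thesis using that[OF mono pb(1)] by auto
qed

text \<open>Splits the universal property into monicity and an equality of sets. All later
  statements about kernels are proved in this form.\<close>

lemma is_kernel_iff:
  "is_kernel C k f \<longleftrightarrow> f \<in> Mor C \<and> Cod C k = Dom C f \<and> monic k \<and> sieve k = kernel_elems f"
proof
  assume "is_kernel C k f"
  then have b0: "k \<in> Mor C" "f \<in> Mor C" "Cod C k = Dom C f" "is_zero_mor C (f \<cdot> k)"
    and all: "\<forall>t\<in>Mor C. Cod C t = Dom C f \<and> is_zero_mor C (f \<cdot> t) \<longrightarrow>
       (\<exists>!u. u \<in> Hom C (Dom C t) (Dom C k) \<and> k \<cdot> u = t)"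
    unfolding is_kernel_def by blast+
  then have b: "k \<in> Mor C" "f \<in> Mor C" "Cod C k = Dom C f" "f \<cdot> k = zero_mor (Dom C k) (Cod C f)"
    by (auto simp: is_zero_mor_iff)
  have un: "\<exists>!u. u \<in> Hom C (Dom C t) (Dom C k) \<and> k \<cdot> u = t" if "t \<in> kernel_elems f" for t
    by (rule all[rule_format]) (use that b in \<open>auto simp: kernel_elems_iff is_zero_mor_iff\<close>)
  have kk: "k \<cdot> u \<in> kernel_elems f" if "u \<in> Mor C" "Cod C u = Dom C k" for u
    by (rule kernel_elems_comp) (use that b in \<open>auto simp: kernel_elems_iff\<close>)
  have "monic k"
  proof (rule monicI)
    fix T u v assume u: "u \<in> Hom C T (Dom C k)" and v: "v \<in> Hom C T (Dom C k)" and eq: "k \<cdot> u = k \<cdot> v"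
    have "\<exists>!w. w \<in> Hom C (Dom C (k \<cdot> u)) (Dom C k) \<and> k \<cdot> w = k \<cdot> u" using un kk u by auto
    moreover have "Dom C (k \<cdot> u) = T" using u b by auto
    ultimately show "u = v" using u v eq by auto
  qed (use b in auto)
  moreover have "sieve k = kernel_elems f"
  proof (intro Set.set_eqI iffI)
    fix t assume "t \<in> sieve k"
    then obtain u where u: "u \<in> Hom C (Dom C t) (Dom C k)" "k \<cdot> u = t" by (rule sieveE)
    from kk[of u] u show "t \<in> kernel_elems f" by simp
  next
    fix t assume "t \<in> kernel_elems f"
    then obtain u where "u \<in> Hom C (Dom C t) (Dom C k)" "k \<cdot> u = t" using un by blast
    then show "t \<in> sieve k" using b(1) by (intro sieveI[of k u]) simp_all
  qed
  ultimately show "f \<in> Mor C \<and> Cod C k = Dom C f \<and> monic k \<and> sieve k = kernel_elems f" using b by auto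
next
  assume A: "f \<in> Mor C \<and> Cod C k = Dom C f \<and> monic k \<and> sieve k = kernel_elems f"
  then have k: "k \<in> Mor C" "monic k" by auto
  have "k \<in> kernel_elems f" using A sieve_self[OF k(1)] by auto
  then have fk: "f \<cdot> k = zero_mor (Dom C k) (Cod C f)" by (rule kernel_elemsE)
  show "is_kernel C k f" unfolding is_kernel_def is_zero_mor_iff
  proof (intro conjI ballI impI)
    fix t assume t: "t \<in> Mor C" "Cod C t = Dom C f \<and> f \<cdot> t \<in> Mor C \<and> f \<cdot> t = zero_mor (Dom C (f \<cdot> t)) (Cod C (f \<cdot> t))"
    then have "t \<in> kernel_elems f" using A by (auto simp: kernel_elems_iff)
    then have "t \<in> sieve k" using A by simp
    then obtain u where u: "u \<in> Hom C (Dom C t) (Dom C k)" "k \<cdot> u = t" by (rule sieveE)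
    show "\<exists>!u. u \<in> Hom C (Dom C t) (Dom C k) \<and> k \<cdot> u = t"
    proof (rule ex1I[of _ u])
      fix v assume "v \<in> Hom C (Dom C t) (Dom C k) \<and> k \<cdot> v = t"
      then have "k \<cdot> v = k \<cdot> u" and v: "v \<in> Hom C (Dom C t) (Dom C k)" using u by auto
      from this(1) show "v = u" by (rule monicD[OF _ k(2)]) (use u v in auto)
    qed (use u in auto)
  qed (use A k fk in auto)
qed

lemma sieve_eq_monic:
  assumes m: "monic m" "m' \<in> Mor C" "Cod C m = Cod C m'" "sieve m \<subseteq> sieve m'"
  obtains u where "u \<in> Hom C (Dom C m) (Dom C m')" "m' \<cdot> u = m"
proof -
  have "m \<in> sieve m'" using sieve_self[of m] m by auto
  then show ?thesis by (rule sieveE) (rule that)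
qed

section \<open>Products and equalizers from pullbacks\<close>

lemma product_obtain:
  assumes a: "a \<in> Obj C" and b: "b \<in> Obj C"
  obtains P p q where "p \<in> Hom C P a" "q \<in> Hom C P b"
    "\<And>T s t. s \<in> Hom C T a \<Longrightarrow> t \<in> Hom C T b \<Longrightarrow> \<exists>u \<in> Hom C T P. p \<cdot> u = s \<and> q \<cdot> u = t"
    "\<And>T u v. u \<in> Hom C T P \<Longrightarrow> v \<in> Hom C T P \<Longrightarrow> p \<cdot> u = p \<cdot> v \<Longrightarrow> q \<cdot> u = q \<cdot> v \<Longrightarrow> u = v"
proof -
  have t: "to_zero a \<in> Mor C" "to_zero b \<in> Mor C" "Cod C (to_zero a) = Cod C (to_zero b)" using a b by auto
  obtain P p q where pb: "p \<in> Hom C P (Dom C (to_zero a))" "q \<in> Hom C P (Dom C (to_zero b))"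
    "\<And>T s t. s \<in> Hom C T (Dom C (to_zero a)) \<Longrightarrow> t \<in> Hom C T (Dom C (to_zero b)) \<Longrightarrow> to_zero a \<cdot> s = to_zero b \<cdot> t \<Longrightarrow>
      \<exists>u \<in> Hom C T P. p \<cdot> u = s \<and> q \<cdot> u = t"
    "\<And>T u v. u \<in> Hom C T P \<Longrightarrow> v \<in> Hom C T P \<Longrightarrow> p \<cdot> u = p \<cdot> v \<Longrightarrow>
      q \<cdot> u = q \<cdot> v \<Longrightarrow> u = v"
    by (rule pullback_obtain[OF t]) (rule that, assumption+)
  show ?thesis
  proof (rule that[of p P q])
    fix T s t assume s: "s \<in> Hom C T a" "t \<in> Hom C T b"
    have "to_zero a \<cdot> s = to_zero T" "to_zero b \<cdot> t = to_zero T" by (rule to_zero_unique; use s a b in auto)+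
    then show "\<exists>u \<in> Hom C T P. p \<cdot> u = s \<and> q \<cdot> u = t" using pb(3)[of s T t] s a b by simp
  qed (use pb a b in auto)
qed

text \<open>The equalizer is the pullback of the pairing of \<open>f\<close> and \<open>g\<close>
  along the diagonal of \<open>Z\<close>.\<close>

lemma equalizer_obtain:
  assumes f: "f \<in> Hom C W Z" and g: "g \<in> Hom C W Z"
  obtains E m where "monic m" "m \<in> Hom C E W"
    "\<And>t. t \<in> sieve m \<longleftrightarrow> t \<in> Mor C \<and> Cod C t = W \<and> f \<cdot> t = g \<cdot> t"
proof -
  have Z: "Z \<in> Obj C" using f by auto
  obtain P p q where P: "p \<in> Hom C P Z" "q \<in> Hom C P Z"
    "\<And>T s t. s \<in> Hom C T Z \<Longrightarrow> t \<in> Hom C T Z \<Longrightarrow> \<exists>u \<in> Hom C T P. p \<cdot> u = s \<and> q \<cdot> u = t"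
    "\<And>T u v. u \<in> Hom C T P \<Longrightarrow> v \<in> Hom C T P \<Longrightarrow> p \<cdot> u = p \<cdot> v \<Longrightarrow> q \<cdot> u = q \<cdot> v \<Longrightarrow> u = v"
    by (rule product_obtain[OF Z Z]) (rule that, assumption+)
  obtain h where h: "h \<in> Hom C W P" "p \<cdot> h = f" "q \<cdot> h = g" using P(3)[OF f g] by blast
  have iZ: "Ident C Z \<in> Hom C Z Z" using Z by auto
  obtain \<Delta> where \<Delta>: "\<Delta> \<in> Hom C Z P" "p \<cdot> \<Delta> = Ident C Z" "q \<cdot> \<Delta> = Ident C Z" using P(3)[OF iZ iZ] by blast
  have c: "h \<in> Mor C" "\<Delta> \<in> Mor C" "Cod C h = Cod C \<Delta>" using h \<Delta> by auto
  obtain E m z where pb: "m \<in> Hom C E (Dom C h)" "z \<in> Hom C E (Dom C \<Delta>)" "h \<cdot> m = \<Delta> \<cdot> z"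
    "\<And>T s t. s \<in> Hom C T (Dom C h) \<Longrightarrow> t \<in> Hom C T (Dom C \<Delta>) \<Longrightarrow> h \<cdot> s = \<Delta> \<cdot> t \<Longrightarrow>
      \<exists>u \<in> Hom C T E. m \<cdot> u = s \<and> z \<cdot> u = t"
    "\<And>T u v. u \<in> Hom C T E \<Longrightarrow> v \<in> Hom C T E \<Longrightarrow> m \<cdot> u = m \<cdot> v \<Longrightarrow>
      z \<cdot> u = z \<cdot> v \<Longrightarrow> u = v"
    by (rule pullback_obtain[OF c]) (rule that, assumption+)
  have fm: "f \<cdot> m = z" and gm: "g \<cdot> m = z"
  proof -
    have "p \<cdot> (h \<cdot> m) = f \<cdot> m" using h(2) by (rule comp_cong1) (use pb P h in auto)
    moreover have "p \<cdot> (\<Delta> \<cdot> z) = Ident C Z \<cdot> z" using \<Delta>(2) by (rule comp_cong1) (use pb P \<Delta> in auto)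
    ultimately show "f \<cdot> m = z" using pb \<Delta> by simp
    have "q \<cdot> (h \<cdot> m) = g \<cdot> m" using h(3) by (rule comp_cong1) (use pb P h in auto)
    moreover have "q \<cdot> (\<Delta> \<cdot> z) = Ident C Z \<cdot> z" using \<Delta>(3) by (rule comp_cong1) (use pb P \<Delta> in auto)
    ultimately show "g \<cdot> m = z" using pb \<Delta> by simp
  qed
  have mono: "monic m"
  proof (rule monicI)
    fix T u v assume u: "u \<in> Hom C T (Dom C m)" and v: "v \<in> Hom C T (Dom C m)" and eq: "m \<cdot> u = m \<cdot> v"
    have "f \<cdot> (m \<cdot> u) = z \<cdot> u" "f \<cdot> (m \<cdot> v) = z \<cdot> v"
      using fm by (rule comp_cong1; use f pb(1) h u v in auto)+
    then have "z \<cdot> u = z \<cdot> v" using eq by simp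
    then show "u = v" using pb(5)[of u T v] u v eq pb(1) by auto
  qed (use pb in auto)
  show ?thesis
  proof (rule that[OF mono])
    show "m \<in> Hom C E W" using pb h by auto
    fix t
    show "t \<in> sieve m \<longleftrightarrow> t \<in> Mor C \<and> Cod C t = W \<and> f \<cdot> t = g \<cdot> t"
    proof
      assume "t \<in> sieve m"
      then obtain u where u: "u \<in> Hom C (Dom C t) (Dom C m)" "m \<cdot> u = t" "t \<in> Mor C" "Cod C t = Cod C m"
        by (rule sieveE)
      have "f \<cdot> (m \<cdot> u) = g \<cdot> (m \<cdot> u)" using fm gm by (intro comp_cong) (use u f g pb(1) h in auto)
      then show "t \<in> Mor C \<and> Cod C t = W \<and> f \<cdot> t = g \<cdot> t" using u pb(1) h by simp
    next
      assume t: "t \<in> Mor C \<and> Cod C t = W \<and> f \<cdot> t = g \<cdot> t"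
      have 1: "p \<cdot> (h \<cdot> t) = f \<cdot> t" using h(2) by (rule comp_cong1) (use t P h in auto)
      have 2: "q \<cdot> (h \<cdot> t) = g \<cdot> t" using h(3) by (rule comp_cong1) (use t P h in auto)
      have 3: "p \<cdot> (\<Delta> \<cdot> (f \<cdot> t)) = Ident C Z \<cdot> (f \<cdot> t)" using \<Delta>(2) by (rule comp_cong1) (use t P \<Delta> f g in auto)
      have 4: "q \<cdot> (\<Delta> \<cdot> (f \<cdot> t)) = Ident C Z \<cdot> (f \<cdot> t)" using \<Delta>(3) by (rule comp_cong1) (use t P \<Delta> f g in auto)
      have "h \<cdot> t = \<Delta> \<cdot> (f \<cdot> t)"
        by (rule P(4)[of _ "Dom C t"]) (use 1 2 3 4 t h(1) \<Delta>(1) f g in auto)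
      then have "\<exists>u \<in> Hom C (Dom C t) E. m \<cdot> u = t \<and> z \<cdot> u = f \<cdot> t"
        by (intro pb(4)) (use t h(1) \<Delta>(1) f g in auto)
      then show "t \<in> sieve m"
        by (intro sieveI_ex[of "Dom C t" m t "\<lambda>u. z \<cdot> u = f \<cdot> t"]) (use pb(1) in simp_all)
    qed
  qed
qed

section \<open>Consequences of protomodularity\<close>

text \<open>The kernel and the section of a point are jointly strongly epic: this is the form in which
  protomodularity enters.\<close>

lemma point_generation:
  assumes r: "r \<in> Hom C W V" and d: "d \<in> Hom C V W" and rd: "r \<cdot> d = Ident C V"
    and m: "monic m" and \<phi>: "\<phi> \<in> Hom C W (Cod C m)" and \<phi>d: "\<phi> \<cdot> d \<in> sieve m"
    and \<phi>k: "\<And>t. t \<in> kernel_elems r \<Longrightarrow> \<phi> \<cdot> t \<in> sieve m"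
  shows "\<phi> \<in> sieve m"
proof -
  have VW: "V \<in> Obj C" "W \<in> Obj C" using r by auto
  have c: "m \<in> Mor C" "\<phi> \<in> Mor C" "Cod C m = Cod C \<phi>" using m \<phi> by auto
  \<comment> \<open>\<open>J\<close> is the inverse image of \<open>m\<close> along
    \<open>\<phi>\<close>. The claim amounts to its inclusion \<open>j\<close> into \<open>W\<close>
    being invertible.\<close>
  obtain J j' j where J: "j' \<in> Hom C J (Dom C m)" "j \<in> Hom C J (Dom C \<phi>)" "m \<cdot> j' = \<phi> \<cdot> j"
    and Jex: "\<And>T s t. s \<in> Hom C T (Dom C m) \<Longrightarrow> t \<in> Hom C T (Dom C \<phi>) \<Longrightarrow> m \<cdot> s = \<phi> \<cdot> t \<Longrightarrow>
      \<exists>u \<in> Hom C T J. j' \<cdot> u = s \<and> j \<cdot> u = t"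
    and Jun: "\<And>T u v. u \<in> Hom C T J \<Longrightarrow> v \<in> Hom C T J \<Longrightarrow> j' \<cdot> u = j' \<cdot> v \<Longrightarrow>
      j \<cdot> u = j \<cdot> v \<Longrightarrow> u = v"
    by (rule pullback_obtain[OF c]) (rule that, assumption+)
  have j: "j \<in> Hom C J W" using J \<phi> by auto
  have jm: "monic j"
  proof (rule monicI)
    fix T u v assume u: "u \<in> Hom C T (Dom C j)" and v: "v \<in> Hom C T (Dom C j)" and eq: "j \<cdot> u = j \<cdot> v"
    have "m \<cdot> (j' \<cdot> u) = \<phi> \<cdot> (j \<cdot> u)" "m \<cdot> (j' \<cdot> v) = \<phi> \<cdot> (j \<cdot> v)"
      using J(3) by (rule comp_cong; use m J(1,2) \<phi> u v in auto)+
    then have "m \<cdot> (j' \<cdot> u) = m \<cdot> (j' \<cdot> v)" using eq by simp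
    then have "j' \<cdot> u = j' \<cdot> v" by (rule monicD[OF _ m]) (use J(1) j u v in auto)
    then show "u = v" using Jun[of u T v] u v eq j by auto
  qed (use j in auto)
  have lift: "\<exists>u \<in> Hom C (Dom C t) J. j \<cdot> u = t" if t: "t \<in> Mor C" "Cod C t = W" "\<phi> \<cdot> t \<in> sieve m" for t
  proof -
    obtain s where s: "s \<in> Hom C (Dom C (\<phi> \<cdot> t)) (Dom C m)" "m \<cdot> s = \<phi> \<cdot> t"
      using t(3) by (rule sieveE)
    have "\<exists>u \<in> Hom C (Dom C t) J. j' \<cdot> u = s \<and> j \<cdot> u = t"
      by (rule Jex) (use s t(1,2) \<phi> in simp_all)
    then show ?thesis by blast
  qed
  obtain dJ where dJ: "dJ \<in> Hom C V J" "j \<cdot> dJ = d" using lift[of d] d \<phi>d by auto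
  have rj: "r \<cdot> j \<in> Hom C J V" using r j by auto
  \<comment> \<open>As \<open>d\<close> factors through \<open>J\<close>, the object
    \<open>J\<close> carries a point over \<open>V\<close>, and \<open>j\<close> is a morphism from
    it to the point \<open>(r, d)\<close>.\<close>
  have p1: "is_point C (r \<cdot> j) dJ" unfolding is_point_def using dJ rd r j by auto
  have p2: "is_point C r d" unfolding is_point_def using r d rd by auto
  \<comment> \<open>Change of base along the zero object of \<open>V\<close> turns both points into
    kernels: \<open>A\<close> of \<open>r \<cdot> j\<close> and \<open>A'\<close> of
    \<open>r\<close>. It remains to see that the comparison \<open>h\<close> between them is
    invertible.\<close>
  have z: "from_zero V \<in> Hom C zero_obj V" using VW by auto
  have c1: "r \<cdot> j \<in> Mor C" "from_zero V \<in> Mor C" "Cod C (r \<cdot> j) = Cod C (from_zero V)" using rj z by auto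
  have c2: "r \<in> Mor C" "from_zero V \<in> Mor C" "Cod C r = Cod C (from_zero V)" using r z by auto
  obtain A a q where A: "is_pullback C (r \<cdot> j) (from_zero V) a q" "a \<in> Hom C A (Dom C (r \<cdot> j))"
      "q \<in> Hom C A (Dom C (from_zero V))" "(r \<cdot> j) \<cdot> a = from_zero V \<cdot> q"
    and Aex: "\<And>T s t. s \<in> Hom C T (Dom C (r \<cdot> j)) \<Longrightarrow> t \<in> Hom C T (Dom C (from_zero V)) \<Longrightarrow>
      (r \<cdot> j) \<cdot> s = from_zero V \<cdot> t \<Longrightarrow> \<exists>u \<in> Hom C T A. a \<cdot> u = s \<and> q \<cdot> u = t"
    and Aun: "\<And>T u v. u \<in> Hom C T A \<Longrightarrow> v \<in> Hom C T A \<Longrightarrow> a \<cdot> u = a \<cdot> v \<Longrightarrow>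
      q \<cdot> u = q \<cdot> v \<Longrightarrow> u = v"
    by (rule pullback_obtain[OF c1]) (rule that, assumption+)
  obtain A' a' q' where A': "is_pullback C r (from_zero V) a' q'" "a' \<in> Hom C A' (Dom C r)"
      "q' \<in> Hom C A' (Dom C (from_zero V))" "r \<cdot> a' = from_zero V \<cdot> q'"
    and A'ex: "\<And>T s t. s \<in> Hom C T (Dom C r) \<Longrightarrow> t \<in> Hom C T (Dom C (from_zero V)) \<Longrightarrow>
      r \<cdot> s = from_zero V \<cdot> t \<Longrightarrow> \<exists>u \<in> Hom C T A'. a' \<cdot> u = s \<and> q' \<cdot> u = t"
    and A'un: "\<And>T u v. u \<in> Hom C T A' \<Longrightarrow> v \<in> Hom C T A' \<Longrightarrow> a' \<cdot> u = a' \<cdot> v \<Longrightarrow>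
      q' \<cdot> u = q' \<cdot> v \<Longrightarrow> u = v"
    by (rule pullback_obtain[OF c2]) (rule that, assumption+)
  have aH: "a \<in> Hom C A J" and a'H: "a' \<in> Hom C A' W" and qH: "q \<in> Hom C A zero_obj" and q'H: "q' \<in> Hom C A' zero_obj"
    using A(2,3) A'(2,3) rj r z by auto
  have AO: "A \<in> Obj C" "A' \<in> Obj C" using aH a'H by auto
  have toz: "u = v" if "u \<in> Hom C T zero_obj" "v \<in> Hom C T zero_obj" for u v T
    using to_zero_unique that by blast
  have "r \<cdot> (j \<cdot> a) = from_zero V \<cdot> q" using A(4) aH rj r j by simp
  then obtain h where h: "h \<in> Hom C A A'" "a' \<cdot> h = j \<cdot> a" "q' \<cdot> h = q"
    using A'ex[of "j \<cdot> a" A q] aH j qH r z by auto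
  have "r \<cdot> a' = zero_mor A' V"
  proof -
    have "q' = to_zero A'" by (rule to_zero_unique[OF q'H])
    then show ?thesis using A'(4) by (simp add: zero_mor_def)
  qed
  then have "a' \<in> kernel_elems r" using a'H r by (auto simp: kernel_elems_iff)
  \<comment> \<open>The hypothesis on the kernel of \<open>r\<close> says that \<open>a'\<close>
    lands in \<open>J\<close>. This lift gives the inverse \<open>u\<close> of
    \<open>h\<close>.\<close>
  then obtain y where y: "y \<in> Hom C A' J" "j \<cdot> y = a'" using lift[of a'] \<phi>k a'H by auto
  have "(r \<cdot> j) \<cdot> y = from_zero V \<cdot> q'" using y A'(4) j r by simp
  then obtain u where u: "u \<in> Hom C A' A" "a \<cdot> u = y" "q \<cdot> u = q'"
    using Aex[of y A' q'] y q'H rj z by auto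
  have 1: "h \<cdot> u = Ident C A'"
  proof (rule A'un[of _ A'])
    have "a' \<cdot> (h \<cdot> u) = j \<cdot> (a \<cdot> u)" using h(2) by (rule comp_cong) (use a'H aH h(1) u(1) j in auto)
    then show "a' \<cdot> (h \<cdot> u) = a' \<cdot> Ident C A'" using u(2) y(2) a'H by simp
    show "q' \<cdot> (h \<cdot> u) = q' \<cdot> Ident C A'" by (rule toz[of _ A']) (use q'H h(1) u(1) AO in auto)
  qed (use h(1) u(1) AO in auto)
  have 2: "u \<cdot> h = Ident C A"
  proof (rule Aun[of _ A])
    have "j \<cdot> (y \<cdot> h) = a' \<cdot> h" using y(2) by (rule comp_cong1) (use y(1) h(1) j in auto)
    then have "j \<cdot> (y \<cdot> h) = j \<cdot> a" using h(2) by simp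
    then have "y \<cdot> h = a" by (rule monicD[OF _ jm]) (use y(1) h(1) aH j in auto)
    moreover have "a \<cdot> (u \<cdot> h) = y \<cdot> h" using u(2) by (rule comp_cong1) (use u(1) h(1) aH in auto)
    ultimately show "a \<cdot> (u \<cdot> h) = a \<cdot> Ident C A" using aH by simp
    show "q \<cdot> (u \<cdot> h) = q \<cdot> Ident C A" by (rule toz[of _ A]) (use qH h(1) u(1) AO in auto)
  qed (use h(1) u(1) AO in auto)
  have hiso: "is_iso C h" unfolding is_iso_def using h(1) u(1) 1 2 by (auto intro!: bexI[of _ u])
  have "is_point C (r \<cdot> j) dJ \<and> is_point C r d \<and> Cod C (r \<cdot> j) = Cod C r \<and>
        j \<in> Hom C (Dom C (r \<cdot> j)) (Dom C r) \<and> r \<cdot> j = r \<cdot> j \<and> j \<cdot> dJ = d \<and>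
        is_pullback C (r \<cdot> j) (from_zero V) a q \<and> is_pullback C r (from_zero V) a' q' \<and>
        h \<in> Hom C (Dom C a) (Dom C a') \<and> a' \<cdot> h = j \<cdot> a \<and> q' \<cdot> h = q \<and> is_iso C h"
    using p1 p2 A(1) A'(1) h hiso dJ(2) rj r j aH a'H by auto
  then have "is_iso C j" using protomodular unfolding is_protomodular_def by blast
  then obtain i where i: "i \<in> Hom C (Cod C j) (Dom C j)" "j \<cdot> i = Ident C (Cod C j)"
    by (rule iso_obtain)
  have "m \<cdot> (j' \<cdot> i) = \<phi> \<cdot> (j \<cdot> i)" using J(3) by (rule comp_cong) (use i(1) J(1) j m \<phi> in auto)
  then have "m \<cdot> (j' \<cdot> i) = \<phi>" using i(2) j \<phi> by simp
  then show ?thesis by (intro sieveI[of m "j' \<cdot> i"]) (use i(1) J(1) j m in auto)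
qed

text \<open>The equalizer of \<open>f\<close> and \<open>g\<close> contains the section and the
  kernel, hence everything by \<open>point_generation\<close>.\<close>

lemma point_jointly_epic:
  assumes r: "r \<in> Hom C W V" and d: "d \<in> Hom C V W" and rd: "r \<cdot> d = Ident C V"
    and f: "f \<in> Hom C W Z" and g: "g \<in> Hom C W Z" and fd: "f \<cdot> d = g \<cdot> d"
    and fk: "\<And>t. t \<in> kernel_elems r \<Longrightarrow> f \<cdot> t = g \<cdot> t"
  shows "f = g"
proof -
  obtain E m where m: "monic m" "m \<in> Hom C E W"
    "\<And>t. t \<in> sieve m \<longleftrightarrow> t \<in> Mor C \<and> Cod C t = W \<and> f \<cdot> t = g \<cdot> t"
    by (rule equalizer_obtain[OF f g]) (rule that, assumption+)
  have W: "W \<in> Obj C" using f by auto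
  have "Ident C W \<in> sieve m"
  proof (rule point_generation[OF r d rd m(1)])
    fix t assume t: "t \<in> kernel_elems r"
    then show "Ident C W \<cdot> t \<in> sieve m" using m(3) fk[OF t] r by (auto simp: kernel_elems_iff)
  qed (use m(2,3) W d fd in auto)
  then show ?thesis using m(3) f g by auto
qed

text \<open>A regular epimorphism is the cokernel of its kernel. The second projection of the kernel
  pair of \<open>e\<close>, with the diagonal as section, is a point whose kernel corresponds to the
  kernel of \<open>e\<close>. So \<open>g\<close> agrees on both projections as soon as it kills
  that kernel, and therefore descends along \<open>e\<close>.\<close>

lemma regepi_factor:
  assumes e: "regepi e" and g: "g \<in> Hom C (Dom C e) Z" and sub: "kernel_elems e \<subseteq> kernel_elems g"
  obtains u where "u \<in> Hom C (Cod C e) Z" "u \<cdot> e = g"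
proof -
  have eM: "e \<in> Mor C" using e by simp
  obtain P p q where pb: "p \<in> Hom C P (Dom C e)" "q \<in> Hom C P (Dom C e)" "e \<cdot> p = e \<cdot> q"
    and ex: "\<And>T s t. s \<in> Hom C T (Dom C e) \<Longrightarrow> t \<in> Hom C T (Dom C e) \<Longrightarrow> e \<cdot> s = e \<cdot> t \<Longrightarrow>
      \<exists>u \<in> Hom C T P. p \<cdot> u = s \<and> q \<cdot> u = t"
    by (rule pullback_obtain[OF eM eM refl]) (rule that, assumption+)
  have iH: "Ident C (Dom C e) \<in> Hom C (Dom C e) (Dom C e)" using eM by auto
  obtain d where d: "d \<in> Hom C (Dom C e) P" "p \<cdot> d = Ident C (Dom C e)" "q \<cdot> d = Ident C (Dom C e)"
    using ex[OF iH iH] by auto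
  have gpq: "g \<cdot> p = g \<cdot> q"
  proof (rule point_jointly_epic[OF pb(2) d(1) d(3), where Z = Z])
    show "(g \<cdot> p) \<cdot> d = (g \<cdot> q) \<cdot> d" using d pb(1,2) g by simp
    fix t assume "t \<in> kernel_elems q"
    then have t: "t \<in> Mor C" "Cod C t = P" "q \<cdot> t = zero_mor (Dom C t) (Dom C e)"
      using pb(2) by (auto simp: kernel_elems_iff)
    have "e \<cdot> (p \<cdot> t) = e \<cdot> (q \<cdot> t)" using pb(3) by (rule comp_cong) (use t pb(1,2) eM in auto)
    then have "p \<cdot> t \<in> kernel_elems e" using t pb(1) eM by (auto simp: kernel_elems_iff)
    then have "p \<cdot> t \<in> kernel_elems g" using sub by auto
    then have "g \<cdot> (p \<cdot> t) = zero_mor (Dom C t) Z" using t pb(1) g by (auto simp: kernel_elems_iff)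
    then show "(g \<cdot> p) \<cdot> t = (g \<cdot> q) \<cdot> t" using t pb(1,2) g by simp
  qed (use pb(1,2) g in auto)
  obtain f1 f2 where B: "f1 \<in> Mor C" "f2 \<in> Mor C" "Dom C f2 = Dom C f1" "Cod C f1 = Dom C e"
    "Cod C f2 = Dom C e" "e \<cdot> f1 = e \<cdot> f2"
    and ex1: "\<And>T t. t \<in> Hom C (Dom C e) T \<Longrightarrow> t \<cdot> f1 = t \<cdot> f2 \<Longrightarrow> \<exists>u \<in> Hom C (Cod C e) T. u \<cdot> e = t"
    using e by (rule regepiE) blast
  obtain w where w: "w \<in> Hom C (Dom C f1) P" "p \<cdot> w = f1" "q \<cdot> w = f2"
    using ex[of f1 "Dom C f1" f2] B by auto
  have "g \<cdot> (p \<cdot> w) = g \<cdot> (q \<cdot> w)" using gpq by (rule comp_cong) (use w(1) pb(1,2) g in auto)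
  then obtain u where "u \<in> Hom C (Cod C e) Z" "u \<cdot> e = g" using ex1[OF g] w by auto
  then show ?thesis by (rule that)
qed

text \<open>The projections of the kernel pair of \<open>h\<close> agree on the diagonal. They also
  agree on the kernel of the second projection, whose elements are sent by the first one into the
  trivial kernel of \<open>h\<close>. Joint epicity makes them equal.\<close>

lemma monic_if_kernel_elems_trivial:
  assumes h: "h \<in> Mor C" and triv: "\<And>t. t \<in> kernel_elems h \<Longrightarrow> t = zero_mor (Dom C t) (Dom C h)"
  shows "monic h"
proof -
  obtain P p q where pb: "p \<in> Hom C P (Dom C h)" "q \<in> Hom C P (Dom C h)" "h \<cdot> p = h \<cdot> q"
    and ex: "\<And>T s t. s \<in> Hom C T (Dom C h) \<Longrightarrow> t \<in> Hom C T (Dom C h) \<Longrightarrow> h \<cdot> s = h \<cdot> t \<Longrightarrow>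
      \<exists>u \<in> Hom C T P. p \<cdot> u = s \<and> q \<cdot> u = t"
    by (rule pullback_obtain[OF h h refl]) (rule that, assumption+)
  have iH: "Ident C (Dom C h) \<in> Hom C (Dom C h) (Dom C h)" using h by auto
  obtain d where d: "d \<in> Hom C (Dom C h) P" "p \<cdot> d = Ident C (Dom C h)" "q \<cdot> d = Ident C (Dom C h)"
    using ex[OF iH iH] by auto
  have "p = q"
  proof (rule point_jointly_epic[OF pb(2) d(1) d(3) pb(1,2)])
    fix t assume "t \<in> kernel_elems q"
    then have t: "t \<in> Mor C" "Cod C t = P" "q \<cdot> t = zero_mor (Dom C t) (Dom C h)"
      using pb(2) by (auto simp: kernel_elems_iff)
    have "h \<cdot> (p \<cdot> t) = h \<cdot> (q \<cdot> t)" using pb(3) by (rule comp_cong) (use t pb(1,2) h in auto)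
    then have "p \<cdot> t \<in> kernel_elems h" using t pb(1) h by (auto simp: kernel_elems_iff)
    from triv[OF this] show "p \<cdot> t = q \<cdot> t" using t pb(1) by simp
  qed (use d in auto)
  show ?thesis
  proof (rule monicI[OF h])
    fix T u v assume "u \<in> Hom C T (Dom C h)" "v \<in> Hom C T (Dom C h)" "h \<cdot> u = h \<cdot> v"
    then show "u = v" using ex[of u T v] \<open>p = q\<close> by auto
  qed
qed

text \<open>The first isomorphism theorem. An element killed by the induced morphism has, on a
  cover, a preimage under \<open>e\<close> that lies in the kernel of \<open>g\<close>, which is
  that of \<open>e\<close>; so the element was zero.\<close>

lemma regepi_kernel_elems_factor_monic:
  assumes e: "regepi e" and g: "g \<in> Hom C (Dom C e) Z" and eq: "kernel_elems e = kernel_elems g"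
  obtains m where "monic m" "m \<in> Hom C (Cod C e) Z" "m \<cdot> e = g"
proof -
  obtain u where u: "u \<in> Hom C (Cod C e) Z" "u \<cdot> e = g"
    using regepi_factor[OF e g] eq by blast
  have "monic u"
  proof (rule monic_if_kernel_elems_trivial)
    fix t assume t: "t \<in> kernel_elems u"
    then have tM: "t \<in> Mor C" "Cod C t = Cod C e" using u by (auto simp: kernel_elems_iff)
    obtain T e' t' where l: "regepi e'" "e' \<in> Hom C T (Dom C t)" "t' \<in> Hom C T (Dom C e)" "e \<cdot> t' = t \<cdot> e'"
      using regepi_lift[OF e tM] by blast
    have "u \<cdot> (e \<cdot> t') = g \<cdot> t'" using u(2) by (rule comp_cong1) (use l(3) e u(1) in auto)
    moreover have "t \<cdot> e' \<in> kernel_elems u" by (rule kernel_elems_comp[OF t]) (use u(1) l in auto)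
    then have "u \<cdot> (e \<cdot> t') = zero_mor T Z" using l(2,4) u(1) tM by (simp add: kernel_elems_iff)
    ultimately have "t' \<in> kernel_elems g" using l(3) g by (simp add: kernel_elems_iff)
    then have "e \<cdot> t' = zero_mor T (Cod C e)" using eq l(3) by (auto simp: kernel_elems_iff)
    then have "t \<cdot> e' = zero_mor (Dom C t) (Cod C e) \<cdot> e'" using l e tM by simp
    then have "t = zero_mor (Dom C t) (Cod C e)"
      by (rule epicD[OF _ regepi_epic[OF l(1)], where T = "Cod C e"]) (use tM l(2) e in auto)
    then show "t = zero_mor (Dom C t) (Dom C u)" using u(1) by simp
  qed (use u in auto)
  then show ?thesis using that u by blast
qed

text \<open>The Mal'tsev property. Composable pairs \<open>((x, y), (y, z))\<close> form a point
  over \<open>S\<close> by the second pair, with section \<open>D\<close> sending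
  \<open>(x, y)\<close> to \<open>((x, x), (x, y))\<close>. On the section the composite is
  \<open>(x, y)\<close>, on the kernel \<open>((x, 0), (0, 0))\<close> it is \<open>(x, 0)\<close>.
  Both are in \<open>S\<close>, so by generation every composite is.\<close>

lemma reflexive_relation_transitive:
  assumes s: "s1 \<in> Hom C S Y" "s2 \<in> Hom C S Y"
    and jm: "\<And>T u v. u \<in> Hom C T S \<Longrightarrow> v \<in> Hom C T S \<Longrightarrow> s1 \<cdot> u = s1 \<cdot> v \<Longrightarrow> s2 \<cdot> u = s2 \<cdot> v \<Longrightarrow> u = v"
    and d: "d \<in> Hom C Y S" "s1 \<cdot> d = Ident C Y" "s2 \<cdot> d = Ident C Y"
    and pb: "is_pullback C s2 s1 p q"
  shows "\<exists>t \<in> Hom C (Dom C p) S. s1 \<cdot> t = s1 \<cdot> p \<and> s2 \<cdot> t = s2 \<cdot> q"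
proof -
  define W where "W = Dom C p"
  have Y: "Y \<in> Obj C" and SO: "S \<in> Obj C" using s by auto
  have p: "p \<in> Hom C W S" "q \<in> Hom C W S" "s2 \<cdot> p = s1 \<cdot> q"
    and ex: "\<And>T u v. u \<in> Hom C T S \<Longrightarrow> v \<in> Hom C T S \<Longrightarrow> s2 \<cdot> u = s1 \<cdot> v \<Longrightarrow>
      \<exists>w \<in> Hom C T W. p \<cdot> w = u \<and> q \<cdot> w = v"
    using pb s unfolding W_def by (auto elim!: pullbackE)
  obtain P \<pi>1 \<pi>2 where P: "\<pi>1 \<in> Hom C P Y" "\<pi>2 \<in> Hom C P Y"
    and Pex: "\<And>T s t. s \<in> Hom C T Y \<Longrightarrow> t \<in> Hom C T Y \<Longrightarrow> \<exists>u \<in> Hom C T P. \<pi>1 \<cdot> u = s \<and> \<pi>2 \<cdot> u = t"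
    and Pun: "\<And>T u v. u \<in> Hom C T P \<Longrightarrow> v \<in> Hom C T P \<Longrightarrow> \<pi>1 \<cdot> u = \<pi>1 \<cdot> v \<Longrightarrow> \<pi>2 \<cdot> u = \<pi>2 \<cdot> v \<Longrightarrow> u = v"
    by (rule product_obtain[OF Y Y]) (rule that, assumption+)
  obtain m where m: "m \<in> Hom C S P" "\<pi>1 \<cdot> m = s1" "\<pi>2 \<cdot> m = s2" using Pex[OF s] by blast
  have m1: "\<pi>1 \<cdot> (m \<cdot> u) = s1 \<cdot> u" if "u \<in> Mor C" "Cod C u = S" for u
    using m(2) by (rule comp_cong1) (use m(1) P that in auto)
  have m2: "\<pi>2 \<cdot> (m \<cdot> u) = s2 \<cdot> u" if "u \<in> Mor C" "Cod C u = S" for u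
    using m(3) by (rule comp_cong1) (use m(1) P that in auto)
  have mm: "monic m"
  proof (rule monicI)
    fix T u v assume u: "u \<in> Hom C T (Dom C m)" "v \<in> Hom C T (Dom C m)" "m \<cdot> u = m \<cdot> v"
    have "s1 \<cdot> u = s1 \<cdot> v" "s2 \<cdot> u = s2 \<cdot> v"
      using m1[of u] m1[of v] m2[of u] m2[of v] u m(1) by auto
    then show "u = v" using jm[of u T v] u m(1) by auto
  qed (use m in auto)
  have "s1 \<cdot> p \<in> Hom C W Y" "s2 \<cdot> q \<in> Hom C W Y" using s p by auto
  then obtain \<phi> where \<phi>: "\<phi> \<in> Hom C W P" "\<pi>1 \<cdot> \<phi> = s1 \<cdot> p" "\<pi>2 \<cdot> \<phi> = s2 \<cdot> q" using Pex by blast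
  have \<phi>1: "\<pi>1 \<cdot> (\<phi> \<cdot> u) = s1 \<cdot> (p \<cdot> u)" if "u \<in> Mor C" "Cod C u = W" for u
    using \<phi>(2) by (rule comp_cong) (use \<phi>(1) P s p that in auto)
  have \<phi>2: "\<pi>2 \<cdot> (\<phi> \<cdot> u) = s2 \<cdot> (q \<cdot> u)" if "u \<in> Mor C" "Cod C u = W" for u
    using \<phi>(3) by (rule comp_cong) (use \<phi>(1) P s p that in auto)
  have "s2 \<cdot> (d \<cdot> s1) = Ident C Y \<cdot> s1" using d(3) by (rule comp_cong1) (use d(1) s in auto)
  then have "s2 \<cdot> (d \<cdot> s1) = s1 \<cdot> Ident C S" using s by simp
  then obtain D where D: "D \<in> Hom C S W" "p \<cdot> D = d \<cdot> s1" "q \<cdot> D = Ident C S"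
    using ex[of "d \<cdot> s1" S "Ident C S"] d(1) s SO by auto
  have "\<phi> \<in> sieve m"
  proof (rule point_generation[OF p(2) D(1) D(3) mm])
    have sds: "s1 \<cdot> (d \<cdot> s1) = Ident C Y \<cdot> s1" using d(2) by (rule comp_cong1) (use d(1) s in auto)
    have "\<phi> \<cdot> D = m"
      by (rule Pun[of _ S]) (use sds \<phi>1[of D] \<phi>2[of D] D m s \<phi>(1) in auto)
    then show "\<phi> \<cdot> D \<in> sieve m" using sieve_self m by auto
    fix t assume "t \<in> kernel_elems q"
    then have t: "t \<in> Mor C" "Cod C t = W" "q \<cdot> t = zero_mor (Dom C t) S" using p by (auto simp: kernel_elems_iff)
    have "s2 \<cdot> (p \<cdot> t) = s1 \<cdot> (q \<cdot> t)" using p(3) by (rule comp_cong) (use p(1,2) s t in auto)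
    then have sps: "s2 \<cdot> (p \<cdot> t) = s2 \<cdot> (q \<cdot> t)" using t s by simp
    have "m \<cdot> (p \<cdot> t) = \<phi> \<cdot> t"
      by (rule Pun[of _ "Dom C t"]) (use sps \<phi>1[of t] \<phi>2[of t] m1[of "p \<cdot> t"] m2[of "p \<cdot> t"] t p(1) m(1) \<phi>(1) in auto)
    then show "\<phi> \<cdot> t \<in> sieve m" by (intro sieveI[of m "p \<cdot> t"]) (use t p(1) m(1) in auto)
  qed (use \<phi>(1) m(1) in auto)
  then obtain t where t: "t \<in> Hom C (Dom C \<phi>) (Dom C m)" "m \<cdot> t = \<phi>" by (rule sieveE)
  have "s1 \<cdot> t = s1 \<cdot> p" "s2 \<cdot> t = s2 \<cdot> q"
    using m1[of t] m2[of t] t m(1) \<phi> by auto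
  then show ?thesis using t(1) \<phi>(1) m(1) W_def by auto
qed

end


section \<open>The lattice of normal subobjects\<close>

context semi_abelian_category
begin

text \<open>\<open>local_join p A\<close> is the join of \<open>A\<close> and the kernel of \<open>p\<close>: the generalised elements that, after
  restriction along a regular epimorphism, agree modulo \<open>p\<close> with an element of \<open>A\<close>.\<close>

definition local_join :: "'m \<Rightarrow> 'm set \<Rightarrow> 'm set" where
  "local_join p A = {t \<in> Mor C. Cod C t = Dom C p \<and>
     (\<exists>e a. regepi e \<and> Cod C e = Dom C t \<and> a \<in> A \<and> Dom C a = Dom C e \<and> p \<cdot> (t \<cdot> e) = p \<cdot> a)}"

lemma local_joinI:
  assumes "t \<in> Mor C" "Cod C t = Dom C p" "regepi e" "Cod C e = Dom C t" "a \<in> A" "Dom C a = Dom C e"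
    "p \<cdot> (t \<cdot> e) = p \<cdot> a"
  shows "t \<in> local_join p A"
  using assms unfolding local_join_def by blast

lemma local_joinE:
  assumes "t \<in> local_join p A"
  obtains e a where "t \<in> Mor C" "Cod C t = Dom C p" "regepi e" "Cod C e = Dom C t" "a \<in> A"
    "Dom C a = Dom C e" "p \<cdot> (t \<cdot> e) = p \<cdot> a"
  using assms unfolding local_join_def by blast

text \<open>The image of \<open>(r1, r2)\<close> along \<open>p \<times> p\<close> inherits reflexivity and symmetry, and transitivity is then
  automatic, so that Barr exactness applies.\<close>

lemma image_of_kernel_pair:
  assumes p: "regepi p" "p \<in> Hom C X Y" and r: "r1 \<in> Hom C R X" "r2 \<in> Hom C R X"
    and \<delta>: "\<delta> \<in> Hom C X R" "r1 \<cdot> \<delta> = Ident C X" "r2 \<cdot> \<delta> = Ident C X"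
    and \<sigma>: "\<sigma> \<in> Hom C R R" "r1 \<cdot> \<sigma> = r2" "r2 \<cdot> \<sigma> = r1"
  obtains S c s1 s2 f where "regepi c" "c \<in> Hom C R S" "s1 \<in> Hom C S Y" "s2 \<in> Hom C S Y"
    "s1 \<cdot> c = p \<cdot> r1" "s2 \<cdot> c = p \<cdot> r2" "is_pullback C f f s1 s2"
proof -
  have Y: "Y \<in> Obj C" and XO: "X \<in> Obj C" using p by auto
  obtain P \<pi>1 \<pi>2 where P: "\<pi>1 \<in> Hom C P Y" "\<pi>2 \<in> Hom C P Y"
    and Pex: "\<And>T s t. s \<in> Hom C T Y \<Longrightarrow> t \<in> Hom C T Y \<Longrightarrow> \<exists>u \<in> Hom C T P. \<pi>1 \<cdot> u = s \<and> \<pi>2 \<cdot> u = t"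
    and Pun: "\<And>T u v. u \<in> Hom C T P \<Longrightarrow> v \<in> Hom C T P \<Longrightarrow> \<pi>1 \<cdot> u = \<pi>1 \<cdot> v \<Longrightarrow> \<pi>2 \<cdot> u = \<pi>2 \<cdot> v \<Longrightarrow> u = v"
    by (rule product_obtain[OF Y Y]) (rule that, assumption+)
  have "p \<cdot> r1 \<in> Hom C R Y" "p \<cdot> r2 \<in> Hom C R Y" using p r by auto
  then obtain \<rho> where \<rho>: "\<rho> \<in> Hom C R P" "\<pi>1 \<cdot> \<rho> = p \<cdot> r1" "\<pi>2 \<cdot> \<rho> = p \<cdot> r2" using Pex by blast
  \<comment> \<open>\<open>S\<close> is the image of the relation in the product \<open>P\<close> of
    \<open>Y\<close> with itself. As \<open>m\<close> is monic, factorisations through it may be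
    tested after the regular epimorphisms \<open>p\<close> and \<open>c\<close>.\<close>
  obtain S c m where I: "regepi c" "monic m" "c \<in> Hom C (Dom C \<rho>) S" "m \<in> Hom C S (Cod C \<rho>)" "m \<cdot> c = \<rho>"
    by (rule image_obtain[of \<rho>]) (use \<rho> in auto)
  have c: "c \<in> Hom C R S" and m: "m \<in> Hom C S P" using I \<rho> by auto
  define s1 where "s1 = \<pi>1 \<cdot> m"
  define s2 where "s2 = \<pi>2 \<cdot> m"
  have s: "s1 \<in> Hom C S Y" "s2 \<in> Hom C S Y" unfolding s1_def s2_def using m P by auto
  have s1c: "s1 \<cdot> c = p \<cdot> r1" and s2c: "s2 \<cdot> c = p \<cdot> r2"
    unfolding s1_def s2_def using I(5) \<rho>(2,3) c m P by auto
  have jm: "u = v" if "u \<in> Hom C T S" "v \<in> Hom C T S" "s1 \<cdot> u = s1 \<cdot> v" "s2 \<cdot> u = s2 \<cdot> v" for T u v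
  proof -
    have "m \<cdot> u = m \<cdot> v"
      by (rule Pun[of _ T]) (use that m P in \<open>auto simp: s1_def s2_def\<close>)
    then show ?thesis by (rule monicD[OF _ I(2)]) (use that m in auto)
  qed
  have iY: "Ident C Y \<in> Hom C Y Y" using Y by auto
  obtain \<Delta> where \<Delta>: "\<Delta> \<in> Hom C Y P" "\<pi>1 \<cdot> \<Delta> = Ident C Y" "\<pi>2 \<cdot> \<Delta> = Ident C Y"
    using Pex[OF iY iY] by blast
  \<comment> \<open>Reflexivity: over the cover \<open>p\<close> the diagonal of \<open>Y\<close>
    comes from the diagonal \<open>\<delta>\<close> of the given relation, so it lies in
    \<open>S\<close> itself.\<close>
  have "\<Delta> \<cdot> p = m \<cdot> (c \<cdot> \<delta>)"
  proof (rule Pun[of _ X])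
    have a1: "\<pi>1 \<cdot> (\<Delta> \<cdot> p) = Ident C Y \<cdot> p" using \<Delta>(2) by (rule comp_cong1) (use \<Delta> p P in auto)
    have a2: "\<pi>2 \<cdot> (\<Delta> \<cdot> p) = Ident C Y \<cdot> p" using \<Delta>(3) by (rule comp_cong1) (use \<Delta> p P in auto)
    have mc: "m \<cdot> (c \<cdot> \<delta>) = \<rho> \<cdot> \<delta>" using I(5) by (rule comp_cong1) (use \<delta> c m in auto)
    have b1: "\<pi>1 \<cdot> (\<rho> \<cdot> \<delta>) = p \<cdot> (r1 \<cdot> \<delta>)" using \<rho>(2) by (rule comp_cong) (use \<rho> \<delta> P p r in auto)
    have b2: "\<pi>2 \<cdot> (\<rho> \<cdot> \<delta>) = p \<cdot> (r2 \<cdot> \<delta>)" using \<rho>(3) by (rule comp_cong) (use \<rho> \<delta> P p r in auto)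
    show "\<pi>1 \<cdot> (\<Delta> \<cdot> p) = \<pi>1 \<cdot> (m \<cdot> (c \<cdot> \<delta>))" using a1 mc b1 \<delta>(2) p by simp
    show "\<pi>2 \<cdot> (\<Delta> \<cdot> p) = \<pi>2 \<cdot> (m \<cdot> (c \<cdot> \<delta>))" using a2 mc b2 \<delta>(3) p by simp
  qed (use \<Delta>(1) p c m \<delta>(1) in auto)
  then have "\<Delta> \<cdot> p \<in> sieve m" by (intro sieveI[of m "c \<cdot> \<delta>"]) (use c m \<delta>(1) in auto)
  then have "\<Delta> \<in> sieve m" by (rule regepi_sieve[OF _ p(1) I(2)]) (use \<Delta>(1) p m in auto)
  then obtain d where d: "d \<in> Hom C (Dom C \<Delta>) (Dom C m)" "m \<cdot> d = \<Delta>" by (rule sieveE)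
  have dH: "d \<in> Hom C Y S" using d(1) \<Delta>(1) m by simp
  have ds: "s1 \<cdot> d = Ident C Y" "s2 \<cdot> d = Ident C Y"
    unfolding s1_def s2_def using d(2) \<Delta>(2,3) dH m P by auto
  \<comment> \<open>Symmetry: exchanging the factors of \<open>P\<close> preserves \<open>S\<close>,
    because over the cover \<open>c\<close> the exchange is induced by
    \<open>\<sigma>\<close>.\<close>
  obtain i where i: "i \<in> Hom C S S" "s1 \<cdot> i = s2" "s2 \<cdot> i = s1"
  proof -
    obtain sw where sw: "sw \<in> Hom C P P" "\<pi>1 \<cdot> sw = \<pi>2" "\<pi>2 \<cdot> sw = \<pi>1" using Pex[OF P(2,1)] by blast
    have "sw \<cdot> (m \<cdot> c) = m \<cdot> (c \<cdot> \<sigma>)"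
    proof (rule Pun[of _ R])
      have a1: "\<pi>1 \<cdot> (sw \<cdot> \<rho>) = \<pi>2 \<cdot> \<rho>" using sw(2) by (rule comp_cong1) (use sw(1) \<rho>(1) P in auto)
      have a2: "\<pi>2 \<cdot> (sw \<cdot> \<rho>) = \<pi>1 \<cdot> \<rho>" using sw(3) by (rule comp_cong1) (use sw(1) \<rho>(1) P in auto)
      have mc: "m \<cdot> (c \<cdot> \<sigma>) = \<rho> \<cdot> \<sigma>" using I(5) by (rule comp_cong1) (use \<sigma>(1) c m in auto)
      have b1: "\<pi>1 \<cdot> (\<rho> \<cdot> \<sigma>) = p \<cdot> (r1 \<cdot> \<sigma>)" using \<rho>(2) by (rule comp_cong) (use \<rho>(1) \<sigma>(1) P p r in auto)
      have b2: "\<pi>2 \<cdot> (\<rho> \<cdot> \<sigma>) = p \<cdot> (r2 \<cdot> \<sigma>)" using \<rho>(3) by (rule comp_cong) (use \<rho>(1) \<sigma>(1) P p r in auto)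
      show "\<pi>1 \<cdot> (sw \<cdot> (m \<cdot> c)) = \<pi>1 \<cdot> (m \<cdot> (c \<cdot> \<sigma>))" using a1 mc b1 \<sigma>(2) \<rho>(3) I(5) by simp
      show "\<pi>2 \<cdot> (sw \<cdot> (m \<cdot> c)) = \<pi>2 \<cdot> (m \<cdot> (c \<cdot> \<sigma>))" using a2 mc b2 \<sigma>(3) \<rho>(2) I(5) by simp
    qed (use sw(1) c m \<sigma>(1) in auto)
    then have "(sw \<cdot> m) \<cdot> c = m \<cdot> (c \<cdot> \<sigma>)" using sw(1) c m by simp
    then have "(sw \<cdot> m) \<cdot> c \<in> sieve m" by (intro sieveI[of m "c \<cdot> \<sigma>"]) (use c m \<sigma>(1) in auto)
    then have "sw \<cdot> m \<in> sieve m" by (rule regepi_sieve[OF _ I(1,2)]) (use sw(1) c m in auto)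
    then obtain i where i: "i \<in> Hom C (Dom C (sw \<cdot> m)) (Dom C m)" "m \<cdot> i = sw \<cdot> m" by (rule sieveE)
    have iH: "i \<in> Hom C S S" using i(1) sw(1) m by simp
    have a1: "\<pi>1 \<cdot> (sw \<cdot> m) = \<pi>2 \<cdot> m" using sw(2) by (rule comp_cong1) (use sw(1) m P in auto)
    have a2: "\<pi>2 \<cdot> (sw \<cdot> m) = \<pi>1 \<cdot> m" using sw(3) by (rule comp_cong1) (use sw(1) m P in auto)
    show ?thesis
      by (rule that[OF iH]) (use a1 a2 i(2) iH m P in \<open>auto simp: s1_def s2_def\<close>)
  qed
  have "is_equivalence_relation C s1 s2" unfolding is_equivalence_relation_def
  proof (intro conjI allI impI)
    show "\<exists>d\<in>Hom C (Cod C s1) (Dom C s1). s1 \<cdot> d = Ident C (Cod C s1) \<and> s2 \<cdot> d = Ident C (Cod C s1)"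
      using ds dH s by auto
    show "\<exists>i\<in>Hom C (Dom C s1) (Dom C s1). s1 \<cdot> i = s2 \<and> s2 \<cdot> i = s1" using i s by auto
    fix a b assume "is_pullback C s2 s1 a b"
    from reflexive_relation_transitive[OF s _ dH ds this]
    show "\<exists>t\<in>Hom C (Dom C a) (Dom C s1). s1 \<cdot> t = s1 \<cdot> a \<and> s2 \<cdot> t = s2 \<cdot> b" using jm s by auto
  next
    show "\<forall>u\<in>Mor C. \<forall>v\<in>Mor C. Dom C u = Dom C v \<and> Cod C u = Dom C s1 \<and> Cod C v = Dom C s1 \<and>
       s1 \<cdot> u = s1 \<cdot> v \<and> s2 \<cdot> u = s2 \<cdot> v \<longrightarrow> u = v" using jm s by auto
  qed (use s in auto)
  then obtain f where "is_pullback C f f s1 s2" using Barr_exact unfolding is_Barr_exact_def by blast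
  then show ?thesis using that[OF I(1) c s s1c s2c] by blast
qed

text \<open>The kernel pair of \<open>f\<close> is the image along \<open>p\<close> of the kernel
  pair \<open>R\<close> of \<open>q\<close>, so \<open>f \<cdot> p\<close> kills \<open>t\<close>
  exactly when \<open>(p \<cdot> t, 0)\<close> lies in this image. For the harder inclusion this
  only gives, on a cover, a pair in \<open>R\<close> whose second entry is killed by
  \<open>p\<close>. Making that entry vanish is a subtraction in the case of groups and is replaced
  here by generation of a point.\<close>

lemma normal_image:
  assumes p: "regepi p" and q: "q \<in> Mor C" "Dom C q = Dom C p"
  obtains f where "f \<in> Mor C" "Dom C f = Cod C p" "kernel_elems (f \<cdot> p) = local_join p (kernel_elems q)"
proof -
  define X where "X = Dom C p"
  define Y where "Y = Cod C p"
  have pH: "p \<in> Hom C X Y" and qH: "q \<in> Hom C X (Cod C q)" using p q unfolding X_def Y_def by auto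
  have XO: "X \<in> Obj C" and YO: "Y \<in> Obj C" using pH by auto
  obtain R r1 r2 where pb: "r1 \<in> Hom C R (Dom C q)" "r2 \<in> Hom C R (Dom C q)" "q \<cdot> r1 = q \<cdot> r2"
    and ex: "\<And>T s t. s \<in> Hom C T (Dom C q) \<Longrightarrow> t \<in> Hom C T (Dom C q) \<Longrightarrow> q \<cdot> s = q \<cdot> t \<Longrightarrow>
      \<exists>u \<in> Hom C T R. r1 \<cdot> u = s \<and> r2 \<cdot> u = t"
    and un: "\<And>T u v. u \<in> Hom C T R \<Longrightarrow> v \<in> Hom C T R \<Longrightarrow> r1 \<cdot> u = r1 \<cdot> v \<Longrightarrow>
      r2 \<cdot> u = r2 \<cdot> v \<Longrightarrow> u = v"
    by (rule pullback_obtain[OF q(1) q(1) refl]) (rule that, assumption+)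
  have r: "r1 \<in> Hom C R X" "r2 \<in> Hom C R X" using pb q X_def by auto
  have iX: "Ident C X \<in> Hom C X (Dom C q)" using XO qH by auto
  obtain \<delta> where \<delta>: "\<delta> \<in> Hom C X R" "r1 \<cdot> \<delta> = Ident C X" "r2 \<cdot> \<delta> = Ident C X"
    using ex[OF iX iX] by auto
  obtain \<sigma> where \<sigma>: "\<sigma> \<in> Hom C R R" "r1 \<cdot> \<sigma> = r2" "r2 \<cdot> \<sigma> = r1" using ex[OF pb(2,1)] pb(3) by auto
  obtain S c s1 s2 f where S: "regepi c" "c \<in> Hom C R S" "s1 \<in> Hom C S Y" "s2 \<in> Hom C S Y"
    "s1 \<cdot> c = p \<cdot> r1" "s2 \<cdot> c = p \<cdot> r2" and pbf: "is_pullback C f f s1 s2"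
    by (rule image_of_kernel_pair[OF p pH r \<delta> \<sigma>]) (rule that, assumption+)
  have f: "f \<in> Mor C" "s1 \<in> Hom C (Dom C s1) (Dom C f)" "f \<cdot> s1 = f \<cdot> s2"
    and fex: "\<And>T s t. s \<in> Hom C T (Dom C f) \<Longrightarrow> t \<in> Hom C T (Dom C f) \<Longrightarrow> f \<cdot> s = f \<cdot> t \<Longrightarrow>
      \<exists>u \<in> Hom C T (Dom C s1). s1 \<cdot> u = s \<and> s2 \<cdot> u = t"
    using pbf by (auto elim!: pullbackE)
  have fH: "f \<in> Hom C Y (Cod C f)" using f S(3) by auto
  have "kernel_elems (f \<cdot> p) = local_join p (kernel_elems q)"
  proof (intro equalityI subsetI)
    fix t assume "t \<in> local_join p (kernel_elems q)"
    then obtain e a where t: "t \<in> Mor C" "Cod C t = X" "regepi e" "Cod C e = Dom C t" "a \<in> kernel_elems q"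
      "Dom C a = Dom C e" "p \<cdot> (t \<cdot> e) = p \<cdot> a" unfolding X_def by (rule local_joinE)
    have a: "a \<in> Hom C (Dom C e) X" "q \<cdot> a = zero_mor (Dom C e) (Cod C q)" using t(5,6) qH by (auto simp: kernel_elems_iff)
    have eO: "Dom C e \<in> Obj C" using t(3) by auto
    have "\<exists>u \<in> Hom C (Dom C e) R. r1 \<cdot> u = a \<and> r2 \<cdot> u = zero_mor (Dom C e) X"
      by (rule ex) (use a qH eO in auto)
    then obtain u where u: "u \<in> Hom C (Dom C e) R" "r1 \<cdot> u = a" "r2 \<cdot> u = zero_mor (Dom C e) X" by blast
    have 1: "s1 \<cdot> (c \<cdot> u) = p \<cdot> (r1 \<cdot> u)" using S(5) by (rule comp_cong) (use S u(1) r pH in auto)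
    have 2: "s2 \<cdot> (c \<cdot> u) = p \<cdot> (r2 \<cdot> u)" using S(6) by (rule comp_cong) (use S u(1) r pH in auto)
    have "f \<cdot> (s1 \<cdot> (c \<cdot> u)) = f \<cdot> (s2 \<cdot> (c \<cdot> u))" using f(3) by (rule comp_cong) (use S u(1) fH in auto)
    then have "f \<cdot> (p \<cdot> a) = zero_mor (Dom C e) (Cod C f)" using 1 2 u(2,3) pH fH eO by simp
    then have "f \<cdot> (p \<cdot> (t \<cdot> e)) = zero_mor (Dom C e) (Cod C f)" using t(7) by simp
    then have "t \<cdot> e \<in> kernel_elems (f \<cdot> p)" using t(1-4) pH fH by (intro kernel_elemsI) auto
    then show "t \<in> kernel_elems (f \<cdot> p)" by (rule kernel_elems_regepi[OF _ t(3)]) (use t(1-4) pH fH in auto)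
  next
    fix t assume "t \<in> kernel_elems (f \<cdot> p)"
    then have t: "t \<in> Hom C (Dom C t) X" "f \<cdot> (p \<cdot> t) = zero_mor (Dom C t) (Cod C f)"
      using pH fH by (auto simp: kernel_elems_iff)
    have tO: "Dom C t \<in> Obj C" using t(1) by auto
    have "\<exists>u \<in> Hom C (Dom C t) (Dom C s1). s1 \<cdot> u = p \<cdot> t \<and> s2 \<cdot> u = zero_mor (Dom C t) Y"
      by (rule fex) (use t tO pH fH YO in auto)
    then obtain u where u: "u \<in> Hom C (Dom C t) S" "s1 \<cdot> u = p \<cdot> t" "s2 \<cdot> u = zero_mor (Dom C t) Y"
      using S(3) by auto
    obtain T e x where l: "regepi e" "e \<in> Hom C T (Dom C u)" "x \<in> Hom C T (Dom C c)" "c \<cdot> x = u \<cdot> e"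
      by (rule regepi_lift[OF S(1), of u]) (use u(1) S(2) in auto)
    have e: "e \<in> Hom C T (Dom C t)" and x: "x \<in> Hom C T R" using l u(1) S(2) by auto
    have TO: "T \<in> Obj C" using e by auto
    have "s1 \<cdot> (c \<cdot> x) = p \<cdot> (r1 \<cdot> x)" using S(5) by (rule comp_cong) (use S x r pH in auto)
    moreover have "s1 \<cdot> (u \<cdot> e) = p \<cdot> (t \<cdot> e)" using u(2) by (rule comp_cong) (use S u(1) e t(1) pH in auto)
    ultimately have px1: "p \<cdot> (r1 \<cdot> x) = p \<cdot> (t \<cdot> e)" using l(4) by simp
    have "s2 \<cdot> (c \<cdot> x) = p \<cdot> (r2 \<cdot> x)" using S(6) by (rule comp_cong) (use S x r pH in auto)
    moreover have "s2 \<cdot> (u \<cdot> e) = zero_mor (Dom C t) Y \<cdot> e" using u(3) by (rule comp_cong1) (use S u(1) e in auto)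
    ultimately have px2: "p \<cdot> (r2 \<cdot> x) = zero_mor T Y" using l(4) e YO tO by simp
    \<comment> \<open>The kernel \<open>W\<close> of \<open>w\<close> consists of the pairs in
      \<open>R\<close> with second entry in the kernel \<open>V\<close> of \<open>p\<close>. The
      second entry makes it a point over \<open>V\<close>.\<close>
    define w where "w = p \<cdot> r2"
    have wH: "w \<in> Hom C R Y" unfolding w_def using pH r by auto
    obtain W kw where kw: "monic kw" "kw \<in> Hom C W R" "sieve kw = kernel_elems w"
      by (rule kernel_obtain[of w]) (use wH in auto)
    obtain V kb where kb: "monic kb" "kb \<in> Hom C V X" "sieve kb = kernel_elems p"
      by (rule kernel_obtain[of p]) (use pH in auto)
    obtain A kA where kA: "monic kA" "kA \<in> Hom C A X" "sieve kA = kernel_elems q"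
      by (rule kernel_obtain[of q]) (use qH in auto)
    obtain M e' m' where I: "regepi e'" "monic m'" "e' \<in> Hom C (Dom C (p \<cdot> kA)) M"
      "m' \<in> Hom C M (Cod C (p \<cdot> kA))" "m' \<cdot> e' = p \<cdot> kA"
      by (rule image_obtain[of "p \<cdot> kA"]) (use pH kA(2) in auto)
    have e'H: "e' \<in> Hom C A M" and m'H: "m' \<in> Hom C M Y" using I pH kA(2) by auto
    have "kw \<in> kernel_elems w" using kw sieve_self[of kw] by auto
    then have wkw: "p \<cdot> (r2 \<cdot> kw) = zero_mor W Y" using kw(2) wH pH r by (auto simp: kernel_elems_iff w_def)
    then have "r2 \<cdot> kw \<in> kernel_elems p" using kw(2) r pH by (intro kernel_elemsI) auto
    then have "r2 \<cdot> kw \<in> sieve kb" using kb(3) by simp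
    then obtain \<rho> where \<rho>: "\<rho> \<in> Hom C (Dom C (r2 \<cdot> kw)) (Dom C kb)" "kb \<cdot> \<rho> = r2 \<cdot> kw" by (rule sieveE)
    have \<rho>H: "\<rho> \<in> Hom C W V" using \<rho>(1) r kw(2) kb(2) by simp
    have "kb \<in> kernel_elems p" using kb sieve_self[of kb] by auto
    then have pkb: "p \<cdot> kb = zero_mor V Y" using kb(2) pH by (auto simp: kernel_elems_iff)
    have r2d: "r2 \<cdot> (\<delta> \<cdot> kb) = Ident C X \<cdot> kb" using \<delta>(3) by (rule comp_cong1) (use r \<delta>(1) kb(2) in auto)
    have r1d: "r1 \<cdot> (\<delta> \<cdot> kb) = Ident C X \<cdot> kb" using \<delta>(2) by (rule comp_cong1) (use r \<delta>(1) kb(2) in auto)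
    have "w \<cdot> (\<delta> \<cdot> kb) = zero_mor V Y" unfolding w_def using r2d pkb r pH \<delta>(1) kb(2) by simp
    then have "\<delta> \<cdot> kb \<in> kernel_elems w" using wH \<delta>(1) kb(2) by (intro kernel_elemsI) auto
    then have "\<delta> \<cdot> kb \<in> sieve kw" using kw(3) by simp
    \<comment> \<open>The section sends an element \<open>b\<close> of \<open>V\<close> to the pair
      \<open>(b, b)\<close>.\<close>
    then obtain d where d: "d \<in> Hom C (Dom C (\<delta> \<cdot> kb)) (Dom C kw)" "kw \<cdot> d = \<delta> \<cdot> kb" by (rule sieveE)
    have dH: "d \<in> Hom C V W" using d(1) \<delta>(1) kw(2) kb(2) by simp
    have \<rho>d: "\<rho> \<cdot> d = Ident C V"
    proof -
      have "kb \<cdot> (\<rho> \<cdot> d) = r2 \<cdot> (kw \<cdot> d)" using \<rho>(2) by (rule comp_cong) (use \<rho>H dH kb(2) r kw(2) in auto)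
      then have "kb \<cdot> (\<rho> \<cdot> d) = kb \<cdot> Ident C V" using d(2) r2d kb(2) by simp
      then show ?thesis by (rule monicD[OF _ kb(1)]) (use \<rho>H dH kb(2) in auto)
    qed
    have \<phi>: "p \<cdot> (r1 \<cdot> kw) \<in> Hom C W Y" using pH r kw(2) by auto
    \<comment> \<open>On the section the first entry is killed by \<open>p\<close>. On the kernel of
      \<open>\<rho>\<close> the pairs are \<open>(a, 0)\<close> with \<open>a\<close> in the kernel
      of \<open>q\<close>, so \<open>p\<close> sends the first entry into the image
      \<open>m'\<close> of that kernel. By generation this holds on all of \<open>W\<close>.\<close>
    have "p \<cdot> (r1 \<cdot> kw) \<in> sieve m'"
    proof (rule point_generation[OF \<rho>H dH \<rho>d I(2)])
      have "(p \<cdot> (r1 \<cdot> kw)) \<cdot> d = p \<cdot> (r1 \<cdot> (kw \<cdot> d))" using pH r kw(2) dH by simp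
      also have "\<dots> = zero_mor V Y" using d(2) r1d pkb kb(2) by simp
      also have "\<dots> = m' \<cdot> zero_mor V M" using m'H kb(2) by auto
      finally show "(p \<cdot> (r1 \<cdot> kw)) \<cdot> d \<in> sieve m'" by (intro sieveI[of m' "zero_mor V M"]) (use m'H kb(2) in auto)
      fix s assume "s \<in> kernel_elems \<rho>"
      then have s: "s \<in> Mor C" "Cod C s = W" "\<rho> \<cdot> s = zero_mor (Dom C s) V" using \<rho>H by (auto simp: kernel_elems_iff)
      have "kb \<cdot> (\<rho> \<cdot> s) = r2 \<cdot> (kw \<cdot> s)" using \<rho>(2) by (rule comp_cong) (use \<rho>H s kb(2) r kw(2) in auto)
      then have r2s: "r2 \<cdot> (kw \<cdot> s) = zero_mor (Dom C s) X" using s kb(2) by simp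
      have "q \<cdot> (r1 \<cdot> (kw \<cdot> s)) = q \<cdot> (r2 \<cdot> (kw \<cdot> s))" using pb(3) by (rule comp_cong) (use r s qH kw(2) in auto)
      then have "r1 \<cdot> (kw \<cdot> s) \<in> kernel_elems q" using r2s s qH r kw(2) by (intro kernel_elemsI) auto
      then have "r1 \<cdot> (kw \<cdot> s) \<in> sieve kA" using kA(3) by simp
      then obtain y where y: "y \<in> Hom C (Dom C (r1 \<cdot> (kw \<cdot> s))) (Dom C kA)" "kA \<cdot> y = r1 \<cdot> (kw \<cdot> s)" by (rule sieveE)
      have yH: "y \<in> Hom C (Dom C s) A" using y(1) s r kw(2) kA(2) by simp
      have "m' \<cdot> (e' \<cdot> y) = p \<cdot> (kA \<cdot> y)" using I(5) by (rule comp_cong) (use m'H e'H yH kA(2) pH in auto)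
      then have "m' \<cdot> (e' \<cdot> y) = (p \<cdot> (r1 \<cdot> kw)) \<cdot> s" using y(2) pH r kw(2) s by simp
      then show "(p \<cdot> (r1 \<cdot> kw)) \<cdot> s \<in> sieve m'" by (intro sieveI[of m' "e' \<cdot> y"]) (use m'H e'H yH in auto)
    qed (use \<phi> m'H in auto)
    then obtain g where g: "g \<in> Hom C (Dom C (p \<cdot> (r1 \<cdot> kw))) (Dom C m')" "m' \<cdot> g = p \<cdot> (r1 \<cdot> kw)" by (rule sieveE)
    have gH: "g \<in> Hom C W M" using g(1) \<phi> m'H by simp
    have "x \<in> kernel_elems w" using px2 x wH pH r by (intro kernel_elemsI) (auto simp: w_def)
    then have "x \<in> sieve kw" using kw(3) by simp
    then obtain y where y: "y \<in> Hom C (Dom C x) (Dom C kw)" "kw \<cdot> y = x" by (rule sieveE)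
    have yH: "y \<in> Hom C T W" using y(1) x kw(2) by simp
    \<comment> \<open>A further cover is needed because belonging to the image \<open>M\<close>
      gives an element of the kernel of \<open>q\<close> only locally.\<close>
    obtain T2 e2 a0 where l2: "regepi e2" "e2 \<in> Hom C T2 (Dom C (g \<cdot> y))" "a0 \<in> Hom C T2 (Dom C e')" "e' \<cdot> a0 = (g \<cdot> y) \<cdot> e2"
      by (rule regepi_lift[OF I(1), of "g \<cdot> y"]) (use gH yH e'H in auto)
    have e2: "e2 \<in> Hom C T2 T" and a0: "a0 \<in> Hom C T2 A" using l2 gH yH e'H by auto
    have "kA \<in> kernel_elems q" using kA sieve_self[of kA] by auto
    then have "kA \<cdot> a0 \<in> kernel_elems q" by (rule kernel_elems_comp) (use kA(2) a0 qH in auto)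
    moreover have "p \<cdot> (t \<cdot> (e \<cdot> e2)) = p \<cdot> (kA \<cdot> a0)"
    proof -
      have "p \<cdot> (kA \<cdot> a0) = m' \<cdot> (e' \<cdot> a0)" using I(5)[symmetric] by (rule comp_cong) (use m'H e'H a0 kA(2) pH in auto)
      also have "\<dots> = m' \<cdot> (g \<cdot> (y \<cdot> e2))" using l2(4) gH yH e2 by simp
      also have "\<dots> = (p \<cdot> (r1 \<cdot> kw)) \<cdot> (y \<cdot> e2)" using g(2) by (rule comp_cong1) (use m'H gH yH e2 in auto)
      also have "\<dots> = p \<cdot> (r1 \<cdot> (kw \<cdot> (y \<cdot> e2)))" using pH r kw(2) yH e2 by simp
      also have "kw \<cdot> (y \<cdot> e2) = x \<cdot> e2" using y(2) by (rule comp_cong1) (use kw(2) yH e2 in auto)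
      also have "p \<cdot> (r1 \<cdot> (x \<cdot> e2)) = (p \<cdot> (r1 \<cdot> x)) \<cdot> e2" using pH r x e2 by simp
      also have "\<dots> = p \<cdot> (t \<cdot> (e \<cdot> e2))" using px1 pH t(1) e e2 by simp
      finally show ?thesis by simp
    qed
    ultimately show "t \<in> local_join p (kernel_elems q)"
      by (intro local_joinI[of t p "e \<cdot> e2" "kA \<cdot> a0"] regepi_comp) (use t(1) X_def e e2 l(1) l2(1) kA(2) a0 in auto)
  qed
  then show ?thesis using that[of f] fH Y_def by simp
qed


text \<open>A normal subobject of \<open>X\<close> is represented by the set of all morphisms into \<open>X\<close> (its generalised
  elements) factoring through it; meets then are intersections.\<close>

definition normal_sets :: "'o \<Rightarrow> 'm set set" where
  "normal_sets X = {kernel_elems f | f. f \<in> Mor C \<and> Dom C f = X}"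

lemma normal_setsI: "f \<in> Mor C \<Longrightarrow> Dom C f = X \<Longrightarrow> kernel_elems f \<in> normal_sets X"
  by (auto simp: normal_sets_def)

lemma normal_sets_regepi:
  assumes "N \<in> normal_sets X"
  obtains p where "regepi p" "Dom C p = X" "N = kernel_elems p"
proof -
  obtain f where f: "f \<in> Mor C" "Dom C f = X" "N = kernel_elems f" using assms by (auto simp: normal_sets_def)
  obtain I c m where I: "regepi c" "monic m" "c \<in> Hom C (Dom C f) I" "m \<in> Hom C I (Cod C f)" "m \<cdot> c = f"
    using f(1) by (rule image_obtain)
  have "kernel_elems (m \<cdot> c) = kernel_elems c" by (rule kernel_elems_monic_comp) (use I in auto)
  then show ?thesis using that[of c] I f by auto
qed

lemma normal_sets_dest: "N \<in> normal_sets X \<Longrightarrow> t \<in> N \<Longrightarrow> t \<in> Mor C \<and> Cod C t = X"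
  by (auto simp: normal_sets_def kernel_elems_iff)

lemma normal_sets_local:
  assumes "t \<cdot> e \<in> N" "N \<in> normal_sets X" "regepi e" "t \<in> Mor C" "Cod C t = X" "Cod C e = Dom C t"
  shows "t \<in> N"
proof -
  obtain f where f: "f \<in> Mor C" "Dom C f = X" "N = kernel_elems f" using assms(2) by (auto simp: normal_sets_def)
  have "t \<cdot> e \<in> kernel_elems f" using assms f by simp
  then have "t \<in> kernel_elems f" by (rule kernel_elems_regepi) (use assms f in auto)
  then show ?thesis using f by simp
qed

lemma normal_sets_zero_mor: "N \<in> normal_sets X \<Longrightarrow> a \<in> Obj C \<Longrightarrow> zero_mor a X \<in> N"
  using kernel_elems_zero_mor by (auto simp: normal_sets_def)

definition zero_elems :: "'o \<Rightarrow> 'm set" where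
  "zero_elems X = kernel_elems (Ident C X)"

lemma zero_elems_normal_sets: "X \<in> Obj C \<Longrightarrow> zero_elems X \<in> normal_sets X"
  unfolding zero_elems_def by (rule normal_setsI) auto

lemma zero_elems_iff: "X \<in> Obj C \<Longrightarrow> t \<in> zero_elems X \<longleftrightarrow> t \<in> Mor C \<and> Cod C t = X \<and> t = zero_mor (Dom C t) X"
  unfolding zero_elems_def by (auto simp: kernel_elems_iff)

lemma zero_elems_least: "X \<in> Obj C \<Longrightarrow> N \<in> normal_sets X \<Longrightarrow> zero_elems X \<subseteq> N"
proof
  fix t assume X: "X \<in> Obj C" "N \<in> normal_sets X" and "t \<in> zero_elems X"
  then have t: "t \<in> Mor C" "t = zero_mor (Dom C t) X" using zero_elems_iff by auto
  from t(1) have "zero_mor (Dom C t) X \<in> N" by (intro normal_sets_zero_mor[OF X(2)]) simp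
  then show "t \<in> N" using t(2) by simp
qed

definition elems :: "'o \<Rightarrow> 'm set" where
  "elems X = {t \<in> Mor C. Cod C t = X}"

lemma elems_normal_sets: assumes "X \<in> Obj C" shows "elems X \<in> normal_sets X"
proof -
  have "to_zero X \<cdot> t = zero_mor (Dom C t) zero_obj" if "t \<in> Mor C" "Cod C t = X" for t
  proof -
    have "to_zero X \<cdot> t = to_zero (Dom C t)" "zero_mor (Dom C t) zero_obj = to_zero (Dom C t)"
      by (rule to_zero_unique; use that assms in simp)+
    then show ?thesis by simp
  qed
  then have "elems X = kernel_elems (to_zero X)"
    using assms by (auto simp: elems_def kernel_elems_iff)
  then show ?thesis using normal_setsI[of "to_zero X" X] assms by auto
qed

text \<open>The intersection is the kernel of the pairing into a product.\<close>

lemma normal_sets_Int: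
  assumes "A \<in> normal_sets X" "B \<in> normal_sets X"
  shows "A \<inter> B \<in> normal_sets X"
proof -
  obtain f where f: "f \<in> Mor C" "Dom C f = X" "A = kernel_elems f" using assms(1) by (auto simp: normal_sets_def)
  obtain g where g: "g \<in> Mor C" "Dom C g = X" "B = kernel_elems g" using assms(2) by (auto simp: normal_sets_def)
  have O: "Cod C f \<in> Obj C" "Cod C g \<in> Obj C" using f g by auto
  obtain P p q where P: "p \<in> Hom C P (Cod C f)" "q \<in> Hom C P (Cod C g)"
    and Pex: "\<And>T s t. s \<in> Hom C T (Cod C f) \<Longrightarrow> t \<in> Hom C T (Cod C g) \<Longrightarrow> \<exists>u \<in> Hom C T P. p \<cdot> u = s \<and> q \<cdot> u = t"
    and Pun: "\<And>T u v. u \<in> Hom C T P \<Longrightarrow> v \<in> Hom C T P \<Longrightarrow> p \<cdot> u = p \<cdot> v \<Longrightarrow> q \<cdot> u = q \<cdot> v \<Longrightarrow> u = v"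
    by (rule product_obtain[OF O]) (rule that, assumption+)
  have "\<exists>u \<in> Hom C X P. p \<cdot> u = f \<and> q \<cdot> u = g" by (rule Pex) (use f g in auto)
  then obtain h where h: "h \<in> Hom C X P" "p \<cdot> h = f" "q \<cdot> h = g" by blast
  have PO: "P \<in> Obj C" using h(1) by auto
  have "kernel_elems h = A \<inter> B"
  proof (intro equalityI subsetI)
    fix t assume t: "t \<in> kernel_elems h"
    have "p \<cdot> h = f" "q \<cdot> h = g" by fact+
    then have "kernel_elems h \<subseteq> kernel_elems f" "kernel_elems h \<subseteq> kernel_elems g"
      using kernel_elems_mono_comp[of h p] kernel_elems_mono_comp[of h q] h(1) P by auto
    then show "t \<in> A \<inter> B" using t f g by auto
  next
    fix t assume "t \<in> A \<inter> B"
    then have t: "t \<in> Mor C" "Cod C t = X" "f \<cdot> t = zero_mor (Dom C t) (Cod C f)" "g \<cdot> t = zero_mor (Dom C t) (Cod C g)"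
      using f g by (auto simp: kernel_elems_iff)
    have 1: "p \<cdot> (h \<cdot> t) = f \<cdot> t" using h(2) by (rule comp_cong1) (use t h(1) P in auto)
    have 2: "q \<cdot> (h \<cdot> t) = g \<cdot> t" using h(3) by (rule comp_cong1) (use t h(1) P in auto)
    have "h \<cdot> t = zero_mor (Dom C t) P"
      by (rule Pun[of _ "Dom C t"]) (use 1 2 t h(1) P PO in auto)
    then show "t \<in> kernel_elems h" using t h(1) by (intro kernel_elemsI) auto
  qed
  then show ?thesis using normal_setsI[of h X] h(1) by auto
qed

section \<open>Joins of normal subobjects\<close>

lemma local_join_normal_sets:
  assumes p: "regepi p" "Dom C p = X" and A: "A \<in> normal_sets X"
  shows "local_join p A \<in> normal_sets X"
proof -
  obtain q where q: "q \<in> Mor C" "Dom C q = X" "A = kernel_elems q" using A by (auto simp: normal_sets_def)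
  obtain f where "f \<in> Mor C" "Dom C f = Cod C p" "kernel_elems (f \<cdot> p) = local_join p (kernel_elems q)"
    by (rule normal_image[OF p(1) q(1)]) (use p q in auto)
  then show ?thesis using normal_setsI[of "f \<cdot> p" X] p q by auto
qed

lemma local_join_upper:
  assumes p: "regepi p" "Dom C p = X" and A: "A \<in> normal_sets X"
  shows "A \<subseteq> local_join p A" "kernel_elems p \<subseteq> local_join p A"
proof
  fix t assume t: "t \<in> A"
  have t': "t \<in> Mor C" "Cod C t = X" using normal_sets_dest[OF A t] by auto
  show "t \<in> local_join p A"
    by (rule local_joinI[of t p "Ident C (Dom C t)" t]) (use t t' p in \<open>auto intro: regepi_Ident\<close>)
next
  show "kernel_elems p \<subseteq> local_join p A"
  proof
    fix t assume "t \<in> kernel_elems p"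
    then have t': "t \<in> Mor C" "Cod C t = X" "p \<cdot> t = zero_mor (Dom C t) (Cod C p)" using p by (auto simp: kernel_elems_iff)
    have X: "X \<in> Obj C" using p by auto
    have "zero_mor (Dom C t) X \<in> A" using normal_sets_zero_mor[OF A] t' by auto
    then show "t \<in> local_join p A"
      by (intro local_joinI[of t p "Ident C (Dom C t)" "zero_mor (Dom C t) X"]) (use t' p X in \<open>auto intro: regepi_Ident\<close>)
  qed
qed

text \<open>A morphism \<open>g\<close> with kernel \<open>N\<close> factors through
  \<open>p\<close>, since \<open>N\<close> contains the kernel of \<open>p\<close>. So elements that
  agree modulo \<open>p\<close> are killed by \<open>g\<close> together.\<close>

lemma local_join_least:
  assumes p: "regepi p" "Dom C p = X" and N: "N \<in> normal_sets X" "A \<subseteq> N" "kernel_elems p \<subseteq> N"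
  shows "local_join p A \<subseteq> N"
proof
  fix t assume "t \<in> local_join p A"
  then obtain e a where t: "t \<in> Mor C" "Cod C t = Dom C p" "regepi e" "Cod C e = Dom C t" "a \<in> A"
    "Dom C a = Dom C e" "p \<cdot> (t \<cdot> e) = p \<cdot> a" by (rule local_joinE)
  obtain g where g: "g \<in> Mor C" "Dom C g = X" "N = kernel_elems g" using N by (auto simp: normal_sets_def)
  obtain u where u: "u \<in> Hom C (Cod C p) (Cod C g)" "u \<cdot> p = g"
    by (rule regepi_factor[OF p(1), of g "Cod C g"]) (use p N g in auto)
  have a: "a \<in> Mor C" "Cod C a = X" "g \<cdot> a = zero_mor (Dom C a) (Cod C g)" using t(5) N(2) g by (auto simp: kernel_elems_iff)
  have "u \<cdot> (p \<cdot> (t \<cdot> e)) = g \<cdot> (t \<cdot> e)" using u(2) by (rule comp_cong1) (use t(1-4) u(1) p in auto)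
  moreover have "u \<cdot> (p \<cdot> a) = g \<cdot> a" using u(2) by (rule comp_cong1) (use a u(1) p in auto)
  ultimately have "g \<cdot> (t \<cdot> e) = zero_mor (Dom C e) (Cod C g)" using t(6,7) a by simp
  then have "t \<cdot> e \<in> N" using t(1-4) p g by (auto intro!: kernel_elemsI)
  then show "t \<in> N" by (rule normal_sets_local[OF _ N(1) t(3,1)]) (use t p in auto)
qed

text \<open>Taken as an intersection, the join depends on no enumeration of its members. That it is
  normal is proved for finite families, by adding the members one at a time through
  \<open>local_join\<close>.\<close>

definition normal_join :: "'o \<Rightarrow> 'm set set \<Rightarrow> 'm set" where
  "normal_join X \<S> = \<Inter>{N \<in> normal_sets X. \<Union>\<S> \<subseteq> N}"

lemma normal_join_upper: "A \<in> \<S> \<Longrightarrow> A \<subseteq> normal_join X \<S>"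
  unfolding normal_join_def by blast

lemma normal_join_least: "N \<in> normal_sets X \<Longrightarrow> (\<And>A. A \<in> \<S> \<Longrightarrow> A \<subseteq> N) \<Longrightarrow> normal_join X \<S> \<subseteq> N"
  unfolding normal_join_def by blast

lemma normal_join_empty: "X \<in> Obj C \<Longrightarrow> normal_join X {} = zero_elems X"
  unfolding normal_join_def using zero_elems_normal_sets zero_elems_least by blast

text \<open>Makes the join computable: if \<open>p\<close> is the quotient by the join of the other
  members, one more member is added by working locally modulo \<open>p\<close>.\<close>

lemma normal_join_insert:
  assumes p: "regepi p" "Dom C p = X" "kernel_elems p = normal_join X \<S>" and A: "A \<in> normal_sets X"
  shows "normal_join X (insert A \<S>) = local_join p A"
proof
  have "normal_join X \<S> \<subseteq> local_join p A" using local_join_upper[OF p(1,2) A] p(3) by simp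
  then show "normal_join X (insert A \<S>) \<subseteq> local_join p A"
    using local_join_upper[OF p(1,2) A] normal_join_upper[of _ \<S> X] by (intro normal_join_least local_join_normal_sets[OF p(1,2) A]) blast
  have "local_join p A \<subseteq> N" if "N \<in> normal_sets X" "\<Union>(insert A \<S>) \<subseteq> N" for N
  proof (rule local_join_least[OF p(1,2) that(1)])
    show "kernel_elems p \<subseteq> N" unfolding p(3) using that by (intro normal_join_least) auto
  qed (use that in auto)
  then show "local_join p A \<subseteq> normal_join X (insert A \<S>)" unfolding normal_join_def by blast
qed

lemma normal_join_normal_sets:
  assumes "X \<in> Obj C" "finite \<S>" "\<S> \<subseteq> normal_sets X"
  shows "normal_join X \<S> \<in> normal_sets X"
  using assms(2,3)
proof (induction \<S>)
  case empty
  then show ?case using normal_join_empty zero_elems_normal_sets assms(1) by simp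
next
  case (insert A \<S>)
  then have "normal_join X \<S> \<in> normal_sets X" by simp
  then obtain p where p: "regepi p" "Dom C p = X" "normal_join X \<S> = kernel_elems p" by (rule normal_sets_regepi)
  have A: "A \<in> normal_sets X" using insert by simp
  show ?case unfolding normal_join_insert[OF p(1,2) p(3)[symmetric] A] by (rule local_join_normal_sets[OF p(1,2) A])
qed

lemma normal_join_mono:
  assumes "X \<in> Obj C" "finite \<T>" "\<T> \<subseteq> normal_sets X" "\<And>A. A \<in> \<S> \<Longrightarrow> \<exists>B\<in>\<T>. A \<subseteq> B"
  shows "normal_join X \<S> \<subseteq> normal_join X \<T>"
proof (rule normal_join_least)
  show "normal_join X \<T> \<in> normal_sets X" using normal_join_normal_sets assms by blast
  fix A assume "A \<in> \<S>"
  then show "A \<subseteq> normal_join X \<T>" using assms(4) normal_join_upper by blast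
qed

text \<open>The local description of joins makes the lattice of normal subobjects modular.\<close>

lemma normal_join_modular:
  assumes X: "X \<in> Obj C" and S: "finite \<S>" "\<S> \<subseteq> normal_sets X" and A: "A \<in> normal_sets X" and B: "B \<in> normal_sets X"
    and sub: "normal_join X \<S> \<subseteq> B"
  shows "normal_join X (insert A \<S>) \<inter> B \<subseteq> normal_join X (insert (A \<inter> B) \<S>)"
proof -
  have "normal_join X \<S> \<in> normal_sets X" using normal_join_normal_sets[OF X S] .
  then obtain p where p: "regepi p" "Dom C p = X" "normal_join X \<S> = kernel_elems p" by (rule normal_sets_regepi)
  have AB: "A \<inter> B \<in> normal_sets X" using A B by (rule normal_sets_Int)
  obtain g where g: "g \<in> Mor C" "Dom C g = X" "B = kernel_elems g" using B by (auto simp: normal_sets_def)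
  \<comment> \<open>\<open>B\<close> contains the kernel of \<open>p\<close>, so belonging to
    \<open>B\<close> depends only on the value under \<open>p\<close>. Hence the representative
    \<open>a\<close> of \<open>t\<close> modulo \<open>p\<close> lies in \<open>B\<close> together
    with \<open>t\<close>.\<close>
  obtain u where u: "u \<in> Hom C (Cod C p) (Cod C g)" "u \<cdot> p = g"
    by (rule regepi_factor[OF p(1), of g "Cod C g"]) (use p sub g in auto)
  show ?thesis unfolding normal_join_insert[OF p(1,2) p(3)[symmetric] A] normal_join_insert[OF p(1,2) p(3)[symmetric] AB]
  proof
    fix t assume "t \<in> local_join p A \<inter> B"
    then have tB: "t \<in> B" and "t \<in> local_join p A" by auto
    then obtain e a where t: "t \<in> Mor C" "Cod C t = Dom C p" "regepi e" "Cod C e = Dom C t" "a \<in> A"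
      "Dom C a = Dom C e" "p \<cdot> (t \<cdot> e) = p \<cdot> a" by - (rule local_joinE)
    have a: "a \<in> Mor C" "Cod C a = X" using normal_sets_dest[OF A t(5)] by auto
    have "t \<cdot> e \<in> kernel_elems g" using tB g t(1-4) by (intro kernel_elems_comp) auto
    then have ge: "g \<cdot> (t \<cdot> e) = zero_mor (Dom C e) (Cod C g)" using t(1-4) by (auto simp: kernel_elems_iff)
    have "u \<cdot> (p \<cdot> (t \<cdot> e)) = g \<cdot> (t \<cdot> e)" using u(2) by (rule comp_cong1) (use t(1-4) u(1) p in auto)
    moreover have "u \<cdot> (p \<cdot> a) = g \<cdot> a" using u(2) by (rule comp_cong1) (use a u(1) p in auto)
    ultimately have "g \<cdot> a = zero_mor (Dom C a) (Cod C g)" using t(6,7) ge by simp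
    then have "a \<in> A \<inter> B" using a g t(5) by (auto intro: kernel_elemsI)
    then show "t \<in> local_join p (A \<inter> B)" using t by (intro local_joinI[of t p e a]) auto
  qed
qed

section \<open>Distributivity conditions\<close>

text \<open>Cutting down from \<open>elems X\<close> gives the empty meet the value
  \<open>X\<close>.\<close>

definition meet_elems :: "'o \<Rightarrow> (nat \<Rightarrow> 'm set) \<Rightarrow> nat set \<Rightarrow> 'm set" where
  "meet_elems X \<K> J = {t \<in> elems X. \<forall>j\<in>J. t \<in> \<K> j}"

lemma meet_elems_Un: "meet_elems X \<K> (I \<union> J) = meet_elems X \<K> I \<inter> meet_elems X \<K> J"
  unfolding meet_elems_def by auto

lemma meet_elems_insert: "meet_elems X \<K> (insert j J) = meet_elems X \<K> {j} \<inter> meet_elems X \<K> J"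
  unfolding meet_elems_def by auto

lemma meet_elems_anti: "I \<subseteq> J \<Longrightarrow> meet_elems X \<K> J \<subseteq> meet_elems X \<K> I"
  unfolding meet_elems_def by auto

lemma meet_elems_empty: "meet_elems X \<K> {} = elems X"
  unfolding meet_elems_def by auto

lemma meet_elems_normal_sets:
  assumes "X \<in> Obj C" "finite J" "\<And>j. j \<in> J \<Longrightarrow> \<K> j \<in> normal_sets X"
  shows "meet_elems X \<K> J \<in> normal_sets X"
  using assms(2,3)
proof (induction J)
  case empty
  then show ?case using meet_elems_empty elems_normal_sets assms(1) by simp
next
  case (insert j J)
  have "meet_elems X \<K> {j} = \<K> j" using insert(4)[of j] normal_sets_dest unfolding meet_elems_def elems_def by auto
  then show ?case unfolding meet_elems_insert[of X \<K> j J] using insert by (intro normal_sets_Int) auto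
qed

text \<open>Exactness in direction \<open>i\<close> at the objects of \<open>3\<^sup>n\<close> with coordinate \<open>2\<close> on \<open>A\<close>, \<open>0\<close> on \<open>B\<close> and \<open>1\<close> elsewhere
  amounts to the inclusion below.\<close>

definition exact_distributive :: "'o \<Rightarrow> nat \<Rightarrow> (nat \<Rightarrow> 'm set) \<Rightarrow> bool" where
  "exact_distributive X n \<K> \<longleftrightarrow> (\<forall>A B i. A \<subseteq> {..<n} \<and> B \<subseteq> {..<n} \<and> i < n \<and> A \<inter> B = {} \<and> i \<notin> A \<union> B \<longrightarrow>
     meet_elems X \<K> (insert i A) \<inter> normal_join X ((\<lambda>b. meet_elems X \<K> (insert b A)) ` B)
       \<subseteq> normal_join X ((\<lambda>b. meet_elems X \<K> (insert i (insert b A))) ` B))"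

text \<open>Induction on the total size of the sets \<open>J i\<close>: a set \<open>J i = J' \<union> {a}\<close> with at least two elements is
  replaced by \<open>J'\<close> and by \<open>{a}\<close>, and the two resulting inclusions are combined by modularity.\<close>

lemma distributive_extend:
  assumes X: "X \<in> Obj C" and K: "\<And>j. j < n \<Longrightarrow> \<K> j \<in> normal_sets X"
    and star: "exact_distributive X n \<K>"
    and I: "finite I" and J0: "J0 \<subseteq> {..<n}" and J: "\<And>i. i \<in> I \<Longrightarrow> J i \<subseteq> {..<n}"
    and d0: "\<And>i. i \<in> I \<Longrightarrow> J0 \<inter> J i = {}"
    and d: "\<And>i j. i \<in> I \<Longrightarrow> j \<in> I \<Longrightarrow> i \<noteq> j \<Longrightarrow> J i \<inter> J j = {}"
  shows "meet_elems X \<K> J0 \<inter> normal_join X ((\<lambda>i. meet_elems X \<K> (J i)) ` I) \<subseteq> normal_join X ((\<lambda>i. meet_elems X \<K> (J0 \<union> J i)) ` I)"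
proof -
  have mtn: "meet_elems X \<K> S \<in> normal_sets X" if "S \<subseteq> {..<n}" for S
    by (rule meet_elems_normal_sets[OF X]) (use that K finite_subset in auto)
  \<comment> \<open>The case in which every \<open>J i\<close> is a singleton, by induction on
    \<open>S\<close>: each further element \<open>i\<close> is absorbed by one instance of the
    hypothesis with \<open>A = S\<close>.\<close>
  have single: "meet_elems X \<K> S \<inter> normal_join X ((\<lambda>b. meet_elems X \<K> {b}) ` B) \<subseteq> normal_join X ((\<lambda>b. meet_elems X \<K> (insert b S)) ` B)"
    if S: "S \<subseteq> {..<n}" and B: "B \<subseteq> {..<n}" and dis: "S \<inter> B = {}" for S B
  proof -
    have fB: "finite B" using B finite_subset by auto
    have "finite S" using S finite_subset by auto
    then show ?thesis using S dis
    proof (induction S)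
      case empty then show ?case by simp
    next
      case (insert i S)
      have "meet_elems X \<K> (insert i S) \<inter> normal_join X ((\<lambda>b. meet_elems X \<K> {b}) ` B)
          \<subseteq> meet_elems X \<K> (insert i S) \<inter> (meet_elems X \<K> S \<inter> normal_join X ((\<lambda>b. meet_elems X \<K> {b}) ` B))"
        using meet_elems_anti[of S "insert i S" X \<K>] by auto
      also have "\<dots> \<subseteq> meet_elems X \<K> (insert i S) \<inter> normal_join X ((\<lambda>b. meet_elems X \<K> (insert b S)) ` B)"
        using insert by blast
      also have "\<dots> \<subseteq> normal_join X ((\<lambda>b. meet_elems X \<K> (insert i (insert b S))) ` B)"
        by (rule star[unfolded exact_distributive_def, rule_format]) (use insert B in auto)
      finally show ?case by (simp add: insert_commute)
    qed
  qed
  show ?thesis using I J0 J d0 d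
  proof (induction "\<Sum>i\<in>I. card (J i)" arbitrary: I J J0 rule: less_induct)
    case less
    have fJ: "finite (J i)" if "i \<in> I" for i using less(4)[OF that] finite_subset by auto
    have sub: "\<And>i. i \<in> I \<Longrightarrow> J0 \<union> J i \<subseteq> {..<n}" using less(3,4) by auto
    have Rn: "(\<lambda>i. meet_elems X \<K> (J0 \<union> J i)) ` I \<subseteq> normal_sets X" using mtn sub by auto
    have Rj: "normal_join X ((\<lambda>i. meet_elems X \<K> (J0 \<union> J i)) ` I) \<in> normal_sets X" using normal_join_normal_sets[OF X _ Rn] less(2) by simp
    consider (e) i where "i \<in> I" "J i = {}" | (s) "\<forall>i\<in>I. card (J i) = 1"
      | (b) i where "i \<in> I" "card (J i) \<ge> 2"
    proof -
      have "card (J i) = 1" if "i \<in> I" "J i \<noteq> {}" "\<not> 2 \<le> card (J i)" for i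
      proof -
        have "card (J i) \<noteq> 0" using that fJ by simp
        then show ?thesis using that(3) by linarith
      qed
      then show ?thesis using that by blast
    qed
    then show ?case
    proof cases
      \<comment> \<open>With \<open>J i\<close> empty, the meet over \<open>J0\<close> is itself one
        of the members of the join on the right.\<close>
      case (e i)
      then have "meet_elems X \<K> J0 \<in> (\<lambda>i. meet_elems X \<K> (J0 \<union> J i)) ` I" by (intro image_eqI[of _ _ i]) auto
      from normal_join_upper[OF this, of X] show ?thesis by blast
    next
      case s
      then have "\<forall>i\<in>I. \<exists>b. J i = {b}" by (auto simp: card_1_singleton_iff)
      then obtain h where h: "\<And>i. i \<in> I \<Longrightarrow> J i = {h i}" by metis
      have 1: "(\<lambda>i. meet_elems X \<K> (J i)) ` I = (\<lambda>b. meet_elems X \<K> {b}) ` (h ` I)"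
        unfolding image_image by (rule image_cong) (use h in auto)
      have 2: "(\<lambda>i. meet_elems X \<K> (J0 \<union> J i)) ` I = (\<lambda>b. meet_elems X \<K> (insert b J0)) ` (h ` I)"
        unfolding image_image by (rule image_cong) (use h in auto)
      show ?thesis unfolding 1 2
      proof (rule single[OF less(3)])
        show "h ` I \<subseteq> {..<n}" using less(4) h by fastforce
        show "J0 \<inter> h ` I = {}" using less(5) h by fastforce
      qed
    next
      case (b i)
      then obtain a where a: "a \<in> J i" by fastforce
      define J' where "J' = J i - {a}"
      have J': "J i = insert a J'" "a \<notin> J'" using a by (auto simp: J'_def)
      have cJ': "card J' < card (J i)" using a fJ[OF b(1)] unfolding J'_def by (intro card_Diff1_less)
      have "card J' > 0" using b a fJ[OF b(1)] by (simp add: J'_def)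
      then have c1: "card {a} < card (J i)" using b by simp
      define I' where "I' = I - {i}"
      have I': "I = insert i I'" "i \<notin> I'" "finite I'" using b(1) less(2) by (auto simp: I'_def)
      define W where "W = (\<lambda>i. meet_elems X \<K> (J0 \<union> J i)) ` I'"
      have Wn: "W \<subseteq> normal_sets X" "finite W" using Rn I' by (auto simp: W_def)
      have dec: "(\<Sum>k\<in>I. card ((J(i := S)) k)) < (\<Sum>k\<in>I. card (J k))" if "card S < card (J i)" for S
        by (rule sum_strict_mono_ex1) (use that less(2) b(1) in auto)
      have im: "(\<lambda>k. f ((J(i := S)) k)) ` I = insert (f S) ((\<lambda>k. f (J k)) ` I')" for f :: "nat set \<Rightarrow> 'm set" and S
      proof -
        have "(\<lambda>k. f ((J(i := S)) k)) ` I' = (\<lambda>k. f (J k)) ` I'" by (rule image_cong) (use I' in auto)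
        then show ?thesis unfolding I'(1) image_insert by simp
      qed
      \<comment> \<open>The induction hypothesis for the family in which \<open>J i\<close> is
        replaced by a smaller part \<open>S\<close>. The set playing the role of \<open>J0\<close>
        may change as well, which \<open>R\<close> below requires.\<close>
      have IH: "meet_elems X \<K> S0 \<inter> normal_join X (insert (meet_elems X \<K> S) ((\<lambda>k. meet_elems X \<K> (J k)) ` I'))
          \<subseteq> normal_join X (insert (meet_elems X \<K> (S0 \<union> S)) ((\<lambda>k. meet_elems X \<K> (S0 \<union> J k)) ` I'))"
        if "card S < card (J i)" "S \<subseteq> J i" "S0 \<subseteq> {..<n}" "S0 \<inter> S = {}" "\<And>k. k \<in> I' \<Longrightarrow> S0 \<inter> J k = {}" for S S0
      proof -
        have JS: "(J(i := S)) k \<subseteq> J k" for k using that(2) by auto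
        have "meet_elems X \<K> S0 \<inter> normal_join X ((\<lambda>k. meet_elems X \<K> ((J(i := S)) k)) ` I)
            \<subseteq> normal_join X ((\<lambda>k. meet_elems X \<K> (S0 \<union> (J(i := S)) k)) ` I)"
        proof (rule less(1)[OF dec[OF that(1)] less(2) that(3)])
          show "(J(i := S)) k \<subseteq> {..<n}" if "k \<in> I" for k using JS[of k] less(4)[OF that] by blast
          show "S0 \<inter> (J(i := S)) k = {}" if "k \<in> I" for k
            using that I' \<open>S0 \<inter> S = {}\<close> \<open>\<And>k. k \<in> I' \<Longrightarrow> S0 \<inter> J k = {}\<close> by auto
          show "(J(i := S)) k \<inter> (J(i := S)) l = {}" if "k \<in> I" "l \<in> I" "k \<noteq> l" for k l
            using JS[of k] JS[of l] less(6)[OF that] by blast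
        qed
        then show ?thesis unfolding im[of "\<lambda>S. meet_elems X \<K> S"] im[of "\<lambda>S. meet_elems X \<K> (S0 \<union> S)"] .
      qed
      have Jin: "J i \<subseteq> {..<n}" "J0 \<inter> J i = {}" using less(4,5) b(1) by auto
      define U where "U = (\<lambda>k. meet_elems X \<K> (J k)) ` I'"
      have Un: "U \<subseteq> normal_sets X" "finite U" using mtn less(4) I' by (auto simp: U_def)
      have P: "meet_elems X \<K> J0 \<inter> normal_join X (insert (meet_elems X \<K> J') U) \<subseteq> normal_join X (insert (meet_elems X \<K> (J0 \<union> J')) W)"
        unfolding U_def W_def by (rule IH[OF cJ']) (use J' Jin less(3,5) I' in auto)
      have Q: "meet_elems X \<K> J0 \<inter> normal_join X (insert (meet_elems X \<K> {a}) U) \<subseteq> normal_join X (insert (meet_elems X \<K> (J0 \<union> {a})) W)"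
        unfolding U_def W_def by (rule IH[OF c1]) (use J' Jin less(3,5) I' in auto)
      \<comment> \<open>\<open>P\<close> and \<open>Q\<close> bound the left side by a join
        containing \<open>A\<close> and by \<open>B\<close>, and modularity leaves only
        \<open>A \<inter> B\<close> to be estimated. As \<open>B\<close> lies below the join of
        \<open>{a}\<close> with the remaining \<open>J k\<close>, this is done by \<open>R\<close>,
        the hypothesis with \<open>J0 \<union> J'\<close> in place of \<open>J0\<close>.\<close>
      have R: "meet_elems X \<K> (J0 \<union> J') \<inter> normal_join X (insert (meet_elems X \<K> {a}) U)
          \<subseteq> normal_join X (insert (meet_elems X \<K> ((J0 \<union> J') \<union> {a})) ((\<lambda>k. meet_elems X \<K> ((J0 \<union> J') \<union> J k)) ` I'))"
        unfolding U_def
      proof (rule IH[OF c1])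
        show "(J0 \<union> J') \<inter> J k = {}" if "k \<in> I'" for k
          using less(5)[of k] less(6)[of i k] that I' b(1) J' by auto
      qed (use J' Jin less(3,5) I' in auto)
      have eqU: "(\<lambda>i. meet_elems X \<K> (J i)) ` I = insert (meet_elems X \<K> (J i)) U"
        "(\<lambda>i. meet_elems X \<K> (J0 \<union> J i)) ` I = insert (meet_elems X \<K> (J0 \<union> J i)) W"
        using I' by (auto simp: U_def W_def)
      define A where "A = meet_elems X \<K> (J0 \<union> J')"
      define B where "B = normal_join X (insert (meet_elems X \<K> (J0 \<union> {a})) W)"
      have An: "A \<in> normal_sets X" unfolding A_def using J' Jin less(3) by (intro mtn) auto
      have an: "meet_elems X \<K> {a} \<in> normal_sets X" "meet_elems X \<K> J' \<in> normal_sets X" "meet_elems X \<K> (J0 \<union> {a}) \<in> normal_sets X"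
        using J' Jin less(3) by (auto intro!: mtn)
      have Bn: "B \<in> normal_sets X" unfolding B_def using an Wn by (intro normal_join_normal_sets X) auto
      have WB: "normal_join X W \<subseteq> B" unfolding B_def using an Wn by (intro normal_join_mono X) auto
      have le1: "normal_join X (insert (meet_elems X \<K> (J i)) U) \<subseteq> normal_join X (insert (meet_elems X \<K> J') U)"
        "normal_join X (insert (meet_elems X \<K> (J i)) U) \<subseteq> normal_join X (insert (meet_elems X \<K> {a}) U)"
        using J' an Un meet_elems_anti[of J' "J i" X \<K>] meet_elems_anti[of "{a}" "J i" X \<K>] by (intro normal_join_mono X; auto)+
      have "meet_elems X \<K> J0 \<inter> normal_join X (insert (meet_elems X \<K> (J i)) U) \<subseteq> normal_join X (insert A W) \<inter> B"
        using P Q le1 unfolding A_def B_def by blast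
      also have "\<dots> \<subseteq> normal_join X (insert (A \<inter> B) W)" by (rule normal_join_modular[OF X Wn(2,1) An Bn WB])
      also have "\<dots> \<subseteq> normal_join X (insert (meet_elems X \<K> (J0 \<union> J i)) W)"
      proof (rule normal_join_least)
        show Fn: "normal_join X (insert (meet_elems X \<K> (J0 \<union> J i)) W) \<in> normal_sets X" using Rj eqU by simp
        have "B \<subseteq> normal_join X (insert (meet_elems X \<K> {a}) U)" unfolding B_def
        proof (rule normal_join_mono[OF X])
          fix S assume "S \<in> insert (meet_elems X \<K> (J0 \<union> {a})) W"
          then show "\<exists>T\<in>insert (meet_elems X \<K> {a}) U. S \<subseteq> T"
            using meet_elems_anti[of "{a}" "J0 \<union> {a}" X \<K>] meet_elems_anti[of _ "J0 \<union> _" X \<K>] by (force simp: W_def U_def)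
        qed (use an Un in auto)
        then have "A \<inter> B \<subseteq> normal_join X (insert (meet_elems X \<K> ((J0 \<union> J') \<union> {a})) ((\<lambda>k. meet_elems X \<K> ((J0 \<union> J') \<union> J k)) ` I'))"
          using R unfolding A_def by blast
        also have "\<dots> \<subseteq> normal_join X (insert (meet_elems X \<K> (J0 \<union> J i)) W)"
        proof (rule normal_join_mono[OF X])
          fix S assume "S \<in> insert (meet_elems X \<K> ((J0 \<union> J') \<union> {a})) ((\<lambda>k. meet_elems X \<K> ((J0 \<union> J') \<union> J k)) ` I')"
          then consider "S = meet_elems X \<K> ((J0 \<union> J') \<union> {a})" | k where "k \<in> I'" "S = meet_elems X \<K> ((J0 \<union> J') \<union> J k)" by auto
          then show "\<exists>T\<in>insert (meet_elems X \<K> (J0 \<union> J i)) W. S \<subseteq> T"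
          proof cases
            case 1
            then show ?thesis using J' by auto
          next
            case 2
            then have "S \<subseteq> meet_elems X \<K> (J0 \<union> J k)" by (auto intro!: meet_elems_anti)
            then show ?thesis using 2 by (auto simp: W_def)
          qed
        qed (use Rn eqU Wn in auto)
        finally have AB: "A \<inter> B \<subseteq> normal_join X (insert (meet_elems X \<K> (J0 \<union> J i)) W)" .
        fix S assume "S \<in> insert (A \<inter> B) W"
        then show "S \<subseteq> normal_join X (insert (meet_elems X \<K> (J0 \<union> J i)) W)" using AB normal_join_upper[of S "insert (meet_elems X \<K> (J0 \<union> J i)) W" X] by auto
      qed
      finally show ?thesis unfolding eqU .
    qed
  qed
qed


text \<open>The nontrivial inclusion from left to right is \<open>distributive_extend\<close>; the
  other inclusion holds in any lattice. For the converse, \<open>insert i A\<close> is taken as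
  \<open>J 0\<close> and the members of \<open>B\<close> as singletons.\<close>

lemma distributive_iff:
  assumes X: "X \<in> Obj C" and K: "\<And>j. j < n \<Longrightarrow> \<K> j \<in> normal_sets X"
  shows "exact_distributive X n \<K> \<longleftrightarrow> (\<forall>(k::nat) (J :: nat \<Rightarrow> nat set).
         k \<ge> 1 \<and> (\<forall>i\<le>k. J i \<subseteq> {0..<n}) \<and> (\<forall>i\<le>k. \<forall>j\<le>k. i \<noteq> j \<longrightarrow> J i \<inter> J j = {}) \<longrightarrow>
         meet_elems X \<K> (J 0) \<inter> normal_join X ((\<lambda>i. meet_elems X \<K> (J i)) ` {1..k}) = normal_join X ((\<lambda>i. meet_elems X \<K> (J 0 \<union> J i)) ` {1..k}))"
    (is "_ \<longleftrightarrow> ?R")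
proof
  have mtn: "meet_elems X \<K> S \<in> normal_sets X" if "S \<subseteq> {..<n}" for S
    by (rule meet_elems_normal_sets[OF X]) (use that K finite_subset in auto)
  show ?R if star: "exact_distributive X n \<K>"
  proof (intro allI impI equalityI)
    fix k :: nat and J :: "nat \<Rightarrow> nat set"
    assume "k \<ge> 1 \<and> (\<forall>i\<le>k. J i \<subseteq> {0..<n}) \<and> (\<forall>i\<le>k. \<forall>j\<le>k. i \<noteq> j \<longrightarrow> J i \<inter> J j = {})"
    then have J: "k \<ge> 1" "\<And>i. i \<le> k \<Longrightarrow> J i \<subseteq> {..<n}" and
      d: "\<And>i j. i \<le> k \<Longrightarrow> j \<le> k \<Longrightarrow> i \<noteq> j \<Longrightarrow> J i \<inter> J j = {}" by (auto simp: atLeast0LessThan)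
    show "meet_elems X \<K> (J 0) \<inter> normal_join X ((\<lambda>i. meet_elems X \<K> (J i)) ` {1..k}) \<subseteq> normal_join X ((\<lambda>i. meet_elems X \<K> (J 0 \<union> J i)) ` {1..k})"
      by (rule distributive_extend[OF X K star]) (use J d in auto)
    have N: "meet_elems X \<K> (J i) \<in> normal_sets X" if "i \<le> k" for i using mtn J(2) that by blast
    have N2: "meet_elems X \<K> (J 0) \<inter> normal_join X ((\<lambda>i. meet_elems X \<K> (J i)) ` {1..k}) \<in> normal_sets X"
      by (rule normal_sets_Int[OF N normal_join_normal_sets[OF X]]) (use N in auto)
    show "normal_join X ((\<lambda>i. meet_elems X \<K> (J 0 \<union> J i)) ` {1..k}) \<subseteq> meet_elems X \<K> (J 0) \<inter> normal_join X ((\<lambda>i. meet_elems X \<K> (J i)) ` {1..k})"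
    proof (rule normal_join_least[OF N2])
      fix A assume "A \<in> (\<lambda>i. meet_elems X \<K> (J 0 \<union> J i)) ` {1..k}"
      then obtain i where i: "i \<in> {1..k}" "A = meet_elems X \<K> (J 0) \<inter> meet_elems X \<K> (J i)" by (auto simp: meet_elems_Un)
      then have "meet_elems X \<K> (J i) \<in> (\<lambda>i. meet_elems X \<K> (J i)) ` {1..k}" by blast
      from normal_join_upper[OF this, of X] i(2)
      show "A \<subseteq> meet_elems X \<K> (J 0) \<inter> normal_join X ((\<lambda>i. meet_elems X \<K> (J i)) ` {1..k})" by blast
    qed
  qed
  show "exact_distributive X n \<K>" if R: ?R
    unfolding exact_distributive_def
  proof (intro allI impI)
    fix A B i assume "A \<subseteq> {..<n} \<and> B \<subseteq> {..<n} \<and> i < n \<and> A \<inter> B = {} \<and> i \<notin> A \<union> B"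
    then have h: "A \<subseteq> {..<n}" "B \<subseteq> {..<n}" "i < n" "A \<inter> B = {}" "i \<notin> A \<union> B" by auto
    have fB: "finite B" using h(2) finite_subset by auto
    have Bn: "(\<lambda>b. meet_elems X \<K> {b}) ` B \<subseteq> normal_sets X" using mtn h(2) by auto
    have Bi: "(\<lambda>b. meet_elems X \<K> (insert i (insert b A))) ` B \<subseteq> normal_sets X" using mtn h(1,2,3) by (auto intro!: mtn)
    show "meet_elems X \<K> (insert i A) \<inter> normal_join X ((\<lambda>b. meet_elems X \<K> (insert b A)) ` B)
       \<subseteq> normal_join X ((\<lambda>b. meet_elems X \<K> (insert i (insert b A))) ` B)"
    proof (cases "B = {}")
      \<comment> \<open>The equality is available for \<open>k \<ge> 1\<close> only, so an empty
        \<open>B\<close> is treated apart: both joins are then joins of the empty family.\<close>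
      case True
      then show ?thesis by auto
    next
      case False
      obtain g where g: "bij_betw g {1..card B} B" using ex_bij_betw_nat_finite_1[OF fB] by blast
      have gB: "g ` {1..card B} = B" using g by (simp add: bij_betw_def)
      have ginj: "g k \<noteq> g l" if "k \<in> {1..card B}" "l \<in> {1..card B}" "k \<noteq> l" for k l
        using inj_onD[OF bij_betw_imp_inj_on[OF g] _ that(1,2)] that(3) by blast
      \<comment> \<open>Index 0 is reserved for the outer meet, so \<open>B\<close> is numbered from
        1.\<close>
      define J where "J = (\<lambda>k. if k = 0 then insert i A else {g k})"
      have gin: "g k \<in> B" if "k \<noteq> 0" "k \<le> card B" for k
      proof -
        have "g k \<in> g ` {1..card B}" using that by (intro imageI) simp
        then show ?thesis by (simp only: gB)
      qed
      have "card B \<ge> 1" using False fB by (simp add: Suc_leI card_gt_0_iff)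
      moreover have "\<forall>k\<le>card B. J k \<subseteq> {0..<n}"
      proof (intro allI impI)
        fix k assume k: "k \<le> card B"
        show "J k \<subseteq> {0..<n}"
        proof (cases "k = 0")
          case True
          then show ?thesis using h(1,3) by (auto simp: J_def)
        next
          case False
          from gin[OF this k] h(2) have "g k < n" by auto
          then show ?thesis using False by (simp add: J_def)
        qed
      qed
      moreover have "\<forall>k\<le>card B. \<forall>l\<le>card B. k \<noteq> l \<longrightarrow> J k \<inter> J l = {}"
      proof (intro allI impI)
        fix k l assume kl: "k \<le> card B" "l \<le> card B" "k \<noteq> l"
        consider "k = 0" "l \<noteq> 0" | "k \<noteq> 0" "l = 0" | "k \<noteq> 0" "l \<noteq> 0" using kl by auto
        then show "J k \<inter> J l = {}"
        proof cases
          case 1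
          have "g l \<in> B" using gin[of l] 1 kl(2) by blast
          then show ?thesis using 1 h(4,5) by (auto simp: J_def)
        next
          case 2
          have "g k \<in> B" using gin[of k] 2 kl(1) by blast
          then show ?thesis using 2 h(4,5) by (auto simp: J_def)
        next
          case 3
          have "g k \<noteq> g l" by (rule ginj) (use 3 kl in auto)
          then show ?thesis using 3 by (simp add: J_def)
        qed
      qed
      ultimately have E: "meet_elems X \<K> (J 0) \<inter> normal_join X ((\<lambda>i. meet_elems X \<K> (J i)) ` {1..card B})
          = normal_join X ((\<lambda>i. meet_elems X \<K> (J 0 \<union> J i)) ` {1..card B})" using R by blast
      have 1: "(\<lambda>i. meet_elems X \<K> (J i)) ` {1..card B} = (\<lambda>b. meet_elems X \<K> {b}) ` (g ` {1..card B})"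
        unfolding image_image by (rule image_cong) (auto simp: J_def)
      have 2: "(\<lambda>k. meet_elems X \<K> (J 0 \<union> J k)) ` {1..card B} = (\<lambda>b. meet_elems X \<K> (insert i (insert b A))) ` (g ` {1..card B})"
      proof -
        have "(\<lambda>k. meet_elems X \<K> (J 0 \<union> J k)) ` {1..card B} = (\<lambda>k. meet_elems X \<K> (insert i (insert (g k) A))) ` {1..card B}"
          by (rule image_cong) (auto simp: J_def insert_commute)
        then show ?thesis unfolding image_image .
      qed
      have E': "meet_elems X \<K> (insert i A) \<inter> normal_join X ((\<lambda>b. meet_elems X \<K> {b}) ` B)
          = normal_join X ((\<lambda>b. meet_elems X \<K> (insert i (insert b A))) ` B)"
        using E unfolding 1 2 gB by (simp add: J_def)
      \<comment> \<open>The family \<open>J\<close> yields the singletons \<open>{b}\<close> where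
        exactness has \<open>insert b A\<close>. The latter give smaller meets, so the required
        inclusion is the weaker one.\<close>
      have "normal_join X ((\<lambda>b. meet_elems X \<K> (insert b A)) ` B) \<subseteq> normal_join X ((\<lambda>b. meet_elems X \<K> {b}) ` B)"
      proof (rule normal_join_mono[OF X _ Bn])
        fix S assume "S \<in> (\<lambda>b. meet_elems X \<K> (insert b A)) ` B"
        then obtain b where b: "b \<in> B" "S = meet_elems X \<K> (insert b A)" by blast
        have "meet_elems X \<K> (insert b A) \<subseteq> meet_elems X \<K> {b}" by (rule meet_elems_anti) auto
        then show "\<exists>T\<in>(\<lambda>b. meet_elems X \<K> {b}) ` B. S \<subseteq> T" using b by blast
      qed (use fB in auto)
      then show ?thesis using E' by blast
    qed
  qed
qed

section \<open>Normal subobjects as sets of generalised elements\<close>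

lemma NSub_carrier: "m \<in> carrier (NSub C X) \<longleftrightarrow> Cod C m = X \<and> monic m \<and> sieve m \<in> normal_sets X"
proof
  assume "m \<in> carrier (NSub C X)"
  then obtain f where "Cod C m = X" "is_kernel C m f" by (auto simp: NSub_def Let_def)
  then show "Cod C m = X \<and> monic m \<and> sieve m \<in> normal_sets X"
    using normal_setsI[of f X] unfolding is_kernel_iff by auto
next
  assume A: "Cod C m = X \<and> monic m \<and> sieve m \<in> normal_sets X"
  then obtain f where f: "f \<in> Mor C" "Dom C f = X" "sieve m = kernel_elems f" by (auto simp: normal_sets_def)
  have "is_kernel C m f" using A f by (auto simp: is_kernel_iff)
  then show "m \<in> carrier (NSub C X)" using A by (auto simp: NSub_def Let_def)
qed

lemma NSub_carrier_exists:
  assumes "N \<in> normal_sets X"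
  obtains m where "m \<in> carrier (NSub C X)" "sieve m = N"
proof -
  obtain f where f: "f \<in> Mor C" "Dom C f = X" "N = kernel_elems f" using assms by (auto simp: normal_sets_def)
  obtain D m where "monic m" "m \<in> Hom C D (Dom C f)" "sieve m = kernel_elems f"
    using f(1) by (rule kernel_obtain)
  then show ?thesis using that[of m] f assms by (auto simp: NSub_carrier)
qed

lemma sieve_subset_iff:
  assumes "m \<in> Mor C" "m' \<in> Mor C" "Cod C m = Cod C m'"
  shows "sieve m \<subseteq> sieve m' \<longleftrightarrow> m \<in> sieve m'"
proof
  show "m \<in> sieve m'" if "sieve m \<subseteq> sieve m'" using that sieve_self assms by blast
  show "sieve m \<subseteq> sieve m'" if "m \<in> sieve m'"
  proof
    fix t assume "t \<in> sieve m"
    then obtain u where u: "u \<in> Hom C (Dom C t) (Dom C m)" "m \<cdot> u = t" by (rule sieveE)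
    have "m \<cdot> u \<in> sieve m'" by (rule sieve_comp[OF that]) (use u assms in simp_all)
    then show "t \<in> sieve m'" using u(2) by simp
  qed
qed

lemma NSub_le:
  assumes "m \<in> carrier (NSub C X)" "m' \<in> carrier (NSub C X)"
  shows "m \<sqsubseteq>\<^bsub>NSub C X\<^esub> m' \<longleftrightarrow> sieve m \<subseteq> sieve m'"
proof -
  have mm: "m \<in> Mor C" "m' \<in> Mor C" "Cod C m = Cod C m'" using assms by (auto simp: NSub_carrier)
  have "m \<sqsubseteq>\<^bsub>NSub C X\<^esub> m' \<longleftrightarrow> (\<exists>u \<in> Hom C (Dom C m) (Dom C m'). m' \<cdot> u = m)"
    by (simp add: NSub_def Let_def)
  also have "\<dots> \<longleftrightarrow> m \<in> sieve m'" using mm by (auto simp: sieve_def)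
  finally show ?thesis using sieve_subset_iff[OF mm] by simp
qed

lemma NSub_eq:
  assumes "m \<in> carrier (NSub C X)" "m' \<in> carrier (NSub C X)"
  shows "m .=\<^bsub>NSub C X\<^esub> m' \<longleftrightarrow> sieve m = sieve m'"
proof -
  have "m .=\<^bsub>NSub C X\<^esub> m' \<longleftrightarrow> m \<sqsubseteq>\<^bsub>NSub C X\<^esub> m' \<and> m' \<sqsubseteq>\<^bsub>NSub C X\<^esub> m"
    by (simp add: NSub_def Let_def)
  then show ?thesis using NSub_le assms by auto
qed

text \<open>Greatest lower bounds are unique only up to \<open>.=\<close>. All of them have the same
  sieve, which identifies them independently of the choice of a representative.\<close>

lemma NSub_greatest:
  assumes A: "A \<subseteq> carrier (NSub C X)" and N: "{t \<in> elems X. \<forall>a\<in>A. t \<in> sieve a} \<in> normal_sets X"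
  shows "greatest (NSub C X) g (Lower (NSub C X) A) \<longleftrightarrow>
    g \<in> carrier (NSub C X) \<and> sieve g = {t \<in> elems X. \<forall>a\<in>A. t \<in> sieve a}"
proof -
  define M where "M = {t \<in> elems X. \<forall>a\<in>A. t \<in> sieve a}"
  have low: "l \<in> Lower (NSub C X) A \<longleftrightarrow> l \<in> carrier (NSub C X) \<and> sieve l \<subseteq> M" for l
  proof -
    have st: "sieve l \<subseteq> elems X" if "l \<in> carrier (NSub C X)"
      using that by (auto simp: NSub_carrier elems_def sieve_def)
    have "l \<in> Lower (NSub C X) A \<longleftrightarrow> l \<in> carrier (NSub C X) \<and> (\<forall>a\<in>A. l \<sqsubseteq>\<^bsub>NSub C X\<^esub> a)"
      using A unfolding Lower_def by auto
    also have "\<dots> \<longleftrightarrow> l \<in> carrier (NSub C X) \<and> (\<forall>a\<in>A. sieve l \<subseteq> sieve a)"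
      using A NSub_le by (meson subsetD)
    also have "\<dots> \<longleftrightarrow> l \<in> carrier (NSub C X) \<and> sieve l \<subseteq> M"
      using st unfolding M_def by blast
    finally show ?thesis .
  qed
  obtain m where m: "m \<in> carrier (NSub C X)" "sieve m = M"
    using N unfolding M_def[symmetric] by (rule NSub_carrier_exists)
  have "greatest (NSub C X) g (Lower (NSub C X) A) \<longleftrightarrow> g \<in> carrier (NSub C X) \<and> sieve g = M"
  proof
    assume g: "greatest (NSub C X) g (Lower (NSub C X) A)"
    then have gl: "g \<in> carrier (NSub C X)" "sieve g \<subseteq> M" unfolding greatest_def low by auto
    have "m \<in> Lower (NSub C X) A" using m low by auto
    then have "m \<sqsubseteq>\<^bsub>NSub C X\<^esub> g" using g unfolding greatest_def by blast
    then have "M \<subseteq> sieve g" using NSub_le[OF m(1) gl(1)] m(2) by simp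
    then show "g \<in> carrier (NSub C X) \<and> sieve g = M" using gl by auto
  next
    assume g: "g \<in> carrier (NSub C X) \<and> sieve g = M"
    have "x \<sqsubseteq>\<^bsub>NSub C X\<^esub> g" if "x \<in> Lower (NSub C X) A" for x
      using that low[of x] g NSub_le[of x X g] by auto
    then show "greatest (NSub C X) g (Lower (NSub C X) A)"
      using g low unfolding greatest_def by (auto simp: Lower_def)
  qed
  then show ?thesis unfolding M_def .
qed

lemma NSub_least:
  assumes X: "X \<in> Obj C" and A: "A \<subseteq> carrier (NSub C X)" "finite A"
  shows "least (NSub C X) s (Upper (NSub C X) A) \<longleftrightarrow>
    s \<in> carrier (NSub C X) \<and> sieve s = normal_join X (sieve ` A)"
proof -
  define M where "M = normal_join X (sieve ` A)"
  have N: "M \<in> normal_sets X" unfolding M_def by (rule normal_join_normal_sets[OF X]) (use A in \<open>auto simp: NSub_carrier\<close>)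
  have upper: "l \<in> Upper (NSub C X) A \<longleftrightarrow> l \<in> carrier (NSub C X) \<and> M \<subseteq> sieve l" for l
  proof -
    have "l \<in> Upper (NSub C X) A \<longleftrightarrow> l \<in> carrier (NSub C X) \<and> (\<forall>a\<in>A. a \<sqsubseteq>\<^bsub>NSub C X\<^esub> l)"
      using A unfolding Upper_def by auto
    also have "\<dots> \<longleftrightarrow> l \<in> carrier (NSub C X) \<and> (\<forall>a\<in>A. sieve a \<subseteq> sieve l)"
      using A NSub_le by (meson subsetD)
    also have "\<dots> \<longleftrightarrow> l \<in> carrier (NSub C X) \<and> M \<subseteq> sieve l"
    proof -
      have "(\<forall>a\<in>A. sieve a \<subseteq> sieve l) \<longleftrightarrow> M \<subseteq> sieve l" if "l \<in> carrier (NSub C X)"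
      proof
        show "M \<subseteq> sieve l" if "\<forall>a\<in>A. sieve a \<subseteq> sieve l"
          unfolding M_def by (rule normal_join_least) (use that \<open>l \<in> carrier (NSub C X)\<close> in \<open>auto simp: NSub_carrier\<close>)
        show "\<forall>a\<in>A. sieve a \<subseteq> sieve l" if "M \<subseteq> sieve l"
        proof
          fix a assume "a \<in> A"
          then have "sieve a \<in> sieve ` A" by blast
          from normal_join_upper[OF this, of X] that show "sieve a \<subseteq> sieve l" unfolding M_def by blast
        qed
      qed
      then show ?thesis by blast
    qed
    finally show ?thesis .
  qed
  obtain m where m: "m \<in> carrier (NSub C X)" "sieve m = M" using N by (rule NSub_carrier_exists)
  have "least (NSub C X) s (Upper (NSub C X) A) \<longleftrightarrow> s \<in> carrier (NSub C X) \<and> sieve s = M"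
  proof
    assume s: "least (NSub C X) s (Upper (NSub C X) A)"
    then have sl: "s \<in> carrier (NSub C X)" "M \<subseteq> sieve s" unfolding least_def upper by auto
    have "m \<in> Upper (NSub C X) A" using m upper by auto
    then have "s \<sqsubseteq>\<^bsub>NSub C X\<^esub> m" using s unfolding least_def by blast
    then have "sieve s \<subseteq> M" using NSub_le[OF sl(1) m(1)] m(2) by simp
    then show "s \<in> carrier (NSub C X) \<and> sieve s = M" using sl by auto
  next
    assume s: "s \<in> carrier (NSub C X) \<and> sieve s = M"
    have "s \<sqsubseteq>\<^bsub>NSub C X\<^esub> x" if "x \<in> Upper (NSub C X) A" for x
      using that upper[of x] s NSub_le[of s X x] by auto
    then show "least (NSub C X) s (Upper (NSub C X) A)"
      using s upper unfolding least_def by (auto simp: Upper_def)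
  qed
  then show ?thesis unfolding M_def .
qed

text \<open>The meet of the lattice is a choice among greatest lower bounds, so it suffices that one
  exists: a representative of the intersection of the sieves.\<close>

lemma NSub_inf:
  assumes A: "A \<subseteq> carrier (NSub C X)" and N: "{t \<in> elems X. \<forall>a\<in>A. t \<in> sieve a} \<in> normal_sets X"
  shows "\<Sqinter>\<^bsub>NSub C X\<^esub> A \<in> carrier (NSub C X)" "sieve (\<Sqinter>\<^bsub>NSub C X\<^esub> A) = {t \<in> elems X. \<forall>a\<in>A. t \<in> sieve a}"
proof -
  obtain m where "m \<in> carrier (NSub C X)" "sieve m = {t \<in> elems X. \<forall>a\<in>A. t \<in> sieve a}"
    using N by (rule NSub_carrier_exists)
  then have "\<exists>m. greatest (NSub C X) m (Lower (NSub C X) A)" using NSub_greatest[OF A N] by blast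
  then have "greatest (NSub C X) (\<Sqinter>\<^bsub>NSub C X\<^esub> A) (Lower (NSub C X) A)" unfolding inf_def by (rule someI_ex)
  then show "\<Sqinter>\<^bsub>NSub C X\<^esub> A \<in> carrier (NSub C X)" "sieve (\<Sqinter>\<^bsub>NSub C X\<^esub> A) = {t \<in> elems X. \<forall>a\<in>A. t \<in> sieve a}"
    using NSub_greatest[OF A N] by blast+
qed

lemma NSub_sup:
  assumes X: "X \<in> Obj C" and A: "A \<subseteq> carrier (NSub C X)" "finite A"
  shows "\<Squnion>\<^bsub>NSub C X\<^esub> A \<in> carrier (NSub C X)" "sieve (\<Squnion>\<^bsub>NSub C X\<^esub> A) = normal_join X (sieve ` A)"
proof -
  have N: "normal_join X (sieve ` A) \<in> normal_sets X" by (rule normal_join_normal_sets[OF X]) (use A in \<open>auto simp: NSub_carrier\<close>)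
  obtain m where "m \<in> carrier (NSub C X)" "sieve m = normal_join X (sieve ` A)"
    using N by (rule NSub_carrier_exists)
  then have "\<exists>m. least (NSub C X) m (Upper (NSub C X) A)" using NSub_least[OF X A] by blast
  then have "least (NSub C X) (\<Squnion>\<^bsub>NSub C X\<^esub> A) (Upper (NSub C X) A)" unfolding sup_def by (rule someI_ex)
  then show "\<Squnion>\<^bsub>NSub C X\<^esub> A \<in> carrier (NSub C X)" "sieve (\<Squnion>\<^bsub>NSub C X\<^esub> A) = normal_join X (sieve ` A)"
    using NSub_least[OF X A] by blast+
qed

text \<open>On sieves, meets are intersections, joins are \<open>normal_join\<close>, and
  \<open>.=\<close> becomes equality. Only index sets inside \<open>{0..<n}\<close> occur, where the
  \<open>K j\<close> are known to be normal.\<close>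

lemma NSub_distributive_iff:
  fixes X K n
  defines "L \<equiv> NSub C X"
  assumes X: "X \<in> Obj C" and K: "\<And>i. i < n \<Longrightarrow> K i \<in> carrier L"
  shows "(\<forall>(k::nat) (J :: nat \<Rightarrow> nat set).
         k \<ge> 1 \<and> (\<forall>i\<le>k. J i \<subseteq> {0..<n}) \<and> (\<forall>i\<le>k. \<forall>j\<le>k. i \<noteq> j \<longrightarrow> J i \<inter> J j = {}) \<longrightarrow>
         (IINF\<^bsub>L\<^esub> j:J 0. K j) \<sqinter>\<^bsub>L\<^esub> (SSUP\<^bsub>L\<^esub> i:{1..k}. (IINF\<^bsub>L\<^esub> j:J i. K j))
           .=\<^bsub>L\<^esub> (SSUP\<^bsub>L\<^esub> i:{1..k}. (IINF\<^bsub>L\<^esub> j:J 0 \<union> J i. K j))) \<longleftrightarrow>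
     exact_distributive X n (\<lambda>j. sieve (K j))"
proof -
  let ?K = "\<lambda>j. sieve (K j)"
  have Kn: "?K j \<in> normal_sets X" if "j < n" for j using K[OF that] by (simp add: NSub_carrier L_def)
  have mtn: "meet_elems X ?K S \<in> normal_sets X" if "S \<subseteq> {0..<n}" for S
    by (rule meet_elems_normal_sets[OF X]) (use that Kn finite_subset in auto)
  have I: "(IINF\<^bsub>L\<^esub> j:S. K j) \<in> carrier L \<and> sieve (IINF\<^bsub>L\<^esub> j:S. K j) = meet_elems X ?K S" if "S \<subseteq> {0..<n}" for S
  proof -
    have e: "{t \<in> elems X. \<forall>a\<in>K ` S. t \<in> sieve a} = meet_elems X ?K S" by (auto simp: meet_elems_def)
    have "K ` S \<subseteq> carrier (NSub C X)" using K that by (auto simp: L_def)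
    from NSub_inf[OF this] show ?thesis unfolding e infi_def L_def using mtn[OF that] by blast
  qed
  have S: "(SSUP\<^bsub>L\<^esub> i:{1..k}. (IINF\<^bsub>L\<^esub> j:F i. K j)) \<in> carrier L \<and>
      sieve (SSUP\<^bsub>L\<^esub> i:{1..k}. (IINF\<^bsub>L\<^esub> j:F i. K j)) = normal_join X ((\<lambda>i. meet_elems X ?K (F i)) ` {1..k})"
    if F: "\<forall>i\<in>{1..k}. F i \<subseteq> {0..<n}" for k :: nat and F
  proof -
    define A where "A = (\<lambda>i. IINF\<^bsub>L\<^esub> j:F i. K j) ` {1..k}"
    have A: "A \<subseteq> carrier (NSub C X)" "finite A" using I F unfolding A_def L_def by auto
    have e: "sieve ` A = (\<lambda>i. meet_elems X ?K (F i)) ` {1..k}" unfolding A_def image_image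
      by (rule image_cong) (use I F in auto)
    show ?thesis unfolding supr_def A_def[symmetric] e[symmetric] unfolding L_def using NSub_sup[OF X A] by blast
  qed
  have M: "x \<sqinter>\<^bsub>L\<^esub> y \<in> carrier L \<and> sieve (x \<sqinter>\<^bsub>L\<^esub> y) = sieve x \<inter> sieve y"
    if "x \<in> carrier L" "y \<in> carrier L" for x y
  proof -
    have e: "{t \<in> elems X. \<forall>a\<in>{x, y}. t \<in> sieve a} = sieve x \<inter> sieve y"
      using that by (auto simp: L_def NSub_carrier elems_def sieve_def)
    have n: "sieve x \<inter> sieve y \<in> normal_sets X" using that by (intro normal_sets_Int) (auto simp: L_def NSub_carrier)
    have "{x, y} \<subseteq> carrier (NSub C X)" using that by (auto simp: L_def)
    from NSub_inf[OF this] show ?thesis unfolding e meet_def L_def using n by blast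
  qed
  have D: "exact_distributive X n ?K \<longleftrightarrow> (\<forall>(k::nat) (J :: nat \<Rightarrow> nat set).
         k \<ge> 1 \<and> (\<forall>i\<le>k. J i \<subseteq> {0..<n}) \<and> (\<forall>i\<le>k. \<forall>j\<le>k. i \<noteq> j \<longrightarrow> J i \<inter> J j = {}) \<longrightarrow>
         meet_elems X ?K (J 0) \<inter> normal_join X ((\<lambda>i. meet_elems X ?K (J i)) ` {1..k}) = normal_join X ((\<lambda>i. meet_elems X ?K (J 0 \<union> J i)) ` {1..k}))"
    by (rule distributive_iff[OF X]) (rule Kn)
  show ?thesis unfolding D
  proof (rule all_cong1, rule all_cong1, rule imp_cong[OF refl])
    fix k :: nat and J :: "nat \<Rightarrow> nat set"
    assume h: "k \<ge> 1 \<and> (\<forall>i\<le>k. J i \<subseteq> {0..<n}) \<and> (\<forall>i\<le>k. \<forall>j\<le>k. i \<noteq> j \<longrightarrow> J i \<inter> J j = {})"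
    have 0: "J 0 \<subseteq> {0..<n}" using h by auto
    have 1: "\<forall>i\<in>{1..k}. J i \<subseteq> {0..<n}" "\<forall>i\<in>{1..k}. J 0 \<union> J i \<subseteq> {0..<n}" using h by auto
    note a = I[OF 0] and b = S[OF 1(1)] and c = S[OF 1(2)]
    note d = M[OF a[THEN conjunct1] b[THEN conjunct1]]
    show "((IINF\<^bsub>L\<^esub> j:J 0. K j) \<sqinter>\<^bsub>L\<^esub> (SSUP\<^bsub>L\<^esub> i:{1..k}. (IINF\<^bsub>L\<^esub> j:J i. K j))
           .=\<^bsub>L\<^esub> (SSUP\<^bsub>L\<^esub> i:{1..k}. (IINF\<^bsub>L\<^esub> j:J 0 \<union> J i. K j)))
      = (meet_elems X ?K (J 0) \<inter> normal_join X ((\<lambda>i. meet_elems X ?K (J i)) ` {1..k}) = normal_join X ((\<lambda>i. meet_elems X ?K (J 0 \<union> J i)) ` {1..k}))"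
      using NSub_eq[OF d[THEN conjunct1, unfolded L_def] c[THEN conjunct1, unfolded L_def]] a b c d
      unfolding L_def by simp
  qed
qed

end


section \<open>Exactness of the sequence of quotients\<close>

context semi_abelian_category
begin

text \<open>A cokernel is a coequalizer with the zero morphism.\<close>

lemma cokernel_regepi:
  assumes "is_cokernel C q f" shows "regepi q"
proof -
  have b: "q \<in> Mor C" "f \<in> Mor C" "Dom C q = Cod C f" "is_zero_mor C (q \<cdot> f)"
    and all: "\<forall>t\<in>Mor C. Dom C t = Cod C f \<and> is_zero_mor C (t \<cdot> f) \<longrightarrow>
       (\<exists>!u. u \<in> Hom C (Cod C q) (Cod C t) \<and> u \<cdot> q = t)"
    using assms unfolding is_cokernel_def by blast+
  have "is_coequalizer C q f (zero_mor (Dom C f) (Cod C f))" unfolding is_coequalizer_def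
  proof (intro conjI ballI impI)
    show "q \<cdot> f = q \<cdot> zero_mor (Dom C f) (Cod C f)" using b by (simp add: is_zero_mor_iff)
    fix t assume t: "t \<in> Mor C" "Dom C t = Cod C f \<and> t \<cdot> f = t \<cdot> zero_mor (Dom C f) (Cod C f)"
    show "\<exists>!u. u \<in> Hom C (Cod C q) (Cod C t) \<and> u \<cdot> q = t"
      by (rule all[rule_format]) (use t b in \<open>simp_all add: is_zero_mor_iff\<close>)
  qed (use b in auto)
  then show ?thesis unfolding is_regular_epi_def by blast
qed

text \<open>By \<open>regepi_factor\<close>, a morphism factors through \<open>q\<close> once it
  kills the kernel of \<open>q\<close>, so the universal property reduces to a comparison of
  kernels.\<close>

lemma cokernelI:
  assumes q: "regepi q" and f: "f \<in> Mor C" "Cod C f = Dom C q" "q \<cdot> f = zero_mor (Dom C f) (Cod C q)"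
    and sub: "\<And>g. g \<in> Mor C \<Longrightarrow> Dom C g = Dom C q \<Longrightarrow> g \<cdot> f = zero_mor (Dom C f) (Cod C g) \<Longrightarrow> kernel_elems q \<subseteq> kernel_elems g"
  shows "is_cokernel C q f"
  unfolding is_cokernel_def
proof (intro conjI ballI impI)
  show "is_zero_mor C (q \<cdot> f)" using q f by (simp add: is_zero_mor_iff)
  fix t assume t: "t \<in> Mor C" "Dom C t = Cod C f \<and> is_zero_mor C (t \<cdot> f)"
  have z: "t \<cdot> f = zero_mor (Dom C (t \<cdot> f)) (Cod C (t \<cdot> f))" using t(2) unfolding is_zero_mor_iff by blast
  have d: "Dom C (t \<cdot> f) = Dom C f" "Cod C (t \<cdot> f) = Cod C t" using t f by simp_all
  have tf: "t \<cdot> f = zero_mor (Dom C f) (Cod C t)" using z by (simp only: d)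
  obtain u where u: "u \<in> Hom C (Cod C q) (Cod C t)" "u \<cdot> q = t"
    by (rule regepi_factor[OF q, of t "Cod C t"]) (use t f sub[OF t(1) _ tf] in auto)
  show "\<exists>!u. u \<in> Hom C (Cod C q) (Cod C t) \<and> u \<cdot> q = t"
  proof (rule ex1I[of _ u])
    fix v assume v: "v \<in> Hom C (Cod C q) (Cod C t) \<and> v \<cdot> q = t"
    then have "v \<cdot> q = u \<cdot> q" using u by simp
    then show "v = u" by (rule epicD[OF _ regepi_epic[OF q]]) (use u v in auto)
  qed (use u in auto)
qed (use q f in auto)

text \<open>Since a regular epimorphism is the cokernel of its kernel, only the kernel half of
  exactness has to be checked.\<close>

lemma short_exact_iff:
  "is_short_exact C k q \<longleftrightarrow> regepi q \<and> monic k \<and> Cod C k = Dom C q \<and> sieve k = kernel_elems q"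
proof
  assume "is_short_exact C k q"
  then show "regepi q \<and> monic k \<and> Cod C k = Dom C q \<and> sieve k = kernel_elems q"
    using cokernel_regepi unfolding is_short_exact_def is_kernel_iff by blast
next
  assume A: "regepi q \<and> monic k \<and> Cod C k = Dom C q \<and> sieve k = kernel_elems q"
  then have "k \<in> kernel_elems q" using sieve_self[of k] by auto
  then have qk: "q \<cdot> k = zero_mor (Dom C k) (Cod C q)" by (rule kernel_elemsE)
  have "is_cokernel C q k"
  proof (rule cokernelI)
    fix g assume g: "g \<in> Mor C" "Dom C g = Dom C q" "g \<cdot> k = zero_mor (Dom C k) (Cod C g)"
    have kg: "k \<in> kernel_elems g" by (rule kernel_elemsI) (use A g in auto)
    show "kernel_elems q \<subseteq> kernel_elems g"
    proof
      fix t assume "t \<in> kernel_elems q"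
      then have "t \<in> sieve k" using A by simp
      then obtain u where u: "u \<in> Hom C (Dom C t) (Dom C k)" "k \<cdot> u = t" by (rule sieveE)
      have "k \<cdot> u \<in> kernel_elems g" by (rule kernel_elems_comp[OF kg]) (use u g in simp_all)
      then show "t \<in> kernel_elems g" using u(2) by simp
    qed
  qed (use A qk in auto)
  then show "is_short_exact C k q" using A unfolding is_short_exact_def is_kernel_iff by auto
qed

text \<open>Unfolds the opposite of the poset category: the pair \<open>(\<sigma>, \<tau>)\<close>
  with \<open>\<sigma> \<le> \<tau>\<close> is a morphism from \<tau> to \<sigma> there.\<close>

lemma n_sequence_iff:
  "is_n_sequence C n E \<longleftrightarrow>
     (\<forall>\<sigma>\<in>three_objs n. FObj E \<sigma> \<in> Obj C) \<and>
     (\<forall>\<sigma>\<in>three_objs n. \<forall>\<tau>\<in>three_objs n. \<sigma> \<le> \<tau> \<longrightarrow> FMor E (\<sigma>, \<tau>) \<in> Hom C (FObj E \<tau>) (FObj E \<sigma>)) \<and>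
     (\<forall>\<sigma>\<in>three_objs n. FMor E (\<sigma>, \<sigma>) = Ident C (FObj E \<sigma>)) \<and>
     (\<forall>\<rho>\<in>three_objs n. \<forall>\<sigma>\<in>three_objs n. \<forall>\<tau>\<in>three_objs n. \<rho> \<le> \<sigma> \<and> \<sigma> \<le> \<tau> \<longrightarrow>
        FMor E (\<rho>, \<tau>) = FMor E (\<rho>, \<sigma>) \<cdot> FMor E (\<sigma>, \<tau>))" (is "?L \<longleftrightarrow> ?R")
proof -
  have A: "Obj (op_cat (three_pow n)) = three_objs n"
    "Mor (op_cat (three_pow n)) = {(a, b). a \<in> three_objs n \<and> b \<in> three_objs n \<and> a \<le> b}"
    "Dom (op_cat (three_pow n)) = snd" "Cod (op_cat (three_pow n)) = fst"
    "Ident (op_cat (three_pow n)) = (\<lambda>a. (a, a))"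
    "Comp (op_cat (three_pow n)) = (\<lambda>g f. (fst g, snd f))"
    by (simp_all add: op_cat_def three_pow_def poset_cat_def)
  show ?thesis
  proof
    assume ?L
    then have F: "\<forall>a\<in>three_objs n. FObj E a \<in> Obj C"
      "\<forall>f\<in>{(a, b). a \<in> three_objs n \<and> b \<in> three_objs n \<and> a \<le> b}. FMor E f \<in> Hom C (FObj E (snd f)) (FObj E (fst f))"
      "\<forall>a\<in>three_objs n. FMor E (a, a) = Ident C (FObj E a)"
      "\<forall>f\<in>{(a, b). a \<in> three_objs n \<and> b \<in> three_objs n \<and> a \<le> b}.
         \<forall>g\<in>{(a, b). a \<in> three_objs n \<and> b \<in> three_objs n \<and> a \<le> b}.
         fst f = snd g \<longrightarrow> FMor E (fst g, snd f) = FMor E g \<cdot> FMor E f"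
      unfolding is_n_sequence_def is_functor_def A by blast+
    show ?R
    proof (intro conjI ballI impI)
      fix \<sigma> assume "\<sigma> \<in> three_objs n"
      then show "FObj E \<sigma> \<in> Obj C" "FMor E (\<sigma>, \<sigma>) = Ident C (FObj E \<sigma>)" using F by blast+
      fix \<tau> assume "\<tau> \<in> three_objs n" "\<sigma> \<le> \<tau>"
      then show "FMor E (\<sigma>, \<tau>) \<in> Hom C (FObj E \<tau>) (FObj E \<sigma>)"
        using F(2)[rule_format, of "(\<sigma>, \<tau>)"] \<open>\<sigma> \<in> three_objs n\<close> by simp
    next
      fix \<rho> \<sigma> \<tau> assume "\<rho> \<in> three_objs n" "\<sigma> \<in> three_objs n" "\<tau> \<in> three_objs n" "\<rho> \<le> \<sigma> \<and> \<sigma> \<le> \<tau>"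
      then show "FMor E (\<rho>, \<tau>) = FMor E (\<rho>, \<sigma>) \<cdot> FMor E (\<sigma>, \<tau>)"
        using F(4)[rule_format, of "(\<sigma>, \<tau>)" "(\<rho>, \<sigma>)"] by simp
    qed
  next
    assume R: ?R
    show ?L unfolding is_n_sequence_def is_functor_def A
    proof (intro conjI ballI impI)
      fix a assume "a \<in> three_objs n"
      then show "FObj E a \<in> Obj C" "FMor E (a, a) = Ident C (FObj E a)"
        using R[THEN conjunct1] R[THEN conjunct2, THEN conjunct2, THEN conjunct1] by blast+
    next
      fix f assume f: "f \<in> {(a, b). a \<in> three_objs n \<and> b \<in> three_objs n \<and> a \<le> b}"
      then obtain a b where ab: "f = (a, b)" "a \<in> three_objs n" "b \<in> three_objs n" "a \<le> b" by blast
      have "FMor E (a, b) \<in> Hom C (FObj E b) (FObj E a)" using R ab by blast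
      then show "FMor E f \<in> Hom C (FObj E (snd f)) (FObj E (fst f))" using ab(1) by simp
      fix g assume g: "g \<in> {(a, b). a \<in> three_objs n \<and> b \<in> three_objs n \<and> a \<le> b}" "fst f = snd g"
      then obtain c where c: "g = (c, a)" "c \<in> three_objs n" "c \<le> a" using ab(1) by auto
      have "FMor E (c, b) = FMor E (c, a) \<cdot> FMor E (a, b)"
        by (rule R[THEN conjunct2, THEN conjunct2, THEN conjunct2, rule_format]) (use ab c in simp_all)
      then show "FMor E (fst g, snd f) = FMor E g \<cdot> FMor E f" using ab(1) c(1) by simp
    qed
  qed
qed

lemma n_sequenceD:
  assumes "is_n_sequence C n E"
  shows "\<sigma> \<in> three_objs n \<Longrightarrow> \<tau> \<in> three_objs n \<Longrightarrow> \<sigma> \<le> \<tau> \<Longrightarrow>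
      FMor E (\<sigma>, \<tau>) \<in> Hom C (FObj E \<tau>) (FObj E \<sigma>)"
    and "\<sigma> \<in> three_objs n \<Longrightarrow> FObj E \<sigma> \<in> Obj C"
    and "\<sigma> \<in> three_objs n \<Longrightarrow> FMor E (\<sigma>, \<sigma>) = Ident C (FObj E \<sigma>)"
    and "\<rho> \<in> three_objs n \<Longrightarrow> \<sigma> \<in> three_objs n \<Longrightarrow> \<tau> \<in> three_objs n \<Longrightarrow> \<rho> \<le> \<sigma> \<Longrightarrow> \<sigma> \<le> \<tau> \<Longrightarrow>
      FMor E (\<rho>, \<sigma>) \<cdot> FMor E (\<sigma>, \<tau>) = FMor E (\<rho>, \<tau>)"
proof -
  note A = assms[unfolded n_sequence_iff]
  show "FMor E (\<sigma>, \<tau>) \<in> Hom C (FObj E \<tau>) (FObj E \<sigma>)"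
    if "\<sigma> \<in> three_objs n" "\<tau> \<in> three_objs n" "\<sigma> \<le> \<tau>"
    using A[THEN conjunct2, THEN conjunct1] that by blast
  show "FObj E \<sigma> \<in> Obj C" if "\<sigma> \<in> three_objs n" using A[THEN conjunct1] that by blast
  show "FMor E (\<sigma>, \<sigma>) = Ident C (FObj E \<sigma>)" if "\<sigma> \<in> three_objs n"
    using A[THEN conjunct2, THEN conjunct2, THEN conjunct1] that by blast
  show "FMor E (\<rho>, \<sigma>) \<cdot> FMor E (\<sigma>, \<tau>) = FMor E (\<rho>, \<tau>)"
    if t: "\<rho> \<in> three_objs n" "\<sigma> \<in> three_objs n" "\<tau> \<in> three_objs n" "\<rho> \<le> \<sigma>" "\<sigma> \<le> \<tau>"
  proof -
    have "FMor E (\<rho>, \<tau>) = FMor E (\<rho>, \<sigma>) \<cdot> FMor E (\<sigma>, \<tau>)"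
      by (rule A[THEN conjunct2, THEN conjunct2, THEN conjunct2, rule_format]) (use t in simp_all)
    then show ?thesis by simp
  qed
qed

section \<open>Coordinates of \<open>3\<^sup>n\<close> and the quotients attached to its
  objects\<close>

lemma three_objs_upd: "\<sigma> \<in> three_objs n \<Longrightarrow> i < n \<Longrightarrow> a \<le> 2 \<Longrightarrow> \<sigma>(i := a) \<in> three_objs n"
  by (auto simp: three_objs_def)

lemma upd_le: "a \<le> b \<Longrightarrow> (\<sigma>::nat \<Rightarrow> nat)(i := a) \<le> \<sigma>(i := b)"
  by (simp add: le_fun_def)

definition twos :: "nat \<Rightarrow> (nat \<Rightarrow> nat) \<Rightarrow> nat set" where
  "twos n \<sigma> = {i. i < n \<and> \<sigma> i = 2}"

definition zeros :: "nat \<Rightarrow> (nat \<Rightarrow> nat) \<Rightarrow> nat set" where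
  "zeros n \<sigma> = {i. i < n \<and> \<sigma> i = 0}"

lemma finite_twos [simp]: "finite (twos n \<sigma>)"
  by (simp add: twos_def)

lemma finite_zeros [simp]: "finite (zeros n \<sigma>)"
  by (simp add: zeros_def)

text \<open>In a \<open>3\<^sup>n\<close>-diagram, \<open>E \<sigma>\<close> is the quotient of the meet over \<open>twos n \<sigma>\<close> by \<open>denominator\<close>.\<close>

definition denominator :: "'o \<Rightarrow> nat \<Rightarrow> (nat \<Rightarrow> 'm set) \<Rightarrow> (nat \<Rightarrow> nat) \<Rightarrow> 'm set" where
  "denominator X n \<K> \<sigma> = normal_join X ((\<lambda>b. meet_elems X \<K> (insert b (twos n \<sigma>))) ` zeros n \<sigma>)"

text \<open>The kernel of \<open>e\<close> is described after composition with \<open>k\<close>,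
  because \<open>denominator\<close> consists of elements of \<open>X\<close> whereas
  \<open>e\<close> starts at the domain of \<open>k\<close>.\<close>

definition resolves_at ::
    "'o \<Rightarrow> nat \<Rightarrow> (nat \<Rightarrow> 'm set) \<Rightarrow> (nat \<Rightarrow> nat) \<Rightarrow> 'm \<Rightarrow> 'm \<Rightarrow> bool" where
  "resolves_at X n \<K> \<sigma> k e \<longleftrightarrow> monic k \<and> Cod C k = X \<and> sieve k = meet_elems X \<K> (twos n \<sigma>) \<and>
     regepi e \<and> Dom C e = Dom C k \<and>
     kernel_elems e = {t \<in> Mor C. Cod C t = Dom C k \<and> k \<cdot> t \<in> denominator X n \<K> \<sigma>}"

lemma resolves_atD:
  assumes "resolves_at X n \<K> \<sigma> k e"
  shows "monic k" "Cod C k = X" "sieve k = meet_elems X \<K> (twos n \<sigma>)" "regepi e" "Dom C e = Dom C k"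
    "\<And>t. t \<in> kernel_elems e \<longleftrightarrow> t \<in> Mor C \<and> Cod C t = Dom C k \<and> k \<cdot> t \<in> denominator X n \<K> \<sigma>"
  using assms unfolding resolves_at_def by blast+

lemma denominator_normal_sets:
  assumes "X \<in> Obj C" "\<forall>j<n. \<K> j \<in> normal_sets X"
  shows "denominator X n \<K> \<sigma> \<in> normal_sets X"
  unfolding denominator_def
proof (rule normal_join_normal_sets[OF assms(1)])
  show "(\<lambda>b. meet_elems X \<K> (insert b (twos n \<sigma>))) ` zeros n \<sigma> \<subseteq> normal_sets X"
    using assms by (auto intro!: meet_elems_normal_sets simp: twos_def zeros_def)
qed (simp add: zeros_def)

lemma twos_zeros_upd:
  assumes "i < n"
  shows "twos n (\<sigma>(i := 2)) = insert i (twos n (\<sigma>(i := 1)))" "zeros n (\<sigma>(i := 2)) = zeros n (\<sigma>(i := 1))"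
    "twos n (\<sigma>(i := 0)) = twos n (\<sigma>(i := 1))" "zeros n (\<sigma>(i := 0)) = insert i (zeros n (\<sigma>(i := 1)))"
    "i \<notin> twos n (\<sigma>(i := 1))" "i \<notin> zeros n (\<sigma>(i := 1))"
  using assms by (auto simp: twos_def zeros_def)

text \<open>Lowering coordinate \<open>i\<close> from 1 to 0 adds a single member to the join,
  namely the meet belonging to coordinate 2. This is the lattice side of taking one cokernel in
  direction \<open>i\<close>.\<close>

lemma denominator_local_join:
  assumes X: "X \<in> Obj C" and K: "\<forall>j<n. \<K> j \<in> normal_sets X" and i: "i < n"
    and p: "regepi p" "Dom C p = X" "kernel_elems p = denominator X n \<K> (\<sigma>(i := 1))"
  shows "denominator X n \<K> (\<sigma>(i := 0)) = local_join p (meet_elems X \<K> (twos n (\<sigma>(i := 2))))"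
proof -
  have "meet_elems X \<K> (twos n (\<sigma>(i := 2))) \<in> normal_sets X"
    by (rule meet_elems_normal_sets[OF X finite_twos]) (simp add: K twos_def)
  from normal_join_insert[OF p(1,2) p(3)[unfolded denominator_def] this]
  show ?thesis unfolding denominator_def by (simp only: twos_zeros_upd[OF i] image_insert)
qed

text \<open>\<open>e\<close> and \<open>p \<cdot> k\<close> have the same kernel, so they differ by
  a monomorphism. Hence equality in the quotient of the meet may be tested in \<open>X\<close>
  modulo \<open>p\<close>.\<close>

lemma quotient_eq_iff:
  assumes k: "monic k" "Cod C k = Dom C p" and e: "regepi e" "Dom C e = Dom C k" and p: "p \<in> Mor C"
    and ker: "\<And>t. t \<in> kernel_elems e \<longleftrightarrow> t \<in> Mor C \<and> Cod C t = Dom C k \<and> k \<cdot> t \<in> kernel_elems p"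
    and u: "u \<in> Hom C T (Dom C k)" and v: "v \<in> Hom C T (Dom C k)"
  shows "e \<cdot> u = e \<cdot> v \<longleftrightarrow> p \<cdot> (k \<cdot> u) = p \<cdot> (k \<cdot> v)"
proof -
  have pk: "p \<cdot> k \<in> Hom C (Dom C e) (Cod C p)" using k e p by auto
  have "kernel_elems e = kernel_elems (p \<cdot> k)"
  proof (rule Set.set_eqI)
    fix t show "t \<in> kernel_elems e \<longleftrightarrow> t \<in> kernel_elems (p \<cdot> k)"
      unfolding ker using k p by (auto simp: kernel_elems_iff)
  qed
  then obtain m where m: "monic m" "m \<in> Hom C (Cod C e) (Cod C p)" "m \<cdot> e = p \<cdot> k"
    using regepi_kernel_elems_factor_monic[OF e(1) pk] by blast
  have 1: "m \<cdot> (e \<cdot> u) = p \<cdot> (k \<cdot> u)" using m(3) by (rule comp_cong) (use m(2) k e p u in auto)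
  have 2: "m \<cdot> (e \<cdot> v) = p \<cdot> (k \<cdot> v)" using m(3) by (rule comp_cong) (use m(2) k e p v in auto)
  show ?thesis
  proof
    assume "p \<cdot> (k \<cdot> u) = p \<cdot> (k \<cdot> v)"
    then have "m \<cdot> (e \<cdot> u) = m \<cdot> (e \<cdot> v)" using 1 2 by simp
    then show "e \<cdot> u = e \<cdot> v" by (rule monicD[OF _ m(1), where T = T]) (use m(2) k e u v in auto)
  qed (use 1 2 in simp)
qed

text \<open>\<open>j\<close> is forced to be the inclusion of meets because
  \<open>k \<sigma>\<close> is monic. The second equation then says that the morphisms of
  \<open>E\<close> are those induced on quotients.\<close>

definition resolves ::
    "'o \<Rightarrow> nat \<Rightarrow> (nat \<Rightarrow> 'm set) \<Rightarrow> ('o, 'm) seq \<Rightarrow> ((nat \<Rightarrow> nat) \<Rightarrow> 'm) \<Rightarrow> ((nat \<Rightarrow> nat) \<Rightarrow> 'm) \<Rightarrow> bool" where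
  "resolves X n \<K> E k e \<longleftrightarrow> is_n_sequence C n E \<and>
     (\<forall>\<sigma>\<in>three_objs n. resolves_at X n \<K> \<sigma> (k \<sigma>) (e \<sigma>) \<and> Cod C (e \<sigma>) = FObj E \<sigma>) \<and>
     (\<forall>\<sigma>\<in>three_objs n. \<forall>\<tau>\<in>three_objs n. \<sigma> \<le> \<tau> \<longrightarrow>
        (\<exists>j \<in> Hom C (Dom C (k \<tau>)) (Dom C (k \<sigma>)). k \<sigma> \<cdot> j = k \<tau> \<and> FMor E (\<sigma>, \<tau>) \<cdot> e \<tau> = e \<sigma> \<cdot> j))"

context
  fixes X n \<K> E k e
  assumes X: "X \<in> Obj C" and K: "\<forall>j<n. \<K> j \<in> normal_sets X"
    and res: "resolves X n \<K> E k e"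
begin

lemma res_seq: "is_n_sequence C n E"
  using res by (simp add: resolves_def)

lemma res_at:
  assumes "\<sigma> \<in> three_objs n"
  shows "monic (k \<sigma>)" "Cod C (k \<sigma>) = X" "sieve (k \<sigma>) = meet_elems X \<K> (twos n \<sigma>)" "regepi (e \<sigma>)"
    "Dom C (e \<sigma>) = Dom C (k \<sigma>)" "Cod C (e \<sigma>) = FObj E \<sigma>"
    "\<And>t. t \<in> kernel_elems (e \<sigma>) \<longleftrightarrow> t \<in> Mor C \<and> Cod C t = Dom C (k \<sigma>) \<and> k \<sigma> \<cdot> t \<in> denominator X n \<K> \<sigma>"
proof -
  have "resolves_at X n \<K> \<sigma> (k \<sigma>) (e \<sigma>)" "Cod C (e \<sigma>) = FObj E \<sigma>" using res assms by (auto simp: resolves_def)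
  note resolves_atD[OF this(1)] this(2)
  then show "monic (k \<sigma>)" "Cod C (k \<sigma>) = X" "sieve (k \<sigma>) = meet_elems X \<K> (twos n \<sigma>)" "regepi (e \<sigma>)"
    "Dom C (e \<sigma>) = Dom C (k \<sigma>)" "Cod C (e \<sigma>) = FObj E \<sigma>"
    "\<And>t. t \<in> kernel_elems (e \<sigma>) \<longleftrightarrow> t \<in> Mor C \<and> Cod C t = Dom C (k \<sigma>) \<and> k \<sigma> \<cdot> t \<in> denominator X n \<K> \<sigma>"
    by blast+
qed

lemma res_nat:
  assumes "\<sigma> \<in> three_objs n" "\<tau> \<in> three_objs n" "\<sigma> \<le> \<tau>"
  obtains j where "j \<in> Hom C (Dom C (k \<tau>)) (Dom C (k \<sigma>))" "k \<sigma> \<cdot> j = k \<tau>"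
    "FMor E (\<sigma>, \<tau>) \<cdot> e \<tau> = e \<sigma> \<cdot> j"
  using res assms unfolding resolves_def by blast

context
  fixes i \<sigma>
  assumes i: "i < n" and \<sigma>: "\<sigma> \<in> three_objs n"
begin

lemma res_objs: "\<sigma>(i := 0) \<in> three_objs n" "\<sigma>(i := 1) \<in> three_objs n" "\<sigma>(i := 2) \<in> three_objs n"
  using three_objs_upd[OF \<sigma> i] by auto

lemma res_edges:
  "FMor E (\<sigma>(i := 1), \<sigma>(i := 2)) \<in> Hom C (FObj E (\<sigma>(i := 2))) (FObj E (\<sigma>(i := 1)))"
  "FMor E (\<sigma>(i := 0), \<sigma>(i := 1)) \<in> Hom C (FObj E (\<sigma>(i := 1))) (FObj E (\<sigma>(i := 0)))"
  using n_sequenceD(1)[OF res_seq res_objs(2,3) upd_le] n_sequenceD(1)[OF res_seq res_objs(1,2) upd_le] by auto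

text \<open>The meet at coordinate 2 is one of the members of the join divided out at coordinate
  0.\<close>

lemma res_comp_zero:
  "FMor E (\<sigma>(i := 0), \<sigma>(i := 1)) \<cdot> FMor E (\<sigma>(i := 1), \<sigma>(i := 2))
     = zero_mor (FObj E (\<sigma>(i := 2))) (FObj E (\<sigma>(i := 0)))"
proof -
  note O = res_objs
  note e0 = res_at[OF O(1)] and e2 = res_at[OF O(3)]
  have le: "\<sigma>(i := 0) \<le> \<sigma>(i := 2)" by (rule upd_le) simp
  obtain j where j: "j \<in> Hom C (Dom C (k (\<sigma>(i := 2)))) (Dom C (k (\<sigma>(i := 0))))"
    "k (\<sigma>(i := 0)) \<cdot> j = k (\<sigma>(i := 2))"
    "FMor E (\<sigma>(i := 0), \<sigma>(i := 2)) \<cdot> e (\<sigma>(i := 2)) = e (\<sigma>(i := 0)) \<cdot> j"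
    by (rule res_nat[OF O(1,3) le])
  have f: "FMor E (\<sigma>(i := 0), \<sigma>(i := 2)) \<in> Hom C (FObj E (\<sigma>(i := 2))) (FObj E (\<sigma>(i := 0)))"
    by (rule n_sequenceD(1)[OF res_seq O(1,3) le])
  have "k (\<sigma>(i := 2)) \<in> meet_elems X \<K> (insert i (twos n (\<sigma>(i := 0))))"
    using sieve_self[of "k (\<sigma>(i := 2))"] e2(1,3) twos_zeros_upd[OF i, of \<sigma>] by simp
  moreover have "meet_elems X \<K> (insert i (twos n (\<sigma>(i := 0)))) \<subseteq> denominator X n \<K> (\<sigma>(i := 0))"
    unfolding denominator_def by (rule normal_join_upper) (use twos_zeros_upd(4)[OF i, of \<sigma>] in blast)
  ultimately have "k (\<sigma>(i := 0)) \<cdot> j \<in> denominator X n \<K> (\<sigma>(i := 0))" using j(2) by auto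
  then have "j \<in> kernel_elems (e (\<sigma>(i := 0)))" using e0(7) j(1) by simp
  then have "e (\<sigma>(i := 0)) \<cdot> j = zero_mor (Dom C (k (\<sigma>(i := 2)))) (FObj E (\<sigma>(i := 0)))"
    using j(1) e0(6) by (auto elim: kernel_elemsE)
  then have "FMor E (\<sigma>(i := 0), \<sigma>(i := 2)) \<cdot> e (\<sigma>(i := 2))
      = zero_mor (FObj E (\<sigma>(i := 2))) (FObj E (\<sigma>(i := 0))) \<cdot> e (\<sigma>(i := 2))"
    using j(3) e2 n_sequenceD(2)[OF res_seq O(1)] by simp
  then have "FMor E (\<sigma>(i := 0), \<sigma>(i := 2)) = zero_mor (FObj E (\<sigma>(i := 2))) (FObj E (\<sigma>(i := 0)))"
    by (rule epicD[OF _ regepi_epic[OF e2(4)], where T = "FObj E (\<sigma>(i := 0))"])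
      (use f e2 n_sequenceD(2)[OF res_seq] O in auto)
  then show ?thesis
    using n_sequenceD(4)[OF res_seq O(1,2,3) upd_le upd_le] by simp
qed

text \<open>Coordinates 0 and 1 belong to the same meet, so \<open>j\<close> is invertible and the
  edge is, after composition with \<open>e\<close>, a quotient map.\<close>

lemma res_regepi: "regepi (FMor E (\<sigma>(i := 0), \<sigma>(i := 1)))"
proof -
  note O = res_objs
  note e0 = res_at[OF O(1)] and e1 = res_at[OF O(2)]
  have le: "\<sigma>(i := 0) \<le> \<sigma>(i := 1)" by (rule upd_le) simp
  obtain j where j: "j \<in> Hom C (Dom C (k (\<sigma>(i := 1)))) (Dom C (k (\<sigma>(i := 0))))"
    "k (\<sigma>(i := 0)) \<cdot> j = k (\<sigma>(i := 1))"
    "FMor E (\<sigma>(i := 0), \<sigma>(i := 1)) \<cdot> e (\<sigma>(i := 1)) = e (\<sigma>(i := 0)) \<cdot> j"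
    by (rule res_nat[OF O(1,2) le])
  have s: "sieve (k (\<sigma>(i := 0))) = sieve (k (\<sigma>(i := 1)))"
    using e0(3) e1(3) twos_zeros_upd[OF i, of \<sigma>] by simp
  obtain j' where j': "j' \<in> Hom C (Dom C (k (\<sigma>(i := 0)))) (Dom C (k (\<sigma>(i := 1))))"
    "k (\<sigma>(i := 1)) \<cdot> j' = k (\<sigma>(i := 0))"
    by (rule sieve_eq_monic[OF e0(1), of "k (\<sigma>(i := 1))"]) (use e0 e1 s in auto)
  have "monic (k (\<sigma>(i := 0)) \<cdot> j)" using j(2) e1(1) by simp
  then have mj: "monic j" by (rule monic_cancel) (use j(1) e0(1) in auto)
  have "k (\<sigma>(i := 0)) \<cdot> (j \<cdot> j') = k (\<sigma>(i := 1)) \<cdot> j'"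
    using j(2) by (rule comp_cong1) (use j(1) j'(1) e0(1) in auto)
  then have "k (\<sigma>(i := 0)) \<cdot> (j \<cdot> j') = k (\<sigma>(i := 0)) \<cdot> Ident C (Dom C (k (\<sigma>(i := 0))))"
    using j'(2) e0(1) by simp
  then have "j \<cdot> j' = Ident C (Dom C (k (\<sigma>(i := 0))))"
    by (rule monicD[OF _ e0(1)]) (use j(1) j'(1) e0(1) in auto)
  then have "is_iso C j" by (intro split_monic_iso[OF mj, of j']) (use j(1) j'(1) in auto)
  obtain j2 where j2: "j2 \<in> Hom C (Cod C j) (Dom C j)" "j \<cdot> j2 = Ident C (Cod C j)"
    using \<open>is_iso C j\<close> by (rule iso_obtain)
  have "regepi j"
  proof (rule regepiI)
    fix m u assume m: "monic m" "Cod C m = Cod C j" "u \<in> Hom C (Dom C j) (Dom C m)" "m \<cdot> u = j"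
    have "m \<cdot> (u \<cdot> j2) = j \<cdot> j2" using m(4) by (rule comp_cong1) (use m j2(1) in auto)
    then show "is_iso C m" by (intro split_monic_iso[OF m(1), of "u \<cdot> j2"]) (use m j2 in auto)
  qed (use j(1) in auto)
  then have "regepi (e (\<sigma>(i := 0)) \<cdot> j)" by (intro regepi_comp) (use e0 j(1) in auto)
  then have "regepi (FMor E (\<sigma>(i := 0), \<sigma>(i := 1)) \<cdot> e (\<sigma>(i := 1)))" using j(3) by simp
  then show ?thesis by (rule regepi_cancel) (use e1 res_edges(2) in auto)
qed

text \<open>Exactness in the middle, on a cover. An element killed by the edge is lifted to the
  meet, where it lies in the denominator at coordinate 0. By \<open>denominator_local_join\<close>
  it is there locally congruent, modulo the denominator at coordinate 1, to an element of the meet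
  at coordinate 2.\<close>

lemma res_kernel_local:
  assumes t: "t \<in> kernel_elems (FMor E (\<sigma>(i := 0), \<sigma>(i := 1)))"
  obtains e' y where "regepi e'" "Cod C e' = Dom C t" "y \<in> Hom C (Dom C e') (FObj E (\<sigma>(i := 2)))"
    "t \<cdot> e' = FMor E (\<sigma>(i := 1), \<sigma>(i := 2)) \<cdot> y"
proof -
  note O = res_objs
  define \<rho> where "\<rho> = \<sigma>(i := 0)"
  define \<tau> where "\<tau> = \<sigma>(i := 1)"
  define \<tau>2 where "\<tau>2 = \<sigma>(i := 2)"
  note O = O[folded \<rho>_def \<tau>_def \<tau>2_def]
  note e0 = res_at[OF O(1)] and e1 = res_at[OF O(2)] and e2 = res_at[OF O(3)]
  note ed = res_edges[folded \<rho>_def \<tau>_def \<tau>2_def]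
  have le1: "\<rho> \<le> \<tau>" and le2: "\<tau> \<le> \<tau>2" unfolding \<rho>_def \<tau>_def \<tau>2_def by (rule upd_le; simp)+
  obtain j where j: "j \<in> Hom C (Dom C (k \<tau>)) (Dom C (k \<rho>))" "k \<rho> \<cdot> j = k \<tau>" "FMor E (\<rho>, \<tau>) \<cdot> e \<tau> = e \<rho> \<cdot> j"
    by (rule res_nat[OF O(1,2) le1])
  obtain j2 where j2: "j2 \<in> Hom C (Dom C (k \<tau>2)) (Dom C (k \<tau>))" "k \<tau> \<cdot> j2 = k \<tau>2" "FMor E (\<tau>, \<tau>2) \<cdot> e \<tau>2 = e \<tau> \<cdot> j2"
    by (rule res_nat[OF O(2,3) le2])
  have tk: "t \<in> Mor C" "Cod C t = FObj E \<tau>" "FMor E (\<rho>, \<tau>) \<cdot> t = zero_mor (Dom C t) (FObj E \<rho>)"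
    using t ed unfolding \<rho>_def[symmetric] \<tau>_def[symmetric] by (auto simp: kernel_elems_iff)
  obtain T e' s where l: "regepi e'" "e' \<in> Hom C T (Dom C t)" "s \<in> Hom C T (Dom C (e \<tau>))" "e \<tau> \<cdot> s = t \<cdot> e'"
    by (rule regepi_lift[OF e1(4), of t]) (use tk e1 in auto)
  have s: "s \<in> Hom C T (Dom C (k \<tau>))" using l(3) e1(5) by simp
  have TO: "T \<in> Obj C" using l by auto
  have "FMor E (\<rho>, \<tau>) \<cdot> (e \<tau> \<cdot> s) = e \<rho> \<cdot> (j \<cdot> s)" using j(3) by (rule comp_cong) (use ed s j(1) e0 e1 in auto)
  moreover have "FMor E (\<rho>, \<tau>) \<cdot> (t \<cdot> e') = zero_mor (Dom C t) (FObj E \<rho>) \<cdot> e'"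
    using tk(3) by (rule comp_cong1) (use ed tk l in auto)
  ultimately have "e \<rho> \<cdot> (j \<cdot> s) = zero_mor T (FObj E \<rho>)" using l n_sequenceD(2)[OF res_seq O(1)] by simp
  then have "j \<cdot> s \<in> kernel_elems (e \<rho>)" using j(1) s e0 by (intro kernel_elemsI) auto
  then have "k \<rho> \<cdot> (j \<cdot> s) \<in> denominator X n \<K> \<rho>" using e0(7) by simp
  moreover have "k \<rho> \<cdot> (j \<cdot> s) = k \<tau> \<cdot> s" using j(2) by (rule comp_cong1) (use j(1) s e0 in auto)
  ultimately have kN: "k \<tau> \<cdot> s \<in> denominator X n \<K> \<rho>" by simp
  obtain p where p: "regepi p" "Dom C p = X" "denominator X n \<K> \<tau> = kernel_elems p"
    using denominator_normal_sets[OF X K] by (rule normal_sets_regepi)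
  have "denominator X n \<K> \<rho> = local_join p (meet_elems X \<K> (twos n \<tau>2))"
    unfolding \<rho>_def \<tau>2_def by (rule denominator_local_join[OF X K i p(1,2)]) (use p(3) \<tau>_def in auto)
  then have "k \<tau> \<cdot> s \<in> local_join p (meet_elems X \<K> (twos n \<tau>2))" using kN by simp
  then obtain e'' a where a: "regepi e''" "Cod C e'' = Dom C (k \<tau> \<cdot> s)" "a \<in> meet_elems X \<K> (twos n \<tau>2)"
    "Dom C a = Dom C e''" "p \<cdot> ((k \<tau> \<cdot> s) \<cdot> e'') = p \<cdot> a" by (rule local_joinE)
  have e'': "e'' \<in> Hom C (Dom C e'') T" using a(1,2) s e1 by simp
  have "a \<in> sieve (k \<tau>2)" using a(3) e2(3) by simp
  then obtain y where y: "y \<in> Hom C (Dom C a) (Dom C (k \<tau>2))" "k \<tau>2 \<cdot> y = a" by (rule sieveE)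
  have y': "y \<in> Hom C (Dom C e'') (Dom C (k \<tau>2))" using y(1) a(4) by simp
  have "k \<tau> \<cdot> (j2 \<cdot> y) = k \<tau>2 \<cdot> y" using j2(2) by (rule comp_cong1) (use j2(1) y' e1 in auto)
  then have "p \<cdot> (k \<tau> \<cdot> (s \<cdot> e'')) = p \<cdot> (k \<tau> \<cdot> (j2 \<cdot> y))" using a(5) y(2) s e'' e1 by simp
  moreover have "(e \<tau> \<cdot> (s \<cdot> e'') = e \<tau> \<cdot> (j2 \<cdot> y)) \<longleftrightarrow> (p \<cdot> (k \<tau> \<cdot> (s \<cdot> e'')) = p \<cdot> (k \<tau> \<cdot> (j2 \<cdot> y)))"
    by (rule quotient_eq_iff[where T = "Dom C e''"]) (use e1 p s e'' j2(1) y' in auto)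
  ultimately have 1: "e \<tau> \<cdot> (s \<cdot> e'') = e \<tau> \<cdot> (j2 \<cdot> y)" by simp
  have "e \<tau> \<cdot> (j2 \<cdot> y) = FMor E (\<tau>, \<tau>2) \<cdot> (e \<tau>2 \<cdot> y)"
    using j2(3)[symmetric] by (rule comp_cong) (use j2(1) y' e1 e2 ed in auto)
  moreover have "e \<tau> \<cdot> (s \<cdot> e'') = t \<cdot> (e' \<cdot> e'')"
    using l(4) by (rule comp_cong) (use s e'' e1 l tk in auto)
  ultimately have "t \<cdot> (e' \<cdot> e'') = FMor E (\<tau>, \<tau>2) \<cdot> (e \<tau>2 \<cdot> y)" using 1 by simp
  moreover have "regepi (e' \<cdot> e'')" by (rule regepi_comp) (use a(1) l e'' in auto)
  ultimately show ?thesis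
    using that[of "e' \<cdot> e''" "e \<tau>2 \<cdot> y"] l e'' y' e2 unfolding \<tau>_def \<tau>2_def by auto
qed

lemma res_cokernel:
  "is_cokernel C (seq_edge E i \<sigma> 1 0) (seq_edge E i \<sigma> 2 1)"
  unfolding seq_edge_def
proof (rule cokernelI[OF res_regepi])
  let ?h = "FMor E (\<sigma>(i := 1), \<sigma>(i := 2))" and ?u = "FMor E (\<sigma>(i := 0), \<sigma>(i := 1))"
  show "?u \<cdot> ?h = zero_mor (Dom C ?h) (Cod C ?u)" using res_comp_zero res_edges by simp
  fix g assume g: "g \<in> Mor C" "Dom C g = Dom C ?u" "g \<cdot> ?h = zero_mor (Dom C ?h) (Cod C g)"
  show "kernel_elems ?u \<subseteq> kernel_elems g"
  proof
    fix t assume t: "t \<in> kernel_elems ?u"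
    obtain e' y where l: "regepi e'" "Cod C e' = Dom C t" "y \<in> Hom C (Dom C e') (FObj E (\<sigma>(i := 2)))"
      "t \<cdot> e' = ?h \<cdot> y" using t by (rule res_kernel_local)
    have t': "t \<in> Mor C" "Cod C t = Dom C ?u" using t by (auto elim: kernel_elemsE)
    have "g \<cdot> (?h \<cdot> y) = zero_mor (Dom C ?h) (Cod C g) \<cdot> y" using g(3) by (rule comp_cong1) (use g l res_edges in auto)
    then have "g \<cdot> (t \<cdot> e') = zero_mor (Dom C e') (Cod C g)" using l(3,4) res_edges g by simp
    then have "t \<cdot> e' \<in> kernel_elems g" using t' l(1,2) g by (intro kernel_elemsI) auto
    then show "t \<in> kernel_elems g" by (rule kernel_elems_regepi[OF _ l(1)]) (use t' l g in auto)
  qed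
qed (use res_edges in auto)

text \<open>Computes the kernel of the first edge. An element of the meet at coordinate 2 becomes
  zero along the edge when it lies in the denominator at coordinate 1, but is zero beforehand only
  when it lies in the denominator at coordinate 2. The gap between the two is measured by
  \<open>exact_distributive\<close>.\<close>

lemma res_kernel_elems_edge:
  assumes "s \<in> Hom C T (Dom C (k (\<sigma>(i := 2))))"
  shows "FMor E (\<sigma>(i := 1), \<sigma>(i := 2)) \<cdot> (e (\<sigma>(i := 2)) \<cdot> s) = zero_mor T (FObj E (\<sigma>(i := 1)))
     \<longleftrightarrow> k (\<sigma>(i := 2)) \<cdot> s \<in> denominator X n \<K> (\<sigma>(i := 1))"
proof -
  note O = res_objs
  define \<tau> where "\<tau> = \<sigma>(i := 1)"
  define \<tau>2 where "\<tau>2 = \<sigma>(i := 2)"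
  note O = O[folded \<tau>_def \<tau>2_def]
  note s = assms[folded \<tau>2_def]
  note e1 = res_at[OF O(2)] and e2 = res_at[OF O(3)]
  note ed = res_edges[folded \<tau>_def \<tau>2_def]
  have le2: "\<tau> \<le> \<tau>2" unfolding \<tau>_def \<tau>2_def by (rule upd_le; simp)+
  obtain j2 where j2: "j2 \<in> Hom C (Dom C (k \<tau>2)) (Dom C (k \<tau>))" "k \<tau> \<cdot> j2 = k \<tau>2" "FMor E (\<tau>, \<tau>2) \<cdot> e \<tau>2 = e \<tau> \<cdot> j2"
    by (rule res_nat[OF O(2,3) le2])
  have 1: "FMor E (\<tau>, \<tau>2) \<cdot> (e \<tau>2 \<cdot> s) = e \<tau> \<cdot> (j2 \<cdot> s)" using j2(3) by (rule comp_cong) (use s e1 e2 ed j2(1) in auto)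
  have 2: "k \<tau> \<cdot> (j2 \<cdot> s) = k \<tau>2 \<cdot> s" using j2(2) by (rule comp_cong1) (use s e1 j2(1) in auto)
  have "j2 \<cdot> s \<in> kernel_elems (e \<tau>) \<longleftrightarrow> e \<tau> \<cdot> (j2 \<cdot> s) = zero_mor T (FObj E \<tau>)"
    using s j2(1) e1 by (simp add: kernel_elems_iff)
  moreover have "j2 \<cdot> s \<in> kernel_elems (e \<tau>) \<longleftrightarrow> k \<tau> \<cdot> (j2 \<cdot> s) \<in> denominator X n \<K> \<tau>"
    using s j2(1) e1(7) by simp
  ultimately show ?thesis using 1 2 unfolding \<tau>_def \<tau>2_def by simp
qed

lemma res_monic:
  assumes "exact_distributive X n \<K>"
  shows "monic (FMor E (\<sigma>(i := 1), \<sigma>(i := 2)))"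
proof (rule monic_if_kernel_elems_trivial)
  note O = res_objs
  note e1 = res_at[OF O(2)] and e2 = res_at[OF O(3)]
  let ?h = "FMor E (\<sigma>(i := 1), \<sigma>(i := 2))"
  show "?h \<in> Mor C" using res_edges by auto
  fix t assume "t \<in> kernel_elems ?h"
  then have t: "t \<in> Mor C" "Cod C t = FObj E (\<sigma>(i := 2))" "?h \<cdot> t = zero_mor (Dom C t) (FObj E (\<sigma>(i := 1)))"
    using res_edges by (auto simp: kernel_elems_iff)
  obtain T e' s where l: "regepi e'" "e' \<in> Hom C T (Dom C t)" "s \<in> Hom C T (Dom C (e (\<sigma>(i := 2))))"
    "e (\<sigma>(i := 2)) \<cdot> s = t \<cdot> e'"
    by (rule regepi_lift[OF e2(4), of t]) (use t e2 in auto)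
  have s: "s \<in> Hom C T (Dom C (k (\<sigma>(i := 2))))" using l(3) e2 by simp
  have O1: "FObj E (\<sigma>(i := 1)) \<in> Obj C" "FObj E (\<sigma>(i := 2)) \<in> Obj C" using n_sequenceD(2)[OF res_seq] O by auto
  have "?h \<cdot> (t \<cdot> e') = zero_mor (Dom C t) (FObj E (\<sigma>(i := 1))) \<cdot> e'"
    using t(3) by (rule comp_cong1) (use res_edges t l in auto)
  then have "?h \<cdot> (e (\<sigma>(i := 2)) \<cdot> s) = zero_mor T (FObj E (\<sigma>(i := 1)))" using l t O1 by simp
  then have "k (\<sigma>(i := 2)) \<cdot> s \<in> denominator X n \<K> (\<sigma>(i := 1))" using res_kernel_elems_edge[OF s] by simp
  moreover have "k (\<sigma>(i := 2)) \<cdot> s \<in> meet_elems X \<K> (insert i (twos n (\<sigma>(i := 1))))"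
    using sieveI[of "k (\<sigma>(i := 2))" s] s e2(1,3) twos_zeros_upd(1)[OF i, of \<sigma>] by simp
  moreover have "meet_elems X \<K> (insert i (twos n (\<sigma>(i := 1)))) \<inter> denominator X n \<K> (\<sigma>(i := 1)) \<subseteq> denominator X n \<K> (\<sigma>(i := 2))"
  proof -
    have "meet_elems X \<K> (insert i (twos n (\<sigma>(i := 1)))) \<inter> normal_join X ((\<lambda>b. meet_elems X \<K> (insert b (twos n (\<sigma>(i := 1))))) ` zeros n (\<sigma>(i := 1)))
       \<subseteq> normal_join X ((\<lambda>b. meet_elems X \<K> (insert i (insert b (twos n (\<sigma>(i := 1)))))) ` zeros n (\<sigma>(i := 1)))"
      by (rule assms[unfolded exact_distributive_def, rule_format])
        (use i twos_zeros_upd(5,6)[OF i, of \<sigma>] in \<open>auto simp: twos_def zeros_def\<close>)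
    then show ?thesis unfolding denominator_def twos_zeros_upd(1,2)[OF i] by (simp add: insert_commute)
  qed
  ultimately have "k (\<sigma>(i := 2)) \<cdot> s \<in> denominator X n \<K> (\<sigma>(i := 2))" by blast
  then have "s \<in> kernel_elems (e (\<sigma>(i := 2)))" using e2(7) s by simp
  then have "e (\<sigma>(i := 2)) \<cdot> s = zero_mor T (FObj E (\<sigma>(i := 2)))" using e2(6) s by (auto elim: kernel_elemsE)
  then have "t \<cdot> e' = zero_mor (Dom C t) (FObj E (\<sigma>(i := 2))) \<cdot> e'" using l t O1 by simp
  then have "t = zero_mor (Dom C t) (FObj E (\<sigma>(i := 2)))"
    by (rule epicD[OF _ regepi_epic[OF l(1)], where T = "FObj E (\<sigma>(i := 2))"]) (use t l O1 in auto)
  then show "t = zero_mor (Dom C t) (Dom C ?h)" using res_edges by simp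
qed

text \<open>The preimages given by \<open>res_kernel_local\<close> exist on covers only. Once the
  first edge is known to be monic, they descend by \<open>regepi_sieve\<close>.\<close>

lemma res_short_exact:
  assumes "exact_distributive X n \<K>"
  shows "is_short_exact C (seq_edge E i \<sigma> 2 1) (seq_edge E i \<sigma> 1 0)"
  unfolding short_exact_iff seq_edge_def
proof (intro conjI equalityI subsetI)
  let ?h = "FMor E (\<sigma>(i := 1), \<sigma>(i := 2))" and ?u = "FMor E (\<sigma>(i := 0), \<sigma>(i := 1))"
  show m: "monic ?h" by (rule res_monic[OF assms])
  show "regepi ?u" by (rule res_regepi)
  show "Cod C ?h = Dom C ?u" using res_edges by simp
  show "t \<in> kernel_elems ?u" if t: "t \<in> sieve ?h" for t
  proof -
    obtain y where y: "y \<in> Hom C (Dom C t) (Dom C ?h)" "?h \<cdot> y = t" using t by (rule sieveE)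
    have "?h \<in> kernel_elems ?u" using res_comp_zero res_edges by (intro kernel_elemsI) auto
    then have "?h \<cdot> y \<in> kernel_elems ?u" by (rule kernel_elems_comp) (use y(1) res_edges in simp_all)
    then show ?thesis using y(2) by simp
  qed
  show "t \<in> sieve ?h" if t: "t \<in> kernel_elems ?u" for t
  proof -
    obtain e' y where l: "regepi e'" "Cod C e' = Dom C t" "y \<in> Hom C (Dom C e') (FObj E (\<sigma>(i := 2)))"
      "t \<cdot> e' = ?h \<cdot> y" using t by (rule res_kernel_local)
    have "t \<cdot> e' \<in> sieve ?h" unfolding l(4) by (rule sieveI[OF _ _ _ refl]) (use l(3) res_edges in auto)
    then show ?thesis by (rule regepi_sieve[OF _ l(1) m]) (use t l(2) res_edges in \<open>auto elim: kernel_elemsE\<close>)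
  qed
qed

end

text \<open>An element of the left side vanishes in the quotient at coordinate 1. Monicity of the
  edge makes it vanish at coordinate 2, and the denominator there is the right side.\<close>

lemma res_exact_distributive:
  assumes mono: "\<And>i \<sigma>. i < n \<Longrightarrow> \<sigma> \<in> three_objs n \<Longrightarrow> monic (FMor E (\<sigma>(i := 1), \<sigma>(i := 2)))"
  shows "exact_distributive X n \<K>"
  unfolding exact_distributive_def
proof (intro allI impI subsetI)
  fix A B i t
  assume "A \<subseteq> {..<n} \<and> B \<subseteq> {..<n} \<and> i < n \<and> A \<inter> B = {} \<and> i \<notin> A \<union> B"
    and "t \<in> meet_elems X \<K> (insert i A) \<inter> normal_join X ((\<lambda>b. meet_elems X \<K> (insert b A)) ` B)"
  then have h: "A \<subseteq> {..<n}" "B \<subseteq> {..<n}" "i < n" "A \<inter> B = {}" "i \<notin> A" "i \<notin> B"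
    and t: "t \<in> meet_elems X \<K> (insert i A)" "t \<in> normal_join X ((\<lambda>b. meet_elems X \<K> (insert b A)) ` B)" by auto
  \<comment> \<open>The object of \<open>3\<^sup>n\<close> whose edge in direction \<open>i\<close>
    encodes the inclusion for \<open>A\<close> and \<open>B\<close>. Beyond \<open>n\<close> the
    value 0 is required by \<open>three_objs\<close>.\<close>
  define \<sigma> :: "nat \<Rightarrow> nat" where "\<sigma> = (\<lambda>j. if n \<le> j \<or> j \<in> B then 0 else if j \<in> A then 2 else 1)"
  have \<sigma>: "\<sigma> \<in> three_objs n" by (auto simp: three_objs_def \<sigma>_def)
  have to_zero_eq: "twos n (\<sigma>(i := 1)) = A" "zeros n (\<sigma>(i := 1)) = B"
    using h by (auto simp: twos_def zeros_def \<sigma>_def)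
  note e2 = res_at[OF res_objs(3)[OF h(3) \<sigma>]]
  note ed = res_edges[OF h(3) \<sigma>]
  have N: "t \<in> denominator X n \<K> (\<sigma>(i := 1))" using t(2) unfolding denominator_def to_zero_eq .
  have "t \<in> sieve (k (\<sigma>(i := 2)))" using t(1) e2(3) twos_zeros_upd(1)[OF h(3), of \<sigma>] to_zero_eq by simp
  then obtain s where s: "s \<in> Hom C (Dom C t) (Dom C (k (\<sigma>(i := 2))))" "k (\<sigma>(i := 2)) \<cdot> s = t" by (rule sieveE)
  have O1: "FObj E (\<sigma>(i := 1)) \<in> Obj C" "FObj E (\<sigma>(i := 2)) \<in> Obj C"
    using n_sequenceD(2)[OF res_seq] res_objs[OF h(3) \<sigma>] by auto
  have tO: "Dom C t \<in> Obj C" using s(1) Obj_simps(1)[of s] by simp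
  have "FMor E (\<sigma>(i := 1), \<sigma>(i := 2)) \<cdot> (e (\<sigma>(i := 2)) \<cdot> s) = zero_mor (Dom C t) (FObj E (\<sigma>(i := 1)))"
    using res_kernel_elems_edge[OF h(3) \<sigma> s(1)] s(2) N by simp
  also have "\<dots> = FMor E (\<sigma>(i := 1), \<sigma>(i := 2)) \<cdot> zero_mor (Dom C t) (FObj E (\<sigma>(i := 2)))"
    using ed tO by simp
  finally have "e (\<sigma>(i := 2)) \<cdot> s = zero_mor (Dom C t) (FObj E (\<sigma>(i := 2)))"
    by (rule monicD[OF _ mono[OF h(3) \<sigma>], where T = "Dom C t"]) (use s(1) e2 ed O1 tO in auto)
  then have "s \<in> kernel_elems (e (\<sigma>(i := 2)))" by (intro kernel_elemsI) (use s(1) e2 in simp_all)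
  then have "t \<in> denominator X n \<K> (\<sigma>(i := 2))" using e2(7) s(2) by simp
  then show "t \<in> normal_join X ((\<lambda>b. meet_elems X \<K> (insert i (insert b A))) ` B)"
    unfolding denominator_def twos_zeros_upd(1,2)[OF h(3)] to_zero_eq by (simp add: insert_commute)
qed

end

end


lemma three_objs_le2: "\<sigma> \<in> three_objs n \<Longrightarrow> \<sigma> i \<le> 2"
  by (cases "i < n") (auto simp: three_objs_def)

lemma ones_three_objs: "ones n \<in> three_objs n"
  by (auto simp: ones_def three_objs_def)

section \<open>Construction of the sequence of quotients and its comparison with successive
  cokernels\<close>

context semi_abelian_category
begin

lemma twos_mono:
  assumes "\<sigma> \<in> three_objs n" "\<tau> \<in> three_objs n" "\<sigma> \<le> \<tau>"
  shows "twos n \<sigma> \<subseteq> twos n \<tau>" "zeros n \<tau> \<subseteq> zeros n \<sigma>"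
proof
  fix i assume "i \<in> twos n \<sigma>"
  moreover have "\<sigma> i \<le> \<tau> i" "\<tau> i \<le> 2" using assms three_objs_le2 by (auto simp: le_fun_def)
  ultimately show "i \<in> twos n \<tau>" by (simp add: twos_def)
next
  show "zeros n \<tau> \<subseteq> zeros n \<sigma>"
  proof
    fix i assume "i \<in> zeros n \<tau>"
    moreover have "\<sigma> i \<le> \<tau> i" using assms by (auto simp: le_fun_def)
    ultimately show "i \<in> zeros n \<sigma>" by (simp add: zeros_def)
  qed
qed

lemma sieve_Ident: "X \<in> Obj C \<Longrightarrow> sieve (Ident C X) = elems X"
  by (auto simp: sieve_def elems_def)

context
  fixes X :: 'o and n :: nat and \<K> :: "nat \<Rightarrow> 'm set"
  assumes X: "X \<in> Obj C" and K: "\<forall>j<n. \<K> j \<in> normal_sets X"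
begin

text \<open>Passing to a larger object leaves fewer members in the join and puts more conditions on
  each of them.\<close>

lemma denominator_mono:
  assumes "\<sigma> \<in> three_objs n" "\<tau> \<in> three_objs n" "\<sigma> \<le> \<tau>"
  shows "denominator X n \<K> \<tau> \<subseteq> denominator X n \<K> \<sigma>"
  unfolding denominator_def
proof (rule normal_join_mono[OF X])
  show "(\<lambda>b. meet_elems X \<K> (insert b (twos n \<sigma>))) ` zeros n \<sigma> \<subseteq> normal_sets X"
    using K by (auto intro!: meet_elems_normal_sets[OF X] simp: twos_def zeros_def)
  fix A assume "A \<in> (\<lambda>b. meet_elems X \<K> (insert b (twos n \<tau>))) ` zeros n \<tau>"
  then obtain b where b: "b \<in> zeros n \<tau>" "A = meet_elems X \<K> (insert b (twos n \<tau>))" by blast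
  have "A \<subseteq> meet_elems X \<K> (insert b (twos n \<sigma>))" unfolding b(2) by (rule meet_elems_anti) (use twos_mono[OF assms] in auto)
  moreover have "b \<in> zeros n \<sigma>" using b twos_mono[OF assms] by blast
  ultimately show "\<exists>B\<in>(\<lambda>b. meet_elems X \<K> (insert b (twos n \<sigma>))) ` zeros n \<sigma>. A \<subseteq> B" by blast
qed simp

text \<open>With \<open>p\<close> the quotient of \<open>X\<close> by the denominator,
  \<open>e\<close> is the regular epimorphism in the image factorisation of
  \<open>p \<cdot> k\<close>.\<close>

lemma resolves_at_exists: "\<exists>k e. resolves_at X n \<K> \<sigma> k e"
proof -
  have "meet_elems X \<K> (twos n \<sigma>) \<in> normal_sets X" by (rule meet_elems_normal_sets[OF X finite_twos]) (simp add: K twos_def)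
  then obtain k where k: "k \<in> carrier (NSub C X)" "sieve k = meet_elems X \<K> (twos n \<sigma>)" by (rule NSub_carrier_exists)
  have k': "monic k" "Cod C k = X" using k(1) by (auto simp: NSub_carrier)
  obtain p where p: "regepi p" "Dom C p = X" "denominator X n \<K> \<sigma> = kernel_elems p"
    using denominator_normal_sets[OF X K] by (rule normal_sets_regepi)
  obtain I e m where e: "regepi e" "monic m" "e \<in> Hom C (Dom C (p \<cdot> k)) I" "m \<in> Hom C I (Cod C (p \<cdot> k))" "m \<cdot> e = p \<cdot> k"
    by (rule image_obtain[of "p \<cdot> k"]) (use p k' in auto)
  have "kernel_elems e = kernel_elems (m \<cdot> e)" by (rule kernel_elems_monic_comp[symmetric]) (use e in auto)
  also have "\<dots> = {t \<in> Mor C. Cod C t = Dom C k \<and> k \<cdot> t \<in> denominator X n \<K> \<sigma>}"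
    unfolding e(5) p(3) using k' p by (auto simp: kernel_elems_iff)
  finally have "resolves_at X n \<K> \<sigma> k e" unfolding resolves_at_def using k k' e p by auto
  then show ?thesis by blast
qed

text \<open>\<open>meets_then_cokernels\<close> demands \<open>X\<close> itself at
  \<open>ones n\<close>, not an isomorphic copy. So identities are taken there, which is possible
  because the meet is empty and nothing is divided out.\<close>

lemma resolves_at_ones: "resolves_at X n \<K> (ones n) (Ident C X) (Ident C X)"
proof -
  have "twos n (ones n) = {}" "zeros n (ones n) = {}" by (auto simp: twos_def zeros_def ones_def)
  then have N: "denominator X n \<K> (ones n) = kernel_elems (Ident C X)" "meet_elems X \<K> (twos n (ones n)) = elems X"
    using normal_join_empty[OF X] by (auto simp: denominator_def zero_elems_def meet_elems_empty)
  show ?thesis unfolding resolves_at_def N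
    using X by (auto simp: sieve_Ident monic_Ident regepi_Ident kernel_elems_iff)
qed

text \<open>The objects are chosen independently of each other, and the morphisms are then forced:
  \<open>k \<sigma>\<close> is monic and \<open>e \<tau>\<close> is epic, so at most one morphism is
  compatible with them. Functoriality follows from this uniqueness.\<close>

lemma resolves_exists:
  obtains E k e where "resolves X n \<K> E k e" "k (ones n) = Ident C X" "e (ones n) = Ident C X"
proof -
  have "\<forall>\<sigma>. \<exists>k e. resolves_at X n \<K> \<sigma> k e \<and> (\<sigma> = ones n \<longrightarrow> k = Ident C X \<and> e = Ident C X)"
  proof
    fix \<sigma> show "\<exists>k e. resolves_at X n \<K> \<sigma> k e \<and> (\<sigma> = ones n \<longrightarrow> k = Ident C X \<and> e = Ident C X)"
      by (cases "\<sigma> = ones n") (use resolves_at_exists resolves_at_ones in blast)+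
  qed
  then obtain k e where ke: "\<And>\<sigma>. resolves_at X n \<K> \<sigma> (k \<sigma>) (e \<sigma>)"
    and one: "k (ones n) = Ident C X" "e (ones n) = Ident C X" by metis
  note at = resolves_atD[OF ke]
  \<comment> \<open>\<open>P \<sigma> \<tau> h\<close> says that \<open>h\<close> is the morphism of
    quotients induced by an inclusion of meets. It has at most one solution
    \<open>h\<close>.\<close>
  define P where "P = (\<lambda>\<sigma> \<tau> h. h \<in> Hom C (Cod C (e \<tau>)) (Cod C (e \<sigma>)) \<and>
    (\<exists>j \<in> Hom C (Dom C (k \<tau>)) (Dom C (k \<sigma>)). k \<sigma> \<cdot> j = k \<tau> \<and> h \<cdot> e \<tau> = e \<sigma> \<cdot> j))"
  have Pex: "\<exists>h. P \<sigma> \<tau> h" if h: "\<sigma> \<in> three_objs n" "\<tau> \<in> three_objs n" "\<sigma> \<le> \<tau>" for \<sigma> \<tau>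
  proof -
    obtain j where j: "j \<in> Hom C (Dom C (k \<tau>)) (Dom C (k \<sigma>))" "k \<sigma> \<cdot> j = k \<tau>"
      by (rule sieve_eq_monic[OF at(1)[of \<tau>], of "k \<sigma>"])
        (use at(1,2,3) meet_elems_anti[OF twos_mono(1)[OF h], of X \<K>] in auto)
    have ej: "e \<sigma> \<cdot> j \<in> Hom C (Dom C (e \<tau>)) (Cod C (e \<sigma>))" using at(4,5) j(1) by simp
    have "kernel_elems (e \<tau>) \<subseteq> kernel_elems (e \<sigma> \<cdot> j)"
    proof
      fix t assume "t \<in> kernel_elems (e \<tau>)"
      then have t: "t \<in> Mor C" "Cod C t = Dom C (k \<tau>)" "k \<tau> \<cdot> t \<in> denominator X n \<K> \<tau>" unfolding at(6) by auto
      have "k \<sigma> \<cdot> (j \<cdot> t) = k \<tau> \<cdot> t" using j(2) by (rule comp_cong1) (use j(1) t at(1) in auto)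
      then have "k \<sigma> \<cdot> (j \<cdot> t) \<in> denominator X n \<K> \<sigma>" using t(3) denominator_mono[OF h] by auto
      then have "j \<cdot> t \<in> kernel_elems (e \<sigma>)" unfolding at(6) using j(1) t by simp
      then show "t \<in> kernel_elems (e \<sigma> \<cdot> j)" using j(1) t at(4,5) by (simp add: kernel_elems_iff)
    qed
    then obtain u where "u \<in> Hom C (Cod C (e \<tau>)) (Cod C (e \<sigma>))" "u \<cdot> e \<tau> = e \<sigma> \<cdot> j"
      using regepi_factor[OF at(4)[of \<tau>] ej] by blast
    then have "P \<sigma> \<tau> u" unfolding P_def using j by blast
    then show ?thesis by blast
  qed
  define E where "E = \<lparr>FObj = (\<lambda>\<sigma>. Cod C (e \<sigma>)), FMor = (\<lambda>(\<sigma>, \<tau>). SOME h. P \<sigma> \<tau> h)\<rparr>"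
  have EO: "FObj E \<sigma> = Cod C (e \<sigma>)" for \<sigma> by (simp add: E_def)
  have EM: "P \<sigma> \<tau> (FMor E (\<sigma>, \<tau>))" if "\<sigma> \<in> three_objs n" "\<tau> \<in> three_objs n" "\<sigma> \<le> \<tau>" for \<sigma> \<tau>
    using someI_ex[OF Pex[OF that]] by (simp add: E_def)
  have eO: "Cod C (e \<sigma>) \<in> Obj C" for \<sigma> using at(4)[of \<sigma>] by auto
  have "is_n_sequence C n E" unfolding n_sequence_iff EO
  proof (intro conjI ballI impI)
    fix \<sigma> assume s: "\<sigma> \<in> three_objs n"
    show "Cod C (e \<sigma>) \<in> Obj C" by (rule eO)
    obtain j where j: "FMor E (\<sigma>, \<sigma>) \<in> Hom C (Cod C (e \<sigma>)) (Cod C (e \<sigma>))" "j \<in> Hom C (Dom C (k \<sigma>)) (Dom C (k \<sigma>))"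
      "k \<sigma> \<cdot> j = k \<sigma>" "FMor E (\<sigma>, \<sigma>) \<cdot> e \<sigma> = e \<sigma> \<cdot> j" using EM[OF s s] unfolding P_def by blast
    have "k \<sigma> \<cdot> j = k \<sigma> \<cdot> Ident C (Dom C (k \<sigma>))" using j(3) at(1)[of \<sigma>] by simp
    then have "j = Ident C (Dom C (k \<sigma>))" by (rule monicD[OF _ at(1)]) (use j(2) at(1)[of \<sigma>] in auto)
    then have "FMor E (\<sigma>, \<sigma>) \<cdot> e \<sigma> = Ident C (Cod C (e \<sigma>)) \<cdot> e \<sigma>" using j(4) at(4,5)[of \<sigma>] by simp
    then show "FMor E (\<sigma>, \<sigma>) = Ident C (Cod C (e \<sigma>))"
      by (rule epicD[OF _ regepi_epic[OF at(4)]]) (use j(1) eO[of \<sigma>] in auto)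
    fix \<tau> assume t: "\<tau> \<in> three_objs n" "\<sigma> \<le> \<tau>"
    show "FMor E (\<sigma>, \<tau>) \<in> Hom C (Cod C (e \<tau>)) (Cod C (e \<sigma>))" using EM[OF s t] unfolding P_def by blast
  next
    fix \<rho> \<sigma> \<tau> assume s: "\<rho> \<in> three_objs n" "\<sigma> \<in> three_objs n" "\<tau> \<in> three_objs n" and le: "\<rho> \<le> \<sigma> \<and> \<sigma> \<le> \<tau>"
    have le': "\<rho> \<le> \<tau>" using le by auto
    obtain j1 where j1: "FMor E (\<rho>, \<sigma>) \<in> Hom C (Cod C (e \<sigma>)) (Cod C (e \<rho>))" "j1 \<in> Hom C (Dom C (k \<sigma>)) (Dom C (k \<rho>))"
      "k \<rho> \<cdot> j1 = k \<sigma>" "FMor E (\<rho>, \<sigma>) \<cdot> e \<sigma> = e \<rho> \<cdot> j1"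
      using EM[OF s(1,2)] le unfolding P_def by blast
    obtain j2 where j2: "FMor E (\<sigma>, \<tau>) \<in> Hom C (Cod C (e \<tau>)) (Cod C (e \<sigma>))" "j2 \<in> Hom C (Dom C (k \<tau>)) (Dom C (k \<sigma>))"
      "k \<sigma> \<cdot> j2 = k \<tau>" "FMor E (\<sigma>, \<tau>) \<cdot> e \<tau> = e \<sigma> \<cdot> j2"
      using EM[OF s(2,3)] le unfolding P_def by blast
    obtain j where j: "FMor E (\<rho>, \<tau>) \<in> Hom C (Cod C (e \<tau>)) (Cod C (e \<rho>))" "j \<in> Hom C (Dom C (k \<tau>)) (Dom C (k \<rho>))"
      "k \<rho> \<cdot> j = k \<tau>" "FMor E (\<rho>, \<tau>) \<cdot> e \<tau> = e \<rho> \<cdot> j"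
      using EM[OF s(1,3) le'] unfolding P_def by blast
    have "k \<rho> \<cdot> (j1 \<cdot> j2) = k \<sigma> \<cdot> j2" using j1(3) by (rule comp_cong1) (use j1(2) j2(2) at(1)[of \<rho>] in auto)
    then have "k \<rho> \<cdot> (j1 \<cdot> j2) = k \<rho> \<cdot> j" using j2(3) j(3) by simp
    then have jj: "j1 \<cdot> j2 = j" by (rule monicD[OF _ at(1)]) (use j1(2) j2(2) j(2) in auto)
    have "FMor E (\<rho>, \<sigma>) \<cdot> (e \<sigma> \<cdot> j2) = e \<rho> \<cdot> (j1 \<cdot> j2)"
      using j1(4) by (rule comp_cong) (use j1(1,2) j2(2) at(4,5)[of \<sigma>] at(4,5)[of \<rho>] in auto)
    then have "(FMor E (\<rho>, \<sigma>) \<cdot> FMor E (\<sigma>, \<tau>)) \<cdot> e \<tau> = FMor E (\<rho>, \<tau>) \<cdot> e \<tau>"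
      using j2(4) j(4) jj j1(1) j2(1) at(4)[of \<tau>] by simp
    then have "FMor E (\<rho>, \<sigma>) \<cdot> FMor E (\<sigma>, \<tau>) = FMor E (\<rho>, \<tau>)"
      by (rule epicD[OF _ regepi_epic[OF at(4)[of \<tau>]], where T = "Cod C (e \<rho>)"]) (use j1(1) j2(1) j(1) in auto)
    then show "FMor E (\<rho>, \<tau>) = FMor E (\<rho>, \<sigma>) \<cdot> FMor E (\<sigma>, \<tau>)" by simp
  qed
  note seq = this
  have "resolves X n \<K> E k e" unfolding resolves_def
  proof (intro conjI ballI impI)
    fix \<sigma> \<tau> assume "\<sigma> \<in> three_objs n" "\<tau> \<in> three_objs n" "\<sigma> \<le> \<tau>"
    from EM[OF this, unfolded P_def, THEN conjunct2]
    show "\<exists>j\<in>Hom C (Dom C (k \<tau>)) (Dom C (k \<sigma>)). k \<sigma> \<cdot> j = k \<tau> \<and> FMor E (\<sigma>, \<tau>) \<cdot> e \<tau> = e \<sigma> \<cdot> j" .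
  qed (use seq ke EO in auto)
  then show ?thesis using one by (rule that)
qed

end

text \<open>If no coordinate is 0, nothing is divided out, so \<open>e \<sigma>\<close> is
  invertible and the morphism from \<open>E \<sigma>\<close> to \<open>X\<close> represents the same
  subobject as \<open>k \<sigma>\<close>. The cokernels are provided by
  \<open>res_cokernel\<close>.\<close>

lemma resolves_meets_then_cokernels:
  assumes X: "X \<in> Obj C" and K: "\<And>i. i < n \<Longrightarrow> K i \<in> carrier (NSub C X)"
    and res: "resolves X n (\<lambda>j. sieve (K j)) E k e"
    and one: "k (ones n) = Ident C X" "e (ones n) = Ident C X"
  shows "meets_then_cokernels C n X K E"
proof -
  have Kn: "\<forall>j<n. sieve (K j) \<in> normal_sets X" using K by (simp add: NSub_carrier)
  note seq = res_seq[OF X Kn res]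
  note at = res_at[OF X Kn res]
  show ?thesis unfolding meets_then_cokernels_def
  proof (intro conjI ballI allI impI)
    show "is_n_sequence C n E" by (rule res_seq[OF X Kn res])
    show "FObj E (ones n) = X" using at(6)[OF ones_three_objs] one(2) X by simp
    fix \<sigma> assume s: "\<sigma> \<in> three_objs n" "\<forall>i<n. \<sigma> i \<noteq> 0"
    have le: "ones n \<le> \<sigma>" using s by (auto simp: le_fun_def ones_def Suc_le_eq)
    obtain j where j: "j \<in> Hom C (Dom C (k \<sigma>)) (Dom C (k (ones n)))" "k (ones n) \<cdot> j = k \<sigma>"
      "FMor E (ones n, \<sigma>) \<cdot> e \<sigma> = e (ones n) \<cdot> j"
      by (rule res_nat[OF X Kn res ones_three_objs s(1) le])
    define h where "h = FMor E (ones n, \<sigma>)"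
    note es = res_at[OF X Kn res s(1)]
    have hH: "h \<in> Hom C (FObj E \<sigma>) X"
      using n_sequenceD(1)[OF res_seq[OF X Kn res] ones_three_objs s(1) le] res_at(6)[OF X Kn res ones_three_objs] one(2) X
      unfolding h_def by simp
    have he: "h \<cdot> e \<sigma> = k \<sigma>" using j one X unfolding h_def by simp
    have "zeros n \<sigma> = {}" using s by (auto simp: zeros_def)
    then have N: "denominator X n (\<lambda>j. sieve (K j)) \<sigma> = zero_elems X" using normal_join_empty[OF X] by (simp add: denominator_def)
    have "monic (e \<sigma>)"
    proof (rule monic_if_kernel_elems_trivial)
      fix t assume "t \<in> kernel_elems (e \<sigma>)"
      then have t: "t \<in> Mor C" "Cod C t = Dom C (k \<sigma>)" "k \<sigma> \<cdot> t \<in> zero_elems X" unfolding es(7) N by auto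
      have "k \<sigma> \<cdot> t = zero_mor (Dom C t) X" using t(3) unfolding zero_elems_iff[OF X] using t(1,2) es(1) by simp
      then have "k \<sigma> \<cdot> t = k \<sigma> \<cdot> zero_mor (Dom C t) (Dom C (k \<sigma>))" using es(1,2) t(1) by simp
      then have "t = zero_mor (Dom C t) (Dom C (k \<sigma>))" by (rule monicD[OF _ es(1)]) (use t es(1) in auto)
      then show "t = zero_mor (Dom C t) (Dom C (e \<sigma>))" using es(5) by simp
    qed (use es in auto)
    then have "is_iso C (e \<sigma>)" using regepi_monic_is_iso es(4) by blast
    then obtain g where g: "g \<in> Hom C (Cod C (e \<sigma>)) (Dom C (e \<sigma>))" "g \<cdot> e \<sigma> = Ident C (Dom C (e \<sigma>))"
      "e \<sigma> \<cdot> g = Ident C (Cod C (e \<sigma>))" by (rule iso_obtain)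
    have "is_iso C g" unfolding is_iso_def using g es(4) by (auto intro!: bexI[of _ "e \<sigma>"])
    then have mg: "monic g" by (rule iso_monic)
    have "h \<cdot> (e \<sigma> \<cdot> g) = k \<sigma> \<cdot> g" using he by (rule comp_cong1) (use hH g(1) es in auto)
    then have hk: "h = k \<sigma> \<cdot> g" using g(3) hH es(6) by simp
    have mh: "monic h" unfolding hk by (rule monic_comp[OF mg es(1)]) (use g(1) es(5) in simp)
    have "sieve h = sieve (k \<sigma>)"
    proof
      have 1: "h \<in> sieve (k \<sigma>)" by (rule sieveI[of "k \<sigma>" g]) (use hk g(1) es in auto)
      show "sieve h \<subseteq> sieve (k \<sigma>)" using 1 by (subst sieve_subset_iff) (use hH es in auto)
      have 2: "k \<sigma> \<in> sieve h" by (rule sieveI[of h "e \<sigma>"]) (use he hH es in auto)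
      show "sieve (k \<sigma>) \<subseteq> sieve h" using 2 by (subst sieve_subset_iff) (use hH es in auto)
    qed
    then have sh: "sieve h = meet_elems X (\<lambda>j. sieve (K j)) (twos n \<sigma>)" using es(3) by simp
    have mtn: "meet_elems X (\<lambda>j. sieve (K j)) (twos n \<sigma>) \<in> normal_sets X"
      by (rule meet_elems_normal_sets[OF X finite_twos]) (simp add: Kn twos_def)
    have eq: "{t \<in> elems X. \<forall>a\<in>K ` {i. i < n \<and> \<sigma> i = 2}. t \<in> sieve a} = meet_elems X (\<lambda>j. sieve (K j)) (twos n \<sigma>)"
      by (auto simp: meet_elems_def twos_def)
    have sub: "K ` {i. i < n \<and> \<sigma> i = 2} \<subseteq> carrier (NSub C X)" using K by auto
    show "greatest (NSub C X) (FMor E (ones n, \<sigma>)) (Lower (NSub C X) (K ` {i. i < n \<and> \<sigma> i = 2}))"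
      using NSub_greatest[OF sub, unfolded eq, OF mtn] mh sh mtn hH unfolding h_def by (simp add: NSub_carrier)
  next
    fix i \<sigma> assume "i < n" "\<sigma> \<in> three_objs n"
    then show "is_cokernel C (seq_edge E i \<sigma> 1 0) (seq_edge E i \<sigma> 2 1)"
      by (rule res_cokernel[OF X Kn res])
  qed
qed

text \<open>The object from which \<sigma> is reached by taking cokernels only. It carries the meet
  of which \<open>E \<sigma>\<close> is to be a quotient.\<close>

definition zeros_to_ones :: "nat \<Rightarrow> (nat \<Rightarrow> nat) \<Rightarrow> nat \<Rightarrow> nat" where
  "zeros_to_ones n \<sigma> = (\<lambda>i. if i < n \<and> \<sigma> i = 0 then 1 else \<sigma> i)"

lemma zeros_to_ones_three_objs: "\<sigma> \<in> three_objs n \<Longrightarrow> zeros_to_ones n \<sigma> \<in> three_objs n"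
  by (auto simp: zeros_to_ones_def three_objs_def)

lemma zeros_to_ones_ge: "\<sigma> \<le> zeros_to_ones n \<sigma>" "\<sigma> \<in> three_objs n \<Longrightarrow> ones n \<le> zeros_to_ones n \<sigma>"
  by (auto simp: zeros_to_ones_def le_fun_def ones_def three_objs_def Suc_le_eq)

lemma zeros_to_ones_mono: "\<sigma> \<le> \<tau> \<Longrightarrow> zeros_to_ones n \<sigma> \<le> zeros_to_ones n \<tau>"
proof -
  assume h: "\<sigma> \<le> \<tau>"
  have le: "\<sigma> i \<le> \<tau> i" for i using h by (auto simp: le_fun_def)
  have "zeros_to_ones n \<sigma> i \<le> zeros_to_ones n \<tau> i" for i
    using le[of i] by (cases "\<tau> i = 0") (auto simp: zeros_to_ones_def)
  then show ?thesis by (simp add: le_fun_def)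
qed

lemma twos_up: "twos n (zeros_to_ones n \<sigma>) = twos n \<sigma>"
  by (auto simp: twos_def zeros_to_ones_def)

text \<open>In a given diagram the inclusions and the quotient maps are morphisms of
  \<open>E\<close> itself, through \<open>zeros_to_ones\<close>. What has to be found is the kernel
  of each quotient map, and it grows by one member of the join with each cokernel taken.\<close>

lemma three_diagram_resolves:
  assumes X: "X \<in> Obj C" and K: "\<And>i. i < n \<Longrightarrow> K i \<in> carrier (NSub C X)"
    and mtc: "meets_then_cokernels C n X K E" and diag: "is_3n_diagram C n E"
  shows "resolves X n (\<lambda>j. sieve (K j)) E (\<lambda>\<sigma>. FMor E (ones n, zeros_to_ones n \<sigma>)) (\<lambda>\<sigma>. FMor E (\<sigma>, zeros_to_ones n \<sigma>))"
proof -
  let ?K = "\<lambda>j. sieve (K j)"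
  have Kn: "\<forall>j<n. sieve (K j) \<in> normal_sets X" using K by (simp add: NSub_carrier)
  define k where "k = (\<lambda>\<sigma>. FMor E (ones n, zeros_to_ones n \<sigma>))"
  define e where "e = (\<lambda>\<sigma>. FMor E (\<sigma>, zeros_to_ones n \<sigma>))"
  have seq: "is_n_sequence C n E" using diag by (simp add: is_3n_diagram_def)
  note D = n_sequenceD[OF seq]
  have oneX: "FObj E (ones n) = X" using mtc by (simp add: meets_then_cokernels_def)
  have kH: "k \<sigma> \<in> Hom C (FObj E (zeros_to_ones n \<sigma>)) X" if "\<sigma> \<in> three_objs n" for \<sigma>
    using D(1)[OF ones_three_objs zeros_to_ones_three_objs[OF that] zeros_to_ones_ge(2)[OF that]] oneX by (simp add: k_def)
  have eH: "e \<sigma> \<in> Hom C (FObj E (zeros_to_ones n \<sigma>)) (FObj E \<sigma>)" if "\<sigma> \<in> three_objs n" for \<sigma>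
    using D(1)[OF that zeros_to_ones_three_objs[OF that] zeros_to_ones_ge(1)] by (simp add: e_def)
  have kat: "monic (k \<sigma>) \<and> sieve (k \<sigma>) = meet_elems X ?K (twos n \<sigma>)" if s: "\<sigma> \<in> three_objs n" for \<sigma>
  proof -
    have "\<forall>i<n. zeros_to_ones n \<sigma> i \<noteq> 0" by (auto simp: zeros_to_ones_def)
    then have g: "greatest (NSub C X) (k \<sigma>) (Lower (NSub C X) (K ` {i. i < n \<and> zeros_to_ones n \<sigma> i = 2}))"
      using mtc zeros_to_ones_three_objs[OF s] unfolding meets_then_cokernels_def k_def by blast
    have mtn: "meet_elems X ?K (twos n (zeros_to_ones n \<sigma>)) \<in> normal_sets X"
      by (rule meet_elems_normal_sets[OF X finite_twos]) (simp add: Kn twos_def)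
    have eq: "{t \<in> elems X. \<forall>a\<in>K ` {i. i < n \<and> zeros_to_ones n \<sigma> i = 2}. t \<in> sieve a} = meet_elems X ?K (twos n (zeros_to_ones n \<sigma>))"
      by (auto simp: meet_elems_def twos_def)
    have sub: "K ` {i. i < n \<and> zeros_to_ones n \<sigma> i = 2} \<subseteq> carrier (NSub C X)" using K by auto
    show ?thesis using NSub_greatest[OF sub, unfolded eq, OF mtn] g by (simp add: NSub_carrier twos_up)
  qed
  have nat: "\<exists>j \<in> Hom C (Dom C (k \<tau>)) (Dom C (k \<sigma>)). k \<sigma> \<cdot> j = k \<tau> \<and> FMor E (\<sigma>, \<tau>) \<cdot> e \<tau> = e \<sigma> \<cdot> j"
    if s: "\<sigma> \<in> three_objs n" "\<tau> \<in> three_objs n" "\<sigma> \<le> \<tau>" for \<sigma> \<tau>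
  proof -
    note u = zeros_to_ones_three_objs[OF s(1)] zeros_to_ones_three_objs[OF s(2)] zeros_to_ones_mono[OF s(3), of n]
    show ?thesis
    proof (intro bexI[of _ "FMor E (zeros_to_ones n \<sigma>, zeros_to_ones n \<tau>)"] conjI)
      show "FMor E (zeros_to_ones n \<sigma>, zeros_to_ones n \<tau>) \<in> Hom C (Dom C (k \<tau>)) (Dom C (k \<sigma>))"
        using D(1)[OF u] kH s by simp
      show "k \<sigma> \<cdot> FMor E (zeros_to_ones n \<sigma>, zeros_to_ones n \<tau>) = k \<tau>" unfolding k_def
        by (rule D(4)[OF ones_three_objs u(1,2) zeros_to_ones_ge(2)[OF s(1)] u(3)])
      show "FMor E (\<sigma>, \<tau>) \<cdot> e \<tau> = e \<sigma> \<cdot> FMor E (zeros_to_ones n \<sigma>, zeros_to_ones n \<tau>)"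
        using D(4)[OF s(1,2) u(2) s(3) zeros_to_ones_ge(1)] D(4)[OF s(1) u(1,2) zeros_to_ones_ge(1) u(3)] by (simp add: e_def)
    qed
  qed
  have eat: "regepi (e \<sigma>) \<and> (\<forall>t. t \<in> kernel_elems (e \<sigma>) \<longleftrightarrow> t \<in> Mor C \<and> Cod C t = Dom C (k \<sigma>) \<and> k \<sigma> \<cdot> t \<in> denominator X n ?K \<sigma>)"
    if "\<sigma> \<in> three_objs n" for \<sigma>
    using that
  proof (induction "card (zeros n \<sigma>)" arbitrary: \<sigma>)
    case 0
    then have "zeros n \<sigma> = {}" by simp
    then have zeros_to_ones: "zeros_to_ones n \<sigma> = \<sigma>" by (auto simp: zeros_to_ones_def zeros_def)
    have N: "denominator X n ?K \<sigma> = zero_elems X" using normal_join_empty[OF X] \<open>zeros n \<sigma> = {}\<close> by (simp add: denominator_def)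
    have s: "\<sigma> \<in> three_objs n" by fact
    have e: "e \<sigma> = Ident C (FObj E \<sigma>)" unfolding e_def zeros_to_ones by (rule D(3)[OF s])
    have O: "FObj E \<sigma> \<in> Obj C" by (rule D(2)[OF s])
    have k: "k \<sigma> \<in> Hom C (FObj E \<sigma>) X" "monic (k \<sigma>)" using kH[OF s] zeros_to_ones kat[OF s] by auto
    have "t \<in> kernel_elems (e \<sigma>) \<longleftrightarrow> t \<in> Mor C \<and> Cod C t = Dom C (k \<sigma>) \<and> k \<sigma> \<cdot> t \<in> denominator X n ?K \<sigma>" for t
    proof
      assume "t \<in> kernel_elems (e \<sigma>)"
      then have t: "t \<in> Mor C" "Cod C t = FObj E \<sigma>" "t = zero_mor (Dom C t) (FObj E \<sigma>)"
        unfolding e using O by (auto simp: kernel_elems_iff)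
      have "k \<sigma> \<cdot> zero_mor (Dom C t) (FObj E \<sigma>) = zero_mor (Dom C t) X" using k(1) t(1) by simp
      then have "k \<sigma> \<cdot> t = zero_mor (Dom C t) X" using t(3) by simp
      then show "t \<in> Mor C \<and> Cod C t = Dom C (k \<sigma>) \<and> k \<sigma> \<cdot> t \<in> denominator X n ?K \<sigma>"
        unfolding N zero_elems_iff[OF X] using t(1,2) k(1) X by simp
    next
      assume t: "t \<in> Mor C \<and> Cod C t = Dom C (k \<sigma>) \<and> k \<sigma> \<cdot> t \<in> denominator X n ?K \<sigma>"
      then have z: "k \<sigma> \<cdot> t = zero_mor (Dom C (k \<sigma> \<cdot> t)) X" unfolding N zero_elems_iff[OF X] by blast
      have d: "Dom C (k \<sigma> \<cdot> t) = Dom C t" using t k(1) by simp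
      have "k \<sigma> \<cdot> t = zero_mor (Dom C t) X" using z unfolding d .
      then have "k \<sigma> \<cdot> t = k \<sigma> \<cdot> zero_mor (Dom C t) (FObj E \<sigma>)" using k(1) t by simp
      then have "t = zero_mor (Dom C t) (FObj E \<sigma>)" by (rule monicD[OF _ k(2), where T = "Dom C t"]) (use t k(1) O in auto)
      then show "t \<in> kernel_elems (e \<sigma>)" unfolding e using t k(1) O by (simp add: kernel_elems_iff)
    qed
    then show ?case using e regepi_Ident[OF O] by auto
  next
    case (Suc m)
    have s: "\<sigma> \<in> three_objs n" by fact
    have "zeros n \<sigma> \<noteq> {}" using Suc(2) by auto
    then obtain i where i: "i < n" "\<sigma> i = 0" by (auto simp: zeros_def)
    have s0: "\<sigma>(i := 0) = \<sigma>" using i by auto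
    \<comment> \<open>Both neighbours of \<sigma> in direction \<open>i\<close> have one zero less,
      so their kernels are known. Short exactness in this direction then determines the kernel of
      \<open>e \<sigma>\<close>, as \<open>e \<sigma>\<close> is
      \<open>u \<cdot> e \<tau>\<close>.\<close>
    define \<tau> where "\<tau> = \<sigma>(i := 1)"
    define \<tau>2 where "\<tau>2 = \<sigma>(i := 2)"
    have t: "\<tau> \<in> three_objs n" "\<tau>2 \<in> three_objs n" unfolding \<tau>_def \<tau>2_def using three_objs_upd[OF s i(1)] by auto
    have "zeros n \<sigma> = insert i (zeros n \<tau>)" "i \<notin> zeros n \<tau>" "zeros n \<tau>2 = zeros n \<tau>"
      using twos_zeros_upd[OF i(1), of \<sigma>] s0 unfolding \<tau>_def \<tau>2_def by auto
    then have card: "m = card (zeros n \<tau>)" "m = card (zeros n \<tau>2)" using Suc(2) by auto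
    note e1 = Suc(1)[OF card(1) t(1)] and e2 = Suc(1)[OF card(2) t(2)]
    have le: "\<sigma> \<le> \<tau>" "\<tau> \<le> \<tau>2" unfolding \<tau>_def \<tau>2_def using upd_le[of 0 1 \<sigma> i] s0 by (auto intro: upd_le)
    have upt: "zeros_to_ones n \<tau> = zeros_to_ones n \<sigma>" using i by (auto simp: zeros_to_ones_def \<tau>_def)
    have keq: "k \<tau> = k \<sigma>" by (simp add: k_def upt)
    define u where "u = FMor E (\<sigma>, \<tau>)"
    define h where "h = FMor E (\<tau>, \<tau>2)"
    have "is_short_exact C (seq_edge E i \<sigma> 2 1) (seq_edge E i \<sigma> 1 0)"
      using diag i(1) s unfolding is_3n_diagram_def by blast
    then have "is_short_exact C h u" by (simp only: seq_edge_def s0 u_def h_def \<tau>_def \<tau>2_def)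
    then have se: "regepi u" "monic h" "sieve h = kernel_elems u" unfolding short_exact_iff by auto
    have uH: "u \<in> Hom C (FObj E \<tau>) (FObj E \<sigma>)" unfolding u_def by (rule D(1)[OF s t(1) le(1)])
    have hH: "h \<in> Hom C (FObj E \<tau>2) (FObj E \<tau>)" unfolding h_def by (rule D(1)[OF t le(2)])
    have ecomp: "e \<sigma> = u \<cdot> e \<tau>" unfolding e_def u_def upt
      by (rule D(4)[OF s t(1) zeros_to_ones_three_objs[OF s] le(1), symmetric]) (use zeros_to_ones_ge(1)[of \<tau> n] upt in simp)
    have es: "e \<tau> \<in> Hom C (FObj E (zeros_to_ones n \<sigma>)) (FObj E \<tau>)" using eH[OF t(1)] upt by simp
    have ks: "k \<sigma> \<in> Hom C (FObj E (zeros_to_ones n \<sigma>)) X" "monic (k \<sigma>)" using kH[OF s] kat[OF s] by auto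
    have e2H: "e \<tau>2 \<in> Hom C (Dom C (k \<tau>2)) (FObj E \<tau>2)" "k \<tau>2 \<in> Hom C (Dom C (k \<tau>2)) X"
      "sieve (k \<tau>2) = meet_elems X ?K (twos n \<tau>2)" using eH[OF t(2)] kH[OF t(2)] kat[OF t(2)] by auto
    obtain j2 where j2: "j2 \<in> Hom C (Dom C (k \<tau>2)) (Dom C (k \<tau>))" "k \<tau> \<cdot> j2 = k \<tau>2" "h \<cdot> e \<tau>2 = e \<tau> \<cdot> j2"
      using nat[OF t le(2)] unfolding h_def by blast
    have j2H: "j2 \<in> Hom C (Dom C (k \<tau>2)) (FObj E (zeros_to_ones n \<sigma>))" using j2(1) keq ks by simp
    obtain p where p: "regepi p" "Dom C p = X" "denominator X n ?K \<tau> = kernel_elems p"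
      using denominator_normal_sets[OF X Kn] by (rule normal_sets_regepi)
    have NNs: "denominator X n ?K \<sigma> = local_join p (meet_elems X ?K (twos n \<tau>2))"
    proof -
      have "denominator X n ?K (\<sigma>(i := 0)) = local_join p (meet_elems X ?K (twos n (\<sigma>(i := 2))))"
        by (rule denominator_local_join[OF X Kn i(1) p(1,2)]) (use p(3) \<tau>_def in auto)
      then show ?thesis unfolding s0 \<tau>2_def .
    qed
    have cmp: "e \<tau> \<cdot> x = e \<tau> \<cdot> y \<longleftrightarrow> p \<cdot> (k \<sigma> \<cdot> x) = p \<cdot> (k \<sigma> \<cdot> y)"
      if "x \<in> Hom C T (FObj E (zeros_to_ones n \<sigma>))" "y \<in> Hom C T (FObj E (zeros_to_ones n \<sigma>))" for x y T
      by (rule quotient_eq_iff[where T = T]) (use ks p e1 es keq that in auto)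
    have "t \<in> kernel_elems (e \<sigma>) \<longleftrightarrow> t \<in> Mor C \<and> Cod C t = Dom C (k \<sigma>) \<and> k \<sigma> \<cdot> t \<in> denominator X n ?K \<sigma>" for t
    proof
      \<comment> \<open>Exactness puts \<open>e \<tau> \<cdot> t\<close> into the image of
        \<open>h\<close>. A preimage in the meet at \<tau>2, found on a cover, is congruent to
        \<open>k \<sigma> \<cdot> t\<close> modulo the denominator at \<tau>, as
        \<open>local_join\<close> requires.\<close>
      assume "t \<in> kernel_elems (e \<sigma>)"
      then have t': "t \<in> Mor C" "Cod C t = FObj E (zeros_to_ones n \<sigma>)" "u \<cdot> (e \<tau> \<cdot> t) = zero_mor (Dom C t) (FObj E \<sigma>)"
        unfolding ecomp using es uH by (auto simp: kernel_elems_iff)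
      have "e \<tau> \<cdot> t \<in> kernel_elems u" by (rule kernel_elemsI) (use t' es uH in auto)
      then have "e \<tau> \<cdot> t \<in> sieve h" using se(3) by simp
      then obtain y where y: "y \<in> Hom C (Dom C (e \<tau> \<cdot> t)) (Dom C h)" "h \<cdot> y = e \<tau> \<cdot> t" by (rule sieveE)
      have yH: "y \<in> Hom C (Dom C t) (FObj E \<tau>2)" using y(1) t' es hH by simp
      obtain T e' w where l: "regepi e'" "e' \<in> Hom C T (Dom C y)" "w \<in> Hom C T (Dom C (e \<tau>2))" "e \<tau>2 \<cdot> w = y \<cdot> e'"
        by (rule regepi_lift[of "e \<tau>2" y]) (use e2 yH e2H in auto)
      have e': "e' \<in> Hom C T (Dom C t)" and w: "w \<in> Hom C T (Dom C (k \<tau>2))" using l yH e2H by auto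
      have "e \<tau> \<cdot> (t \<cdot> e') = h \<cdot> (y \<cdot> e')" using y(2)[symmetric] by (rule comp_cong) (use t' e' es hH yH in auto)
      also have "\<dots> = h \<cdot> (e \<tau>2 \<cdot> w)" using l(4) by simp
      also have "\<dots> = e \<tau> \<cdot> (j2 \<cdot> w)" using j2(3) by (rule comp_cong) (use w e2H hH j2H es in auto)
      finally have "p \<cdot> (k \<sigma> \<cdot> (t \<cdot> e')) = p \<cdot> (k \<sigma> \<cdot> (j2 \<cdot> w))"
        using cmp[of "t \<cdot> e'" T "j2 \<cdot> w"] t' e' w j2H by simp
      moreover have "k \<sigma> \<cdot> (j2 \<cdot> w) = k \<tau>2 \<cdot> w" using j2(2)[unfolded keq] by (rule comp_cong1) (use w j2H ks in auto)
      ultimately have 1: "p \<cdot> ((k \<sigma> \<cdot> t) \<cdot> e') = p \<cdot> (k \<tau>2 \<cdot> w)" using t' e' ks p by simp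
      have 2: "k \<tau>2 \<cdot> w \<in> meet_elems X ?K (twos n \<tau>2)" using sieveI[of "k \<tau>2" w] w e2H by auto
      have "k \<sigma> \<cdot> t \<in> local_join p (meet_elems X ?K (twos n \<tau>2))"
        by (rule local_joinI[OF _ _ l(1) _ 2 _ 1]) (use t' ks p e' w e2H in auto)
      then show "t \<in> Mor C \<and> Cod C t = Dom C (k \<sigma>) \<and> k \<sigma> \<cdot> t \<in> denominator X n ?K \<sigma>" using t' ks NNs by simp
    next
      assume "t \<in> Mor C \<and> Cod C t = Dom C (k \<sigma>) \<and> k \<sigma> \<cdot> t \<in> denominator X n ?K \<sigma>"
      then have t': "t \<in> Mor C" "Cod C t = FObj E (zeros_to_ones n \<sigma>)" "k \<sigma> \<cdot> t \<in> local_join p (meet_elems X ?K (twos n \<tau>2))"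
        using ks NNs by auto
      from t'(3) obtain e' a where a: "regepi e'" "Cod C e' = Dom C (k \<sigma> \<cdot> t)" "a \<in> meet_elems X ?K (twos n \<tau>2)"
        "Dom C a = Dom C e'" "p \<cdot> ((k \<sigma> \<cdot> t) \<cdot> e') = p \<cdot> a" by (rule local_joinE)
      have e': "e' \<in> Hom C (Dom C e') (Dom C t)" using a(1,2) t' ks by simp
      have "a \<in> sieve (k \<tau>2)" using a(3) e2H by simp
      then obtain w where w: "w \<in> Hom C (Dom C a) (Dom C (k \<tau>2))" "k \<tau>2 \<cdot> w = a" by (rule sieveE)
      have wH: "w \<in> Hom C (Dom C e') (Dom C (k \<tau>2))" using w(1) a(4) by simp
      have "k \<sigma> \<cdot> (j2 \<cdot> w) = k \<tau>2 \<cdot> w" using j2(2)[unfolded keq] by (rule comp_cong1) (use wH j2H ks in auto)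
      then have "p \<cdot> (k \<sigma> \<cdot> (t \<cdot> e')) = p \<cdot> (k \<sigma> \<cdot> (j2 \<cdot> w))" using a(5) w(2) t' e' ks p by simp
      then have "e \<tau> \<cdot> (t \<cdot> e') = e \<tau> \<cdot> (j2 \<cdot> w)"
        using cmp[of "t \<cdot> e'" "Dom C e'" "j2 \<cdot> w"] t' e' wH j2H by simp
      also have "\<dots> = h \<cdot> (e \<tau>2 \<cdot> w)" using j2(3)[symmetric] by (rule comp_cong) (use wH e2H hH j2H es in auto)
      finally have eh: "e \<tau> \<cdot> (t \<cdot> e') = h \<cdot> (e \<tau>2 \<cdot> w)" .
      have "h \<in> kernel_elems u" using se(2,3) sieve_self[of h] by auto
      then have "h \<cdot> (e \<tau>2 \<cdot> w) \<in> kernel_elems u" by (rule kernel_elems_comp) (use uH hH e2H wH in auto)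
      then have "e \<tau> \<cdot> (t \<cdot> e') \<in> kernel_elems u" using eh by simp
      then have "u \<cdot> (e \<tau> \<cdot> (t \<cdot> e')) = zero_mor (Dom C e') (FObj E \<sigma>)" using t' e' es uH by (auto simp: kernel_elems_iff)
      then have "t \<cdot> e' \<in> kernel_elems (e \<sigma>)" unfolding ecomp using t' e' es uH by (intro kernel_elemsI) auto
      then show "t \<in> kernel_elems (e \<sigma>)" by (rule kernel_elems_regepi[OF _ a(1)]) (use t' e' es uH ecomp in auto)
    qed
    moreover have "regepi (e \<sigma>)" unfolding ecomp by (rule regepi_comp) (use e1 se(1) es uH in auto)
    ultimately show ?case by blast
  qed
  have "resolves X n ?K E k e" unfolding resolves_def resolves_at_def
  proof (intro conjI ballI impI)
    fix \<sigma> assume s: "\<sigma> \<in> three_objs n"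
    show "kernel_elems (e \<sigma>) = {t \<in> Mor C. Cod C t = Dom C (k \<sigma>) \<and> k \<sigma> \<cdot> t \<in> denominator X n ?K \<sigma>}"
      using eat[OF s] by blast
    show "monic (k \<sigma>)" "sieve (k \<sigma>) = meet_elems X ?K (twos n \<sigma>)" "regepi (e \<sigma>)" "Cod C (k \<sigma>) = X"
      "Dom C (e \<sigma>) = Dom C (k \<sigma>)" "Cod C (e \<sigma>) = FObj E \<sigma>"
      using kat[OF s] eat[OF s] kH[OF s] eH[OF s] by auto
  qed (use seq nat in auto)
  then show ?thesis unfolding k_def e_def .
qed

text \<open>Both directions pass through \<open>resolves\<close>: an arbitrary diagram
  \<open>E\<close> resolves and has monic edges, and conversely the constructed sequence of
  quotients is exact once the inclusions hold.\<close>

theorem exists_three_diagram_iff: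
  assumes X: "X \<in> Obj C" and K: "\<And>i. i < n \<Longrightarrow> K i \<in> carrier (NSub C X)"
  shows "(\<exists>E. meets_then_cokernels C n X K E \<and> is_3n_diagram C n E) \<longleftrightarrow> exact_distributive X n (\<lambda>j. sieve (K j))"
proof
  have Kn: "\<forall>j<n. sieve (K j) \<in> normal_sets X" using K by (simp add: NSub_carrier)
  assume "\<exists>E. meets_then_cokernels C n X K E \<and> is_3n_diagram C n E"
  then obtain E where E: "meets_then_cokernels C n X K E" "is_3n_diagram C n E" by blast
  show "exact_distributive X n (\<lambda>j. sieve (K j))"
  proof (rule res_exact_distributive[OF X Kn three_diagram_resolves[OF X K E]])
    fix i \<sigma> assume "i < n" "\<sigma> \<in> three_objs n"
    then have "is_short_exact C (seq_edge E i \<sigma> 2 1) (seq_edge E i \<sigma> 1 0)"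
      using E(2) unfolding is_3n_diagram_def by blast
    then show "monic (FMor E (\<sigma>(i := 1), \<sigma>(i := 2)))" unfolding short_exact_iff seq_edge_def by blast
  qed
next
  have Kn: "\<forall>j<n. sieve (K j) \<in> normal_sets X" using K by (simp add: NSub_carrier)
  assume d: "exact_distributive X n (\<lambda>j. sieve (K j))"
  obtain E k e where E: "resolves X n (\<lambda>j. sieve (K j)) E k e" "k (ones n) = Ident C X" "e (ones n) = Ident C X"
    by (rule resolves_exists[OF X Kn])
  have "meets_then_cokernels C n X K E" by (rule resolves_meets_then_cokernels[OF X K E])
  moreover have "is_3n_diagram C n E" unfolding is_3n_diagram_def
  proof (intro conjI allI impI ballI)
    show "is_n_sequence C n E" by (rule res_seq[OF X Kn E(1)])
    fix i \<sigma> assume "i < n" "\<sigma> \<in> three_objs n"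
    then show "is_short_exact C (seq_edge E i \<sigma> 2 1) (seq_edge E i \<sigma> 1 0)"
      by (rule res_short_exact[OF X Kn E(1) _ _ d])
  qed
  ultimately show "\<exists>E. meets_then_cokernels C n X K E \<and> is_3n_diagram C n E" by blast
qed

end


section \<open>Cubes in iterated arrow categories\<close>

lemma Arr_pow_simps [simp]:
  "Arr_pow C 0 = base_cat C" "Arr_pow C (Suc n) = arrow_cat (Arr_pow C n)"
  by (simp_all add: Arr_pow_def)

lemma base_cat_simps [simp]:
  "Obj (base_cat C) = Ob ` Obj C" "Mor (base_cat C) = Ar ` Mor C"
  "Dom (base_cat C) x = Ob (Dom C (un_Ar x))" "Cod (base_cat C) x = Ob (Cod C (un_Ar x))"
  "Ident (base_cat C) y = Ar (Ident C (un_Ob y))" "z \<cdot>\<^bsub>base_cat C\<^esub> x = Ar (un_Ar z \<cdot>\<^bsub>C\<^esub> un_Ar x)"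
  by (simp_all add: base_cat_def)

lemma arrow_cat_simps [simp]:
  "Obj (arrow_cat D) = Mor D"
  "Dom (arrow_cat D) = sq_src" "Cod (arrow_cat D) = sq_trg"
  "Ident (arrow_cat D) f = Sq f f (Ident D (Dom D f)) (Ident D (Cod D f))"
  "y \<cdot>\<^bsub>arrow_cat D\<^esub> x = Sq (sq_src x) (sq_trg y) (sq_fst y \<cdot>\<^bsub>D\<^esub> sq_fst x) (sq_snd y \<cdot>\<^bsub>D\<^esub> sq_snd x)"
  by (simp_all add: arrow_cat_def)

lemma Sq_in_Mor_arrow_cat [simp]:
  "Sq f g a b \<in> Mor (arrow_cat D) \<longleftrightarrow> f \<in> Mor D \<and> g \<in> Mor D \<and>
     a \<in> Hom D (Dom D f) (Dom D g) \<and> b \<in> Hom D (Cod D f) (Cod D g) \<and> g \<cdot>\<^bsub>D\<^esub> a = b \<cdot>\<^bsub>D\<^esub> f"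
  by (auto simp: arrow_cat_def)

lemma Mor_arrow_cat_cases:
  assumes "x \<in> Mor (arrow_cat D)"
  obtains f g a b where "x = Sq f g a b" "f \<in> Mor D" "g \<in> Mor D"
    "a \<in> Hom D (Dom D f) (Dom D g)" "b \<in> Hom D (Cod D f) (Cod D g)" "g \<cdot>\<^bsub>D\<^esub> a = b \<cdot>\<^bsub>D\<^esub> f"
  using assms unfolding arrow_cat_def by auto

lemma category_base_cat: "category C \<Longrightarrow> category (base_cat C)"
proof -
  assume "category C"
  then interpret category C .
  show ?thesis by unfold_locales auto
qed

lemma category_arrow_cat:
  fixes D :: "('o, 'm) cell_cat"
  assumes "category D"
  shows "category (arrow_cat D)"
proof -
  interpret D: category D by fact
  show ?thesis
  proof
    fix f assume "f \<in> Mor (arrow_cat D)"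
    then show "Dom (arrow_cat D) f \<in> Obj (arrow_cat D)" "Cod (arrow_cat D) f \<in> Obj (arrow_cat D)"
      by (auto elim: Mor_arrow_cat_cases)
  next
    fix a assume "a \<in> Obj (arrow_cat D)"
    then show "Ident (arrow_cat D) a \<in> Hom (arrow_cat D) a a" by auto
  next
    fix f g a b c
    assume f: "f \<in> Hom (arrow_cat D) a b" and g: "g \<in> Hom (arrow_cat D) b c"
    obtain f1 f0 where f': "f = Sq a b f1 f0" "a \<in> Mor D" "b \<in> Mor D"
      "f1 \<in> Hom D (Dom D a) (Dom D b)" "f0 \<in> Hom D (Cod D a) (Cod D b)" "b \<cdot>\<^bsub>D\<^esub> f1 = f0 \<cdot>\<^bsub>D\<^esub> a"
      using f by (auto elim: Mor_arrow_cat_cases)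
    obtain g1 g0 where g': "g = Sq b c g1 g0" "c \<in> Mor D"
      "g1 \<in> Hom D (Dom D b) (Dom D c)" "g0 \<in> Hom D (Cod D b) (Cod D c)" "c \<cdot>\<^bsub>D\<^esub> g1 = g0 \<cdot>\<^bsub>D\<^esub> b"
      using g by (auto elim: Mor_arrow_cat_cases)
    have "c \<cdot>\<^bsub>D\<^esub> (g1 \<cdot>\<^bsub>D\<^esub> f1) = g0 \<cdot>\<^bsub>D\<^esub> (b \<cdot>\<^bsub>D\<^esub> f1)"
      using g'(5) by (rule D.comp_cong) (use f'(2-5) g'(2-4) in auto)
    also have "\<dots> = (g0 \<cdot>\<^bsub>D\<^esub> f0) \<cdot>\<^bsub>D\<^esub> a" using f'(2-6) g'(2-4) by simp
    finally show "g \<cdot>\<^bsub>arrow_cat D\<^esub> f \<in> Hom (arrow_cat D) a c" using f'(1-5) g'(1-4) by simp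
  next
    fix f a b
    assume f: "f \<in> Hom (arrow_cat D) a b"
    obtain f1 f0 where f': "f = Sq a b f1 f0" "a \<in> Mor D" "b \<in> Mor D"
      "f1 \<in> Hom D (Dom D a) (Dom D b)" "f0 \<in> Hom D (Cod D a) (Cod D b)"
      using f by (auto elim: Mor_arrow_cat_cases)
    then show "f \<cdot>\<^bsub>arrow_cat D\<^esub> Ident (arrow_cat D) a = f" "Ident (arrow_cat D) b \<cdot>\<^bsub>arrow_cat D\<^esub> f = f"
      by simp_all
  next
    fix f g h a b c d
    assume f: "f \<in> Hom (arrow_cat D) a b" and g: "g \<in> Hom (arrow_cat D) b c" and h: "h \<in> Hom (arrow_cat D) c d"
    obtain f1 f0 where f': "f = Sq a b f1 f0"
      "f1 \<in> Hom D (Dom D a) (Dom D b)" "f0 \<in> Hom D (Cod D a) (Cod D b)"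
      using f by (auto elim: Mor_arrow_cat_cases)
    obtain g1 g0 where g': "g = Sq b c g1 g0"
      "g1 \<in> Hom D (Dom D b) (Dom D c)" "g0 \<in> Hom D (Cod D b) (Cod D c)"
      using g by (auto elim: Mor_arrow_cat_cases)
    obtain h1 h0 where h': "h = Sq c d h1 h0"
      "h1 \<in> Hom D (Dom D c) (Dom D d)" "h0 \<in> Hom D (Cod D c) (Cod D d)"
      using h by (auto elim: Mor_arrow_cat_cases)
    show "(h \<cdot>\<^bsub>arrow_cat D\<^esub> g) \<cdot>\<^bsub>arrow_cat D\<^esub> f = h \<cdot>\<^bsub>arrow_cat D\<^esub> (g \<cdot>\<^bsub>arrow_cat D\<^esub> f)"
      using f' g' h' by simp
  qed
qed

lemma category_Arr_pow: "category C \<Longrightarrow> category (Arr_pow C n)"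
  by (induction n) (simp_all add: category_base_cat category_arrow_cat)

lemma base_cat_pullback:
  assumes "category C" and pb: "is_pullback C f g p q"
  shows "is_pullback (base_cat C) (Ar f) (Ar g) (Ar p) (Ar q)"
proof -
  interpret category C by fact
  interpret B: category "base_cat C" by (rule category_base_cat) fact
  show ?thesis
  proof (rule B.pullbackI[where P = "Ob (Dom C p)"])
    show "Ar f \<in> Mor (base_cat C)" "Ar g \<in> Mor (base_cat C)" "Cod (base_cat C) (Ar f) = Cod (base_cat C) (Ar g)"
      "Ar p \<in> Hom (base_cat C) (Ob (Dom C p)) (Dom (base_cat C) (Ar f))"
      "Ar q \<in> Hom (base_cat C) (Ob (Dom C p)) (Dom (base_cat C) (Ar g))"
      "Ar f \<cdot>\<^bsub>base_cat C\<^esub> Ar p = Ar g \<cdot>\<^bsub>base_cat C\<^esub> Ar q"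
      using pb by (auto elim!: pullbackE)
    fix T s t
    assume s: "s \<in> Hom (base_cat C) T (Dom (base_cat C) (Ar f))" and t: "t \<in> Hom (base_cat C) T (Dom (base_cat C) (Ar g))"
      and eq: "Ar f \<cdot>\<^bsub>base_cat C\<^esub> s = Ar g \<cdot>\<^bsub>base_cat C\<^esub> t"
    obtain s' where s': "s = Ar s'" "s' \<in> Mor C" "T = Ob (Dom C s')" "Cod C s' = Dom C f" using s by auto
    obtain t' where t': "t = Ar t'" "t' \<in> Mor C" "Dom C t' = Dom C s'" "Cod C t' = Dom C g" using t s' by auto
    have "\<exists>u \<in> Hom C (Dom C s') (Dom C p). p \<cdot>\<^bsub>C\<^esub> u = s' \<and> q \<cdot>\<^bsub>C\<^esub> u = t'"
      using pb by (rule pullbackE) (use s' t' eq in simp)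
    then obtain u where "u \<in> Hom C (Dom C s') (Dom C p)" "p \<cdot>\<^bsub>C\<^esub> u = s'" "q \<cdot>\<^bsub>C\<^esub> u = t'" by blast
    then show "\<exists>u\<in>Hom (base_cat C) T (Ob (Dom C p)). Ar p \<cdot>\<^bsub>base_cat C\<^esub> u = s \<and> Ar q \<cdot>\<^bsub>base_cat C\<^esub> u = t"
      using s' t' by (intro bexI[of _ "Ar u"]) simp_all
  next
    fix T u v
    assume u: "u \<in> Hom (base_cat C) T (Ob (Dom C p))" and v: "v \<in> Hom (base_cat C) T (Ob (Dom C p))"
      and eq: "Ar p \<cdot>\<^bsub>base_cat C\<^esub> u = Ar p \<cdot>\<^bsub>base_cat C\<^esub> v" "Ar q \<cdot>\<^bsub>base_cat C\<^esub> u = Ar q \<cdot>\<^bsub>base_cat C\<^esub> v"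
    obtain u' where u': "u = Ar u'" "u' \<in> Mor C" "T = Ob (Dom C u')" "Cod C u' = Dom C p" using u by auto
    obtain v' where v': "v = Ar v'" "v' \<in> Mor C" "Dom C v' = Dom C u'" "Cod C v' = Dom C p" using v u' by auto
    have "u' = v'" using pb by (rule pullbackE) (use u' v' eq in simp)
    then show "u = v" using u'(1) v'(1) by simp
  qed
qed

text \<open>Pullbacks in an arrow category are formed on domains and codomains separately. The two
  induced components form a commutative square because the projections between the codomains are
  jointly monic.\<close>

lemma arrow_cat_pullback:
  fixes D :: "('o, 'm) cell_cat"
  assumes "category D"
    and x: "Sq F H x1 x0 \<in> Mor (arrow_cat D)" and y: "Sq G H y1 y0 \<in> Mor (arrow_cat D)"
    and p: "Sq P F p1 p0 \<in> Mor (arrow_cat D)" and q: "Sq P G q1 q0 \<in> Mor (arrow_cat D)"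
    and pb1: "is_pullback D x1 y1 p1 q1" and pb0: "is_pullback D x0 y0 p0 q0"
  shows "is_pullback (arrow_cat D) (Sq F H x1 x0) (Sq G H y1 y0) (Sq P F p1 p0) (Sq P G q1 q0)"
proof -
  interpret D: category D by fact
  interpret A: category "arrow_cat D" by (rule category_arrow_cat) fact
  have P1: "x1 \<cdot>\<^bsub>D\<^esub> p1 = y1 \<cdot>\<^bsub>D\<^esub> q1" using pb1 by (rule D.pullbackE)
  have ex1: "\<exists>u \<in> Hom D T (Dom D p1). p1 \<cdot>\<^bsub>D\<^esub> u = s \<and> q1 \<cdot>\<^bsub>D\<^esub> u = t"
    if "s \<in> Hom D T (Dom D x1)" "t \<in> Hom D T (Dom D y1)" "x1 \<cdot>\<^bsub>D\<^esub> s = y1 \<cdot>\<^bsub>D\<^esub> t" for T s t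
    using pb1 by (rule D.pullbackE) (use that in blast)
  have un1: "u = v"
    if "u \<in> Hom D T (Dom D p1)" "v \<in> Hom D T (Dom D p1)" "p1 \<cdot>\<^bsub>D\<^esub> u = p1 \<cdot>\<^bsub>D\<^esub> v" "q1 \<cdot>\<^bsub>D\<^esub> u = q1 \<cdot>\<^bsub>D\<^esub> v" for T u v
    using pb1 by (rule D.pullbackE) (use that in blast)
  have P0: "x0 \<cdot>\<^bsub>D\<^esub> p0 = y0 \<cdot>\<^bsub>D\<^esub> q0" using pb0 by (rule D.pullbackE)
  have ex0: "\<exists>u \<in> Hom D T (Dom D p0). p0 \<cdot>\<^bsub>D\<^esub> u = s \<and> q0 \<cdot>\<^bsub>D\<^esub> u = t"
    if "s \<in> Hom D T (Dom D x0)" "t \<in> Hom D T (Dom D y0)" "x0 \<cdot>\<^bsub>D\<^esub> s = y0 \<cdot>\<^bsub>D\<^esub> t" for T s t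
    using pb0 by (rule D.pullbackE) (use that in blast)
  have un0: "u = v"
    if "u \<in> Hom D T (Dom D p0)" "v \<in> Hom D T (Dom D p0)" "p0 \<cdot>\<^bsub>D\<^esub> u = p0 \<cdot>\<^bsub>D\<^esub> v" "q0 \<cdot>\<^bsub>D\<^esub> u = q0 \<cdot>\<^bsub>D\<^esub> v" for T u v
    using pb0 by (rule D.pullbackE) (use that in blast)
  have X: "F \<in> Mor D" "H \<in> Mor D" "x1 \<in> Hom D (Dom D F) (Dom D H)" "x0 \<in> Hom D (Cod D F) (Cod D H)"
    using x by simp_all
  have Y: "G \<in> Mor D" "y1 \<in> Hom D (Dom D G) (Dom D H)" "y0 \<in> Hom D (Cod D G) (Cod D H)"
    using y by simp_all
  have PP: "P \<in> Mor D" "p1 \<in> Hom D (Dom D P) (Dom D F)" "p0 \<in> Hom D (Cod D P) (Cod D F)" "F \<cdot>\<^bsub>D\<^esub> p1 = p0 \<cdot>\<^bsub>D\<^esub> P"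
    using p by simp_all
  have Q: "q1 \<in> Hom D (Dom D P) (Dom D G)" "q0 \<in> Hom D (Cod D P) (Cod D G)" "G \<cdot>\<^bsub>D\<^esub> q1 = q0 \<cdot>\<^bsub>D\<^esub> P"
    using q by simp_all
  show ?thesis
  proof (rule A.pullbackI[where P = P])
    show "Sq F H x1 x0 \<in> Mor (arrow_cat D)" "Sq G H y1 y0 \<in> Mor (arrow_cat D)" by fact+
    show "Cod (arrow_cat D) (Sq F H x1 x0) = Cod (arrow_cat D) (Sq G H y1 y0)" by simp
    show "Sq P F p1 p0 \<in> Hom (arrow_cat D) P (Dom (arrow_cat D) (Sq F H x1 x0))" using p by simp
    show "Sq P G q1 q0 \<in> Hom (arrow_cat D) P (Dom (arrow_cat D) (Sq G H y1 y0))" using q by simp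
    show "Sq F H x1 x0 \<cdot>\<^bsub>arrow_cat D\<^esub> Sq P F p1 p0 = Sq G H y1 y0 \<cdot>\<^bsub>arrow_cat D\<^esub> Sq P G q1 q0"
      using P1 P0 by simp
    fix S s t
    assume s: "s \<in> Hom (arrow_cat D) S (Dom (arrow_cat D) (Sq F H x1 x0))"
      and t: "t \<in> Hom (arrow_cat D) S (Dom (arrow_cat D) (Sq G H y1 y0))"
      and eq: "Sq F H x1 x0 \<cdot>\<^bsub>arrow_cat D\<^esub> s = Sq G H y1 y0 \<cdot>\<^bsub>arrow_cat D\<^esub> t"
    obtain s1 s0 where s': "s = Sq S F s1 s0" "S \<in> Mor D" "s1 \<in> Hom D (Dom D S) (Dom D F)"
      "s0 \<in> Hom D (Cod D S) (Cod D F)" "F \<cdot>\<^bsub>D\<^esub> s1 = s0 \<cdot>\<^bsub>D\<^esub> S"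
      using s by (auto elim: Mor_arrow_cat_cases)
    obtain t1 t0 where t': "t = Sq S G t1 t0" "t1 \<in> Hom D (Dom D S) (Dom D G)"
      "t0 \<in> Hom D (Cod D S) (Cod D G)" "G \<cdot>\<^bsub>D\<^esub> t1 = t0 \<cdot>\<^bsub>D\<^esub> S"
      using t by (auto elim: Mor_arrow_cat_cases)
    have e: "x1 \<cdot>\<^bsub>D\<^esub> s1 = y1 \<cdot>\<^bsub>D\<^esub> t1" "x0 \<cdot>\<^bsub>D\<^esub> s0 = y0 \<cdot>\<^bsub>D\<^esub> t0" using eq s'(1) t'(1) by simp_all
    have "\<exists>u \<in> Hom D (Dom D S) (Dom D p1). p1 \<cdot>\<^bsub>D\<^esub> u = s1 \<and> q1 \<cdot>\<^bsub>D\<^esub> u = t1"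
      by (rule ex1) (use s' t' X Y e in simp_all)
    then obtain u1 where u1: "u1 \<in> Hom D (Dom D S) (Dom D P)" "p1 \<cdot>\<^bsub>D\<^esub> u1 = s1" "q1 \<cdot>\<^bsub>D\<^esub> u1 = t1"
      using PP by auto
    have "\<exists>u \<in> Hom D (Cod D S) (Dom D p0). p0 \<cdot>\<^bsub>D\<^esub> u = s0 \<and> q0 \<cdot>\<^bsub>D\<^esub> u = t0"
      by (rule ex0) (use s' t' X Y e in simp_all)
    then obtain u0 where u0: "u0 \<in> Hom D (Cod D S) (Cod D P)" "p0 \<cdot>\<^bsub>D\<^esub> u0 = s0" "q0 \<cdot>\<^bsub>D\<^esub> u0 = t0"
      using PP by auto
    have "P \<cdot>\<^bsub>D\<^esub> u1 = u0 \<cdot>\<^bsub>D\<^esub> S"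
    proof (rule un0[of _ "Dom D S"])
      have "p0 \<cdot>\<^bsub>D\<^esub> (P \<cdot>\<^bsub>D\<^esub> u1) = F \<cdot>\<^bsub>D\<^esub> (p1 \<cdot>\<^bsub>D\<^esub> u1)"
        using PP(4)[symmetric] by (rule D.comp_cong) (use PP(1-3) X(1) u1(1) in auto)
      moreover have "p0 \<cdot>\<^bsub>D\<^esub> (u0 \<cdot>\<^bsub>D\<^esub> S) = s0 \<cdot>\<^bsub>D\<^esub> S"
        using u0(2) by (rule D.comp_cong1) (use PP(1-3) u0(1) s'(2) in auto)
      ultimately show "p0 \<cdot>\<^bsub>D\<^esub> (P \<cdot>\<^bsub>D\<^esub> u1) = p0 \<cdot>\<^bsub>D\<^esub> (u0 \<cdot>\<^bsub>D\<^esub> S)" using u1(2) s'(5) by simp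
      have "q0 \<cdot>\<^bsub>D\<^esub> (P \<cdot>\<^bsub>D\<^esub> u1) = G \<cdot>\<^bsub>D\<^esub> (q1 \<cdot>\<^bsub>D\<^esub> u1)"
        using Q(3)[symmetric] by (rule D.comp_cong) (use PP(1) Q(1,2) Y(1) u1(1) in auto)
      moreover have "q0 \<cdot>\<^bsub>D\<^esub> (u0 \<cdot>\<^bsub>D\<^esub> S) = t0 \<cdot>\<^bsub>D\<^esub> S"
        using u0(3) by (rule D.comp_cong1) (use Q(1,2) u0(1) s'(2) in auto)
      ultimately show "q0 \<cdot>\<^bsub>D\<^esub> (P \<cdot>\<^bsub>D\<^esub> u1) = q0 \<cdot>\<^bsub>D\<^esub> (u0 \<cdot>\<^bsub>D\<^esub> S)" using u1(3) t'(4) by simp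
    qed (use PP(1-3) u1(1) u0(1) s'(2) in auto)
    then show "\<exists>u\<in>Hom (arrow_cat D) S P. Sq P F p1 p0 \<cdot>\<^bsub>arrow_cat D\<^esub> u = s \<and> Sq P G q1 q0 \<cdot>\<^bsub>arrow_cat D\<^esub> u = t"
      using u1 u0 s'(1,2) t'(1) PP(1) by (intro bexI[of _ "Sq S P u1 u0"]) simp_all
  next
    fix S u v
    assume u: "u \<in> Hom (arrow_cat D) S P" and v: "v \<in> Hom (arrow_cat D) S P"
      and eq: "Sq P F p1 p0 \<cdot>\<^bsub>arrow_cat D\<^esub> u = Sq P F p1 p0 \<cdot>\<^bsub>arrow_cat D\<^esub> v"
        "Sq P G q1 q0 \<cdot>\<^bsub>arrow_cat D\<^esub> u = Sq P G q1 q0 \<cdot>\<^bsub>arrow_cat D\<^esub> v"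
    obtain u1 u0 where u': "u = Sq S P u1 u0" "u1 \<in> Hom D (Dom D S) (Dom D P)" "u0 \<in> Hom D (Cod D S) (Cod D P)"
      using u by (auto elim: Mor_arrow_cat_cases)
    obtain v1 v0 where v': "v = Sq S P v1 v0" "v1 \<in> Hom D (Dom D S) (Dom D P)" "v0 \<in> Hom D (Cod D S) (Cod D P)"
      using v by (auto elim: Mor_arrow_cat_cases)
    have "u1 = v1" by (rule un1[of _ "Dom D S"]) (use u' v' eq PP in simp_all)
    moreover have "u0 = v0" by (rule un0[of _ "Cod D S"]) (use u' v' eq PP in simp_all)
    ultimately show "u = v" using u'(1) v'(1) by simp
  qed
qed

section \<open>Functors on \<open>{0, 1}\<^sup>m\<close> as cells of iterated arrow
  categories\<close>

definition two_objs :: "nat \<Rightarrow> (nat \<Rightarrow> nat) set" where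
  "two_objs m = {v. (\<forall>i<m. v i \<in> {0, 1}) \<and> (\<forall>i\<ge>m. v i = 0)}"

lemma two_objs_upd: "v \<in> two_objs m \<Longrightarrow> a \<le> 1 \<Longrightarrow> v(m := a) \<in> two_objs (Suc m)"
  by (auto simp: two_objs_def less_Suc_eq)

lemma fun_upd_mono: "v \<le> w \<Longrightarrow> (a::nat) \<le> b \<Longrightarrow> v(m := a) \<le> w(m := b)"
  by (auto simp: le_fun_def)

definition slice :: "nat \<Rightarrow> nat \<Rightarrow> ((nat \<Rightarrow> nat) \<Rightarrow> (nat \<Rightarrow> nat) \<Rightarrow> 'm) \<Rightarrow> (nat \<Rightarrow> nat) \<Rightarrow> (nat \<Rightarrow> nat) \<Rightarrow> 'm" where
  "slice m a F = (\<lambda>v w. F (v(m := a)) (w(m := a)))"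

text \<open>A contravariant functor \<open>F\<close> on \<open>{0, 1}\<^sup>m\<close> is given by its morphisms \<open>F v w\<close> from \<open>w\<close> to \<open>v\<close> for \<open>v \<le> w\<close>;
  \<open>ncube m F G \<eta>\<close> is the morphism of \<open>Arr\<^sup>m(C)\<close> corresponding to a natural transformation \<open>\<eta>\<close> from
  \<open>F\<close> to \<open>G\<close>, and \<open>ocube\<close> the object corresponding to a functor.\<close>

fun ncube :: "nat \<Rightarrow> ((nat \<Rightarrow> nat) \<Rightarrow> (nat \<Rightarrow> nat) \<Rightarrow> 'm) \<Rightarrow> ((nat \<Rightarrow> nat) \<Rightarrow> (nat \<Rightarrow> nat) \<Rightarrow> 'm) \<Rightarrow>
    ((nat \<Rightarrow> nat) \<Rightarrow> 'm) \<Rightarrow> ('o, 'm) cell" where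
  "ncube 0 F G \<eta> = Ar (\<eta> (\<lambda>_. 0))"
| "ncube (Suc m) F G \<eta> =
     Sq (ncube m (slice m 1 F) (slice m 0 F) (\<lambda>v. F (v(m := 0)) (v(m := 1))))
        (ncube m (slice m 1 G) (slice m 0 G) (\<lambda>v. G (v(m := 0)) (v(m := 1))))
        (ncube m (slice m 1 F) (slice m 1 G) (\<lambda>v. \<eta> (v(m := 1))))
        (ncube m (slice m 0 F) (slice m 0 G) (\<lambda>v. \<eta> (v(m := 0))))"

text \<open>A functor on the cube is given by its morphisms alone, so its objects are read off from
  the endomorphisms \<open>F v v\<close>.\<close>

definition cube_obj :: "('o, 'm) category \<Rightarrow> ((nat \<Rightarrow> nat) \<Rightarrow> (nat \<Rightarrow> nat) \<Rightarrow> 'm) \<Rightarrow> (nat \<Rightarrow> nat) \<Rightarrow> 'o" where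
  "cube_obj C F v = Dom C (F v v)"

fun ocube :: "('o, 'm) category \<Rightarrow> nat \<Rightarrow> ((nat \<Rightarrow> nat) \<Rightarrow> (nat \<Rightarrow> nat) \<Rightarrow> 'm) \<Rightarrow> ('o, 'm) cell" where
  "ocube C 0 F = Ob (cube_obj C F (\<lambda>_. 0))"
| "ocube C (Suc m) F = ncube m (slice m 1 F) (slice m 0 F) (\<lambda>v. F (v(m := 0)) (v(m := 1)))"

text \<open>The arguments of \<open>ncube\<close> are total functions, while the equations needed
  later hold on the vertices of the cube only.\<close>

lemma ncube_cong:
  assumes "\<And>v w. v \<in> two_objs m \<Longrightarrow> w \<in> two_objs m \<Longrightarrow> v \<le> w \<Longrightarrow> F v w = F' v w"
    and "\<And>v w. v \<in> two_objs m \<Longrightarrow> w \<in> two_objs m \<Longrightarrow> v \<le> w \<Longrightarrow> G v w = G' v w"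
    and "\<And>v. v \<in> two_objs m \<Longrightarrow> \<eta> v = \<eta>' v"
  shows "(ncube m F G \<eta> :: ('o, 'm) cell) = ncube m F' G' \<eta>'"
  using assms
proof (induction m arbitrary: F G \<eta> F' G' \<eta>')
  case 0
  have "(\<lambda>_. 0) \<in> two_objs 0" by (simp add: two_objs_def)
  then show ?case using 0(3) by simp
next
  case (Suc m)
  have s1: "slice m a F v w = slice m a F' v w"
    if "v \<in> two_objs m" "w \<in> two_objs m" "v \<le> w" "a \<le> 1" for a v w
    unfolding slice_def by (rule Suc.prems(1)[OF two_objs_upd two_objs_upd fun_upd_mono]) (use that in simp_all)
  have s2: "slice m a G v w = slice m a G' v w"
    if "v \<in> two_objs m" "w \<in> two_objs m" "v \<le> w" "a \<le> 1" for a v w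
    unfolding slice_def by (rule Suc.prems(2)[OF two_objs_upd two_objs_upd fun_upd_mono]) (use that in simp_all)
  have e1: "F (v(m := 0)) (v(m := 1)) = F' (v(m := 0)) (v(m := 1))" if "v \<in> two_objs m" for v
    by (rule Suc.prems(1)[OF two_objs_upd two_objs_upd fun_upd_mono]) (use that in simp_all)
  have e2: "G (v(m := 0)) (v(m := 1)) = G' (v(m := 0)) (v(m := 1))" if "v \<in> two_objs m" for v
    by (rule Suc.prems(2)[OF two_objs_upd two_objs_upd fun_upd_mono]) (use that in simp_all)
  have n: "\<eta> (v(m := a)) = \<eta>' (v(m := a))" if "v \<in> two_objs m" "a \<le> 1" for v a
    by (rule Suc.prems(3)[OF two_objs_upd]) (use that in simp_all)
  have "(ncube m (slice m 1 F) (slice m 0 F) (\<lambda>v. F (v(m := 0)) (v(m := 1))) :: ('o, 'm) cell)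
      = ncube m (slice m 1 F') (slice m 0 F') (\<lambda>v. F' (v(m := 0)) (v(m := 1)))"
    by (rule Suc.IH; (rule s1 | rule e1); (assumption | simp))
  moreover have "(ncube m (slice m 1 G) (slice m 0 G) (\<lambda>v. G (v(m := 0)) (v(m := 1))) :: ('o, 'm) cell)
      = ncube m (slice m 1 G') (slice m 0 G') (\<lambda>v. G' (v(m := 0)) (v(m := 1)))"
    by (rule Suc.IH; (rule s2 | rule e2); (assumption | simp))
  moreover have "(ncube m (slice m a F) (slice m a G) (\<lambda>v. \<eta> (v(m := a))) :: ('o, 'm) cell)
      = ncube m (slice m a F') (slice m a G') (\<lambda>v. \<eta>' (v(m := a)))" if "a \<le> 1" for a
    by (rule Suc.IH; (rule s1 | rule s2 | rule n); (assumption | rule that))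
  ultimately show ?case by simp
qed

text \<open>Recognises the first two sides of the square as the cells of the functors themselves.
  \<open>C\<close> does not occur on the left, so it has to be supplied when rewriting.\<close>

lemma ncube_Suc:
  "ncube (Suc m) F G \<eta> = Sq (ocube C (Suc m) F) (ocube C (Suc m) G)
        (ncube m (slice m 1 F) (slice m 1 G) (\<lambda>v. \<eta> (v(m := 1))))
        (ncube m (slice m 0 F) (slice m 0 G) (\<lambda>v. \<eta> (v(m := 0))))"
  by simp

lemma ncube_comp:
  "ncube m G H \<theta> \<cdot>\<^bsub>Arr_pow C m\<^esub> ncube m F G \<eta> = ncube m F H (\<lambda>v. \<theta> v \<cdot>\<^bsub>C\<^esub> \<eta> v)"
  by (induction m arbitrary: F G H \<eta> \<theta>) simp_all

definition cube_functor :: "('o, 'm) category \<Rightarrow> nat \<Rightarrow> ((nat \<Rightarrow> nat) \<Rightarrow> (nat \<Rightarrow> nat) \<Rightarrow> 'm) \<Rightarrow> bool" where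
  "cube_functor C m F \<longleftrightarrow>
     (\<forall>v\<in>two_objs m. \<forall>w\<in>two_objs m. v \<le> w \<longrightarrow> F v w \<in> Hom C (cube_obj C F w) (cube_obj C F v)) \<and>
     (\<forall>u\<in>two_objs m. \<forall>v\<in>two_objs m. \<forall>w\<in>two_objs m. u \<le> v \<longrightarrow> v \<le> w \<longrightarrow> F u v \<cdot>\<^bsub>C\<^esub> F v w = F u w)"

definition cube_natural :: "('o, 'm) category \<Rightarrow> nat \<Rightarrow> ((nat \<Rightarrow> nat) \<Rightarrow> (nat \<Rightarrow> nat) \<Rightarrow> 'm) \<Rightarrow>
    ((nat \<Rightarrow> nat) \<Rightarrow> (nat \<Rightarrow> nat) \<Rightarrow> 'm) \<Rightarrow> ((nat \<Rightarrow> nat) \<Rightarrow> 'm) \<Rightarrow> bool" where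
  "cube_natural C m F G \<eta> \<longleftrightarrow>
     (\<forall>v\<in>two_objs m. \<eta> v \<in> Hom C (cube_obj C F v) (cube_obj C G v)) \<and>
     (\<forall>v\<in>two_objs m. \<forall>w\<in>two_objs m. v \<le> w \<longrightarrow> G v w \<cdot>\<^bsub>C\<^esub> \<eta> w = \<eta> v \<cdot>\<^bsub>C\<^esub> F v w)"

lemma cube_functorD:
  assumes "cube_functor C m F"
  shows "v \<in> two_objs m \<Longrightarrow> w \<in> two_objs m \<Longrightarrow> v \<le> w \<Longrightarrow> F v w \<in> Hom C (cube_obj C F w) (cube_obj C F v)"
    and "u \<in> two_objs m \<Longrightarrow> v \<in> two_objs m \<Longrightarrow> w \<in> two_objs m \<Longrightarrow> u \<le> v \<Longrightarrow> v \<le> w \<Longrightarrow>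
      F u v \<cdot>\<^bsub>C\<^esub> F v w = F u w"
  using assms unfolding cube_functor_def by blast+

lemma cube_naturalD:
  assumes "cube_natural C m F G \<eta>"
  shows "v \<in> two_objs m \<Longrightarrow> \<eta> v \<in> Hom C (cube_obj C F v) (cube_obj C G v)"
    and "v \<in> two_objs m \<Longrightarrow> w \<in> two_objs m \<Longrightarrow> v \<le> w \<Longrightarrow> G v w \<cdot>\<^bsub>C\<^esub> \<eta> w = \<eta> v \<cdot>\<^bsub>C\<^esub> F v w"
  using assms unfolding cube_natural_def by blast+

lemma cube_obj_slice [simp]: "cube_obj C (slice m a F) v = cube_obj C F (v(m := a))"
  by (simp add: cube_obj_def slice_def)

lemma cube_functor_slice:
  assumes F: "cube_functor C (Suc m) F" and a: "a \<le> 1"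
  shows "cube_functor C m (slice m a F)"
  unfolding cube_functor_def
proof (intro conjI ballI impI)
  fix v w assume h: "v \<in> two_objs m" "w \<in> two_objs m" "v \<le> w"
  show "slice m a F v w \<in> Hom C (cube_obj C (slice m a F) w) (cube_obj C (slice m a F) v)"
    unfolding cube_obj_slice unfolding slice_def
    by (rule cube_functorD(1)[OF F]) ((intro two_objs_upd fun_upd_mono; use h a in simp)+)
next
  fix u v w assume h: "u \<in> two_objs m" "v \<in> two_objs m" "w \<in> two_objs m" "u \<le> v" "v \<le> w"
  show "slice m a F u v \<cdot>\<^bsub>C\<^esub> slice m a F v w = slice m a F u w"
    unfolding slice_def
    by (rule cube_functorD(2)[OF F]) ((intro two_objs_upd fun_upd_mono; use h a in simp)+)
qed

lemma cube_natural_slice: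
  assumes n: "cube_natural C (Suc m) F G \<eta>" and a: "a \<le> 1"
  shows "cube_natural C m (slice m a F) (slice m a G) (\<lambda>v. \<eta> (v(m := a)))"
  unfolding cube_natural_def
proof (intro conjI ballI impI)
  fix v assume h: "v \<in> two_objs m"
  show "\<eta> (v(m := a)) \<in> Hom C (cube_obj C (slice m a F) v) (cube_obj C (slice m a G) v)"
    unfolding cube_obj_slice by (rule cube_naturalD(1)[OF n]) ((intro two_objs_upd fun_upd_mono; use h a in simp)+)
  fix w assume h': "w \<in> two_objs m" "v \<le> w"
  show "slice m a G v w \<cdot>\<^bsub>C\<^esub> \<eta> (w(m := a)) = \<eta> (v(m := a)) \<cdot>\<^bsub>C\<^esub> slice m a F v w"
    unfolding slice_def
    by (rule cube_naturalD(2)[OF n]) ((intro two_objs_upd fun_upd_mono; use h h' a in simp)+)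
qed

lemma cube_natural_edge:
  assumes F: "cube_functor C (Suc m) F"
  shows "cube_natural C m (slice m 1 F) (slice m 0 F) (\<lambda>v. F (v(m := 0)) (v(m := 1)))"
  unfolding cube_natural_def
proof (intro conjI ballI impI)
  fix v assume h: "v \<in> two_objs m"
  show "F (v(m := 0)) (v(m := 1)) \<in> Hom C (cube_obj C (slice m 1 F) v) (cube_obj C (slice m 0 F) v)"
    unfolding cube_obj_slice by (rule cube_functorD(1)[OF F]) ((intro two_objs_upd fun_upd_mono; use h in simp)+)
  fix w assume h': "w \<in> two_objs m" "v \<le> w"
  have "F (v(m := 0)) (w(m := 0)) \<cdot>\<^bsub>C\<^esub> F (w(m := 0)) (w(m := 1)) = F (v(m := 0)) (w(m := 1))"
    by (rule cube_functorD(2)[OF F]) ((intro two_objs_upd fun_upd_mono; use h h' in simp)+)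
  moreover have "F (v(m := 0)) (v(m := 1)) \<cdot>\<^bsub>C\<^esub> F (v(m := 1)) (w(m := 1)) = F (v(m := 0)) (w(m := 1))"
    by (rule cube_functorD(2)[OF F]) ((intro two_objs_upd fun_upd_mono; use h h' in simp)+)
  ultimately show "slice m 0 F v w \<cdot>\<^bsub>C\<^esub> F (w(m := 0)) (w(m := 1)) = F (v(m := 0)) (v(m := 1)) \<cdot>\<^bsub>C\<^esub> slice m 1 F v w"
    by (simp add: slice_def)
qed

lemma ncube_Hom:
  assumes "cube_functor C m F" "cube_functor C m G" "cube_natural C m F G \<eta>"
  shows "ncube m F G \<eta> \<in> Hom (Arr_pow C m) (ocube C m F) (ocube C m G)"
  using assms
proof (induction m arbitrary: F G \<eta>)
  case 0
  have "(\<lambda>_. 0) \<in> two_objs 0" by (simp add: two_objs_def)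
  from cube_naturalD(1)[OF 0(3) this] show ?case by simp
next
  case (Suc m)
  note F = cube_functor_slice[OF Suc.prems(1)] and G = cube_functor_slice[OF Suc.prems(2)]
  note eF = cube_natural_edge[OF Suc.prems(1)] and eG = cube_natural_edge[OF Suc.prems(2)]
  note n = cube_natural_slice[OF Suc.prems(3)]
  have f: "ocube C (Suc m) F \<in> Hom (Arr_pow C m) (ocube C m (slice m 1 F)) (ocube C m (slice m 0 F))"
    unfolding ocube.simps by (rule Suc.IH[OF F F eF]) simp_all
  have g: "ocube C (Suc m) G \<in> Hom (Arr_pow C m) (ocube C m (slice m 1 G)) (ocube C m (slice m 0 G))"
    unfolding ocube.simps by (rule Suc.IH[OF G G eG]) simp_all
  have a: "ncube m (slice m a F) (slice m a G) (\<lambda>v. \<eta> (v(m := a))) \<in> Hom (Arr_pow C m) (ocube C m (slice m a F)) (ocube C m (slice m a G))"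
    if "a \<le> 1" for a using that by (intro Suc.IH F G n)
  have "ocube C (Suc m) G \<cdot>\<^bsub>Arr_pow C m\<^esub> ncube m (slice m 1 F) (slice m 1 G) (\<lambda>v. \<eta> (v(m := 1)))
      = ncube m (slice m 0 F) (slice m 0 G) (\<lambda>v. \<eta> (v(m := 0))) \<cdot>\<^bsub>Arr_pow C m\<^esub> ocube C (Suc m) F"
    unfolding ocube.simps ncube_comp
  proof (rule ncube_cong)
    fix v assume v: "v \<in> two_objs m"
    show "G (v(m := 0)) (v(m := 1)) \<cdot>\<^bsub>C\<^esub> \<eta> (v(m := 1)) = \<eta> (v(m := 0)) \<cdot>\<^bsub>C\<^esub> F (v(m := 0)) (v(m := 1))"
      by (rule cube_naturalD(2)[OF Suc.prems(3)]) ((intro two_objs_upd fun_upd_mono; use v in simp)+)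
  qed simp_all
  then show ?case using f g a[of 0] a[of 1] unfolding ncube_Suc[where C = C] by (simp del: ocube.simps)
qed

text \<open>Iterates \<open>arrow_cat_pullback\<close>: a square of natural transformations is a
  pullback in \<open>Arr_pow C m\<close> if it is one at every vertex.\<close>

lemma ncube_pullback:
  assumes C: "category C"
    and "cube_functor C m F" "cube_functor C m G" "cube_functor C m H" "cube_functor C m P"
    and "cube_natural C m F H \<eta>" "cube_natural C m G H \<theta>" "cube_natural C m P F \<pi>" "cube_natural C m P G \<rho>"
    and "\<And>v. v \<in> two_objs m \<Longrightarrow> is_pullback C (\<eta> v) (\<theta> v) (\<pi> v) (\<rho> v)"
  shows "is_pullback (Arr_pow C m) (ncube m F H \<eta>) (ncube m G H \<theta>) (ncube m P F \<pi>) (ncube m P G \<rho>)"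
proof -
  \<comment> \<open>All hypotheses on the four functors and four transformations are packed into one
    predicate, so that the induction can quantify over them and pass to both faces.\<close>
  define ok where "ok = (\<lambda>m F G H P \<eta> \<theta> \<pi> \<rho>.
    (cube_functor C m F \<and> cube_functor C m G \<and> cube_functor C m H \<and> cube_functor C m P) \<and>
    (cube_natural C m F H \<eta> \<and> cube_natural C m G H \<theta> \<and> cube_natural C m P F \<pi> \<and> cube_natural C m P G \<rho>) \<and>
    (\<forall>v\<in>two_objs m. is_pullback C (\<eta> v) (\<theta> v) (\<pi> v) (\<rho> v)))"
  define Q where "Q = (\<lambda>m. \<forall>F G H P \<eta> \<theta> \<pi> \<rho>. ok m F G H P \<eta> \<theta> \<pi> \<rho> \<longrightarrow>
    is_pullback (Arr_pow C m) (ncube m F H \<eta>) (ncube m G H \<theta>) (ncube m P F \<pi>) (ncube m P G \<rho>))"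
  have "Q m"
  proof (induction m)
  case 0
  show ?case unfolding Q_def
  proof (intro allI impI)
    fix F G H P \<eta> \<theta> \<pi> \<rho> assume "ok 0 F G H P \<eta> \<theta> \<pi> \<rho>"
    moreover have "(\<lambda>_. 0) \<in> two_objs 0" by (simp add: two_objs_def)
    ultimately have "is_pullback C (\<eta> (\<lambda>_. 0)) (\<theta> (\<lambda>_. 0)) (\<pi> (\<lambda>_. 0)) (\<rho> (\<lambda>_. 0))" unfolding ok_def by blast
    from base_cat_pullback[OF C this]
    show "is_pullback (Arr_pow C 0) (ncube 0 F H \<eta>) (ncube 0 G H \<theta>) (ncube 0 P F \<pi>) (ncube 0 P G \<rho>)" by simp
  qed
next
  case (Suc m)
  show ?case unfolding Q_def
  proof (intro allI impI)
  fix F G H P \<eta> \<theta> \<pi> \<rho> assume "ok (Suc m) F G H P \<eta> \<theta> \<pi> \<rho>"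
  then have prems: "cube_functor C (Suc m) F" "cube_functor C (Suc m) G" "cube_functor C (Suc m) H"
    "cube_functor C (Suc m) P" "cube_natural C (Suc m) F H \<eta>" "cube_natural C (Suc m) G H \<theta>"
    "cube_natural C (Suc m) P F \<pi>" "cube_natural C (Suc m) P G \<rho>"
    and pbs: "\<And>v. v \<in> two_objs (Suc m) \<Longrightarrow> is_pullback C (\<eta> v) (\<theta> v) (\<pi> v) (\<rho> v)"
    unfolding ok_def by blast+
  note Hom = ncube_Hom[where m = "Suc m"]
  have pb: "is_pullback (Arr_pow C m)
      (ncube m (slice m a F) (slice m a H) (\<lambda>v. \<eta> (v(m := a)))) (ncube m (slice m a G) (slice m a H) (\<lambda>v. \<theta> (v(m := a))))
      (ncube m (slice m a P) (slice m a F) (\<lambda>v. \<pi> (v(m := a)))) (ncube m (slice m a P) (slice m a G) (\<lambda>v. \<rho> (v(m := a))))"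
    if "a \<le> 1" for a
  proof (rule Suc.IH[unfolded Q_def, rule_format], unfold ok_def, intro conjI ballI)
    show "cube_functor C m (slice m a F)" by (rule cube_functor_slice[OF prems(1) that])
    show "cube_functor C m (slice m a G)" by (rule cube_functor_slice[OF prems(2) that])
    show "cube_functor C m (slice m a H)" by (rule cube_functor_slice[OF prems(3) that])
    show "cube_functor C m (slice m a P)" by (rule cube_functor_slice[OF prems(4) that])
    show "cube_natural C m (slice m a F) (slice m a H) (\<lambda>v. \<eta> (v(m := a)))"
      by (rule cube_natural_slice[OF prems(5) that])
    show "cube_natural C m (slice m a G) (slice m a H) (\<lambda>v. \<theta> (v(m := a)))"
      by (rule cube_natural_slice[OF prems(6) that])
    show "cube_natural C m (slice m a P) (slice m a F) (\<lambda>v. \<pi> (v(m := a)))"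
      by (rule cube_natural_slice[OF prems(7) that])
    show "cube_natural C m (slice m a P) (slice m a G) (\<lambda>v. \<rho> (v(m := a)))"
      by (rule cube_natural_slice[OF prems(8) that])
    fix v assume "v \<in> two_objs m"
    then have "v(m := a) \<in> two_objs (Suc m)" using that by (rule two_objs_upd)
    from pbs[OF this]
    show "is_pullback C (\<eta> (v(m := a))) (\<theta> (v(m := a))) (\<pi> (v(m := a))) (\<rho> (v(m := a)))" .
  qed
  have h: "ncube (Suc m) F H \<eta> \<in> Mor (arrow_cat (Arr_pow C m))" "ncube (Suc m) G H \<theta> \<in> Mor (arrow_cat (Arr_pow C m))"
    "ncube (Suc m) P F \<pi> \<in> Mor (arrow_cat (Arr_pow C m))" "ncube (Suc m) P G \<rho> \<in> Mor (arrow_cat (Arr_pow C m))"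
    using Hom[OF prems(1,3,5)] Hom[OF prems(2,3,6)] Hom[OF prems(4,1,7)] Hom[OF prems(4,2,8)]
    unfolding Hom_iff Arr_pow_simps by blast+
  show "is_pullback (Arr_pow C (Suc m)) (ncube (Suc m) F H \<eta>) (ncube (Suc m) G H \<theta>)
      (ncube (Suc m) P F \<pi>) (ncube (Suc m) P G \<rho>)"
    using h unfolding ncube_Suc[where C = C] Arr_pow_simps
    by (rule arrow_cat_pullback[OF category_Arr_pow[OF C] _ _ _ _ pb pb]) simp_all
  qed
  qed
  moreover have "ok m F G H P \<eta> \<theta> \<pi> \<rho>" unfolding ok_def using assms by blast
  ultimately show ?thesis unfolding Q_def by blast
qed

section \<open>Restrictions of sequences to cubes\<close>

text \<open>Reconciles two encodings: \<open>ncube\<close> runs over the coordinates below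
  \<open>m\<close>, whereas \<open>seq_cube\<close> carries the coordinates from \<open>m\<close> on
  in its argument.\<close>

definition merge_coords :: "nat \<Rightarrow> (nat \<Rightarrow> nat) \<Rightarrow> (nat \<Rightarrow> nat) \<Rightarrow> nat \<Rightarrow> nat" where
  "merge_coords m v \<sigma> = (\<lambda>i. if i < m then v i else \<sigma> i)"

lemma merge_coords_Suc: "merge_coords (Suc m) (v(m := a)) \<sigma> = merge_coords m v (\<sigma>(m := a))"
  by (auto simp: merge_coords_def)

lemma merge_coords_two: "v \<in> two_objs m \<Longrightarrow> merge_coords m v (\<lambda>_. 0) = v" "v \<in> two_objs m \<Longrightarrow> merge_coords m v ((\<lambda>_. 0)(m := a)) = v(m := a)"
  by (auto simp: merge_coords_def two_objs_def fun_eq_iff)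

text \<open>Both recursions split off the highest coordinate first, so after
  \<open>merge_coords_Suc\<close> the two sides coincide literally.\<close>

lemma seq_cube_ncube:
  "seq_cube E m \<sigma> \<tau> = ncube m (\<lambda>v w. FMor E (merge_coords m v \<tau>, merge_coords m w \<tau>)) (\<lambda>v w. FMor E (merge_coords m v \<sigma>, merge_coords m w \<sigma>))
     (\<lambda>v. FMor E (merge_coords m v \<sigma>, merge_coords m v \<tau>))"
proof (induction m arbitrary: \<sigma> \<tau>)
  case 0
  have "merge_coords 0 v \<sigma> = \<sigma>" for v \<sigma> by (simp add: merge_coords_def)
  then show ?case by simp
next
  case (Suc m)
  show ?case unfolding seq_cube.simps ncube.simps slice_def merge_coords_Suc Suc.IH by (rule refl)
qed

lemma cube_restriction_ocube:
  "cube_restriction (Suc m) E = ocube C (Suc m) (\<lambda>v w. FMor E (v, w))"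
  unfolding cube_restriction.simps seq_cube_ncube ocube.simps
  by (rule ncube_cong) (simp_all add: slice_def merge_coords_two fun_upd_idem two_objs_def)


section \<open>From \<open>3\<^sup>n\<close>-diagrams to cubic extensions\<close>

context semi_abelian_category
begin

lemma Hom_Dom_Obj: "f \<in> Hom C a b \<Longrightarrow> a \<in> Obj C"
  by auto

text \<open>A subobject that covers the base and contains the kernel is everything. The pullback
  \<open>W\<close> of \<open>p \<cdot> \<iota>\<close> and \<open>p\<close> is a point over
  \<open>I\<close>, with section induced by \<iota>. Its projection \<phi> to \<open>P\<close> sends
  the section and the kernel into \<iota>, hence factors through \<iota>. As \<phi> is also a
  regular epimorphism, \<iota> is invertible.\<close>

lemma monic_iso_over_regepi:
  assumes \<iota>: "monic \<iota>" "\<iota> \<in> Hom C I P" and p: "p \<in> Hom C P A" and re: "regepi (p \<cdot> \<iota>)"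
    and ker: "kernel_elems p \<subseteq> sieve \<iota>"
  shows "is_iso C \<iota>"
proof -
  have M: "p \<cdot> \<iota> \<in> Mor C" "p \<in> Mor C" "Cod C (p \<cdot> \<iota>) = Cod C p" using \<iota> p by auto
  obtain W i \<phi> where pb: "is_pullback C (p \<cdot> \<iota>) p i \<phi>" "i \<in> Hom C W (Dom C (p \<cdot> \<iota>))" "\<phi> \<in> Hom C W (Dom C p)"
    "(p \<cdot> \<iota>) \<cdot> i = p \<cdot> \<phi>"
    and ex: "\<And>T s t. s \<in> Hom C T (Dom C (p \<cdot> \<iota>)) \<Longrightarrow> t \<in> Hom C T (Dom C p) \<Longrightarrow> (p \<cdot> \<iota>) \<cdot> s = p \<cdot> t \<Longrightarrow>
      \<exists>u \<in> Hom C T W. i \<cdot> u = s \<and> \<phi> \<cdot> u = t"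
    by (rule pullback_obtain[OF M]) (rule that, assumption+)
  have iH: "i \<in> Hom C W I" and \<phi>H: "\<phi> \<in> Hom C W P" using pb(2,3) \<iota> p by auto
  have IO: "I \<in> Obj C" using \<iota>(2) by auto
  have "\<exists>u \<in> Hom C I W. i \<cdot> u = Ident C I \<and> \<phi> \<cdot> u = \<iota>"
    by (rule ex) (use \<iota>(2) p IO in auto)
  then obtain d where d: "d \<in> Hom C I W" "i \<cdot> d = Ident C I" "\<phi> \<cdot> d = \<iota>" by blast
  have "\<phi> \<in> sieve \<iota>"
  proof (rule point_generation[OF iH d(1,2) \<iota>(1)])
    show "\<phi> \<cdot> d \<in> sieve \<iota>" using d(3) sieve_self \<iota>(2) by simp
    fix t assume "t \<in> kernel_elems i"
    then have t: "t \<in> Mor C" "Cod C t = W" "i \<cdot> t = zero_mor (Dom C t) I" using iH by (auto simp: kernel_elems_iff)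
    have "(p \<cdot> \<iota>) \<cdot> (i \<cdot> t) = p \<cdot> (\<phi> \<cdot> t)" using pb(4) by (rule comp_cong) (use t iH \<phi>H \<iota>(2) p in auto)
    then have "p \<cdot> (\<phi> \<cdot> t) = zero_mor (Dom C t) A" using t \<iota>(2) p by simp
    then have "\<phi> \<cdot> t \<in> kernel_elems p" using t \<phi>H p by (intro kernel_elemsI) auto
    then show "\<phi> \<cdot> t \<in> sieve \<iota>" using ker by blast
  qed (use \<phi>H \<iota>(2) in auto)
  then obtain w where w: "w \<in> Hom C (Dom C \<phi>) (Dom C \<iota>)" "\<iota> \<cdot> w = \<phi>" by (rule sieveE)
  have "regepi \<phi>" by (rule regepi_pullback[OF pb(1) re])
  then show ?thesis by (rule regepi_monic_iso[OF _ \<iota>(1) w])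
qed

text \<open>The image of \<open>u\<close> covers \<open>E10\<close> because \<open>x\<close> does,
  so it only has to contain the kernel of \<open>p\<close>. An element of that kernel is determined
  by its second projection, which lies in the kernel \<open>E02\<close> of \<open>b\<close>. On a
  cover this comes from \<open>E12\<close>, and \<open>kx\<close> carries it to a preimage in
  \<open>E11\<close>.\<close>

lemma comparison_regepi:
  assumes x: "x \<in> Hom C E11 E10" "regepi x" and y: "y \<in> Hom C E11 E01"
    and pb: "is_pullback C g b p q" and g: "g \<in> Hom C E10 E00" and b: "b \<in> Hom C E01 E00"
    and u: "u \<in> Hom C E11 (Dom C p)" "p \<cdot> u = x" "q \<cdot> u = y"
    and kb: "kb \<in> Hom C E02 E01" "sieve kb = kernel_elems b"
    and r: "r \<in> Hom C E12 E02" "regepi r"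
    and kx: "kx \<in> Hom C E12 E11" "x \<cdot> kx = zero_mor E12 E10" "y \<cdot> kx = kb \<cdot> r"
  shows "regepi u"
proof -
  define P where "P = Dom C p"
  have pq: "p \<in> Hom C P E10" "q \<in> Hom C P E01" "g \<cdot> p = b \<cdot> q"
    using pb g b unfolding P_def by (auto elim!: pullbackE)
  have jm: "s = t" if "s \<in> Hom C T P" "t \<in> Hom C T P" "p \<cdot> s = p \<cdot> t" "q \<cdot> s = q \<cdot> t" for s t T
    using pb by (rule pullbackE) (use that P_def in blast)
  have uH: "u \<in> Hom C E11 P" using u(1) P_def by simp
  obtain I c \<iota> where I: "regepi c" "monic \<iota>" "c \<in> Hom C (Dom C u) I" "\<iota> \<in> Hom C I (Cod C u)" "\<iota> \<cdot> c = u"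
    by (rule image_obtain[of u]) (use uH in auto)
  have c: "c \<in> Hom C E11 I" and \<iota>: "\<iota> \<in> Hom C I P" using I uH by auto
  have "(p \<cdot> \<iota>) \<cdot> c = x" using I(5) u(2) c \<iota> pq by simp
  then have "regepi ((p \<cdot> \<iota>) \<cdot> c)" using x(2) by simp
  then have re: "regepi (p \<cdot> \<iota>)" by (rule regepi_cancel) (use c \<iota> pq in auto)
  have "kernel_elems p \<subseteq> sieve \<iota>"
  proof
    fix t assume "t \<in> kernel_elems p"
    then have t: "t \<in> Hom C (Dom C t) P" "p \<cdot> t = zero_mor (Dom C t) E10" using pq by (auto simp: kernel_elems_iff)
    have tO: "Dom C t \<in> Obj C" "E00 \<in> Obj C" "E10 \<in> Obj C" using t(1) g by auto
    have "g \<cdot> (p \<cdot> t) = b \<cdot> (q \<cdot> t)" using pq(3) by (rule comp_cong) (use t(1) pq g b in auto)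
    then have "b \<cdot> (q \<cdot> t) = zero_mor (Dom C t) E00" using t g tO by simp
    then have "q \<cdot> t \<in> kernel_elems b" using t(1) pq b by (intro kernel_elemsI) auto
    then have "q \<cdot> t \<in> sieve kb" using kb(2) by simp
    then obtain s where s: "s \<in> Hom C (Dom C (q \<cdot> t)) (Dom C kb)" "kb \<cdot> s = q \<cdot> t" by (rule sieveE)
    have sH: "s \<in> Hom C (Dom C t) E02" using s(1) t(1) pq kb(1) by simp
    obtain T e s' where l: "regepi e" "e \<in> Hom C T (Dom C s)" "s' \<in> Hom C T (Dom C r)" "r \<cdot> s' = s \<cdot> e"
      by (rule regepi_lift[OF r(2), of s]) (use sH r in auto)
    have e: "e \<in> Hom C T (Dom C t)" and s': "s' \<in> Hom C T E12" using l sH r by auto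
    have TO: "T \<in> Obj C" using e by auto
    have "t \<cdot> e = u \<cdot> (kx \<cdot> s')"
    proof (rule jm[of _ T])
      have "p \<cdot> (u \<cdot> (kx \<cdot> s')) = x \<cdot> (kx \<cdot> s')" using u(2) by (rule comp_cong1) (use pq uH kx(1) s' in auto)
      also have "\<dots> = zero_mor E12 E10 \<cdot> s'" using kx(2) by (rule comp_cong1) (use x kx(1) s' in auto)
      also have "\<dots> = zero_mor T E10" using s' tO by simp
      also have "\<dots> = p \<cdot> (t \<cdot> e)"
      proof -
        have "p \<cdot> (t \<cdot> e) = zero_mor (Dom C t) E10 \<cdot> e" using t(2) by (rule comp_cong1) (use t(1) e pq in auto)
        then show ?thesis using e tO by simp
      qed
      finally show "p \<cdot> (t \<cdot> e) = p \<cdot> (u \<cdot> (kx \<cdot> s'))" by simp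
      have "q \<cdot> (u \<cdot> (kx \<cdot> s')) = y \<cdot> (kx \<cdot> s')" using u(3) by (rule comp_cong1) (use pq uH kx(1) s' in auto)
      also have "\<dots> = kb \<cdot> (r \<cdot> s')" using kx(3) by (rule comp_cong) (use y kx(1) s' kb(1) r in auto)
      also have "\<dots> = kb \<cdot> (s \<cdot> e)" using l(4) by simp
      also have "\<dots> = q \<cdot> (t \<cdot> e)" using s(2) by (rule comp_cong) (use sH e kb(1) t(1) pq in auto)
      finally show "q \<cdot> (t \<cdot> e) = q \<cdot> (u \<cdot> (kx \<cdot> s'))" by simp
    qed (use t(1) e uH kx(1) s' in auto)
    also have "\<dots> = \<iota> \<cdot> (c \<cdot> (kx \<cdot> s'))" using I(5)[symmetric] c \<iota> kx(1) s' by simp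
    finally have "t \<cdot> e \<in> sieve \<iota>" by (intro sieveI[of \<iota> "c \<cdot> (kx \<cdot> s')"]) (use c \<iota> kx(1) s' in auto)
    then show "t \<in> sieve \<iota>" by (rule regepi_sieve[OF _ l(1) I(2)]) (use t(1) e \<iota> in auto)
  qed
  then have "is_iso C \<iota>" by (rule monic_iso_over_regepi[OF I(2) \<iota> pq(1) re])
  then have "regepi (\<iota> \<cdot> c)" by (intro regepi_iso_comp[OF I(1)]) (use c \<iota> in auto)
  then show ?thesis using I(5) by simp
qed

text \<open>The kernel of \<open>u\<close> is the intersection of the kernels of \<open>x\<close>
  and \<open>y\<close>. On the kernel \<open>E21\<close> of \<open>y\<close> the morphism
  \<open>x\<close> becomes \<open>z \<cdot> w\<close> with \<open>z\<close> monic, so the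
  intersection is the kernel \<open>E22\<close> of \<open>w\<close>.\<close>

lemma comparison_kernel:
  assumes x: "x \<in> Hom C E11 E10" and y: "y \<in> Hom C E11 E01"
    and pb: "is_pullback C g b p q" and g: "g \<in> Hom C E10 E00" and b: "b \<in> Hom C E01 E00"
    and u: "u \<in> Hom C E11 (Dom C p)" "p \<cdot> u = x" "q \<cdot> u = y"
    and ky: "ky \<in> Hom C E21 E11" "monic ky" "sieve ky = kernel_elems y"
    and k2: "k2 \<in> Hom C E22 E21" "monic k2" "sieve k2 = kernel_elems w"
    and w: "w \<in> Hom C E21 E20" and z: "z \<in> Hom C E20 E10" "monic z" "x \<cdot> ky = z \<cdot> w"
  shows "monic (ky \<cdot> k2)" "sieve (ky \<cdot> k2) = kernel_elems u"
proof -
  define P where "P = Dom C p"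
  have pq: "p \<in> Hom C P E10" "q \<in> Hom C P E01"
    using pb g b unfolding P_def by (auto elim!: pullbackE)
  have jm: "s = t" if "s \<in> Hom C T P" "t \<in> Hom C T P" "p \<cdot> s = p \<cdot> t" "q \<cdot> s = q \<cdot> t" for s t T
    using pb by (rule pullbackE) (use that P_def in blast)
  have uH: "u \<in> Hom C E11 P" using u(1) P_def by simp
  have O: "E11 \<in> Obj C" "E10 \<in> Obj C" "E01 \<in> Obj C" "P \<in> Obj C" "E20 \<in> Obj C" using x y uH w by auto
  show "monic (ky \<cdot> k2)" by (rule monic_comp[OF k2(2) ky(2)]) (use k2 ky in auto)
  have kk: "ky \<cdot> k2 \<in> Hom C E22 E11" using ky k2 by auto
  show "sieve (ky \<cdot> k2) = kernel_elems u"
  proof (intro equalityI subsetI)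
    fix t assume "t \<in> sieve (ky \<cdot> k2)"
    then obtain s where s: "s \<in> Hom C (Dom C t) (Dom C (ky \<cdot> k2))" "(ky \<cdot> k2) \<cdot> s = t" by (rule sieveE)
    have sH: "s \<in> Hom C (Dom C t) E22" using s(1) kk by simp
    have tO: "Dom C t \<in> Obj C" using sH by (rule Hom_Dom_Obj)
    have k2s: "w \<cdot> (k2 \<cdot> s) = zero_mor (Dom C t) E20"
    proof -
      have "k2 \<cdot> s \<in> kernel_elems w" using sieveI[of k2 s "k2 \<cdot> s"] sH k2 by simp
      then show ?thesis using sH k2 w by (simp add: kernel_elems_iff)
    qed
    have "ky \<in> kernel_elems y" using ky sieve_self[of ky] by auto
    then have yk: "y \<cdot> ky = zero_mor E21 E01" using ky y by (auto simp: kernel_elems_iff)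
    have "u \<cdot> (ky \<cdot> (k2 \<cdot> s)) = zero_mor (Dom C t) P"
    proof (rule jm[of _ "Dom C t"])
      have "p \<cdot> (u \<cdot> (ky \<cdot> (k2 \<cdot> s))) = x \<cdot> (ky \<cdot> (k2 \<cdot> s))" using u(2) by (rule comp_cong1) (use pq uH ky k2 sH in auto)
      also have "\<dots> = z \<cdot> (w \<cdot> (k2 \<cdot> s))" using z(3) by (rule comp_cong) (use x ky k2 sH w z in auto)
      finally show "p \<cdot> (u \<cdot> (ky \<cdot> (k2 \<cdot> s))) = p \<cdot> zero_mor (Dom C t) P" using k2s z(1) pq(1) tO by simp
      have "q \<cdot> (u \<cdot> (ky \<cdot> (k2 \<cdot> s))) = y \<cdot> (ky \<cdot> (k2 \<cdot> s))" using u(3) by (rule comp_cong1) (use pq uH ky k2 sH in auto)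
      also have "\<dots> = zero_mor E21 E01 \<cdot> (k2 \<cdot> s)" using yk by (rule comp_cong1) (use y ky k2 sH in auto)
      finally show "q \<cdot> (u \<cdot> (ky \<cdot> (k2 \<cdot> s))) = q \<cdot> zero_mor (Dom C t) P" using k2 sH pq(2) tO O by simp
    qed (use uH ky k2 sH tO O in auto)
    moreover have "ky \<cdot> (k2 \<cdot> s) = t" using s(2) ky(1) k2(1) sH by simp
    ultimately have "u \<cdot> t = zero_mor (Dom C t) P" by simp
    moreover have "t \<in> Mor C" "Cod C t = E11" using \<open>ky \<cdot> (k2 \<cdot> s) = t\<close>[symmetric] ky(1) k2(1) sH by simp_all
    ultimately show "t \<in> kernel_elems u" using uH by (simp add: kernel_elems_iff)
  next
    fix t assume "t \<in> kernel_elems u"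
    then have t: "t \<in> Hom C (Dom C t) E11" "u \<cdot> t = zero_mor (Dom C t) P" using uH by (auto simp: kernel_elems_iff)
    have tO: "Dom C t \<in> Obj C" using t(1) by auto
    have "p \<cdot> (u \<cdot> t) = x \<cdot> t" using u(2) by (rule comp_cong1) (use pq uH t(1) in auto)
    then have xt: "x \<cdot> t = zero_mor (Dom C t) E10" using t(2) pq(1) tO by simp
    have "q \<cdot> (u \<cdot> t) = y \<cdot> t" using u(3) by (rule comp_cong1) (use pq uH t(1) in auto)
    then have "y \<cdot> t = zero_mor (Dom C t) E01" using t(2) pq(2) tO by simp
    then have "t \<in> kernel_elems y" using t(1) y by (intro kernel_elemsI) auto
    then have "t \<in> sieve ky" using ky(3) by simp
    then obtain s where s: "s \<in> Hom C (Dom C t) (Dom C ky)" "ky \<cdot> s = t" by (rule sieveE)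
    have sH: "s \<in> Hom C (Dom C t) E21" using s(1) ky(1) by simp
    have "x \<cdot> (ky \<cdot> s) = z \<cdot> (w \<cdot> s)" using z(3) by (rule comp_cong) (use x ky sH w z in auto)
    then have "z \<cdot> (w \<cdot> s) = z \<cdot> zero_mor (Dom C t) E20" using s(2) xt z(1) tO by simp
    then have "w \<cdot> s = zero_mor (Dom C t) E20" by (rule monicD[OF _ z(2), where T = "Dom C t"]) (use w z(1) sH tO O in auto)
    then have "s \<in> kernel_elems w" by (intro kernel_elemsI) (use sH w in auto)
    then have "s \<in> sieve k2" using k2(3) by simp
    then obtain s' where s': "s' \<in> Hom C (Dom C s) (Dom C k2)" "k2 \<cdot> s' = s" by (rule sieveE)
    have "(ky \<cdot> k2) \<cdot> s' = t" using s' s(2) ky(1) k2(1) sH by simp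
    then show "t \<in> sieve (ky \<cdot> k2)" by (intro sieveI[of _ s']) (use s' kk k2(1) in simp_all)
  qed
qed

text \<open>Kernels commute with pullbacks. An element killed by \<open>vP\<close> has its two
  projections in the kernels \<open>A2\<close> and \<open>B2\<close>, and monicity of
  \<open>kC\<close> shows that these agree over \<open>C2\<close>, so that they define an element of
  the pullback there.\<close>

lemma pullback_kernel:
  assumes pb2: "is_pullback C g2 b2 p2 q2" and pb1: "is_pullback C g1 b1 p1 q1" and pb0: "is_pullback C g0 b0 p0 q0"
    and G2: "g2 \<in> Hom C A2 C2" "b2 \<in> Hom C B2 C2" and G1: "g1 \<in> Hom C A1 C1" "b1 \<in> Hom C B1 C1"
    and G0: "g0 \<in> Hom C A0 C0" "b0 \<in> Hom C B0 C0"
    and kA: "kA \<in> Hom C A2 A1" "monic kA" "sieve kA = kernel_elems vA" "vA \<in> Hom C A1 A0"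
    and kB: "kB \<in> Hom C B2 B1" "monic kB" "sieve kB = kernel_elems vB" "vB \<in> Hom C B1 B0"
    and kC: "kC \<in> Hom C C2 C1" "monic kC" "g1 \<cdot> kA = kC \<cdot> g2" "b1 \<cdot> kB = kC \<cdot> b2"
    and kP: "kP \<in> Hom C (Dom C p2) (Dom C p1)" "p1 \<cdot> kP = kA \<cdot> p2" "q1 \<cdot> kP = kB \<cdot> q2"
    and vP: "vP \<in> Hom C (Dom C p1) (Dom C p0)" "p0 \<cdot> vP = vA \<cdot> p1" "q0 \<cdot> vP = vB \<cdot> q1"
  shows "monic kP" "sieve kP = kernel_elems vP"
proof -
  have P2: "p2 \<in> Hom C (Dom C p2) A2" "q2 \<in> Hom C (Dom C p2) B2" using pb2 G2 by (auto elim!: pullbackE)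
  have P1: "p1 \<in> Hom C (Dom C p1) A1" "q1 \<in> Hom C (Dom C p1) B1" "g1 \<cdot> p1 = b1 \<cdot> q1" using pb1 G1 by (auto elim!: pullbackE)
  have P0: "p0 \<in> Hom C (Dom C p0) A0" "q0 \<in> Hom C (Dom C p0) B0" using pb0 G0 by (auto elim!: pullbackE)
  have jm2: "s = t" if "s \<in> Hom C T (Dom C p2)" "t \<in> Hom C T (Dom C p2)" "p2 \<cdot> s = p2 \<cdot> t" "q2 \<cdot> s = q2 \<cdot> t" for s t T
    using pb2 by (rule pullbackE) (use that in blast)
  have jm1: "s = t" if "s \<in> Hom C T (Dom C p1)" "t \<in> Hom C T (Dom C p1)" "p1 \<cdot> s = p1 \<cdot> t" "q1 \<cdot> s = q1 \<cdot> t" for s t T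
    using pb1 by (rule pullbackE) (use that in blast)
  have jm0: "s = t" if "s \<in> Hom C T (Dom C p0)" "t \<in> Hom C T (Dom C p0)" "p0 \<cdot> s = p0 \<cdot> t" "q0 \<cdot> s = q0 \<cdot> t" for s t T
    using pb0 by (rule pullbackE) (use that in blast)
  have ex2: "\<exists>u \<in> Hom C T (Dom C p2). p2 \<cdot> u = s \<and> q2 \<cdot> u = t"
    if "s \<in> Hom C T (Dom C g2)" "t \<in> Hom C T (Dom C b2)" "g2 \<cdot> s = b2 \<cdot> t" for s t T
    using pb2 by (rule pullbackE) (use that in blast)
  have G2d: "A2 = Dom C g2" "B2 = Dom C b2" using G2 by auto
  have p1k: "p1 \<cdot> (kP \<cdot> s) = kA \<cdot> (p2 \<cdot> s)" "q1 \<cdot> (kP \<cdot> s) = kB \<cdot> (q2 \<cdot> s)" if "s \<in> Hom C T (Dom C p2)" for s T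
  proof -
    show "p1 \<cdot> (kP \<cdot> s) = kA \<cdot> (p2 \<cdot> s)" using kP(2) by (rule comp_cong) (use kP(1) P1 P2 kA that in auto)
    show "q1 \<cdot> (kP \<cdot> s) = kB \<cdot> (q2 \<cdot> s)" using kP(3) by (rule comp_cong) (use kP(1) P1 P2 kB that in auto)
  qed
  have p0v: "p0 \<cdot> (vP \<cdot> s) = vA \<cdot> (p1 \<cdot> s)" "q0 \<cdot> (vP \<cdot> s) = vB \<cdot> (q1 \<cdot> s)" if "s \<in> Hom C T (Dom C p1)" for s T
  proof -
    show "p0 \<cdot> (vP \<cdot> s) = vA \<cdot> (p1 \<cdot> s)" using vP(2) by (rule comp_cong) (use vP(1) P1 P0 kA that in auto)
    show "q0 \<cdot> (vP \<cdot> s) = vB \<cdot> (q1 \<cdot> s)" using vP(3) by (rule comp_cong) (use vP(1) P1 P0 kB that in auto)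
  qed
  show "monic kP"
  proof (rule monicI)
    fix T s t assume "s \<in> Hom C T (Dom C kP)" "t \<in> Hom C T (Dom C kP)" and eq: "kP \<cdot> s = kP \<cdot> t"
    then have st: "s \<in> Hom C T (Dom C p2)" "t \<in> Hom C T (Dom C p2)" using kP(1) by auto
    have "kA \<cdot> (p2 \<cdot> s) = kA \<cdot> (p2 \<cdot> t)" using p1k(1)[OF st(1)] p1k(1)[OF st(2)] eq by simp
    then have 1: "p2 \<cdot> s = p2 \<cdot> t" by (rule monicD[OF _ kA(2), where T = T]) (use st P2 kA in auto)
    have "kB \<cdot> (q2 \<cdot> s) = kB \<cdot> (q2 \<cdot> t)" using p1k(2)[OF st(1)] p1k(2)[OF st(2)] eq by simp
    then have 2: "q2 \<cdot> s = q2 \<cdot> t" by (rule monicD[OF _ kB(2), where T = T]) (use st P2 kB in auto)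
    show "s = t" by (rule jm2[OF st 1 2])
  qed (use kP in auto)
  have O: "A0 \<in> Obj C" "B0 \<in> Obj C" "Dom C p0 \<in> Obj C" using P0 by auto
  show "sieve kP = kernel_elems vP"
  proof (intro equalityI subsetI)
    fix t assume "t \<in> sieve kP"
    then obtain s where s: "s \<in> Hom C (Dom C t) (Dom C kP)" "kP \<cdot> s = t" by (rule sieveE)
    have sH: "s \<in> Hom C (Dom C t) (Dom C p2)" using s(1) kP(1) by simp
    have ksH: "kP \<cdot> s \<in> Hom C (Dom C t) (Dom C p1)" using sH kP(1) by simp
    have tO: "Dom C t \<in> Obj C" using sH by (rule Hom_Dom_Obj)
    have "vP \<cdot> (kP \<cdot> s) = zero_mor (Dom C t) (Dom C p0)"
    proof (rule jm0[of _ "Dom C t"])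
      have "kA \<in> kernel_elems vA" using kA sieve_self[of kA] by auto
      then have "kA \<cdot> (p2 \<cdot> s) \<in> kernel_elems vA" by (rule kernel_elems_comp) (use kA sH P2 in auto)
      then have "vA \<cdot> (kA \<cdot> (p2 \<cdot> s)) = zero_mor (Dom C t) A0" using kA sH P2 by (auto simp: kernel_elems_iff)
      then show "p0 \<cdot> (vP \<cdot> (kP \<cdot> s)) = p0 \<cdot> zero_mor (Dom C t) (Dom C p0)"
        using p0v(1)[OF ksH] p1k(1)[OF sH] P0(1) tO by simp
      have "kB \<in> kernel_elems vB" using kB sieve_self[of kB] by auto
      then have "kB \<cdot> (q2 \<cdot> s) \<in> kernel_elems vB" by (rule kernel_elems_comp) (use kB sH P2 in auto)
      then have "vB \<cdot> (kB \<cdot> (q2 \<cdot> s)) = zero_mor (Dom C t) B0" using kB sH P2 by (auto simp: kernel_elems_iff)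
      then show "q0 \<cdot> (vP \<cdot> (kP \<cdot> s)) = q0 \<cdot> zero_mor (Dom C t) (Dom C p0)"
        using p0v(2)[OF ksH] p1k(2)[OF sH] P0(2) tO by simp
    qed (use vP(1) ksH tO O in auto)
    then have "kP \<cdot> s \<in> kernel_elems vP" using ksH vP(1) by (intro kernel_elemsI) auto
    then show "t \<in> kernel_elems vP" using s(2) by simp
  next
    fix t assume "t \<in> kernel_elems vP"
    then have t: "t \<in> Hom C (Dom C t) (Dom C p1)" "vP \<cdot> t = zero_mor (Dom C t) (Dom C p0)" using vP(1) by (auto simp: kernel_elems_iff)
    have tO: "Dom C t \<in> Obj C" using t(1) by auto
    have "vA \<cdot> (p1 \<cdot> t) = zero_mor (Dom C t) A0" using p0v(1)[OF t(1)] t(2) P0(1) tO by simp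
    then have "p1 \<cdot> t \<in> kernel_elems vA" using t(1) P1 kA(4) by (intro kernel_elemsI) auto
    then have "p1 \<cdot> t \<in> sieve kA" using kA(3) by simp
    then obtain \<alpha> where \<alpha>: "\<alpha> \<in> Hom C (Dom C (p1 \<cdot> t)) (Dom C kA)" "kA \<cdot> \<alpha> = p1 \<cdot> t" by (rule sieveE)
    have \<alpha>H: "\<alpha> \<in> Hom C (Dom C t) A2" using \<alpha>(1) t(1) P1 kA(1) by simp
    have "vB \<cdot> (q1 \<cdot> t) = zero_mor (Dom C t) B0" using p0v(2)[OF t(1)] t(2) P0(2) tO by simp
    then have "q1 \<cdot> t \<in> kernel_elems vB" using t(1) P1 kB(4) by (intro kernel_elemsI) auto
    then have "q1 \<cdot> t \<in> sieve kB" using kB(3) by simp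
    then obtain \<beta> where \<beta>: "\<beta> \<in> Hom C (Dom C (q1 \<cdot> t)) (Dom C kB)" "kB \<cdot> \<beta> = q1 \<cdot> t" by (rule sieveE)
    have \<beta>H: "\<beta> \<in> Hom C (Dom C t) B2" using \<beta>(1) t(1) P1 kB(1) by simp
    have "kC \<cdot> (g2 \<cdot> \<alpha>) = g1 \<cdot> (kA \<cdot> \<alpha>)" using kC(3)[symmetric] by (rule comp_cong) (use \<alpha>H kC(1) kA(1) G1 G2 in auto)
    also have "\<dots> = b1 \<cdot> (kB \<cdot> \<beta>)"
    proof -
      have "g1 \<cdot> (p1 \<cdot> t) = b1 \<cdot> (q1 \<cdot> t)" using P1(3) by (rule comp_cong) (use t(1) P1 G1 in auto)
      then show ?thesis using \<alpha>(2) \<beta>(2) by simp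
    qed
    also have "\<dots> = kC \<cdot> (b2 \<cdot> \<beta>)" using kC(4) by (rule comp_cong) (use \<beta>H kC(1) kB(1) G1 G2 in auto)
    finally have "g2 \<cdot> \<alpha> = b2 \<cdot> \<beta>" by (rule monicD[OF _ kC(2), where T = "Dom C t"]) (use \<alpha>H \<beta>H G2 kC(1) in auto)
    from ex2[OF \<alpha>H[unfolded G2d] \<beta>H[unfolded G2d] this] obtain s where s: "s \<in> Hom C (Dom C t) (Dom C p2)" "p2 \<cdot> s = \<alpha>" "q2 \<cdot> s = \<beta>" by blast
    have "kP \<cdot> s = t"
      by (rule jm1[of _ "Dom C t"]) (use p1k[OF s(1)] s \<alpha>(2) \<beta>(2) t(1) kP(1) in simp_all)
    then show "t \<in> sieve kP" by (intro sieveI[of kP s]) (use s(1) kP(1) in simp_all)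
  qed
qed

section \<open>Edges and faces of \<open>3\<^sup>n\<close>-diagrams\<close>

lemma three_diagram_exact:
  assumes "is_3n_diagram C n E" "i < n" "\<sigma> \<in> three_objs n"
  shows "regepi (FMor E (\<sigma>(i := 0), \<sigma>(i := 1)))" "monic (FMor E (\<sigma>(i := 1), \<sigma>(i := 2)))"
    "sieve (FMor E (\<sigma>(i := 1), \<sigma>(i := 2))) = kernel_elems (FMor E (\<sigma>(i := 0), \<sigma>(i := 1)))"
proof -
  have "is_short_exact C (seq_edge E i \<sigma> 2 1) (seq_edge E i \<sigma> 1 0)"
    using assms unfolding is_3n_diagram_def by blast
  then show "regepi (FMor E (\<sigma>(i := 0), \<sigma>(i := 1)))" "monic (FMor E (\<sigma>(i := 1), \<sigma>(i := 2)))"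
    "sieve (FMor E (\<sigma>(i := 1), \<sigma>(i := 2))) = kernel_elems (FMor E (\<sigma>(i := 0), \<sigma>(i := 1)))"
    unfolding short_exact_iff seq_edge_def by blast+
qed

text \<open>Serves for the faces of a diagram: \<phi> fixes a coordinate and renames the others, and
  \<open>d i\<close> is the direction of \<open>E\<close> that plays the role of direction
  \<open>i\<close>.\<close>

lemma three_diagram_reindex:
  assumes diag: "is_3n_diagram C n E"
    and \<phi>: "\<And>\<sigma>. \<sigma> \<in> three_objs m \<Longrightarrow> \<phi> \<sigma> \<in> three_objs n"
    and mono: "\<And>\<sigma> \<tau>. \<sigma> \<le> \<tau> \<Longrightarrow> \<phi> \<sigma> \<le> \<phi> \<tau>"
    and dir: "\<And>i \<sigma> x. i < m \<Longrightarrow> \<phi> (\<sigma>(i := x)) = (\<phi> \<sigma>)(d i := x)" "\<And>i. i < m \<Longrightarrow> d i < n"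
  shows "is_3n_diagram C m \<lparr>FObj = (\<lambda>\<sigma>. FObj E (\<phi> \<sigma>)), FMor = (\<lambda>p. FMor E (\<phi> (fst p), \<phi> (snd p)))\<rparr>"
    (is "is_3n_diagram C m ?E")
proof -
  have seq: "is_n_sequence C n E" using diag by (simp add: is_3n_diagram_def)
  note D = n_sequenceD[OF seq]
  show ?thesis unfolding is_3n_diagram_def n_sequence_iff
  proof (intro conjI ballI allI impI)
    fix \<sigma> assume s: "\<sigma> \<in> three_objs m"
    show "FObj ?E \<sigma> \<in> Obj C" using D(2)[OF \<phi>[OF s]] by simp
    show "FMor ?E (\<sigma>, \<sigma>) = Ident C (FObj ?E \<sigma>)" using D(3)[OF \<phi>[OF s]] by simp
    fix \<tau> assume t: "\<tau> \<in> three_objs m" "\<sigma> \<le> \<tau>"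
    show "FMor ?E (\<sigma>, \<tau>) \<in> Hom C (FObj ?E \<tau>) (FObj ?E \<sigma>)"
      using D(1)[OF \<phi>[OF s] \<phi>[OF t(1)] mono[OF t(2)]] by simp
  next
    fix \<rho> \<sigma> \<tau> assume "\<rho> \<in> three_objs m" "\<sigma> \<in> three_objs m" "\<tau> \<in> three_objs m" "\<rho> \<le> \<sigma> \<and> \<sigma> \<le> \<tau>"
    then show "FMor ?E (\<rho>, \<tau>) = FMor ?E (\<rho>, \<sigma>) \<cdot> FMor ?E (\<sigma>, \<tau>)"
      using D(4)[OF \<phi> \<phi> \<phi> mono mono] by simp
  next
    fix i \<sigma> assume i: "i < m" "\<sigma> \<in> three_objs m"
    have "is_short_exact C (seq_edge E (d i) (\<phi> \<sigma>) 2 1) (seq_edge E (d i) (\<phi> \<sigma>) 1 0)"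
      using diag dir(2)[OF i(1)] \<phi>[OF i(2)] unfolding is_3n_diagram_def by blast
    then show "is_short_exact C (seq_edge ?E i \<sigma> 2 1) (seq_edge ?E i \<sigma> 1 0)"
      unfolding seq_edge_def by (simp only: dir(1)[OF i(1)] functor_data.simps fst_conv snd_conv)
  qed
qed

end

text \<open>\<sigma> is meant to range over \<open>three_objs (Suc m)\<close>. Its own coordinate
  \<open>m\<close> is overwritten, which leaves it free to number the direction of the
  comparison.\<close>

definition last_two :: "nat \<Rightarrow> (nat \<Rightarrow> nat) \<Rightarrow> nat \<Rightarrow> nat \<Rightarrow> nat \<Rightarrow> nat" where
  "last_two m \<sigma> a b = \<sigma>(m := a, Suc m := b)"

lemma last_two_three_objs:
  "\<sigma> \<in> three_objs (Suc m) \<Longrightarrow> a \<le> 2 \<Longrightarrow> b \<le> 2 \<Longrightarrow> last_two m \<sigma> a b \<in> three_objs (Suc (Suc m))"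
  by (auto simp: last_two_def three_objs_def less_Suc_eq)

lemma last_two_mono: "\<sigma> \<le> \<tau> \<Longrightarrow> a \<le> a' \<Longrightarrow> b \<le> b' \<Longrightarrow> last_two m \<sigma> a b \<le> last_two m \<tau> a' b'"
  by (auto simp: last_two_def le_fun_def)

lemma last_two_upd [simp]:
  "last_two m (\<sigma>(m := x)) a b = last_two m \<sigma> a b"
  "(last_two m \<sigma> a b)(m := x) = last_two m \<sigma> x b" "(last_two m \<sigma> a b)(Suc m := x) = last_two m \<sigma> a x"
  by (auto simp: last_two_def fun_eq_iff)

lemma last_two_upd_low: "i < m \<Longrightarrow> last_two m (\<sigma>(i := x)) a b = (last_two m \<sigma> a b)(i := x)"
  by (auto simp: last_two_def fun_eq_iff)

context semi_abelian_category
begin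

text \<open>The diagram with \<open>E\<^sub>2\<^sub>2 \<rightarrow> E\<^sub>1\<^sub>1 \<rightarrow> E\<^sub>1\<^sub>0 \<times> E\<^sub>0\<^sub>1\<close> (over \<open>E\<^sub>0\<^sub>0\<close>) as its last direction, where the indices are
  the last two coordinates of \<open>E\<close>.\<close>

definition comparison_pb :: "nat \<Rightarrow> ('o, 'm) seq \<Rightarrow> (nat \<Rightarrow> nat) \<Rightarrow> 'm \<times> 'm" where
  "comparison_pb m E \<sigma> = (SOME z. is_pullback C (FMor E (last_two m \<sigma> 0 0, last_two m \<sigma> 1 0)) (FMor E (last_two m \<sigma> 0 0, last_two m \<sigma> 0 1))
     (fst z) (snd z))"

definition comparison_obj :: "nat \<Rightarrow> ('o, 'm) seq \<Rightarrow> (nat \<Rightarrow> nat) \<Rightarrow> 'o" where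
  "comparison_obj m E \<sigma> = (if \<sigma> m = 0 then Dom C (fst (comparison_pb m E \<sigma>)) else FObj E (last_two m \<sigma> (\<sigma> m) (\<sigma> m)))"

text \<open>The morphisms to \<open>E\<^sub>1\<^sub>0\<close> and \<open>E\<^sub>0\<^sub>1\<close>
  are defined at all three values of the last coordinate, not only at the pullback, so that
  compatibility with them describes every morphism of the new diagram in the same way.\<close>

definition comparison_fst :: "nat \<Rightarrow> ('o, 'm) seq \<Rightarrow> (nat \<Rightarrow> nat) \<Rightarrow> 'm" where
  "comparison_fst m E \<sigma> = (if \<sigma> m = 0 then fst (comparison_pb m E \<sigma>) else FMor E (last_two m \<sigma> 1 0, last_two m \<sigma> (\<sigma> m) (\<sigma> m)))"

definition comparison_snd :: "nat \<Rightarrow> ('o, 'm) seq \<Rightarrow> (nat \<Rightarrow> nat) \<Rightarrow> 'm" where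
  "comparison_snd m E \<sigma> = (if \<sigma> m = 0 then snd (comparison_pb m E \<sigma>) else FMor E (last_two m \<sigma> 0 1, last_two m \<sigma> (\<sigma> m) (\<sigma> m)))"

text \<open>Into the pullback the morphism is given by choice, but its two composites with the
  projections determine it. Elsewhere it is the diagonal morphism of \<open>E\<close>.\<close>

definition comparison_mor :: "nat \<Rightarrow> ('o, 'm) seq \<Rightarrow> (nat \<Rightarrow> nat) \<Rightarrow> (nat \<Rightarrow> nat) \<Rightarrow> 'm" where
  "comparison_mor m E \<sigma> \<tau> = (if \<sigma> m = 0 then
       (SOME u. u \<in> Hom C (comparison_obj m E \<tau>) (comparison_obj m E \<sigma>) \<and>
          comparison_fst m E \<sigma> \<cdot> u = FMor E (last_two m \<sigma> 1 0, last_two m \<tau> 1 0) \<cdot> comparison_fst m E \<tau> \<and>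
          comparison_snd m E \<sigma> \<cdot> u = FMor E (last_two m \<sigma> 0 1, last_two m \<tau> 0 1) \<cdot> comparison_snd m E \<tau>)
     else FMor E (last_two m \<sigma> (\<sigma> m) (\<sigma> m), last_two m \<tau> (\<tau> m) (\<tau> m)))"

definition comparison_seq :: "nat \<Rightarrow> ('o, 'm) seq \<Rightarrow> ('o, 'm) seq" where
  "comparison_seq m E = \<lparr>FObj = comparison_obj m E, FMor = (\<lambda>p. comparison_mor m E (fst p) (snd p))\<rparr>"

section \<open>Functoriality and exactness of the comparison diagram\<close>

context
  fixes m :: nat and E :: "('o, 'm) seq"
  assumes diag: "is_3n_diagram C (Suc (Suc m)) E"
begin

lemma last_two_seq: "is_n_sequence C (Suc (Suc m)) E"
  using diag by (simp add: is_3n_diagram_def)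

lemma last_two_Hom:
  assumes "\<sigma> \<in> three_objs (Suc m)" "\<tau> \<in> three_objs (Suc m)" "\<sigma> \<le> \<tau>" "a \<le> a'" "b \<le> b'" "a' \<le> 2" "b' \<le> 2"
  shows "FMor E (last_two m \<sigma> a b, last_two m \<tau> a' b') \<in> Hom C (FObj E (last_two m \<tau> a' b')) (FObj E (last_two m \<sigma> a b))"
  by (rule n_sequenceD(1)[OF last_two_seq last_two_three_objs last_two_three_objs last_two_mono]) (use assms in simp_all)

lemma last_two_comp:
  assumes "\<rho> \<in> three_objs (Suc m)" "\<sigma> \<in> three_objs (Suc m)" "\<tau> \<in> three_objs (Suc m)" "\<rho> \<le> \<sigma>" "\<sigma> \<le> \<tau>"
    "a \<le> a'" "b \<le> b'" "a' \<le> a''" "b' \<le> b''" "a'' \<le> 2" "b'' \<le> 2"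
  shows "FMor E (last_two m \<rho> a b, last_two m \<sigma> a' b') \<cdot> FMor E (last_two m \<sigma> a' b', last_two m \<tau> a'' b'')
    = FMor E (last_two m \<rho> a b, last_two m \<tau> a'' b'')"
  by (rule n_sequenceD(4)[OF last_two_seq last_two_three_objs last_two_three_objs last_two_three_objs last_two_mono last_two_mono])
    (use assms in simp_all)

lemma last_two_id:
  assumes "\<sigma> \<in> three_objs (Suc m)" "a \<le> 2" "b \<le> 2"
  shows "FMor E (last_two m \<sigma> a b, last_two m \<sigma> a b) = Ident C (FObj E (last_two m \<sigma> a b))" "FObj E (last_two m \<sigma> a b) \<in> Obj C"
  using n_sequenceD(2,3)[OF last_two_seq last_two_three_objs[OF assms]] by blast+

lemma last_two_exact_fst:
  assumes "\<sigma> \<in> three_objs (Suc m)" "b \<le> 2"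
  shows "regepi (FMor E (last_two m \<sigma> 0 b, last_two m \<sigma> 1 b))" "monic (FMor E (last_two m \<sigma> 1 b, last_two m \<sigma> 2 b))"
    "sieve (FMor E (last_two m \<sigma> 1 b, last_two m \<sigma> 2 b)) = kernel_elems (FMor E (last_two m \<sigma> 0 b, last_two m \<sigma> 1 b))"
  using three_diagram_exact[OF diag _ last_two_three_objs[OF assms(1) _ assms(2), of 0], of m] by simp_all

lemma last_two_exact_snd:
  assumes "\<sigma> \<in> three_objs (Suc m)" "a \<le> 2"
  shows "regepi (FMor E (last_two m \<sigma> a 0, last_two m \<sigma> a 1))" "monic (FMor E (last_two m \<sigma> a 1, last_two m \<sigma> a 2))"
    "sieve (FMor E (last_two m \<sigma> a 1, last_two m \<sigma> a 2)) = kernel_elems (FMor E (last_two m \<sigma> a 0, last_two m \<sigma> a 1))"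
  using three_diagram_exact[OF diag _ last_two_three_objs[OF assms, of 0], of "Suc m"] by simp_all

lemma last_two_exact_low:
  assumes "\<sigma> \<in> three_objs (Suc m)" "a \<le> 2" "b \<le> 2" "i < m"
  shows "regepi (FMor E (last_two m (\<sigma>(i := 0)) a b, last_two m (\<sigma>(i := 1)) a b))"
    "monic (FMor E (last_two m (\<sigma>(i := 1)) a b, last_two m (\<sigma>(i := 2)) a b))"
    "sieve (FMor E (last_two m (\<sigma>(i := 1)) a b, last_two m (\<sigma>(i := 2)) a b))
      = kernel_elems (FMor E (last_two m (\<sigma>(i := 0)) a b, last_two m (\<sigma>(i := 1)) a b))"
  using three_diagram_exact[OF diag _ last_two_three_objs[OF assms(1-3)], of i] assms(4)
  unfolding last_two_upd_low[OF assms(4)] by simp_all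

lemma comparison_pb_pullback:
  assumes s: "\<sigma> \<in> three_objs (Suc m)"
  shows "is_pullback C (FMor E (last_two m \<sigma> 0 0, last_two m \<sigma> 1 0)) (FMor E (last_two m \<sigma> 0 0, last_two m \<sigma> 0 1))
     (fst (comparison_pb m E \<sigma>)) (snd (comparison_pb m E \<sigma>))"
proof -
  have 1: "FMor E (last_two m \<sigma> 0 0, last_two m \<sigma> 1 0) \<in> Hom C (FObj E (last_two m \<sigma> 1 0)) (FObj E (last_two m \<sigma> 0 0))"
    by (rule last_two_Hom) (use s in simp_all)
  have 2: "FMor E (last_two m \<sigma> 0 0, last_two m \<sigma> 0 1) \<in> Hom C (FObj E (last_two m \<sigma> 0 1)) (FObj E (last_two m \<sigma> 0 0))"
    by (rule last_two_Hom) (use s in simp_all)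
  obtain p q where "is_pullback C (FMor E (last_two m \<sigma> 0 0, last_two m \<sigma> 1 0)) (FMor E (last_two m \<sigma> 0 0, last_two m \<sigma> 0 1)) p q"
    by (rule pullback_obtain[of "FMor E (last_two m \<sigma> 0 0, last_two m \<sigma> 1 0)" "FMor E (last_two m \<sigma> 0 0, last_two m \<sigma> 0 1)"])
      (use 1 2 in simp_all)
  then have "\<exists>z. is_pullback C (FMor E (last_two m \<sigma> 0 0, last_two m \<sigma> 1 0)) (FMor E (last_two m \<sigma> 0 0, last_two m \<sigma> 0 1)) (fst z) (snd z)"
    by (intro exI[of _ "(p, q)"]) simp
  then show ?thesis unfolding comparison_pb_def by (rule someI_ex)
qed

lemma comparison_square:
  assumes s: "\<sigma> \<in> three_objs (Suc m)"
  shows "comparison_fst m E \<sigma> \<in> Hom C (comparison_obj m E \<sigma>) (FObj E (last_two m \<sigma> 1 0))" "comparison_snd m E \<sigma> \<in> Hom C (comparison_obj m E \<sigma>) (FObj E (last_two m \<sigma> 0 1))"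
    "FMor E (last_two m \<sigma> 0 0, last_two m \<sigma> 1 0) \<cdot> comparison_fst m E \<sigma> = FMor E (last_two m \<sigma> 0 0, last_two m \<sigma> 0 1) \<cdot> comparison_snd m E \<sigma>"
proof -
  have 1: "FMor E (last_two m \<sigma> 0 0, last_two m \<sigma> 1 0) \<in> Hom C (FObj E (last_two m \<sigma> 1 0)) (FObj E (last_two m \<sigma> 0 0))"
    by (rule last_two_Hom) (use s in simp_all)
  have 2: "FMor E (last_two m \<sigma> 0 0, last_two m \<sigma> 0 1) \<in> Hom C (FObj E (last_two m \<sigma> 0 1)) (FObj E (last_two m \<sigma> 0 0))"
    by (rule last_two_Hom) (use s in simp_all)
  have "comparison_fst m E \<sigma> \<in> Hom C (comparison_obj m E \<sigma>) (FObj E (last_two m \<sigma> 1 0)) \<and> comparison_snd m E \<sigma> \<in> Hom C (comparison_obj m E \<sigma>) (FObj E (last_two m \<sigma> 0 1)) \<and>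
    FMor E (last_two m \<sigma> 0 0, last_two m \<sigma> 1 0) \<cdot> comparison_fst m E \<sigma> = FMor E (last_two m \<sigma> 0 0, last_two m \<sigma> 0 1) \<cdot> comparison_snd m E \<sigma>"
  proof (cases "\<sigma> m = 0")
    case True
    then show ?thesis using comparison_pb_pullback[OF s] 1 2 by (auto simp: comparison_fst_def comparison_snd_def comparison_obj_def elim!: pullbackE)
  next
    case False
    then have le: "1 \<le> \<sigma> m" "\<sigma> m \<le> 2" using three_objs_le2[OF s] by auto
    have a: "FMor E (last_two m \<sigma> 1 0, last_two m \<sigma> (\<sigma> m) (\<sigma> m)) \<in> Hom C (FObj E (last_two m \<sigma> (\<sigma> m) (\<sigma> m))) (FObj E (last_two m \<sigma> 1 0))"
      by (rule last_two_Hom) (use s le in simp_all)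
    have b: "FMor E (last_two m \<sigma> 0 1, last_two m \<sigma> (\<sigma> m) (\<sigma> m)) \<in> Hom C (FObj E (last_two m \<sigma> (\<sigma> m) (\<sigma> m))) (FObj E (last_two m \<sigma> 0 1))"
      by (rule last_two_Hom) (use s le in simp_all)
    have "FMor E (last_two m \<sigma> 0 0, last_two m \<sigma> 1 0) \<cdot> FMor E (last_two m \<sigma> 1 0, last_two m \<sigma> (\<sigma> m) (\<sigma> m)) = FMor E (last_two m \<sigma> 0 0, last_two m \<sigma> (\<sigma> m) (\<sigma> m))"
      by (rule last_two_comp) (use s le in simp_all)
    moreover have "FMor E (last_two m \<sigma> 0 0, last_two m \<sigma> 0 1) \<cdot> FMor E (last_two m \<sigma> 0 1, last_two m \<sigma> (\<sigma> m) (\<sigma> m)) = FMor E (last_two m \<sigma> 0 0, last_two m \<sigma> (\<sigma> m) (\<sigma> m))"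
      by (rule last_two_comp) (use s le in simp_all)
    ultimately show ?thesis using False a b by (simp add: comparison_fst_def comparison_snd_def comparison_obj_def)
  qed
  then show "comparison_fst m E \<sigma> \<in> Hom C (comparison_obj m E \<sigma>) (FObj E (last_two m \<sigma> 1 0))" "comparison_snd m E \<sigma> \<in> Hom C (comparison_obj m E \<sigma>) (FObj E (last_two m \<sigma> 0 1))"
    "FMor E (last_two m \<sigma> 0 0, last_two m \<sigma> 1 0) \<cdot> comparison_fst m E \<sigma> = FMor E (last_two m \<sigma> 0 0, last_two m \<sigma> 0 1) \<cdot> comparison_snd m E \<sigma>" by blast+
qed

lemma comparison_pullback:
  assumes "\<sigma> \<in> three_objs (Suc m)" "\<sigma> m = 0"
  shows "is_pullback C (FMor E (last_two m \<sigma> 0 0, last_two m \<sigma> 1 0)) (FMor E (last_two m \<sigma> 0 0, last_two m \<sigma> 0 1)) (comparison_fst m E \<sigma>) (comparison_snd m E \<sigma>)"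
    "Dom C (comparison_fst m E \<sigma>) = comparison_obj m E \<sigma>"
  using comparison_pb_pullback[OF assms(1)] assms(2) by (simp_all add: comparison_fst_def comparison_snd_def comparison_obj_def)

lemma comparison_joint:
  assumes "\<sigma> \<in> three_objs (Suc m)" "\<sigma> m = 0" "u \<in> Hom C T (comparison_obj m E \<sigma>)" "v \<in> Hom C T (comparison_obj m E \<sigma>)"
    "comparison_fst m E \<sigma> \<cdot> u = comparison_fst m E \<sigma> \<cdot> v" "comparison_snd m E \<sigma> \<cdot> u = comparison_snd m E \<sigma> \<cdot> v"
  shows "u = v"
  using comparison_pullback(1)[OF assms(1,2)] by (rule pullbackE) (use assms(3-6)[folded comparison_pullback(2)[OF assms(1,2)]] in blast)

lemma comparison_mor_props:
  assumes s: "\<sigma> \<in> three_objs (Suc m)" "\<tau> \<in> three_objs (Suc m)" "\<sigma> \<le> \<tau>"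
  shows "comparison_mor m E \<sigma> \<tau> \<in> Hom C (comparison_obj m E \<tau>) (comparison_obj m E \<sigma>)"
    "comparison_fst m E \<sigma> \<cdot> comparison_mor m E \<sigma> \<tau> = FMor E (last_two m \<sigma> 1 0, last_two m \<tau> 1 0) \<cdot> comparison_fst m E \<tau>"
    "comparison_snd m E \<sigma> \<cdot> comparison_mor m E \<sigma> \<tau> = FMor E (last_two m \<sigma> 0 1, last_two m \<tau> 0 1) \<cdot> comparison_snd m E \<tau>"
proof -
  let ?F = "\<lambda>\<sigma> a b \<tau> a' b'. FMor E (last_two m \<sigma> a b, last_two m \<tau> a' b')"
  have st: "\<sigma> m \<le> \<tau> m" "\<tau> m \<le> 2" using s three_objs_le2[OF s(2)] by (auto simp: le_fun_def)
  note dt = comparison_square[OF s(2)]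
  have "comparison_mor m E \<sigma> \<tau> \<in> Hom C (comparison_obj m E \<tau>) (comparison_obj m E \<sigma>) \<and>
    comparison_fst m E \<sigma> \<cdot> comparison_mor m E \<sigma> \<tau> = ?F \<sigma> 1 0 \<tau> 1 0 \<cdot> comparison_fst m E \<tau> \<and>
    comparison_snd m E \<sigma> \<cdot> comparison_mor m E \<sigma> \<tau> = ?F \<sigma> 0 1 \<tau> 0 1 \<cdot> comparison_snd m E \<tau>"
  proof (cases "\<sigma> m = 0")
    case True
    have H1: "?F \<sigma> 1 0 \<tau> 1 0 \<in> Hom C (FObj E (last_two m \<tau> 1 0)) (FObj E (last_two m \<sigma> 1 0))" by (rule last_two_Hom) (use s in simp_all)
    have H2: "?F \<sigma> 0 1 \<tau> 0 1 \<in> Hom C (FObj E (last_two m \<tau> 0 1)) (FObj E (last_two m \<sigma> 0 1))" by (rule last_two_Hom) (use s in simp_all)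
    have H3: "?F \<sigma> 0 0 \<sigma> 1 0 \<in> Hom C (FObj E (last_two m \<sigma> 1 0)) (FObj E (last_two m \<sigma> 0 0))" by (rule last_two_Hom) (use s in simp_all)
    have H4: "?F \<sigma> 0 0 \<sigma> 0 1 \<in> Hom C (FObj E (last_two m \<sigma> 0 1)) (FObj E (last_two m \<sigma> 0 0))" by (rule last_two_Hom) (use s in simp_all)
    have H5: "?F \<tau> 0 0 \<tau> 1 0 \<in> Hom C (FObj E (last_two m \<tau> 1 0)) (FObj E (last_two m \<tau> 0 0))" by (rule last_two_Hom) (use s in simp_all)
    have H6: "?F \<tau> 0 0 \<tau> 0 1 \<in> Hom C (FObj E (last_two m \<tau> 0 1)) (FObj E (last_two m \<tau> 0 0))" by (rule last_two_Hom) (use s in simp_all)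
    have H7: "?F \<sigma> 0 0 \<tau> 0 0 \<in> Hom C (FObj E (last_two m \<tau> 0 0)) (FObj E (last_two m \<sigma> 0 0))" by (rule last_two_Hom) (use s in simp_all)
    have c1: "?F \<sigma> 0 0 \<sigma> 1 0 \<cdot> ?F \<sigma> 1 0 \<tau> 1 0 = ?F \<sigma> 0 0 \<tau> 1 0" by (rule last_two_comp) (use s in simp_all)
    have c2: "?F \<sigma> 0 0 \<tau> 0 0 \<cdot> ?F \<tau> 0 0 \<tau> 1 0 = ?F \<sigma> 0 0 \<tau> 1 0" by (rule last_two_comp) (use s in simp_all)
    have c3: "?F \<sigma> 0 0 \<sigma> 0 1 \<cdot> ?F \<sigma> 0 1 \<tau> 0 1 = ?F \<sigma> 0 0 \<tau> 0 1" by (rule last_two_comp) (use s in simp_all)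
    have c4: "?F \<sigma> 0 0 \<tau> 0 0 \<cdot> ?F \<tau> 0 0 \<tau> 0 1 = ?F \<sigma> 0 0 \<tau> 0 1" by (rule last_two_comp) (use s in simp_all)
    have "?F \<sigma> 0 0 \<sigma> 1 0 \<cdot> (?F \<sigma> 1 0 \<tau> 1 0 \<cdot> comparison_fst m E \<tau>) = ?F \<sigma> 0 0 \<tau> 0 0 \<cdot> (?F \<tau> 0 0 \<tau> 1 0 \<cdot> comparison_fst m E \<tau>)"
      by (rule comp_cong) (use c1 c2 H1 H3 H5 H7 dt in simp_all)
    also have "\<dots> = ?F \<sigma> 0 0 \<tau> 0 0 \<cdot> (?F \<tau> 0 0 \<tau> 0 1 \<cdot> comparison_snd m E \<tau>)" using dt(3) by simp
    also have "\<dots> = ?F \<sigma> 0 0 \<sigma> 0 1 \<cdot> (?F \<sigma> 0 1 \<tau> 0 1 \<cdot> comparison_snd m E \<tau>)"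
      by (rule comp_cong) (use c3 c4 H2 H4 H6 H7 dt in simp_all)
    finally have e: "?F \<sigma> 0 0 \<sigma> 1 0 \<cdot> (?F \<sigma> 1 0 \<tau> 1 0 \<cdot> comparison_fst m E \<tau>) = ?F \<sigma> 0 0 \<sigma> 0 1 \<cdot> (?F \<sigma> 0 1 \<tau> 0 1 \<cdot> comparison_snd m E \<tau>)" .
    have "\<exists>u \<in> Hom C (comparison_obj m E \<tau>) (Dom C (comparison_fst m E \<sigma>)). comparison_fst m E \<sigma> \<cdot> u = ?F \<sigma> 1 0 \<tau> 1 0 \<cdot> comparison_fst m E \<tau> \<and> comparison_snd m E \<sigma> \<cdot> u = ?F \<sigma> 0 1 \<tau> 0 1 \<cdot> comparison_snd m E \<tau>"
    proof -
      have d: "Dom C (?F \<sigma> 0 0 \<sigma> 1 0) = FObj E (last_two m \<sigma> 1 0)" "Dom C (?F \<sigma> 0 0 \<sigma> 0 1) = FObj E (last_two m \<sigma> 0 1)"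
        using H3 H4 by auto
      have 1: "?F \<sigma> 1 0 \<tau> 1 0 \<cdot> comparison_fst m E \<tau> \<in> Hom C (comparison_obj m E \<tau>) (Dom C (?F \<sigma> 0 0 \<sigma> 1 0))"
        "?F \<sigma> 0 1 \<tau> 0 1 \<cdot> comparison_snd m E \<tau> \<in> Hom C (comparison_obj m E \<tau>) (Dom C (?F \<sigma> 0 0 \<sigma> 0 1))"
        unfolding d using H1 H2 dt by simp_all
      show ?thesis using comparison_pullback(1)[OF s(1) True] by (rule pullbackE) (use e 1 in blast)
    qed
    then have "\<exists>u. u \<in> Hom C (comparison_obj m E \<tau>) (comparison_obj m E \<sigma>) \<and> comparison_fst m E \<sigma> \<cdot> u = ?F \<sigma> 1 0 \<tau> 1 0 \<cdot> comparison_fst m E \<tau> \<and> comparison_snd m E \<sigma> \<cdot> u = ?F \<sigma> 0 1 \<tau> 0 1 \<cdot> comparison_snd m E \<tau>"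
      unfolding comparison_pullback(2)[OF s(1) True] by blast
    from someI_ex[OF this] show ?thesis unfolding comparison_mor_def if_P[OF True] .
  next
    case False
    \<comment> \<open>The last coordinate can only increase from \<sigma> to \<tau>, so no pullback
      is involved on either side.\<close>
    then have le: "1 \<le> \<sigma> m" "\<sigma> m \<le> 2" "\<tau> m \<noteq> 0" "1 \<le> \<tau> m" using st by auto
    have "?F \<sigma> (\<sigma> m) (\<sigma> m) \<tau> (\<tau> m) (\<tau> m) \<in> Hom C (FObj E (last_two m \<tau> (\<tau> m) (\<tau> m))) (FObj E (last_two m \<sigma> (\<sigma> m) (\<sigma> m)))"
      by (rule last_two_Hom) (use s st in simp_all)
    moreover have "?F \<sigma> 1 0 \<sigma> (\<sigma> m) (\<sigma> m) \<cdot> ?F \<sigma> (\<sigma> m) (\<sigma> m) \<tau> (\<tau> m) (\<tau> m) = ?F \<sigma> 1 0 \<tau> (\<tau> m) (\<tau> m)"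
      by (rule last_two_comp) (use s st le in simp_all)
    moreover have "?F \<sigma> 1 0 \<tau> 1 0 \<cdot> ?F \<tau> 1 0 \<tau> (\<tau> m) (\<tau> m) = ?F \<sigma> 1 0 \<tau> (\<tau> m) (\<tau> m)"
      by (rule last_two_comp) (use s st le in simp_all)
    moreover have "?F \<sigma> 0 1 \<sigma> (\<sigma> m) (\<sigma> m) \<cdot> ?F \<sigma> (\<sigma> m) (\<sigma> m) \<tau> (\<tau> m) (\<tau> m) = ?F \<sigma> 0 1 \<tau> (\<tau> m) (\<tau> m)"
      by (rule last_two_comp) (use s st le in simp_all)
    moreover have "?F \<sigma> 0 1 \<tau> 0 1 \<cdot> ?F \<tau> 0 1 \<tau> (\<tau> m) (\<tau> m) = ?F \<sigma> 0 1 \<tau> (\<tau> m) (\<tau> m)"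
      by (rule last_two_comp) (use s st le in simp_all)
    ultimately show ?thesis using False le by (simp add: comparison_mor_def comparison_fst_def comparison_snd_def comparison_obj_def)
  qed
  then show "comparison_mor m E \<sigma> \<tau> \<in> Hom C (comparison_obj m E \<tau>) (comparison_obj m E \<sigma>)"
    "comparison_fst m E \<sigma> \<cdot> comparison_mor m E \<sigma> \<tau> = FMor E (last_two m \<sigma> 1 0, last_two m \<tau> 1 0) \<cdot> comparison_fst m E \<tau>"
    "comparison_snd m E \<sigma> \<cdot> comparison_mor m E \<sigma> \<tau> = FMor E (last_two m \<sigma> 0 1, last_two m \<tau> 0 1) \<cdot> comparison_snd m E \<tau>" by blast+
qed

end

context
  fixes m :: nat and E :: "('o, 'm) seq"
  assumes diag: "is_3n_diagram C (Suc (Suc m)) E"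
begin

lemmas diagram_Hom = last_two_Hom[OF diag] and diagram_comp = last_two_comp[OF diag] and diagram_id = last_two_id[OF diag]
  and diagram_mor = comparison_mor_props[OF diag] and diagram_square = comparison_square[OF diag] and diagram_joint = comparison_joint[OF diag]
  and diagram_pullback = comparison_pullback[OF diag]

lemma comparison_obj_Obj: "\<sigma> \<in> three_objs (Suc m) \<Longrightarrow> comparison_obj m E \<sigma> \<in> Obj C"
  using diagram_square(1) by (rule Hom_Dom_Obj)

lemma comparison_mor_id:
  assumes s: "\<sigma> \<in> three_objs (Suc m)"
  shows "comparison_mor m E \<sigma> \<sigma> = Ident C (comparison_obj m E \<sigma>)"
proof (cases "\<sigma> m = 0")
  case True
  note P = diagram_mor[OF s s order_refl] and S = diagram_square[OF s]
  have i: "FMor E (last_two m \<sigma> 1 0, last_two m \<sigma> 1 0) = Ident C (FObj E (last_two m \<sigma> 1 0))"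
    "FMor E (last_two m \<sigma> 0 1, last_two m \<sigma> 0 1) = Ident C (FObj E (last_two m \<sigma> 0 1))"
    by (rule diagram_id(1)[OF s]; simp)+
  show ?thesis
    by (rule diagram_joint[OF s True, where T = "comparison_obj m E \<sigma>"]) (use P S i comparison_obj_Obj[OF s] in simp_all)
next
  case False
  then show ?thesis using diagram_id(1)[OF s three_objs_le2[OF s] three_objs_le2[OF s]] by (simp add: comparison_mor_def comparison_obj_def)
qed

lemma comparison_mor_comp:
  assumes s: "\<rho> \<in> three_objs (Suc m)" "\<sigma> \<in> three_objs (Suc m)" "\<tau> \<in> three_objs (Suc m)" "\<rho> \<le> \<sigma>" "\<sigma> \<le> \<tau>"
  shows "comparison_mor m E \<rho> \<sigma> \<cdot> comparison_mor m E \<sigma> \<tau> = comparison_mor m E \<rho> \<tau>"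
proof -
  have le: "\<rho> \<le> \<tau>" using s by auto
  have st: "\<rho> m \<le> \<sigma> m" "\<sigma> m \<le> \<tau> m" "\<tau> m \<le> 2" using s three_objs_le2[OF s(3)] by (auto simp: le_fun_def)
  note P1 = diagram_mor[OF s(1,2,4)] and P2 = diagram_mor[OF s(2,3,5)] and P3 = diagram_mor[OF s(1,3) le]
  note S1 = diagram_square[OF s(1)] and S2 = diagram_square[OF s(2)] and S3 = diagram_square[OF s(3)]
  show ?thesis
  proof (cases "\<rho> m = 0")
    case True
    have H1: "FMor E (last_two m \<rho> a b, last_two m \<sigma> a b) \<in> Hom C (FObj E (last_two m \<sigma> a b)) (FObj E (last_two m \<rho> a b))"
      "FMor E (last_two m \<sigma> a b, last_two m \<tau> a b) \<in> Hom C (FObj E (last_two m \<tau> a b)) (FObj E (last_two m \<sigma> a b))"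
      "FMor E (last_two m \<rho> a b, last_two m \<sigma> a b) \<cdot> FMor E (last_two m \<sigma> a b, last_two m \<tau> a b) = FMor E (last_two m \<rho> a b, last_two m \<tau> a b)"
      if "a \<le> 2" "b \<le> 2" for a b
      by (rule diagram_Hom diagram_comp; use s that in simp)+
    show ?thesis
    proof (rule diagram_joint[OF s(1) True, where T = "comparison_obj m E \<tau>"])
      have "comparison_fst m E \<rho> \<cdot> (comparison_mor m E \<rho> \<sigma> \<cdot> comparison_mor m E \<sigma> \<tau>) = FMor E (last_two m \<rho> 1 0, last_two m \<sigma> 1 0) \<cdot> (comparison_fst m E \<sigma> \<cdot> comparison_mor m E \<sigma> \<tau>)"
        using P1(2) by (rule comp_cong) (use P1(1) P2(1) S1 S2 H1(1)[of 1 0] in simp_all)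
      also have "\<dots> = FMor E (last_two m \<rho> 1 0, last_two m \<tau> 1 0) \<cdot> comparison_fst m E \<tau>"
        unfolding P2(2) by (rule comp_cong1) (use H1[of 1 0] S3 in simp_all)
      finally show "comparison_fst m E \<rho> \<cdot> (comparison_mor m E \<rho> \<sigma> \<cdot> comparison_mor m E \<sigma> \<tau>) = comparison_fst m E \<rho> \<cdot> comparison_mor m E \<rho> \<tau>" using P3(2) by simp
      have "comparison_snd m E \<rho> \<cdot> (comparison_mor m E \<rho> \<sigma> \<cdot> comparison_mor m E \<sigma> \<tau>) = FMor E (last_two m \<rho> 0 1, last_two m \<sigma> 0 1) \<cdot> (comparison_snd m E \<sigma> \<cdot> comparison_mor m E \<sigma> \<tau>)"
        using P1(3) by (rule comp_cong) (use P1(1) P2(1) S1 S2 H1(1)[of 0 1] in simp_all)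
      also have "\<dots> = FMor E (last_two m \<rho> 0 1, last_two m \<tau> 0 1) \<cdot> comparison_snd m E \<tau>"
        unfolding P2(3) by (rule comp_cong1) (use H1[of 0 1] S3 in simp_all)
      finally show "comparison_snd m E \<rho> \<cdot> (comparison_mor m E \<rho> \<sigma> \<cdot> comparison_mor m E \<sigma> \<tau>) = comparison_snd m E \<rho> \<cdot> comparison_mor m E \<rho> \<tau>" using P3(3) by simp
    qed (use P1(1) P2(1) P3(1) in simp_all)
  next
    case False
    have "FMor E (last_two m \<rho> (\<rho> m) (\<rho> m), last_two m \<sigma> (\<sigma> m) (\<sigma> m)) \<cdot> FMor E (last_two m \<sigma> (\<sigma> m) (\<sigma> m), last_two m \<tau> (\<tau> m) (\<tau> m))
       = FMor E (last_two m \<rho> (\<rho> m) (\<rho> m), last_two m \<tau> (\<tau> m) (\<tau> m))" by (rule diagram_comp) (use s st in simp_all)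
    then show ?thesis using False st by (simp add: comparison_mor_def)
  qed
qed

text \<open>Only the nine objects \<open>E\<^sub>a\<^sub>b\<close> at a fixed \<sigma> are involved:
  this is the statement for \<open>3\<^sup>2\<close>-diagrams that their initial corner covers the
  pullback, with kernel \<open>E\<^sub>2\<^sub>2\<close>.\<close>

lemma comparison_mor_exact_last:
  assumes s: "\<sigma> \<in> three_objs (Suc m)"
  shows "regepi (comparison_mor m E (\<sigma>(m := 0)) (\<sigma>(m := 1)))" (is "regepi ?u")
    "monic (comparison_mor m E (\<sigma>(m := 1)) (\<sigma>(m := 2)))" (is "monic ?k")
    "sieve (comparison_mor m E (\<sigma>(m := 1)) (\<sigma>(m := 2))) = kernel_elems (comparison_mor m E (\<sigma>(m := 0)) (\<sigma>(m := 1)))"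
proof -
  let ?F = "\<lambda>a b a' b'. FMor E (last_two m \<sigma> a b, last_two m \<sigma> a' b')" and ?O = "\<lambda>a b. FObj E (last_two m \<sigma> a b)"
  have s0: "\<sigma>(m := 0) \<in> three_objs (Suc m)" and s1: "\<sigma>(m := 1) \<in> three_objs (Suc m)"
    using three_objs_upd[OF s] by auto
  have H: "?F a b a' b' \<in> Hom C (?O a' b') (?O a b)" if "a \<le> a'" "b \<le> b'" "a' \<le> 2" "b' \<le> 2" for a b a' b'
    by (rule diagram_Hom) (use s that in simp_all)
  have c: "?F a b a' b' \<cdot> ?F a' b' a'' b'' = ?F a b a'' b''"
    if "a \<le> a'" "b \<le> b'" "a' \<le> a''" "b' \<le> b''" "a'' \<le> 2" "b'' \<le> 2" for a b a' b' a'' b''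
    by (rule diagram_comp) (use s that in simp_all)
  note P = diagram_mor[OF s0 s1 upd_le] and S = diagram_square[OF s1] and PB = diagram_pullback[OF s0]
  have d1: "comparison_obj m E (\<sigma>(m := 1)) = ?O 1 1" "comparison_fst m E (\<sigma>(m := 1)) = ?F 1 0 1 1" "comparison_snd m E (\<sigma>(m := 1)) = ?F 0 1 1 1"
    by (simp_all add: comparison_obj_def comparison_fst_def comparison_snd_def)
  have u1: "?u \<in> Hom C (?O 1 1) (Dom C (comparison_fst m E (\<sigma>(m := 0))))" using P(1) PB(2) d1 by simp
  have i: "?F 1 0 1 0 = Ident C (?O 1 0)" "?F 0 1 0 1 = Ident C (?O 0 1)" by (rule diagram_id(1)[OF s]; simp)+
  have u2: "comparison_fst m E (\<sigma>(m := 0)) \<cdot> ?u = ?F 1 0 1 1" "comparison_snd m E (\<sigma>(m := 0)) \<cdot> ?u = ?F 0 1 1 1"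
    using P(2,3) unfolding d1 last_two_upd i using H[of 1 1 0 1] H[of 0 1 1 1] by simp_all
  have PB': "is_pullback C (?F 0 0 1 0) (?F 0 0 0 1) (comparison_fst m E (\<sigma>(m := 0))) (comparison_snd m E (\<sigma>(m := 0)))"
    using PB(1) by simp
  have one2: "(1::nat) \<le> 2" by simp
  note e1 = last_two_exact_snd[OF diag s one2] and e0 = last_two_exact_snd[OF diag s, of 0, simplified]
    and e2 = last_two_exact_snd[OF diag s order_refl]
  note f1 = last_two_exact_fst[OF diag s one2] and f0 = last_two_exact_fst[OF diag s, of 0, simplified]
    and f2 = last_two_exact_fst[OF diag s order_refl]
  have "?F 1 1 1 2 \<in> kernel_elems (?F 1 0 1 1)" using e1(2,3) sieve_self[of "?F 1 1 1 2"] by auto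
  then have z: "?F 1 0 1 1 \<cdot> ?F 1 1 1 2 = zero_mor (?O 1 2) (?O 1 0)"
    using H[of 1 1 0 1] H[of 1 1 1 2] by (simp add: kernel_elems_iff)
  \<comment> \<open>The lifting from \<open>E\<^sub>0\<^sub>2\<close> to
    \<open>E\<^sub>1\<^sub>2\<close> is possible because this edge lies in the outer row, where it
    is again a regular epimorphism by exactness.\<close>
  show "regepi ?u"
  proof (rule comparison_regepi[OF H[of 1 1 0 1] e1(1) H[of 0 1 1 1] PB' H[of 0 1 0 0] H[of 0 0 0 1] u1 u2
        H[of 0 0 1 2] _ H[of 0 1 2 2] f2(1) H[of 1 1 1 2] z])
    show "sieve (?F 0 1 0 2) = kernel_elems (?F 0 0 0 1)" using e0(3) by simp
    show "?F 0 1 1 1 \<cdot> ?F 1 1 1 2 = ?F 0 1 0 2 \<cdot> ?F 0 2 1 2" using c[of 0 1 1 1 1 2] c[of 0 0 1 2 1 2] by simp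
  qed simp_all
  have zz: "?F 1 0 1 1 \<cdot> ?F 1 1 2 1 = ?F 1 0 2 0 \<cdot> ?F 2 0 2 1" using c[of 1 1 0 1 2 1] c[of 1 2 0 0 2 1] by simp
  \<comment> \<open>The diagonal from \<open>E\<^sub>2\<^sub>2\<close> to
    \<open>E\<^sub>1\<^sub>1\<close> is factored through \<open>E\<^sub>2\<^sub>1\<close>: the
    kernel of one side, followed by the kernel of the other side restricted to it.\<close>
  have k: "?k = ?F 1 1 2 1 \<cdot> ?F 2 1 2 2" using c[of 1 2 1 1 2 2] by (simp add: comparison_mor_def)
  have "monic (?F 1 1 2 1 \<cdot> ?F 2 1 2 2) \<and> sieve (?F 1 1 2 1 \<cdot> ?F 2 1 2 2) = kernel_elems ?u"
    by (intro conjI; rule comparison_kernel[OF H[of 1 1 0 1] H[of 0 1 1 1] PB' H[of 0 1 0 0] H[of 0 0 0 1] u1 u2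
        H[of 1 2 1 1] f1(2,3) H[of 2 2 1 2] e2(2,3) H[of 2 2 0 1] H[of 1 2 0 0] _ zz])
      (use f0(2) in simp_all)
  then show "monic ?k" "sieve ?k = kernel_elems ?u" unfolding k by blast+
qed

text \<open>Away from the pullback this is exactness of \<open>E\<close>, and at the pullback
  kernels are inherited. Regular epimorphisms on the three corners need not induce one on pullbacks.
  Here it follows by cancellation, since the initial corners cover the pullbacks and are themselves
  connected by a regular epimorphism.\<close>

lemma comparison_mor_exact_low:
  assumes s: "\<sigma> \<in> three_objs (Suc m)" and i: "i < m"
  shows "regepi (comparison_mor m E (\<sigma>(i := 0)) (\<sigma>(i := 1)))" "monic (comparison_mor m E (\<sigma>(i := 1)) (\<sigma>(i := 2)))"
    "sieve (comparison_mor m E (\<sigma>(i := 1)) (\<sigma>(i := 2))) = kernel_elems (comparison_mor m E (\<sigma>(i := 0)) (\<sigma>(i := 1)))"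
proof -
  have im: "(\<sigma>(i := x)) m = \<sigma> m" for x using i by simp
  have "regepi (comparison_mor m E (\<sigma>(i := 0)) (\<sigma>(i := 1))) \<and> monic (comparison_mor m E (\<sigma>(i := 1)) (\<sigma>(i := 2))) \<and>
    sieve (comparison_mor m E (\<sigma>(i := 1)) (\<sigma>(i := 2))) = kernel_elems (comparison_mor m E (\<sigma>(i := 0)) (\<sigma>(i := 1)))"
  proof (cases "\<sigma> m = 0")
    case False
    have "\<sigma> m \<le> 2" by (rule three_objs_le2[OF s])
    note e = last_two_exact_low[OF diag s this this i]
    have d: "comparison_mor m E (\<sigma>(i := x)) (\<sigma>(i := y)) = FMor E (last_two m (\<sigma>(i := x)) (\<sigma> m) (\<sigma> m), last_two m (\<sigma>(i := y)) (\<sigma> m) (\<sigma> m))" for x y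
      using False unfolding comparison_mor_def im by simp
    show ?thesis unfolding d using e by blast
  next
    case True
    define \<tau> where "\<tau> = (\<lambda>x. \<sigma>(i := x))"
    have t: "\<tau> x \<in> three_objs (Suc m)" if "x \<le> 2" for x unfolding \<tau>_def using three_objs_upd[OF s _ that] i by simp
    have tle: "\<tau> x \<le> \<tau> y" if "x \<le> y" for x y unfolding \<tau>_def by (rule upd_le[OF that])
    have t0: "\<tau> x m = 0" for x unfolding \<tau>_def im by (rule True)
    let ?F = "\<lambda>x a b y a' b'. FMor E (last_two m (\<tau> x) a b, last_two m (\<tau> y) a' b')" and ?O = "\<lambda>x a b. FObj E (last_two m (\<tau> x) a b)"
    have H: "?F x a b y a' b' \<in> Hom C (?O y a' b') (?O x a b)"
      if "x \<le> y" "y \<le> 2" "a \<le> a'" "b \<le> b'" "a' \<le> 2" "b' \<le> 2" for x y a b a' b'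
      by (rule diagram_Hom) (use t tle that in simp_all)
    have c: "?F x a b y a' b' \<cdot> ?F y a' b' z a'' b'' = ?F x a b z a'' b''"
      if "x \<le> y" "y \<le> z" "z \<le> 2" "a \<le> a'" "b \<le> b'" "a' \<le> a''" "b' \<le> b''" "a'' \<le> 2" "b'' \<le> 2" for x y z a b a' b' a'' b''
      by (rule diagram_comp) (use t tle that in simp_all)
    have e: "regepi (?F 0 a b 1 a b)" "monic (?F 1 a b 2 a b)" "sieve (?F 1 a b 2 a b) = kernel_elems (?F 0 a b 1 a b)"
      if "a \<le> 2" "b \<le> 2" for a b
      unfolding \<tau>_def using last_two_exact_low[OF diag s that i] by blast+
    have pb: "is_pullback C (?F x 0 0 x 1 0) (?F x 0 0 x 0 1) (comparison_fst m E (\<tau> x)) (comparison_snd m E (\<tau> x))"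
      "Dom C (comparison_fst m E (\<tau> x)) = comparison_obj m E (\<tau> x)" if "x \<le> 2" for x
      using diagram_pullback[OF t[OF that] t0] by blast+
    note P1 = diagram_mor[OF t[of 1] t[of 2] tle[of 1 2], simplified] and P0 = diagram_mor[OF t[of 0] t[of 1] tle[of 0 1], simplified]
    have K: "monic (comparison_mor m E (\<tau> 1) (\<tau> 2)) \<and> sieve (comparison_mor m E (\<tau> 1) (\<tau> 2)) = kernel_elems (comparison_mor m E (\<tau> 0) (\<tau> 1))"
    proof (intro conjI; rule pullback_kernel[where vP = "comparison_mor m E (\<tau> 0) (\<tau> 1)",
          OF pb(1)[of 2] pb(1)[of 1] pb(1)[of 0] H[of 2 2 0 1 0 0] H[of 2 2 0 0 0 1]
          H[of 1 1 0 1 0 0] H[of 1 1 0 0 0 1] H[of 0 0 0 1 0 0] H[of 0 0 0 0 0 1]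
          H[of 1 2 1 1 0 0] e(2,3)[of 1 0] H[of 0 1 1 1 0 0]
          H[of 1 2 0 0 1 1] e(2,3)[of 0 1] H[of 0 1 0 0 1 1]
          H[of 1 2 0 0 0 0] e(2)[of 0 0]])
      \<comment> \<open>These two squares are premises of both goals, monicity and the kernel
        equation, hence each is shown twice.\<close>
      show "?F 1 0 0 1 1 0 \<cdot> ?F 1 1 0 2 1 0 = ?F 1 0 0 2 0 0 \<cdot> ?F 2 0 0 2 1 0"
        using c[of 1 1 2 0 1 0 0 1 0] c[of 1 2 2 0 0 0 0 1 0] by simp
      then show "?F 1 0 0 1 1 0 \<cdot> ?F 1 1 0 2 1 0 = ?F 1 0 0 2 0 0 \<cdot> ?F 2 0 0 2 1 0" .
      show "?F 1 0 0 1 0 1 \<cdot> ?F 1 0 1 2 0 1 = ?F 1 0 0 2 0 0 \<cdot> ?F 2 0 0 2 0 1"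
        using c[of 1 1 2 0 0 0 1 0 1] c[of 1 2 2 0 0 0 0 0 1] by simp
      then show "?F 1 0 0 1 0 1 \<cdot> ?F 1 0 1 2 0 1 = ?F 1 0 0 2 0 0 \<cdot> ?F 2 0 0 2 0 1" .
    qed (use P1 P0 pb(2) in simp_all)
    have "regepi (comparison_mor m E (\<tau> 0) (\<tau> 1))"
    proof -
      \<comment> \<open>Setting the last coordinate to 1 passes from the pullback to the initial
        corner \<open>E\<^sub>1\<^sub>1\<close> above it.\<close>
      define \<upsilon> where "\<upsilon> = (\<lambda>x. (\<tau> x)(m := 1))"
      have u: "\<upsilon> x \<in> three_objs (Suc m)" "\<tau> x \<le> \<upsilon> x" if "x \<le> 2" for x
      proof -
        show "\<upsilon> x \<in> three_objs (Suc m)" unfolding \<upsilon>_def by (rule three_objs_upd[OF t[OF that]]) simp_all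
        show "\<tau> x \<le> \<upsilon> x" unfolding \<upsilon>_def using t0[of x] by (simp add: le_fun_def)
      qed
      have ule: "\<upsilon> 0 \<le> \<upsilon> 1" unfolding \<upsilon>_def by (rule fun_upd_mono[OF tle]) simp_all
      have tt: "(\<tau> 0)(m := 0) = \<tau> 0" using t0[of 0] by (simp add: fun_upd_idem)
      have r1: "regepi (comparison_mor m E (\<tau> 0) (\<upsilon> 0))"
        using comparison_mor_exact_last(1)[OF t[of 0]] unfolding tt \<upsilon>_def by simp
      have "comparison_mor m E (\<upsilon> 0) (\<upsilon> 1) = ?F 0 1 1 1 1 1" unfolding \<upsilon>_def comparison_mor_def by simp
      then have r2: "regepi (comparison_mor m E (\<upsilon> 0) (\<upsilon> 1))" using e(1)[of 1 1] by simp
      have H1: "comparison_mor m E (\<tau> 0) (\<upsilon> 0) \<in> Hom C (comparison_obj m E (\<upsilon> 0)) (comparison_obj m E (\<tau> 0))"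
        by (rule diagram_mor(1)) (use t u in simp_all)
      have H2: "comparison_mor m E (\<upsilon> 0) (\<upsilon> 1) \<in> Hom C (comparison_obj m E (\<upsilon> 1)) (comparison_obj m E (\<upsilon> 0))"
        by (rule diagram_mor(1)) (use u ule in simp_all)
      have H3: "comparison_mor m E (\<tau> 1) (\<upsilon> 1) \<in> Hom C (comparison_obj m E (\<upsilon> 1)) (comparison_obj m E (\<tau> 1))"
        by (rule diagram_mor(1)) (use t u in simp_all)
      have "regepi (comparison_mor m E (\<tau> 0) (\<upsilon> 0) \<cdot> comparison_mor m E (\<upsilon> 0) (\<upsilon> 1))"
        by (rule regepi_comp[OF r2 r1]) (use H1 H2 in simp)
      moreover have "comparison_mor m E (\<tau> 0) (\<upsilon> 0) \<cdot> comparison_mor m E (\<upsilon> 0) (\<upsilon> 1) = comparison_mor m E (\<tau> 0) (\<upsilon> 1)"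
        by (rule comparison_mor_comp) (use t u ule in simp_all)
      moreover have "comparison_mor m E (\<tau> 0) (\<tau> 1) \<cdot> comparison_mor m E (\<tau> 1) (\<upsilon> 1) = comparison_mor m E (\<tau> 0) (\<upsilon> 1)"
        by (rule comparison_mor_comp) (use t u tle in simp_all)
      ultimately have "regepi (comparison_mor m E (\<tau> 0) (\<tau> 1) \<cdot> comparison_mor m E (\<tau> 1) (\<upsilon> 1))" by simp
      then show ?thesis by (rule regepi_cancel) (use H3 P0(1) in simp_all)
    qed
    then show ?thesis using K unfolding \<tau>_def by blast
  qed
  then show "regepi (comparison_mor m E (\<sigma>(i := 0)) (\<sigma>(i := 1)))" "monic (comparison_mor m E (\<sigma>(i := 1)) (\<sigma>(i := 2)))"
    "sieve (comparison_mor m E (\<sigma>(i := 1)) (\<sigma>(i := 2))) = kernel_elems (comparison_mor m E (\<sigma>(i := 0)) (\<sigma>(i := 1)))" by blast+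
qed

lemma comparison_seq_diagram: "is_3n_diagram C (Suc m) (comparison_seq m E)"
  unfolding is_3n_diagram_def n_sequence_iff
proof (intro conjI ballI allI impI)
  fix \<sigma> assume s: "\<sigma> \<in> three_objs (Suc m)"
  show "FObj (comparison_seq m E) \<sigma> \<in> Obj C" using comparison_obj_Obj[OF s] by (simp add: comparison_seq_def)
  show "FMor (comparison_seq m E) (\<sigma>, \<sigma>) = Ident C (FObj (comparison_seq m E) \<sigma>)" using comparison_mor_id[OF s] by (simp add: comparison_seq_def)
  fix \<tau> assume t: "\<tau> \<in> three_objs (Suc m)" "\<sigma> \<le> \<tau>"
  show "FMor (comparison_seq m E) (\<sigma>, \<tau>) \<in> Hom C (FObj (comparison_seq m E) \<tau>) (FObj (comparison_seq m E) \<sigma>)"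
    using diagram_mor(1)[OF s t] by (simp add: comparison_seq_def)
next
  fix \<rho> \<sigma> \<tau> assume "\<rho> \<in> three_objs (Suc m)" "\<sigma> \<in> three_objs (Suc m)" "\<tau> \<in> three_objs (Suc m)" "\<rho> \<le> \<sigma> \<and> \<sigma> \<le> \<tau>"
  then show "FMor (comparison_seq m E) (\<rho>, \<tau>) = FMor (comparison_seq m E) (\<rho>, \<sigma>) \<cdot> FMor (comparison_seq m E) (\<sigma>, \<tau>)"
    using comparison_mor_comp[of \<rho> \<sigma> \<tau>] by (simp add: comparison_seq_def)
next
  fix i \<sigma> assume i: "i < Suc m" and s: "\<sigma> \<in> three_objs (Suc m)"
  have e: "regepi (comparison_mor m E (\<sigma>(i := 0)) (\<sigma>(i := 1))) \<and> monic (comparison_mor m E (\<sigma>(i := 1)) (\<sigma>(i := 2))) \<and>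
    sieve (comparison_mor m E (\<sigma>(i := 1)) (\<sigma>(i := 2))) = kernel_elems (comparison_mor m E (\<sigma>(i := 0)) (\<sigma>(i := 1)))"
  proof (cases "i = m")
    case True
    then show ?thesis using comparison_mor_exact_last[OF s] by blast
  next
    case False
    then show ?thesis using comparison_mor_exact_low[OF s, of i] i by simp
  qed
  have u: "\<sigma>(i := x) \<in> three_objs (Suc m)" if "x \<le> 2" for x by (rule three_objs_upd[OF s i that])
  have "comparison_mor m E (\<sigma>(i := 0)) (\<sigma>(i := 1)) \<in> Hom C (comparison_obj m E (\<sigma>(i := 1))) (comparison_obj m E (\<sigma>(i := 0)))"
    by (rule diagram_mor(1)[OF u u upd_le]) simp_all
  moreover have "comparison_mor m E (\<sigma>(i := 1)) (\<sigma>(i := 2)) \<in> Hom C (comparison_obj m E (\<sigma>(i := 2))) (comparison_obj m E (\<sigma>(i := 1)))"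
    by (rule diagram_mor(1)[OF u u upd_le]) simp_all
  ultimately show "is_short_exact C (seq_edge (comparison_seq m E) i \<sigma> 2 1) (seq_edge (comparison_seq m E) i \<sigma> 1 0)"
    using e unfolding short_exact_iff seq_edge_def comparison_seq_def by simp
qed

end
end


lemma two_objs_three: "v \<in> two_objs m \<Longrightarrow> v \<in> three_objs (Suc m)"
  by (auto simp: two_objs_def three_objs_def less_Suc_eq)

lemma ocube_Hom:
  assumes "cube_functor C (Suc k) F"
  shows "ocube C (Suc k) F \<in> Hom (Arr_pow C k) (ocube C k (slice k 1 F)) (ocube C k (slice k 0 F))"
  unfolding ocube.simps
  by (rule ncube_Hom[OF cube_functor_slice[OF assms] cube_functor_slice[OF assms] cube_natural_edge[OF assms]]) simp_all

section \<open>Induction on the number of directions\<close>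

context semi_abelian_category
begin

lemma n_sequence_cube_functor:
  assumes E: "is_n_sequence C n E"
    and \<phi>: "\<And>v. v \<in> two_objs k \<Longrightarrow> \<phi> v \<in> three_objs n" "\<And>v w. v \<le> w \<Longrightarrow> \<phi> v \<le> \<phi> w"
  shows "cube_functor C k (\<lambda>v w. FMor E (\<phi> v, \<phi> w))"
    "\<And>v. v \<in> two_objs k \<Longrightarrow> cube_obj C (\<lambda>v w. FMor E (\<phi> v, \<phi> w)) v = FObj E (\<phi> v)"
proof -
  note D = n_sequenceD[OF E]
  show ob: "cube_obj C (\<lambda>v w. FMor E (\<phi> v, \<phi> w)) v = FObj E (\<phi> v)" if "v \<in> two_objs k" for v
    unfolding cube_obj_def D(3)[OF \<phi>(1)[OF that]] by (rule Ident_simps(2)[OF D(2)[OF \<phi>(1)[OF that]]])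
  show "cube_functor C k (\<lambda>v w. FMor E (\<phi> v, \<phi> w))" unfolding cube_functor_def
  proof (intro conjI ballI impI)
    fix v w assume h: "v \<in> two_objs k" "w \<in> two_objs k" "v \<le> w"
    show "FMor E (\<phi> v, \<phi> w) \<in> Hom C (cube_obj C (\<lambda>v w. FMor E (\<phi> v, \<phi> w)) w) (cube_obj C (\<lambda>v w. FMor E (\<phi> v, \<phi> w)) v)"
      unfolding ob[OF h(1)] ob[OF h(2)] by (rule D(1)[OF \<phi>(1)[OF h(1)] \<phi>(1)[OF h(2)] \<phi>(2)[OF h(3)]])
  next
    fix u v w assume h: "u \<in> two_objs k" "v \<in> two_objs k" "w \<in> two_objs k" "u \<le> v" "v \<le> w"
    show "FMor E (\<phi> u, \<phi> v) \<cdot> FMor E (\<phi> v, \<phi> w) = FMor E (\<phi> u, \<phi> w)"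
      by (rule D(4)[OF \<phi>(1)[OF h(1)] \<phi>(1)[OF h(2)] \<phi>(1)[OF h(3)] \<phi>(2)[OF h(4)] \<phi>(2)[OF h(5)]])
  qed
qed

text \<open>The recursion asks for five cubes of one dimension less, each obtained from its own
  diagram, so the induction is over all \<open>E\<close>. The four sides are faces of
  \<open>E\<close>, and the fifth cube belongs to \<open>comparison_seq\<close>. The pullback in
  \<open>Arr_pow C m\<close> is assembled from the vertexwise ones by
  \<open>ncube_pullback\<close>.\<close>

lemma three_diagram_cubic_extension:
  "is_3n_diagram C (Suc m) E \<Longrightarrow> cubic_extension C (Suc m) (ocube C (Suc m) (\<lambda>v w. FMor E (v, w)))"
proof (induction m arbitrary: E)
  case (0 E)
  have z: "(\<lambda>_. 0) \<in> three_objs (Suc 0)" by (simp add: three_objs_def)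
  have "regepi (FMor E ((\<lambda>_. 0)(0 := 0), (\<lambda>_. 0)(0 := 1)))"
    by (rule three_diagram_exact(1)[OF 0 _ z]) simp
  then show ?case by simp
next
  case (Suc m E)
  note diag = Suc.prems
  define F where "F = (\<lambda>v w. FMor E (v, w))"
  \<comment> \<open>\<open>G a b\<close> is the corner with last two coordinates \<open>a\<close>
    and \<open>b\<close>, still a cube in the coordinates below \<open>m\<close>.\<close>
  define G where "G = (\<lambda>a b v w. FMor E (last_two m v a b, last_two m w a b))"
  have seq: "is_n_sequence C (Suc (Suc m)) E" by (rule last_two_seq[OF diag])
  have funG: "cube_functor C m (G a b)" "v \<in> two_objs m \<Longrightarrow> cube_obj C (G a b) v = FObj E (last_two m v a b)"
    if "a \<le> 1" "b \<le> 1" for a b v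
    unfolding G_def
    by (rule n_sequence_cube_functor[OF seq]; (rule last_two_three_objs last_two_mono)?; use that two_objs_three in simp)+
  have natG: "cube_natural C m (G a' b') (G a b) (\<lambda>v. FMor E (last_two m v a b, last_two m v a' b'))"
    if h: "a \<le> a'" "b \<le> b'" "a' \<le> 1" "b' \<le> 1" for a b a' b'
    unfolding cube_natural_def
  proof (intro conjI ballI impI)
    fix v assume v: "v \<in> two_objs m"
    have f: "cube_obj C (G a' b') v = FObj E (last_two m v a' b')" "cube_obj C (G a b) v = FObj E (last_two m v a b)"
      by (rule funG(2); use h v in simp)+
    show "FMor E (last_two m v a b, last_two m v a' b') \<in> Hom C (cube_obj C (G a' b') v) (cube_obj C (G a b) v)"
      unfolding f by (rule last_two_Hom[OF diag]) (use h two_objs_three[OF v] in simp_all)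
    fix w assume w: "w \<in> two_objs m" "v \<le> w"
    have "FMor E (last_two m v a b, last_two m w a b) \<cdot> FMor E (last_two m w a b, last_two m w a' b') = FMor E (last_two m v a b, last_two m w a' b')"
      by (rule last_two_comp[OF diag]) (use h two_objs_three v w in simp_all)
    moreover have "FMor E (last_two m v a b, last_two m v a' b') \<cdot> FMor E (last_two m v a' b', last_two m w a' b') = FMor E (last_two m v a b, last_two m w a' b')"
      by (rule last_two_comp[OF diag]) (use h two_objs_three v w in simp_all)
    ultimately show "G a b v w \<cdot> FMor E (last_two m w a b, last_two m w a' b') = FMor E (last_two m v a b, last_two m v a' b') \<cdot> G a' b' v w"
      unfolding G_def by simp
  qed
  \<comment> \<open>The arguments are in the order of the pairs of \<open>FMor\<close>: the target
    corner comes before the source corner.\<close>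
  define side where "side = (\<lambda>a b a' b'. ncube m (G a' b') (G a b) (\<lambda>v. FMor E (last_two m v a b, last_two m v a' b')) :: ('o, 'm) cell)"
  have xeq: "ocube C (Suc (Suc m)) F = Sq (side 0 1 1 1) (side 0 0 1 0) (side 1 0 1 1) (side 0 0 0 1)"
    unfolding ocube.simps ncube.simps side_def G_def F_def slice_def last_two_def by (rule refl)
  have funF: "cube_functor C (Suc (Suc m)) F" unfolding F_def
    by (rule n_sequence_cube_functor(1)[OF seq, where \<phi> = "\<lambda>v. v"])
      (auto simp: two_objs_def three_objs_def)
  have xObj: "ocube C (Suc (Suc m)) F \<in> Obj (Arr_pow C (Suc (Suc m)))"
    using ocube_Hom[OF funF] unfolding Arr_pow_simps(2)[of C "Suc m"] arrow_cat_simps(1) by simp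
  \<comment> \<open>The sides in direction \<open>m\<close> lie in the face where the last
    coordinate is fixed, and need no renaming of directions.\<close>
  have re1: "cubic_extension C (Suc m) (side 0 b 1 b)" if b: "b \<le> 1" for b
  proof -
    define E1 where "E1 = \<lparr>FObj = (\<lambda>\<sigma>. FObj E (\<sigma>(Suc m := b))), FMor = (\<lambda>p. FMor E ((fst p)(Suc m := b), (snd p)(Suc m := b)))\<rparr>"
    have "is_3n_diagram C (Suc m) E1" unfolding E1_def
    proof (rule three_diagram_reindex[OF diag, where d = "\<lambda>i. i"])
      fix \<sigma> assume "\<sigma> \<in> three_objs (Suc m)"
      then show "\<sigma>(Suc m := b) \<in> three_objs (Suc (Suc m))" using b by (auto simp: three_objs_def less_Suc_eq)
    qed (auto simp: fun_upd_twist le_fun_def)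
    from Suc.IH[OF this]
    have "cubic_extension C (Suc m) (ocube C (Suc m) (\<lambda>v w. FMor E1 (v, w)))" .
    moreover have "ocube C (Suc m) (\<lambda>v w. FMor E1 (v, w)) = side 0 b 1 b"
      unfolding ocube.simps side_def G_def slice_def last_two_def E1_def functor_data.simps fst_conv snd_conv by (rule refl)
    ultimately show ?thesis by simp
  qed
  have re2: "cubic_extension C (Suc m) (side a 0 a 1)" if a: "a \<le> 1" for a
  proof -
    \<comment> \<open>Here coordinate \<open>m\<close> is the fixed one, so the last direction of
      \<open>E\<close> is renumbered as direction \<open>m\<close> of the face.\<close>
    define E1 where "E1 = \<lparr>FObj = (\<lambda>\<sigma>. FObj E (last_two m \<sigma> a (\<sigma> m))),
      FMor = (\<lambda>p. FMor E (last_two m (fst p) a (fst p m), last_two m (snd p) a (snd p m)))\<rparr>"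
    have "is_3n_diagram C (Suc m) E1" unfolding E1_def
    proof (rule three_diagram_reindex[OF diag, where d = "\<lambda>i. if i = m then Suc m else i"])
      fix \<sigma> assume s: "\<sigma> \<in> three_objs (Suc m)"
      show "last_two m \<sigma> a (\<sigma> m) \<in> three_objs (Suc (Suc m))"
        by (rule last_two_three_objs[OF s _ three_objs_le2[OF s]]) (use a in simp)
    next
      fix \<sigma> \<tau> :: "nat \<Rightarrow> nat" assume "\<sigma> \<le> \<tau>"
      then show "last_two m \<sigma> a (\<sigma> m) \<le> last_two m \<tau> a (\<tau> m)" by (intro last_two_mono) (auto simp: le_fun_def)
    next
      fix i x and \<sigma> :: "nat \<Rightarrow> nat" assume "i < Suc m"
      then show "last_two m (\<sigma>(i := x)) a ((\<sigma>(i := x)) m) = (last_two m \<sigma> a (\<sigma> m))(if i = m then Suc m else i := x)"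
        by (cases "i = m") (simp_all add: last_two_upd_low)
    qed auto
    from Suc.IH[OF this]
    have "cubic_extension C (Suc m) (ocube C (Suc m) (\<lambda>v w. FMor E1 (v, w)))" .
    moreover have "ocube C (Suc m) (\<lambda>v w. FMor E1 (v, w)) = side a 0 a 1"
    proof -
      have "(v(m := x)) m = x" for v :: "nat \<Rightarrow> nat" and x by simp
      then show ?thesis
        unfolding ocube.simps side_def G_def slice_def E1_def functor_data.simps fst_conv snd_conv last_two_upd by simp
    qed
    ultimately show ?thesis by simp
  qed
  define D where "D = (\<lambda>v w. FMor (comparison_seq m E) (v, w))"
  have Ddm: "D v w = comparison_mor m E v w" for v w by (simp add: D_def comparison_seq_def)
  have cub: "cubic_extension C (Suc m) (ocube C (Suc m) D)"
    unfolding D_def by (rule Suc.IH[OF comparison_seq_diagram[OF diag]])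
  have dseqs: "is_n_sequence C (Suc m) (comparison_seq m E)" using comparison_seq_diagram[OF diag] by (simp add: is_3n_diagram_def)
  have funD: "cube_functor C (Suc m) D" "v \<in> two_objs (Suc m) \<Longrightarrow> cube_obj C D v = comparison_obj m E v" for v
  proof -
    have t: "\<And>v. v \<in> two_objs (Suc m) \<Longrightarrow> v \<in> three_objs (Suc m)" by (auto simp: two_objs_def three_objs_def)
    show "cube_functor C (Suc m) D" unfolding D_def
      by (rule n_sequence_cube_functor(1)[OF dseqs, where \<phi> = "\<lambda>v. v"]) (use t in simp_all)
    show "cube_obj C D v = comparison_obj m E v" if "v \<in> two_objs (Suc m)"
      using n_sequence_cube_functor(2)[OF dseqs, where \<phi> = "\<lambda>v. v" and k = "Suc m", OF t _ that]
      unfolding D_def by (simp add: comparison_seq_def)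
  qed
  \<comment> \<open>The face of the comparison diagram that consists of the chosen pullbacks. Its
    functoriality comes with that of \<open>comparison_seq\<close>.\<close>
  define P where "P = slice m 0 D"
  have funP: "cube_functor C m P" unfolding P_def by (rule cube_functor_slice[OF funD(1)]) simp
  have v0: "v(m := 0) = v" if "v \<in> two_objs m" for v using that by (auto simp: two_objs_def)
  have t0: "v \<in> three_objs (Suc m)" "v m = 0" if "v \<in> two_objs m" for v
    using two_objs_three[OF that] that by (auto simp: two_objs_def)
  have Pdm: "P v w = comparison_mor m E v w" if "v \<in> two_objs m" "w \<in> two_objs m" for v w
    unfolding P_def slice_def v0[OF that(1)] v0[OF that(2)] by (rule Ddm)
  have fobP: "cube_obj C P v = comparison_obj m E v" if "v \<in> two_objs m" for v
    unfolding P_def cube_obj_slice v0[OF that] by (rule funD(2)) (use two_objs_upd[OF that, of 0] v0[OF that] in simp)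
  have natp: "cube_natural C m P (G 1 0) (comparison_fst m E)"
    unfolding cube_natural_def
  proof (intro conjI ballI impI)
    fix v assume v: "v \<in> two_objs m"
    have f: "cube_obj C (G 1 0) v = FObj E (last_two m v 1 0)" by (rule funG(2)[OF _ _ v]) simp_all
    show "comparison_fst m E v \<in> Hom C (cube_obj C P v) (cube_obj C (G 1 0) v)" unfolding fobP[OF v] f by (rule comparison_square(1)[OF diag t0(1)[OF v]])
    fix w assume w: "w \<in> two_objs m" "v \<le> w"
    show "G 1 0 v w \<cdot> comparison_fst m E w = comparison_fst m E v \<cdot> P v w"
      unfolding Pdm[OF v w(1)] G_def by (rule comparison_mor_props(2)[OF diag t0(1)[OF v] t0(1)[OF w(1)] w(2), symmetric])
  qed
  have natq: "cube_natural C m P (G 0 1) (comparison_snd m E)"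
    unfolding cube_natural_def
  proof (intro conjI ballI impI)
    fix v assume v: "v \<in> two_objs m"
    have f: "cube_obj C (G 0 1) v = FObj E (last_two m v 0 1)" by (rule funG(2)[OF _ _ v]) simp_all
    show "comparison_snd m E v \<in> Hom C (cube_obj C P v) (cube_obj C (G 0 1) v)" unfolding fobP[OF v] f by (rule comparison_square(2)[OF diag t0(1)[OF v]])
    fix w assume w: "w \<in> two_objs m" "v \<le> w"
    show "G 0 1 v w \<cdot> comparison_snd m E w = comparison_snd m E v \<cdot> P v w"
      unfolding Pdm[OF v w(1)] G_def by (rule comparison_mor_props(3)[OF diag t0(1)[OF v] t0(1)[OF w(1)] w(2), symmetric])
  qed
  have pb: "is_pullback (Arr_pow C m) (side 0 0 1 0) (side 0 0 0 1) (ncube m P (G 1 0) (comparison_fst m E)) (ncube m P (G 0 1) (comparison_snd m E))"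
    unfolding side_def
  proof (rule ncube_pullback[OF category_axioms])
    fix v assume v: "v \<in> two_objs m"
    show "is_pullback C (FMor E (last_two m v 0 0, last_two m v 1 0)) (FMor E (last_two m v 0 0, last_two m v 0 1)) (comparison_fst m E v) (comparison_snd m E v)"
      by (rule comparison_pullback(1)[OF diag t0[OF v]])
  qed (use funG(1) funP natp natq natG in simp_all)
  \<comment> \<open>The opposite face of the comparison diagram is the initial corner of the square,
    so the last direction of the diagram is the required comparison.\<close>
  have s1: "slice m 1 D = G 1 1"
    unfolding slice_def Ddm G_def comparison_mor_def by (intro ext) simp
  have ceq: "ocube C (Suc m) D = ncube m (G 1 1) P (\<lambda>v. comparison_mor m E (v(m := 0)) (v(m := 1)))"
    unfolding ocube.simps s1 P_def[symmetric] Ddm by (rule refl)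
  have natc: "cube_natural C m (G 1 1) P (\<lambda>v. comparison_mor m E (v(m := 0)) (v(m := 1)))"
    using cube_natural_edge[OF funD(1)] unfolding s1 P_def[symmetric] Ddm .
  have cHom: "ocube C (Suc m) D \<in> Hom (Arr_pow C m) (Dom (Arr_pow C m) (side 0 1 1 1)) (Dom (Arr_pow C m) (ncube m P (G 1 0) (comparison_fst m E)))"
  proof -
    have "side 0 1 1 1 \<in> Hom (Arr_pow C m) (ocube C m (G 1 1)) (ocube C m (G 0 1))"
      unfolding side_def by (rule ncube_Hom[OF funG(1) funG(1) natG]) simp_all
    moreover have "ncube m P (G 1 0) (comparison_fst m E) \<in> Hom (Arr_pow C m) (ocube C m P) (ocube C m (G 1 0))"
      by (rule ncube_Hom[OF funP funG(1) natp]) simp_all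
    moreover have "ocube C (Suc m) D \<in> Hom (Arr_pow C m) (ocube C m (G 1 1)) (ocube C m P)"
      unfolding ceq by (rule ncube_Hom[OF funG(1) funP natc]) simp_all
    ultimately show ?thesis by (simp del: ocube.simps)
  qed
  \<comment> \<open>Compatibility with the projections, taken along the last direction, where the
    morphisms of \<open>E\<close> on the two legs are identities. It says that the comparison
    factors the two sides at the initial corner.\<close>
  have dmp: "comparison_fst m E v \<cdot> comparison_mor m E (v(m := 0)) (v(m := 1)) = FMor E (last_two m v 1 0, last_two m v 1 1)"
    "comparison_snd m E v \<cdot> comparison_mor m E (v(m := 0)) (v(m := 1)) = FMor E (last_two m v 0 1, last_two m v 1 1)" if v: "v \<in> two_objs m" for v
  proof -
    have u: "v(m := 1) \<in> three_objs (Suc m)" by (rule three_objs_upd[OF t0(1)[OF v]]) simp_all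
    have le: "v \<le> v(m := 1)" using upd_le[of 0 1 v m] v0[OF v] by simp
    note DP = comparison_mor_props[OF diag t0(1)[OF v] u le]
    have d: "comparison_fst m E (v(m := 1)) = FMor E (last_two m v 1 0, last_two m v 1 1)" "comparison_snd m E (v(m := 1)) = FMor E (last_two m v 0 1, last_two m v 1 1)"
      by (simp_all add: comparison_fst_def comparison_snd_def)
    have i: "FMor E (last_two m v 1 0, last_two m v 1 0) = Ident C (FObj E (last_two m v 1 0))"
      "FMor E (last_two m v 0 1, last_two m v 0 1) = Ident C (FObj E (last_two m v 0 1))"
      by (rule last_two_id(1)[OF diag t0(1)[OF v]]; simp)+
    have h: "FMor E (last_two m v 1 0, last_two m v 1 1) \<in> Hom C (FObj E (last_two m v 1 1)) (FObj E (last_two m v 1 0))"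
      "FMor E (last_two m v 0 1, last_two m v 1 1) \<in> Hom C (FObj E (last_two m v 1 1)) (FObj E (last_two m v 0 1))"
      by (rule last_two_Hom[OF diag t0(1)[OF v] t0(1)[OF v]]; simp)+
    show "comparison_fst m E v \<cdot> comparison_mor m E (v(m := 0)) (v(m := 1)) = FMor E (last_two m v 1 0, last_two m v 1 1)"
      using DP(2) h(1) unfolding v0[OF v] d last_two_upd i by simp
    show "comparison_snd m E v \<cdot> comparison_mor m E (v(m := 0)) (v(m := 1)) = FMor E (last_two m v 0 1, last_two m v 1 1)"
      using DP(3) h(2) unfolding v0[OF v] d last_two_upd i by simp
  qed
  have pc: "ncube m P (G 1 0) (comparison_fst m E) \<cdot>\<^bsub>Arr_pow C m\<^esub> ocube C (Suc m) D = side 1 0 1 1"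
    unfolding ceq ncube_comp side_def by (rule ncube_cong[OF refl refl dmp(1)])
  have qc: "ncube m P (G 0 1) (comparison_snd m E) \<cdot>\<^bsub>Arr_pow C m\<^esub> ocube C (Suc m) D = side 0 1 1 1"
    unfolding ceq ncube_comp side_def by (rule ncube_cong[OF refl refl dmp(2)])
  have "cubic_extension C (Suc (Suc m)) (ocube C (Suc (Suc m)) F)"
    unfolding cubic_extension.simps(3)
  proof (intro conjI exI)
    show "ocube C (Suc (Suc m)) F \<in> Obj (Arr_pow C (Suc (Suc m)))" by (rule xObj)
    show "ocube C (Suc (Suc m)) F = Sq (side 0 1 1 1) (side 0 0 1 0) (side 1 0 1 1) (side 0 0 0 1)" by (rule xeq)
    show "cubic_extension C (Suc m) (side 0 1 1 1)" by (rule re1) simp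
    show "cubic_extension C (Suc m) (side 0 0 1 0)" by (rule re1) simp
    show "cubic_extension C (Suc m) (side 1 0 1 1)" by (rule re2) simp
    show "cubic_extension C (Suc m) (side 0 0 0 1)" by (rule re2) simp
    show "is_pullback (Arr_pow C m) (side 0 0 1 0) (side 0 0 0 1) (ncube m P (G 1 0) (comparison_fst m E)) (ncube m P (G 0 1) (comparison_snd m E))"
      by (rule pb)
    show "ocube C (Suc m) D \<in> Hom (Arr_pow C m) (Dom (Arr_pow C m) (side 0 1 1 1)) (Dom (Arr_pow C m) (ncube m P (G 1 0) (comparison_fst m E)))"
      by (rule cHom)
  qed (rule pc qc cub)+
  then show ?case unfolding F_def .
qed

end

theorem corollary4p6:
  fixes C :: "('o, 'm) category" and X :: 'o and n :: nat and K :: "nat \<Rightarrow> 'm"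
  defines "L \<equiv> NSub C X"
  assumes "semi_abelian_category C"
    and "n \<ge> 1"
    and "X \<in> Obj C"
    and "\<And>i. i < n \<Longrightarrow> K i \<in> carrier L"
  shows "((\<exists>E. meets_then_cokernels C n X K E \<and> is_3n_diagram C n E) \<longleftrightarrow>
      (\<forall>(k::nat) (J :: nat \<Rightarrow> nat set).
         k \<ge> 1 \<and> (\<forall>i\<le>k. J i \<subseteq> {0..<n}) \<and> (\<forall>i\<le>k. \<forall>j\<le>k. i \<noteq> j \<longrightarrow> J i \<inter> J j = {}) \<longrightarrow>
         (IINF\<^bsub>L\<^esub> j:J 0. K j) \<sqinter>\<^bsub>L\<^esub> (SSUP\<^bsub>L\<^esub> i:{1..k}. (IINF\<^bsub>L\<^esub> j:J i. K j))
           .=\<^bsub>L\<^esub> (SSUP\<^bsub>L\<^esub> i:{1..k}. (IINF\<^bsub>L\<^esub> j:J 0 \<union> J i. K j)))) \<and>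
    (\<forall>E. meets_then_cokernels C n X K E \<and> is_3n_diagram C n E \<longrightarrow>
       cubic_extension C n (cube_restriction n E))"
proof -
  interpret semi_abelian_category C by fact
  have K: "\<And>i. i < n \<Longrightarrow> K i \<in> carrier (NSub C X)" using assms(5) unfolding L_def .
  \<comment> \<open>For \<open>n = 0\<close> the predicate \<open>cubic_extension\<close> is false
    by definition, so the second claim depends on \<open>n\<close> being a successor.\<close>
  obtain m where m: "n = Suc m" using \<open>n \<ge> 1\<close> by (cases n) auto
  show ?thesis unfolding L_def
  proof (rule conjI)
    show "(\<exists>E. meets_then_cokernels C n X K E \<and> is_3n_diagram C n E) \<longleftrightarrow>
      (\<forall>(k::nat) (J :: nat \<Rightarrow> nat set).
         k \<ge> 1 \<and> (\<forall>i\<le>k. J i \<subseteq> {0..<n}) \<and> (\<forall>i\<le>k. \<forall>j\<le>k. i \<noteq> j \<longrightarrow> J i \<inter> J j = {}) \<longrightarrow>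
         (IINF\<^bsub>NSub C X\<^esub> j:J 0. K j) \<sqinter>\<^bsub>NSub C X\<^esub> (SSUP\<^bsub>NSub C X\<^esub> i:{1..k}. (IINF\<^bsub>NSub C X\<^esub> j:J i. K j))
           .=\<^bsub>NSub C X\<^esub> (SSUP\<^bsub>NSub C X\<^esub> i:{1..k}. (IINF\<^bsub>NSub C X\<^esub> j:J 0 \<union> J i. K j)))"
      using exists_three_diagram_iff[of X n K] NSub_distributive_iff[of X n K] K \<open>X \<in> Obj C\<close> by simp
    show "\<forall>E. meets_then_cokernels C n X K E \<and> is_3n_diagram C n E \<longrightarrow>
       cubic_extension C n (cube_restriction n E)"
      unfolding m cube_restriction_ocube[where C = C] using three_diagram_cubic_extension by blast
  qed
qed


end
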